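(* Let $A\subset M$ be a unital inclusion of von Neumann algebras and assume that there exists a faithful normal semifinite operator valued weight $E_A\colon M\to A$. For $x\in M$ put $\mathcal K(x,A):=\overline{\mathrm{conv}}^{\,\sigma\text{-weak}}\{uxu^*\mid u\in\mathcal U(A)\}\subset M$. The following conditions are equivalent. (1) $E_A(x)=\infty$ for all nonzero positive $x\in A'\cap M$. (2) For every $x\in M^+$ with $E_A(x)<\infty$, the set $\mathcal K(x,A)$ contains $0$. (3) For every $x\in M^+$ with $E_A(x)<\infty$, we have $A'\cap\mathcal K(x,A)=\{0\}$.
   Context: $\mathcal U(A)$ is the unitary group of $A$. For a von Neumann algebra $A$, the extended positive cone $\widehat A^+$ is the set of lower semicontinuous, additive, positively homogeneous maps $m\colon A_*^+\to[0,\infty]$; $A^+\subset\widehat A^+$ via evaluation. An operator valued weight from $M$ to $A$ is a map $T\colon M^+\to\widehat A^+$ that is additive, positively homogeneous, and satisfies $T(a^*xa)=a^*T(x)a$ for $x\in M^+$, $a\in A$. It is faithful if $T(x)=0$ implies $x=0$ for $x\in M^+$; normal if $T(x_i)\nearrow T(x)$ whenever $x_i\nearrow x$ in $M^+$; semifinite if the linear span of $\{x\in M^+\mid T(x)\in A^+\}$ is $\sigma$-weakly dense in $M$. For $x\in M^+$, "$E_A(x)<\infty$" means $E_A(x)\in A^+$ (i.e. $E_A(x)$ is bounded), and "$E_A(x)=\infty$" means $E_A(x)\notin A^+$. *)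

theory Defs
  imports "HOL-Analysis.Analysis" "HOL-Library.Nonpos_Ints"
begin

section \<open>Complex Hilbert spaces\<close>

class complex_vector = real_vector +
  fixes scaleC :: "complex \<Rightarrow> 'a \<Rightarrow> 'a" (infixr "*\<^sub>C" 75)
  assumes scaleR_scaleC: "r *\<^sub>R x = complex_of_real r *\<^sub>C x"
    and scaleC_add_right: "c *\<^sub>C (x + y) = c *\<^sub>C x + c *\<^sub>C y"
    and scaleC_add_left: "(c + d) *\<^sub>C x = c *\<^sub>C x + d *\<^sub>C x"
    and scaleC_scaleC: "c *\<^sub>C d *\<^sub>C x = (c * d) *\<^sub>C x"
    and scaleC_one: "1 *\<^sub>C x = x"

global_interpretation complex_vector: vector_space "scaleC :: complex \<Rightarrow> 'a \<Rightarrow> 'a::complex_vector"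
  defines cspan = complex_vector.span
  by unfold_locales (simp_all add: scaleC_add_right scaleC_add_left scaleC_scaleC scaleC_one)

text \<open>The inner product is linear in the second and antilinear in the first variable.\<close>

class chilbert_space = complex_vector + banach +
  fixes cinner :: "'a \<Rightarrow> 'a \<Rightarrow> complex"
  assumes cinner_commute: "cinner x y = cnj (cinner y x)"
    and cinner_add_right: "cinner x (y + z) = cinner x y + cinner x z"
    and cinner_scaleC_right: "cinner x (c *\<^sub>C y) = c * cinner x y"
    and cinner_ge_zero: "cinner x x \<in> \<real>\<^sub>\<ge>\<^sub>0"
    and norm_eq_sqrt_cinner: "norm x = sqrt (Re (cinner x x))"

lemma norm_scaleC:
  fixes x :: "'a::chilbert_space"
  shows "norm (c *\<^sub>C x) = cmod c * norm x"
proof -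
  have "cinner (c *\<^sub>C x) (c *\<^sub>C x) = c * cnj (cinner x (c *\<^sub>C x))"
    by (metis cinner_commute cinner_scaleC_right)
  also have "\<dots> = c * cnj c * cinner x x"
    by (metis (no_types) cinner_commute cinner_scaleC_right complex_cnj_mult mult.assoc)
  also have "\<dots> = complex_of_real ((cmod c)\<^sup>2) * cinner x x"
    by (simp add: complex_norm_square del: of_real_power)
  finally have "Re (cinner (c *\<^sub>C x) (c *\<^sub>C x)) = (cmod c)\<^sup>2 * Re (cinner x x)"
    by simp
  then show ?thesis
    by (simp add: norm_eq_sqrt_cinner real_sqrt_mult)
qed

lemma bounded_linear_scaleC: "bounded_linear ((*\<^sub>C) c :: 'a::chilbert_space \<Rightarrow> 'a)"
  by (rule bounded_linear_intro[where K = "cmod c"])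
    (simp_all add: scaleC_add_right scaleR_scaleC scaleC_scaleC norm_scaleC mult.commute)

instantiation complex :: chilbert_space
begin

definition "scaleC_complex (c::complex) (x::complex) = c * x"
definition "cinner_complex (x::complex) (y::complex) = cnj x * y"

instance
proof
  fix x y z c d :: complex and r :: real
  show "r *\<^sub>R x = complex_of_real r *\<^sub>C x"
    by (simp add: scaleC_complex_def scaleR_conv_of_real)
  have *: "cnj x * x = complex_of_real ((cmod x)\<^sup>2)"
    by (simp only: complex_norm_square mult.commute)
  show "cinner x x \<in> \<real>\<^sub>\<ge>\<^sub>0"
    unfolding cinner_complex_def * by (simp add: complex_nonneg_Reals_iff)
  show "norm x = sqrt (Re (cinner x x))"
    unfolding cinner_complex_def * by simp
qed (simp_all add: scaleC_complex_def cinner_complex_def algebra_simps)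

end

instantiation blinfun :: (real_normed_vector, chilbert_space) complex_vector
begin

lift_definition scaleC_blinfun :: "complex \<Rightarrow> 'a \<Rightarrow>\<^sub>L 'b \<Rightarrow> 'a \<Rightarrow>\<^sub>L 'b"
  is "\<lambda>c f v. c *\<^sub>C f v"
  by (rule bounded_linear_compose[OF bounded_linear_scaleC])

instance
  by standard (transfer; simp add: fun_eq_iff scaleR_scaleC scaleC_add_right scaleC_add_left
      scaleC_scaleC scaleC_one)+

end

section \<open>Operators and von Neumann algebras\<close>

text \<open>
  The type of bounded operators used here consists of all real-linear bounded maps;
  \<open>bounded_ops\<close> is the algebra B(H) of complex-linear ones.
\<close>

definition bounded_ops :: "('h::chilbert_space \<Rightarrow>\<^sub>L 'h) set" where
  "bounded_ops = {x :: 'h \<Rightarrow>\<^sub>L 'h. \<forall>c v. x (c *\<^sub>C v) = c *\<^sub>C x v}"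

definition adj :: "('h::chilbert_space \<Rightarrow>\<^sub>L 'h) \<Rightarrow> 'h \<Rightarrow>\<^sub>L 'h" where
  "adj x = (THE y :: 'h \<Rightarrow>\<^sub>L 'h. \<forall>v w. cinner (y v) w = cinner v (x w))"

definition commutant :: "('h::chilbert_space \<Rightarrow>\<^sub>L 'h) set \<Rightarrow> ('h \<Rightarrow>\<^sub>L 'h) set" where
  "commutant M = {y \<in> bounded_ops. \<forall>x\<in>M. y o\<^sub>L x = x o\<^sub>L y}"

definition von_neumann_algebra :: "('h::chilbert_space \<Rightarrow>\<^sub>L 'h) set \<Rightarrow> bool" where
  "von_neumann_algebra M \<longleftrightarrow>
    M \<subseteq> bounded_ops \<and> (\<forall>x\<in>M. adj x \<in> M) \<and> commutant (commutant M) = M"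

definition op_le :: "('h::chilbert_space \<Rightarrow>\<^sub>L 'h) \<Rightarrow> ('h \<Rightarrow>\<^sub>L 'h) \<Rightarrow> bool" where
  "op_le x y \<longleftrightarrow> (\<forall>v. cinner v ((y - x) v) \<in> \<real>\<^sub>\<ge>\<^sub>0)"

definition positive_cone :: "('h::chilbert_space \<Rightarrow>\<^sub>L 'h) set \<Rightarrow> ('h \<Rightarrow>\<^sub>L 'h) set" where
  "positive_cone M = {x \<in> M. op_le 0 x}"

definition unitary_group :: "('h::chilbert_space \<Rightarrow>\<^sub>L 'h) set \<Rightarrow> ('h \<Rightarrow>\<^sub>L 'h) set" where
  "unitary_group A = {u \<in> A. adj u o\<^sub>L u = id_blinfun \<and> u o\<^sub>L adj u = id_blinfun}"

definition square_summable :: "(nat \<Rightarrow> 'h::chilbert_space) \<Rightarrow> bool" where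
  "square_summable \<xi> \<longleftrightarrow> summable (\<lambda>n. (norm (\<xi> n))\<^sup>2)"

definition vector_functional ::
  "(nat \<Rightarrow> 'h::chilbert_space) \<Rightarrow> (nat \<Rightarrow> 'h) \<Rightarrow> ('h \<Rightarrow>\<^sub>L 'h) \<Rightarrow> complex" where
  "vector_functional \<xi> \<eta> x = (\<Sum>n. cinner (\<xi> n) (x (\<eta> n)))"

text \<open>
  The relative topology on \<open>M\<close> of the initial topology on B(H) for the functionals
  \<open>vector_functional \<xi> \<eta>\<close> with \<open>\<xi>\<close>, \<open>\<eta>\<close> square summable.
\<close>

definition sigma_weak :: "('h::chilbert_space \<Rightarrow>\<^sub>L 'h) set \<Rightarrow> ('h \<Rightarrow>\<^sub>L 'h) topology" where
  "sigma_weak M = subtopology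
    (topology_generated_by
      {{x \<in> bounded_ops. vector_functional \<xi> \<eta> x \<in> U} | \<xi> \<eta> U.
        square_summable \<xi> \<and> square_summable \<eta> \<and> open U}) M"

definition conj_hull ::
  "('h::chilbert_space \<Rightarrow>\<^sub>L 'h) set \<Rightarrow> ('h \<Rightarrow>\<^sub>L 'h) set \<Rightarrow> ('h \<Rightarrow>\<^sub>L 'h) \<Rightarrow> ('h \<Rightarrow>\<^sub>L 'h) set" where
  "conj_hull M A x =
    sigma_weak M closure_of (convex hull {u o\<^sub>L x o\<^sub>L adj u | u. u \<in> unitary_group A})"

section \<open>Predual and extended positive cone\<close>

text \<open>
  Functionals on \<open>A\<close> are represented by functions on all operators that vanish outside \<open>A\<close>.
  Likewise, elements of the extended positive cone vanish outside the positive cone of the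
  predual. Equality of functions is thus equality on the intended domain.
\<close>

definition predual :: "('h::chilbert_space \<Rightarrow>\<^sub>L 'h) set \<Rightarrow> (('h \<Rightarrow>\<^sub>L 'h) \<Rightarrow> complex) set" where
  "predual A = {\<phi>.
    (\<forall>x. x \<notin> A \<longrightarrow> \<phi> x = 0) \<and>
    (\<forall>x\<in>A. \<forall>y\<in>A. \<phi> (x + y) = \<phi> x + \<phi> y) \<and>
    (\<forall>c. \<forall>x\<in>A. \<phi> (c *\<^sub>C x) = c * \<phi> x) \<and>
    continuous_map (sigma_weak A) euclidean \<phi>}"

definition predual_pos :: "('h::chilbert_space \<Rightarrow>\<^sub>L 'h) set \<Rightarrow> (('h \<Rightarrow>\<^sub>L 'h) \<Rightarrow> complex) set" where
  "predual_pos A = {\<phi> \<in> predual A. \<forall>x\<in>positive_cone A. \<phi> x \<in> \<real>\<^sub>\<ge>\<^sub>0}"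

definition predual_norm ::
  "('h::chilbert_space \<Rightarrow>\<^sub>L 'h) set \<Rightarrow> (('h \<Rightarrow>\<^sub>L 'h) \<Rightarrow> complex) \<Rightarrow> real" where
  "predual_norm A \<phi> = (SUP x \<in> {x \<in> A. norm x \<le> 1}. cmod (\<phi> x))"

type_synonym 'h ext_pos = "(('h \<Rightarrow>\<^sub>L 'h) \<Rightarrow> complex) \<Rightarrow> ennreal"

text \<open>Lower semicontinuity refers to the norm topology of the predual; \<open>0 * \<infinity> = 0\<close>.\<close>

definition extended_positive_cone :: "('h::chilbert_space \<Rightarrow>\<^sub>L 'h) set \<Rightarrow> 'h ext_pos set" where
  "extended_positive_cone A = {m.
    (\<forall>\<phi>. \<phi> \<notin> predual_pos A \<longrightarrow> m \<phi> = 0) \<and>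
    (\<forall>\<phi>\<in>predual_pos A. \<forall>\<psi>\<in>predual_pos A. m (\<lambda>x. \<phi> x + \<psi> x) = m \<phi> + m \<psi>) \<and>
    (\<forall>r\<ge>0. \<forall>\<phi>\<in>predual_pos A. m (\<lambda>x. complex_of_real r * \<phi> x) = ennreal r * m \<phi>) \<and>
    (\<forall>\<phi>\<in>predual_pos A. \<forall>c < m \<phi>. \<exists>\<epsilon>>0. \<forall>\<psi>\<in>predual_pos A.
        predual_norm A (\<lambda>x. \<psi> x - \<phi> x) < \<epsilon> \<longrightarrow> c < m \<psi>)}"

definition evaluation :: "('h::chilbert_space \<Rightarrow>\<^sub>L 'h) set \<Rightarrow> ('h \<Rightarrow>\<^sub>L 'h) \<Rightarrow> 'h ext_pos" where
  "evaluation A b = (\<lambda>\<phi>. if \<phi> \<in> predual_pos A then ennreal (Re (\<phi> b)) else 0)"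

text \<open>\<open>a\<^sup>* m a\<close> is \<open>m\<close> composed with \<open>\<phi> \<mapsto> \<phi>(a\<^sup>* \<cdot> a)\<close>, which extends \<open>b \<mapsto> a\<^sup>* b a\<close>.\<close>

definition ext_conj ::
  "('h::chilbert_space \<Rightarrow>\<^sub>L 'h) set \<Rightarrow> ('h \<Rightarrow>\<^sub>L 'h) \<Rightarrow> 'h ext_pos \<Rightarrow> 'h ext_pos" where
  "ext_conj A a m = (\<lambda>\<phi>. if \<phi> \<in> predual_pos A
    then m (\<lambda>x. if x \<in> A then \<phi> (adj a o\<^sub>L x o\<^sub>L a) else 0) else 0)"

section \<open>Operator valued weights\<close>

text \<open>Only the values of \<open>T\<close> on \<open>positive_cone M\<close> are relevant.\<close>

definition operator_valued_weight ::
  "('h::chilbert_space \<Rightarrow>\<^sub>L 'h) set \<Rightarrow> ('h \<Rightarrow>\<^sub>L 'h) set \<Rightarrow> (('h \<Rightarrow>\<^sub>L 'h) \<Rightarrow> 'h ext_pos) \<Rightarrow> bool" where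
  "operator_valued_weight M A T \<longleftrightarrow>
    (\<forall>x\<in>positive_cone M. T x \<in> extended_positive_cone A) \<and>
    (\<forall>x\<in>positive_cone M. \<forall>y\<in>positive_cone M. T (x + y) = (\<lambda>\<phi>. T x \<phi> + T y \<phi>)) \<and>
    (\<forall>r\<ge>0. \<forall>x\<in>positive_cone M. T (r *\<^sub>R x) = (\<lambda>\<phi>. ennreal r * T x \<phi>)) \<and>
    (\<forall>x\<in>positive_cone M. \<forall>a\<in>A. T (adj a o\<^sub>L x o\<^sub>L a) = ext_conj A a (T x))"

definition weight_finite_at ::
  "('h::chilbert_space \<Rightarrow>\<^sub>L 'h) set \<Rightarrow> (('h \<Rightarrow>\<^sub>L 'h) \<Rightarrow> 'h ext_pos) \<Rightarrow> ('h \<Rightarrow>\<^sub>L 'h) \<Rightarrow> bool" where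
  "weight_finite_at A T x \<longleftrightarrow> T x \<in> evaluation A ` positive_cone A"

definition weight_faithful ::
  "('h::chilbert_space \<Rightarrow>\<^sub>L 'h) set \<Rightarrow> (('h \<Rightarrow>\<^sub>L 'h) \<Rightarrow> 'h ext_pos) \<Rightarrow> bool" where
  "weight_faithful M T \<longleftrightarrow> (\<forall>x\<in>positive_cone M. T x = (\<lambda>\<phi>. 0) \<longrightarrow> x = 0)"

definition is_sup_in ::
  "('h::chilbert_space \<Rightarrow>\<^sub>L 'h) set \<Rightarrow> ('h \<Rightarrow>\<^sub>L 'h) set \<Rightarrow> ('h \<Rightarrow>\<^sub>L 'h) \<Rightarrow> bool" where
  "is_sup_in P D x \<longleftrightarrow> x \<in> P \<and> (\<forall>y\<in>D. op_le y x) \<and>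
    (\<forall>z\<in>P. (\<forall>y\<in>D. op_le y z) \<longrightarrow> op_le x z)"

text \<open>Increasing nets are replaced by their ranges, the upward directed sets.\<close>

definition weight_normal ::
  "('h::chilbert_space \<Rightarrow>\<^sub>L 'h) set \<Rightarrow> ('h \<Rightarrow>\<^sub>L 'h) set \<Rightarrow> (('h \<Rightarrow>\<^sub>L 'h) \<Rightarrow> 'h ext_pos) \<Rightarrow> bool" where
  "weight_normal M A T \<longleftrightarrow> (\<forall>D x.
    D \<subseteq> positive_cone M \<and> D \<noteq> {} \<and> (\<forall>y\<in>D. \<forall>z\<in>D. \<exists>w\<in>D. op_le y w \<and> op_le z w) \<and>
    is_sup_in (positive_cone M) D x \<longrightarrow>
    (\<forall>\<phi>\<in>predual_pos A. T x \<phi> = (SUP y\<in>D. T y \<phi>)))"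

definition weight_semifinite ::
  "('h::chilbert_space \<Rightarrow>\<^sub>L 'h) set \<Rightarrow> ('h \<Rightarrow>\<^sub>L 'h) set \<Rightarrow> (('h \<Rightarrow>\<^sub>L 'h) \<Rightarrow> 'h ext_pos) \<Rightarrow> bool" where
  "weight_semifinite M A T \<longleftrightarrow>
    sigma_weak M closure_of cspan {x \<in> positive_cone M. weight_finite_at A T x} = M"

end

(*
  Only the quadratic forms e(x,h), the value of E(x) at the vector state of h, matter: x has finite
  E(x) iff e(x,h) <= C |h|^2. If y in A' lies in K(x,A), lower semicontinuity of h-seminorms
  e(z*z,h) up to a factor 2 along bounded convex sets makes E(y*y) finite, so (1) forces y = 0.
  That 0 lies in K(x,A) is shown corner by corner. Let q in A be the projection onto the closure
  of A'h. If near minimisers, over averages of qxq by unitaries of qAq, of the supremum of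
  e(z*z,uh) over all unitaries u form a Cauchy sequence at h, the averages converge strongly to
  some y commuting with qAq; a spectral projection of y*y would extend to a nonzero element of
  A' and M with finite weight, so y = 0. The Cauchy property follows from the parallelogram law
  once small averages of a positive d in qAq force d to be small at h. This holds if some corner
  below q has its projections dominated, up to unitary conjugation, by a vector state; if no corner
  has this, enough projections of qAq are infinite in a sense that lets d be averaged up to a
  multiple of a central projection. Such corners exhaust the identity and are treated one after
  the other.
*)

theory Submission
  imports Defs
begin

section \<open>Inner products and orthogonal projections\<close>

text \<open>The obstacle: e(u x u*, h) = e(x, u* h), so no single form is invariant under
  conjugation. If the vector state of h were a trace on \<open>A\<close>, the element of least
  h-seminorm in the closed convex hull would be unique and hence commute with \<open>A\<close>. In
  general the quantity minimised is the supremum over the orbit of h. It is invariant, but a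
  supremum of Hilbert seminorms has no parallelogram law: for near minimisers a and b and any chosen
  average, the averaged weight of |a - b|^2 is small, but only at some vector uh that cannot be
  prescribed. The property \<open>good\<close> says exactly that this is enough. It holds at two
  opposite extremes, one resembling a finite trace and one resembling a properly infinite algebra.
  Corners enter because \<open>A\<close> may lack a separating vector, while h separates its own
  corner. Passing from seminorms at h to strong convergence calls for sums of 2^n |d_n|^2, which are
  unbounded; the operator monotone function t/(1+t) turns the partial sums into a bounded increasing
  sequence in \<open>M\<close>, to which normality applies.\<close>

lemma cinner_add_left:
  fixes x y z :: "'h::chilbert_space"
  shows "cinner (x + y) z = cinner x z + cinner y z"
  by (metis cinner_add_right cinner_commute complex_cnj_add)

lemma cinner_scaleC_left:
  fixes x y :: "'h::chilbert_space"
  shows "cinner (c *\<^sub>C x) y = cnj c * cinner x y"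
  by (metis cinner_scaleC_right cinner_commute complex_cnj_mult)

lemma cinner_scaleR_left:
  fixes x y :: "'h::chilbert_space"
  shows "cinner (r *\<^sub>R x) y = of_real r * cinner x y"
  by (simp add: scaleR_scaleC cinner_scaleC_left)

lemma cinner_scaleR_right:
  fixes x y :: "'h::chilbert_space"
  shows "cinner x (r *\<^sub>R y) = of_real r * cinner x y"
  by (simp add: scaleR_scaleC cinner_scaleC_right)

lemma cinner_minus_right:
  fixes x y :: "'h::chilbert_space"
  shows "cinner x (- y) = - cinner x y"
  using cinner_scaleR_right[of x "- 1" y] by simp

lemma cinner_self:
  fixes x :: "'h::chilbert_space"
  shows "cinner x x = of_real ((norm x)\<^sup>2)"
proof -
  have "0 \<le> Re (cinner x x)" "Im (cinner x x) = 0"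
    using cinner_ge_zero[of x] by (auto simp: complex_nonneg_Reals_iff)
  then show ?thesis
    by (simp add: complex_eq_iff norm_eq_sqrt_cinner[of x])
qed

lemma norm_sq_cinner:
  fixes x :: "'h::chilbert_space"
  shows "(norm x)\<^sup>2 = Re (cinner x x)"
  by (simp add: cinner_self)

lemma Re_cinner_commute:
  fixes x y :: "'h::chilbert_space"
  shows "Re (cinner x y) = Re (cinner y x)"
  by (metis cinner_commute complex_cnj(1) Re_complex_of_real cnj.simps(1))

lemma norm_add_sq:
  fixes x y :: "'h::chilbert_space"
  shows "(norm (x + y))\<^sup>2 = (norm x)\<^sup>2 + 2 * Re (cinner x y) + (norm y)\<^sup>2"
  by (simp add: norm_sq_cinner cinner_add_left cinner_add_right Re_cinner_commute[of y x])

lemma CS_Re: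
  fixes x y :: "'h::chilbert_space"
  shows "Re (cinner x y) \<le> norm x * norm y"
proof (cases "x = 0 \<or> y = 0")
  case True
  then show ?thesis
    using cinner_scaleC_left[of 0 0 y] cinner_scaleC_right[of x 0 0] by auto
next
  case False
  then have pos: "norm x > 0" "norm y > 0" by auto
  have "0 \<le> (norm (norm y *\<^sub>R x + (- norm x) *\<^sub>R y))\<^sup>2" by simp
  also have "\<dots> = 2 * (norm x * norm y) * (norm x * norm y - Re (cinner x y))"
    unfolding norm_add_sq
    by (simp add: cinner_scaleR_left cinner_scaleR_right cinner_minus_right power2_eq_square algebra_simps)
  finally show ?thesis
    using pos by (smt (verit) mult_pos_pos mult_pos_neg zero_le_mult_iff)
qed

lemma cinner_CS:
  fixes x y :: "'h::chilbert_space"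
  shows "cmod (cinner x y) \<le> norm x * norm y"
proof (cases "cinner x y = 0")
  case False
  define c where "c = cnj (cinner x y) / cmod (cinner x y)"
  have c: "cmod c = 1" using False by (simp add: c_def norm_divide)
  have "c * cinner x y = of_real (cmod (cinner x y))"
    using False by (simp add: c_def complex_norm_square[symmetric] power2_eq_square mult.commute)
  then have "cmod (cinner x y) = Re (cinner x (c *\<^sub>C y))"
    by (simp add: cinner_scaleC_right)
  also have "\<dots> \<le> norm x * norm (c *\<^sub>C y)" by (rule CS_Re)
  finally show ?thesis by (simp add: norm_scaleC c)
qed simp

interpretation cinner: bounded_bilinear "cinner :: 'h::chilbert_space \<Rightarrow> 'h \<Rightarrow> complex"
  by (unfold_locales)
    (auto simp: cinner_add_left cinner_add_right cinner_scaleR_left cinner_scaleR_right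
      scaleR_conv_of_real intro!: exI[of _ 1] cinner_CS)

lemma parallelogram:
  fixes x y :: "'h::chilbert_space"
  shows "(norm (x + y))\<^sup>2 + (norm (x - y))\<^sup>2 = 2 * (norm x)\<^sup>2 + 2 * (norm y)\<^sup>2"
  using norm_add_sq[of x y] norm_add_sq[of x "- y"] by (simp add: cinner.minus_right)

lemma cinner_eqI:
  fixes x y :: "'h::chilbert_space"
  assumes "\<And>v. cinner v x = cinner v y"
  shows "x = y"
proof -
  have "cinner (x - y) (x - y) = 0"
    using assms[of "x - y"] by (simp add: cinner.diff_right)
  then show ?thesis by (simp add: cinner_self)
qed

lemma cspan_scaleR:
  "complex_vector.subspace S \<Longrightarrow> x \<in> S \<Longrightarrow> r *\<^sub>R x \<in> S"
  for x :: "'a::complex_vector"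
  by (simp add: scaleR_scaleC complex_vector.subspace_scale)

lemma closest_point_exists:
  fixes S :: "'h::chilbert_space set"
  assumes S: "complex_vector.subspace S" "closed S"
  shows "\<exists>s\<in>S. \<forall>t\<in>S. cinner t (v - s) = 0"
proof -
  define d where "d = (INF s\<in>S. (norm (v - s))\<^sup>2)"
  have ne: "S \<noteq> {}" using complex_vector.subspace_0[OF S(1)] by auto
  have bdd: "bdd_below ((\<lambda>s. (norm (v - s))\<^sup>2) ` S)" by (rule bdd_belowI[of _ 0]) auto
  have lower: "d \<le> (norm (v - s))\<^sup>2" if "s \<in> S" for s
    unfolding d_def by (rule cINF_lower[OF bdd that])
  have "\<exists>s\<in>S. (norm (v - s))\<^sup>2 < d + 1 / real (Suc n)" for n
    using cINF_less_iff[OF ne bdd, of "d + 1 / real (Suc n)"] unfolding d_def by simp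
  then obtain s where s: "\<And>n. s n \<in> S" "\<And>n. (norm (v - s n))\<^sup>2 < d + 1 / real (Suc n)"
    by metis
  \<comment> \<open>The midpoint of \<open>a\<close> and \<open>b\<close> stays in \<open>S\<close>;
    with the parallelogram law this makes every minimising sequence Cauchy.\<close>
  have key: "(norm (a - b))\<^sup>2 \<le> 2 * ((norm (v - a))\<^sup>2 - d) + 2 * ((norm (v - b))\<^sup>2 - d)"
    if "a \<in> S" "b \<in> S" for a b
  proof -
    have "(1/2) *\<^sub>R (a + b) \<in> S"
      using that S(1) by (intro cspan_scaleR complex_vector.subspace_add)
    then have "d \<le> (norm (v - (1/2) *\<^sub>R (a + b)))\<^sup>2" by (rule lower)
    also have "v - (1/2) *\<^sub>R (a + b) = (1/2) *\<^sub>R ((v - a) + (v - b))"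
      by (simp add: algebra_simps flip: scaleR_2)
    also have "(norm \<dots>)\<^sup>2 = (norm ((v - a) + (v - b)))\<^sup>2 / 4"
      by (simp add: power_mult_distrib power_divide)
    finally show ?thesis
      using parallelogram[of "v - a" "v - b"] by (simp add: norm_minus_commute)
  qed
  have "Cauchy s"
  proof (rule metric_CauchyI)
    fix e :: real assume "e > 0"
    then obtain N where N: "1 / real (Suc N) < e\<^sup>2 / 4"
      using nat_approx_posE[of "e\<^sup>2/4"] by auto
    have "dist (s m) (s n) < e" if "m \<ge> N" "n \<ge> N" for m n
    proof -
      have "1 / real (Suc k) \<le> 1 / real (Suc N)" if "k \<ge> N" for k
        using that by (simp add: frac_le)
      then have small: "(norm (v - s k))\<^sup>2 - d < e\<^sup>2 / 4" if "k \<ge> N" for k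
        using s(2)[of k] N that by (smt (verit))
      have aux: "a < y" if "a \<le> 2 * b + 2 * c" "b < y / 4" "c < y / 4" for a b c y :: real
        using that by simp
      have "(norm (s m - s n))\<^sup>2 < e\<^sup>2"
        by (rule aux[OF key[OF s(1) s(1)] small[OF that(1)] small[OF that(2)]])
      then show ?thesis
        using \<open>e > 0\<close> by (simp add: dist_norm power_less_imp_less_base)
    qed
    then show "\<exists>M. \<forall>m\<ge>M. \<forall>n\<ge>M. dist (s m) (s n) < e" by blast
  qed
  then obtain l where l: "s \<longlonglongrightarrow> l" using Cauchy_convergent_iff convergent_def by blast
  have lS: "l \<in> S" using closed_sequentially[OF S(2)] s(1) l by auto
  have "(\<lambda>n. (norm (v - s n))\<^sup>2) \<longlonglongrightarrow> (norm (v - l))\<^sup>2"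
    by (intro tendsto_intros l)
  moreover have "(\<lambda>n. d + 1 / real (Suc n)) \<longlonglongrightarrow> d + 0"
    by (intro tendsto_intros) (rule LIMSEQ_inverse_real_of_nat[unfolded inverse_eq_divide])
  ultimately have ld: "(norm (v - l))\<^sup>2 \<le> d"
    using s(2) by (intro LIMSEQ_le[of _ "(norm (v - l))\<^sup>2" _ "d"]) (auto intro: less_imp_le)
  have "cinner t (v - l) = 0" if t: "t \<in> S" for t
  proof (cases "t = 0")
    case False
    \<comment> \<open>The optimal step along \<open>t\<close>: it lowers the squared distance by
      |c|^2 |t|^2, so minimality of \<open>l\<close> forces \<open>c = 0\<close>.\<close>
    define c where "c = cinner t (v - l) / of_real ((norm t)\<^sup>2)"
    define u where "u = v - l"
    have nt: "(norm t)\<^sup>2 > 0" using False by simp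
    have "l + c *\<^sub>C t \<in> S"
      using t lS S(1) by (intro complex_vector.subspace_add complex_vector.subspace_scale)
    then have "(norm u)\<^sup>2 \<le> (norm (v - (l + c *\<^sub>C t)))\<^sup>2"
      using lower[of "l + c *\<^sub>C t"] ld unfolding u_def by linarith
    also have "v - (l + c *\<^sub>C t) = u + (- c) *\<^sub>C t" by (simp add: u_def)
    also have "(norm (u + (- c) *\<^sub>C t))\<^sup>2 = (norm u)\<^sup>2 - 2 * Re (c * cinner u t) + (cmod c)\<^sup>2 * (norm t)\<^sup>2"
      unfolding norm_add_sq cinner_scaleC_right norm_scaleC by (simp add: power_mult_distrib)
    also have "c * cinner u t = of_real ((cmod c)\<^sup>2 * (norm t)\<^sup>2)"
    proof -
      have "cinner t u = c * of_real ((norm t)\<^sup>2)" using nt by (simp add: c_def u_def)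
      then have "cinner u t = cnj c * of_real ((norm t)\<^sup>2)"
        by (metis cinner_commute complex_cnj_complex_of_real complex_cnj_mult)
      then have "c * cinner u t = (c * cnj c) * of_real ((norm t)\<^sup>2)" by simp
      also have "c * cnj c = of_real ((cmod c)\<^sup>2)" by (simp only: complex_norm_square)
      finally show ?thesis by simp
    qed
    finally have "(cmod c)\<^sup>2 * (norm t)\<^sup>2 \<le> 0" by (simp add: mult.commute)
    then have "c = 0" using nt by (simp add: mult_le_0_iff)
    then show ?thesis using nt by (simp add: c_def)
  qed (simp add: cinner.zero_left)
  with lS show ?thesis by blast
qed

lemma riesz:
  fixes f :: "'h::chilbert_space \<Rightarrow> complex"
  assumes add: "\<And>x y. f (x + y) = f x + f y" and scale: "\<And>c x. f (c *\<^sub>C x) = c * f x"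
    and bound: "\<And>x. cmod (f x) \<le> K * norm x"
  shows "\<exists>r. \<forall>x. f x = cinner r x"
proof (cases "\<forall>x. f x = 0")
  case True then show ?thesis by (intro exI[of _ 0]) (auto simp: cinner.zero_left)
next
  case False
  then obtain v where v: "f v \<noteq> 0" by blast
  have bl: "bounded_linear f"
    by (rule bounded_linear_intro[where K = K])
      (auto simp: add scaleR_scaleC[of _ "x :: 'h" for x] scale scaleR_conv_of_real
        intro: order_trans[OF bound] simp: mult.commute)
  define S where "S = {x. f x = 0}"
  have "closed S"
    unfolding S_def using bl
    by (intro closed_Collect_eq continuous_intros linear_continuous_on)
  moreover have "complex_vector.subspace S"
    unfolding S_def complex_vector.subspace_def
    using scale[of 0] by (auto simp: add scale)
  ultimately obtain s where s: "s \<in> S" "\<And>t. t \<in> S \<Longrightarrow> cinner t (v - s) = 0"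
    using closest_point_exists by metis
  define w where "w = v - s"
  have fw: "f w = f v" using add[of w s] s(1) by (simp add: w_def S_def)
  have w0: "w \<noteq> 0" using fw v scale[of 0 w] by auto
  have "f x = cinner ((cnj (f w) / of_real ((norm w)\<^sup>2)) *\<^sub>C w) x" for x
  proof -
    have "x + (- f x / f w) *\<^sub>C w \<in> S"
      using fw v by (simp add: S_def add scale del: complex_vector.scale_minus_left)
    then have "cinner (x + (- f x / f w) *\<^sub>C w) w = 0" using s(2) by (simp add: w_def)
    then have "cinner w (x + (- f x / f w) *\<^sub>C w) = 0" by (metis cinner_commute complex_cnj_zero)
    then have "cinner w x = (f x / f w) * of_real ((norm w)\<^sup>2)"
      unfolding cinner_add_right cinner_scaleC_right cinner_self by (simp add: add_eq_0_iff)
    then show ?thesis using w0 fw v by (simp add: cinner_scaleC_left)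
  qed
  then show ?thesis by blast
qed

section \<open>Adjoints\<close>

lemma bounded_opsD:
  "x \<in> bounded_ops \<Longrightarrow> blinfun_apply x (c *\<^sub>C v) = c *\<^sub>C blinfun_apply x v"
  by (simp add: bounded_ops_def)

lemma bounded_opsI:
  "(\<And>c v. blinfun_apply x (c *\<^sub>C v) = c *\<^sub>C blinfun_apply x v) \<Longrightarrow> x \<in> bounded_ops"
  by (simp add: bounded_ops_def)

lemma blinfun_from_linear:
  fixes f :: "'h::chilbert_space \<Rightarrow> 'h"
  assumes "\<And>x y. f (x + y) = f x + f y" "\<And>c x. f (c *\<^sub>C x) = c *\<^sub>C f x"
    and "\<And>x. norm (f x) \<le> K * norm x"
  shows "\<exists>y\<in>bounded_ops. \<forall>v. blinfun_apply y v = f v"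
proof -
  have bl: "bounded_linear f"
    by (rule bounded_linear_intro[where K = K]) (auto simp: assms scaleR_scaleC mult.commute)
  show ?thesis
    by (rule bexI[of _ "Blinfun f"])
      (auto simp: bounded_linear_Blinfun_apply[OF bl] assms intro!: bounded_opsI)
qed

text \<open>Riesz representation in one slot for each fixed vector in the other. It produces
  adjoints here and, later, the element of \<open>A\<close> behind a bounded member of the extended
  positive cone.\<close>

lemma op_from_form:
  fixes B :: "'h::chilbert_space \<Rightarrow> 'h \<Rightarrow> complex"
  assumes "\<And>x y z. B x (y + z) = B x y + B x z" "\<And>c x y. B x (c *\<^sub>C y) = c * B x y"
    and "\<And>x y z. B (x + y) z = B x z + B y z" "\<And>c x y. B (c *\<^sub>C x) y = cnj c * B x y"
    and bound: "\<And>x y. cmod (B x y) \<le> K * norm x * norm y" and K: "K \<ge> 0"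
  shows "\<exists>b\<in>bounded_ops. \<forall>x y. B x y = cinner x (blinfun_apply b y)"
proof -
  have "\<exists>r. \<forall>x. cnj (B x y) = cinner r x" for y
    by (rule riesz[where K = "K * norm y"]) (auto simp: assms mult.assoc mult.left_commute
        intro: order_trans[OF bound])
  then obtain r where r0: "\<And>x y. cnj (B x y) = cinner (r y) x" by metis
  have r: "B x y = cinner x (r y)" for x y
    by (metis r0 cinner_commute complex_cnj_cnj)
  have "\<exists>b\<in>bounded_ops. \<forall>v. blinfun_apply b v = r v"
  proof (rule blinfun_from_linear[where K = K])
    show "r (x + y) = r x + r y" for x y
      by (rule cinner_eqI) (simp add: cinner_add_right flip: r, simp add: assms)
    show "r (c *\<^sub>C x) = c *\<^sub>C r x" for c x
      by (rule cinner_eqI) (simp add: cinner_scaleC_right flip: r, simp add: assms)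
    show "norm (r x) \<le> K * norm x" for x
    proof (cases "r x = 0")
      case False
      have "(norm (r x))\<^sup>2 = cmod (B (r x) x)" by (simp add: r cinner_self norm_power)
      also have "\<dots> \<le> K * norm (r x) * norm x" by (rule bound)
      finally show ?thesis using False by (simp add: power2_eq_square mult.commute mult.left_commute)
    qed (simp add: K)
  qed
  then show ?thesis using r by metis
qed

lemma adj_exists:
  assumes "x \<in> bounded_ops"
  shows "\<exists>y\<in>bounded_ops. \<forall>v w. cinner (blinfun_apply y v) w = cinner v (blinfun_apply x w)"
proof -
  have "\<exists>b\<in>bounded_ops. \<forall>u v. cinner (x u) v = cinner u (blinfun_apply b v)"
    by (rule op_from_form[where K = "norm x"])
      (auto simp: blinfun.add_right cinner_add_left cinner_add_right bounded_opsD[OF assms]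
        cinner_scaleC_left cinner_scaleC_right
        intro!: order_trans[OF cinner_CS] mult_right_mono[OF norm_blinfun])
  then show ?thesis by (metis cinner_commute)
qed

lemma adj_unique:
  assumes "\<And>v w. cinner (blinfun_apply y v) w = cinner v (blinfun_apply x w)"
  shows "adj x = y"
  unfolding adj_def
proof (rule the_equality)
  fix z assume z: "\<forall>v w. cinner (blinfun_apply z v) w = cinner v (x w)"
  show "z = y"
  proof (rule blinfun_eqI, rule cinner_eqI)
    fix i v show "cinner v (z i) = cinner v (y i)"
      using assms[of i v] z by (metis cinner_commute)
  qed
qed (simp add: assms)

lemma
  assumes "x \<in> bounded_ops"
  shows adj_bounded_ops[simp]: "adj x \<in> bounded_ops"
    and cinner_adj_left: "cinner (blinfun_apply (adj x) v) w = cinner v (blinfun_apply x w)"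
    and cinner_adj_right: "cinner v (blinfun_apply (adj x) w) = cinner (blinfun_apply x v) w"
proof -
  obtain y where y: "y \<in> bounded_ops" "\<And>v w. cinner (blinfun_apply y v) w = cinner v (x w)"
    using adj_exists[OF assms] by blast
  then have "adj x = y" using adj_unique by blast
  then show "adj x \<in> bounded_ops" "cinner (adj x v) w = cinner v (x w)" using y by auto
  then show "cinner v (adj x w) = cinner (x v) w"
    using y \<open>adj x = y\<close> by (metis cinner_commute)
qed

lemma adj_adj[simp]: "x \<in> bounded_ops \<Longrightarrow> adj (adj x) = x"
  by (rule adj_unique) (simp add: cinner_adj_right)

lemma bounded_ops_id[simp]: "id_blinfun \<in> bounded_ops"
  and bounded_ops_zero[simp]: "0 \<in> bounded_ops"
  and bounded_ops_add[simp]: "x \<in> bounded_ops \<Longrightarrow> y \<in> bounded_ops \<Longrightarrow> x + y \<in> bounded_ops"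
  and bounded_ops_diff[simp]: "x \<in> bounded_ops \<Longrightarrow> y \<in> bounded_ops \<Longrightarrow> x - y \<in> bounded_ops"
  and bounded_ops_minus[simp]: "x \<in> bounded_ops \<Longrightarrow> - x \<in> bounded_ops"
  and bounded_ops_comp[simp]: "x \<in> bounded_ops \<Longrightarrow> y \<in> bounded_ops \<Longrightarrow> x o\<^sub>L y \<in> bounded_ops"
  by (auto simp: bounded_ops_def blinfun.add_left blinfun.diff_left blinfun.minus_left
      complex_vector.scale_right_distrib complex_vector.scale_right_diff_distrib)

lemma blinfun_scaleC_apply[simp]: "blinfun_apply (c *\<^sub>C x) v = c *\<^sub>C blinfun_apply x v"
  by (transfer; simp)

lemma bounded_ops_scaleC[simp]: "x \<in> bounded_ops \<Longrightarrow> c *\<^sub>C x \<in> bounded_ops"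
  by (auto simp: bounded_ops_def scaleC_scaleC mult.commute)

lemma bounded_ops_scaleR[simp]: "x \<in> bounded_ops \<Longrightarrow> r *\<^sub>R x \<in> bounded_ops"
  by (simp add: scaleR_scaleC)

lemma bounded_ops_sum: "(\<And>i. i \<in> F \<Longrightarrow> f i \<in> bounded_ops) \<Longrightarrow> sum f F \<in> bounded_ops"
  by (induction F rule: infinite_finite_induct) auto

lemma adj_comp: "x \<in> bounded_ops \<Longrightarrow> y \<in> bounded_ops \<Longrightarrow> adj (x o\<^sub>L y) = adj y o\<^sub>L adj x"
  by (rule adj_unique) (simp add: cinner_adj_left)

lemma adj_add: "x \<in> bounded_ops \<Longrightarrow> y \<in> bounded_ops \<Longrightarrow> adj (x + y) = adj x + adj y"
  by (rule adj_unique) (simp add: cinner_adj_left blinfun.add_left cinner_add_left cinner_add_right)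

lemma adj_diff: "x \<in> bounded_ops \<Longrightarrow> y \<in> bounded_ops \<Longrightarrow> adj (x - y) = adj x - adj y"
  by (rule adj_unique) (simp add: cinner_adj_left blinfun.diff_left cinner.diff_left cinner.diff_right)

lemma adj_scaleC: "x \<in> bounded_ops \<Longrightarrow> adj (c *\<^sub>C x) = cnj c *\<^sub>C adj x"
  by (rule adj_unique) (simp add: cinner_adj_left cinner_scaleC_left cinner_scaleC_right)

section \<open>Positive operators\<close>

text \<open>Complex linearity has to be demanded explicitly, because the ambient type also contains
  maps that are only real-linear.\<close>

definition sa :: "('h::chilbert_space \<Rightarrow>\<^sub>L 'h) \<Rightarrow> bool" where
  "sa x \<longleftrightarrow> x \<in> bounded_ops \<and> (\<forall>v w. cinner (x v) w = cinner v (x w))"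

definition pos :: "('h::chilbert_space \<Rightarrow>\<^sub>L 'h) \<Rightarrow> bool" where
  "pos x \<longleftrightarrow> sa x \<and> (\<forall>v. 0 \<le> Re (cinner v (x v)))"

definition proj :: "('h::chilbert_space \<Rightarrow>\<^sub>L 'h) \<Rightarrow> bool" where
  "proj p \<longleftrightarrow> sa p \<and> (\<forall>v. p (p v) = p v)"

lemma saD: "sa x \<Longrightarrow> cinner (blinfun_apply x v) w = cinner v (blinfun_apply x w)"
  and sa_bounded_ops: "sa x \<Longrightarrow> x \<in> bounded_ops"
  by (auto simp: sa_def)

lemma sa_iff_adj: "sa x \<longleftrightarrow> x \<in> bounded_ops \<and> adj x = x"
  using adj_unique[of x x] cinner_adj_left[of x] by (auto simp: sa_def)

lemma sa_adj: "sa x \<Longrightarrow> adj x = x"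
  by (simp add: sa_iff_adj)

lemma saI: "x \<in> bounded_ops \<Longrightarrow>
    (\<And>v w. cinner (blinfun_apply x v) w = cinner v (blinfun_apply x w)) \<Longrightarrow> sa x"
  by (simp add: sa_def)

lemma posD: "pos x \<Longrightarrow> 0 \<le> Re (cinner v (blinfun_apply x v))"
  and pos_sa: "pos x \<Longrightarrow> sa x"
  and pos_bounded_ops: "pos x \<Longrightarrow> x \<in> bounded_ops"
  by (auto simp: pos_def sa_def)

lemma posI: "sa x \<Longrightarrow> (\<And>v. 0 \<le> Re (cinner v (blinfun_apply x v))) \<Longrightarrow> pos x"
  by (simp add: pos_def)

lemma sa_cinner_real:
  "sa x \<Longrightarrow> cinner v (blinfun_apply x v) = of_real (Re (cinner v (blinfun_apply x v)))"
proof -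
  assume "sa x"
  then have "cinner v (blinfun_apply x v) = cnj (cinner v (blinfun_apply x v))"
    using cinner_commute[of v "blinfun_apply x v"] by (simp add: saD)
  then have "Im (cinner v (blinfun_apply x v)) = 0" by (simp add: complex_eq_iff)
  then show ?thesis by (simp add: complex_eq_iff)
qed

lemma polarization:
  fixes x :: "'h::chilbert_space \<Rightarrow>\<^sub>L 'h"
  assumes "x \<in> bounded_ops"
  shows "4 * cinner v (x w) = cinner (v + w) (x (v + w)) - cinner (v - w) (x (v - w))
    - \<i> * cinner (v + \<i> *\<^sub>C w) (x (v + \<i> *\<^sub>C w)) + \<i> * cinner (v - \<i> *\<^sub>C w) (x (v - \<i> *\<^sub>C w))"
  by (simp add: blinfun.add_right blinfun.diff_right cinner.add_left cinner.add_right
      cinner.diff_left cinner.diff_right bounded_opsD[OF assms] cinner_scaleC_left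
      cinner_scaleC_right algebra_simps)

text \<open>Real diagonal values agree with those of \<open>adj x\<close>, and polarisation recovers
  an operator from its diagonal. This is what identifies the order \<open>op_le\<close> with
  \<open>pos\<close>.\<close>

lemma sa_if_form_real:
  assumes x: "x \<in> bounded_ops" and re: "\<And>v. Im (cinner v (blinfun_apply x v)) = 0"
  shows "sa x"
proof (rule saI[OF x])
  fix v w
  have ad: "cinner u (x u) = cinner u (adj x u)" for u
    using re[of u] by (simp add: cinner_adj_right[OF x] cinner_commute[of "x u" u] complex_eq_iff)
  have "4 * cinner v (x w) = 4 * cinner v (adj x w)"
    unfolding polarization[OF x] polarization[OF adj_bounded_ops[OF x]] ad ..
  then show "cinner (x v) w = cinner v (x w)" by (simp add: cinner_adj_right[OF x])
qed

lemma op_le_pos: "x \<in> bounded_ops \<Longrightarrow> y \<in> bounded_ops \<Longrightarrow> op_le x y \<longleftrightarrow> pos (y - x)"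
proof
  assume xy: "x \<in> bounded_ops" "y \<in> bounded_ops" and "op_le x y"
  then have *: "\<And>v. cinner v ((y - x) v) \<in> \<real>\<^sub>\<ge>\<^sub>0" by (simp add: op_le_def)
  show "pos (y - x)"
    using * by (intro posI sa_if_form_real) (auto simp: xy complex_nonneg_Reals_iff)
next
  assume xy: "x \<in> bounded_ops" "y \<in> bounded_ops" and p: "pos (y - x)"
  show "op_le x y"
    unfolding op_le_def complex_nonneg_Reals_iff
  proof
    fix v
    show "0 \<le> Re (cinner v ((y - x) v)) \<and> Im (cinner v ((y - x) v)) = 0"
      using posD[OF p, of v] arg_cong[OF sa_cinner_real[OF pos_sa[OF p], of v], of Im] by simp
  qed
qed

lemma op_le_zero_pos: "x \<in> bounded_ops \<Longrightarrow> op_le 0 x \<longleftrightarrow> pos x"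
  using op_le_pos[of 0 x] by simp

lemma sa_add: "sa x \<Longrightarrow> sa y \<Longrightarrow> sa (x + y)"
  and sa_diff: "sa x \<Longrightarrow> sa y \<Longrightarrow> sa (x - y)"
  and sa_scaleR: "sa x \<Longrightarrow> sa (r *\<^sub>R x)"
  and sa_zero: "sa 0" and sa_id: "sa id_blinfun"
  by (auto simp: sa_def blinfun.bilinear_simps cinner.add_left cinner.add_right cinner.diff_left
      cinner.diff_right cinner_scaleR_left cinner_scaleR_right)

lemma pos_add: "pos x \<Longrightarrow> pos y \<Longrightarrow> pos (x + y)"
  and pos_scaleR: "0 \<le> r \<Longrightarrow> pos x \<Longrightarrow> pos (r *\<^sub>R x)"
  and pos_zero: "pos 0" and pos_id: "pos id_blinfun"
  by (auto simp: pos_def sa_add sa_scaleR sa_zero sa_id blinfun.bilinear_simps cinner.add_right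
      cinner_scaleR_right simp flip: norm_sq_cinner)

lemma pos_sum: "(\<And>i. i \<in> F \<Longrightarrow> pos (f i)) \<Longrightarrow> pos (sum f F)"
  by (induction F rule: infinite_finite_induct) (auto intro: pos_add pos_zero)

lemma pos_conj: "pos x \<Longrightarrow> b \<in> bounded_ops \<Longrightarrow> pos (adj b o\<^sub>L x o\<^sub>L b)"
  unfolding pos_def sa_def
  by (auto simp: cinner_adj_left cinner_adj_right)

lemma pos_adj_comp: "b \<in> bounded_ops \<Longrightarrow> pos (adj b o\<^sub>L b)"
  by (intro posI saI) (auto simp: cinner_adj_left cinner_adj_right simp flip: norm_sq_cinner)

lemma Re_cinner_le: "Re (cinner v (x v)) \<le> norm x * (norm v)\<^sup>2"
  for x :: "'h::chilbert_space \<Rightarrow>\<^sub>L 'h"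
proof -
  have "Re (cinner v (x v)) \<le> norm v * norm (x v)" by (rule CS_Re)
  also have "\<dots> \<le> norm v * (norm x * norm v)" by (intro mult_left_mono norm_blinfun) simp
  finally show ?thesis by (simp add: power2_eq_square mult_ac)
qed

lemma pos_CS:
  assumes "pos x"
  shows "(cmod (cinner v (blinfun_apply x w)))\<^sup>2
    \<le> Re (cinner v (blinfun_apply x v)) * Re (cinner w (blinfun_apply x w))"
proof -
  define a b where "a = Re (cinner v (x v))" and "b = Re (cinner w (x w))"
  define c where "c = cinner v (x w)"
  have ab: "0 \<le> a" "0 \<le> b" using posD[OF assms] by (auto simp: a_def b_def)
  have bo: "x \<in> bounded_ops" using assms by (rule pos_bounded_ops)
  have cw: "cinner w (x v) = cnj c"
    unfolding c_def by (metis saD[OF pos_sa[OF assms]] cinner_commute)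
  \<comment> \<open>The phase of \<open>z\<close> makes the cross term real, so positivity of the
    form at \<open>v + z *\<^sub>C w\<close> becomes a quadratic inequality in
    \<open>t\<close>.\<close>
  have ex: "0 \<le> a - 2 * t * (cmod c)\<^sup>2 + t\<^sup>2 * (cmod c)\<^sup>2 * b" for t :: real
  proof -
    define z where "z = - of_real t * cnj c"
    have "0 \<le> Re (cinner (v + z *\<^sub>C w) (x (v + z *\<^sub>C w)))" by (rule posD[OF assms])
    also have "\<dots> = a + 2 * Re (z * c) + (cmod z)\<^sup>2 * b"
    proof -
      have "cinner (v + z *\<^sub>C w) (x (v + z *\<^sub>C w)) =
        cinner v (x v) + z * c + cnj z * cnj c + cnj z * z * cinner w (x w)"
        by (simp add: blinfun.add_right bounded_opsD[OF bo] cinner.add_left cinner.add_right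
            cinner_scaleC_left cinner_scaleC_right cw c_def[symmetric] algebra_simps)
      moreover have "cnj z * z = of_real ((cmod z)\<^sup>2)" by (simp only: complex_norm_square mult.commute)
      moreover have "Re (cnj z * cnj c) = Re (z * c)" by simp
      ultimately show ?thesis by (simp add: a_def b_def)
    qed
    also have "z * c = of_real (- t * (cmod c)\<^sup>2)"
      by (simp add: z_def complex_norm_square del: of_real_power)
    also have "(cmod z)\<^sup>2 = t\<^sup>2 * (cmod c)\<^sup>2"
      by (simp add: z_def norm_mult power_mult_distrib)
    finally show ?thesis by simp
  qed
  show ?thesis
  proof (cases "b = 0")
    case True
    have "(cmod c)\<^sup>2 \<le> 0"
    proof (rule ccontr)
      assume "\<not> (cmod c)\<^sup>2 \<le> 0"
      \<comment> \<open>At this \<open>t\<close>, with \<open>b = 0\<close>, the right side of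
        \<open>ex\<close> equals -1.\<close>
      then show False using ex[of "(a + 1) / (2 * (cmod c)\<^sup>2)"] True by simp
    qed
    then show ?thesis using ab by (simp add: c_def a_def b_def)
  next
    case False
    then have "b > 0" using ab by simp
    have "0 \<le> a - (cmod c)\<^sup>2 / b"
      using ex[of "1 / b"] \<open>b > 0\<close> by (simp add: power2_eq_square field_simps)
    then show ?thesis using \<open>b > 0\<close> by (simp add: a_def[symmetric] b_def[symmetric] c_def[symmetric] field_simps)
  qed
qed

text \<open>Cauchy-Schwarz for the form of \<open>x\<close> at the pair \<open>x v\<close>,
  \<open>v\<close>. In operator terms this is x^2 \<le> |x| x, the standard way below to get from
  forms to norms.\<close>

lemma pos_norm_sq_le:
  assumes "pos x"
  shows "(norm (blinfun_apply x v))\<^sup>2 \<le> norm x * Re (cinner v (blinfun_apply x v))"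
proof (cases "x v = 0")
  case False
  have "((norm (x v))\<^sup>2)\<^sup>2 = (cmod (cinner (x v) (x v)))\<^sup>2" by (simp add: cinner_self norm_power)
  also have "\<dots> \<le> Re (cinner (x v) (x (x v))) * Re (cinner v (x v))" by (rule pos_CS[OF assms])
  also have "\<dots> \<le> (norm x * (norm (x v))\<^sup>2) * Re (cinner v (x v))"
    by (intro mult_right_mono Re_cinner_le posD[OF assms])
  finally have "(norm (x v))\<^sup>2 * (norm (x v))\<^sup>2 \<le> (norm (x v))\<^sup>2 * (norm x * Re (cinner v (x v)))"
    by (simp only: power2_eq_square mult_ac)
  then show ?thesis using False by (subst (asm) mult_le_cancel_left_pos) auto
qed (simp add: cinner.zero_right)

lemma pos_form_zero:
  "pos x \<Longrightarrow> Re (cinner v (blinfun_apply x v)) = 0 \<Longrightarrow> blinfun_apply x v = 0"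
  using pos_norm_sq_le[of x v] by (simp add: power2_eq_square mult_le_0_iff)

text \<open>The same pair \<open>x v\<close>, \<open>v\<close> in \<open>pos_CS\<close>, now with
  only a bound on the form as input.\<close>

lemma pos_norm_le:
  assumes "pos x" "\<And>v. Re (cinner v (blinfun_apply x v)) \<le> c * (norm v)\<^sup>2" "0 \<le> c"
  shows "norm x \<le> c"
proof (rule norm_blinfun_bound[OF assms(3)])
  fix v
  show "norm (x v) \<le> c * norm v"
  proof (cases "x v = 0")
    case False
    have "((norm (x v))\<^sup>2)\<^sup>2 = (cmod (cinner (x v) (x v)))\<^sup>2" by (simp add: cinner_self norm_power)
    also have "\<dots> \<le> Re (cinner (x v) (x (x v))) * Re (cinner v (x v))" by (rule pos_CS[OF assms(1)])
    also have "\<dots> \<le> (c * (norm (x v))\<^sup>2) * (c * (norm v)\<^sup>2)"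
      by (intro mult_mono assms posD[OF assms(1)]) (simp add: assms(3))
    finally have "(norm (x v))\<^sup>2 * (norm (x v))\<^sup>2 \<le> (norm (x v))\<^sup>2 * ((c * norm v)\<^sup>2)"
      by (simp only: power2_eq_square mult_ac)
    then have "(norm (x v))\<^sup>2 \<le> (c * norm v)\<^sup>2"
      using False by (subst (asm) mult_le_cancel_left_pos) auto
    then show ?thesis using assms(3) by (meson mult_nonneg_nonneg norm_ge_zero power2_le_imp_le)
  qed (use assms(3) in simp)
qed

lemma sa_zero_form: "sa x \<Longrightarrow> (\<And>v. Re (cinner v (blinfun_apply x v)) = 0) \<Longrightarrow> x = 0"
  using pos_form_zero[of x] posI[of x] by (intro blinfun_eqI) auto

lemma proj_sa: "proj p \<Longrightarrow> sa p" and projD: "proj p \<Longrightarrow> blinfun_apply p (blinfun_apply p v) = blinfun_apply p v"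
  and proj_bounded_ops: "proj p \<Longrightarrow> p \<in> bounded_ops"
  by (auto simp: proj_def sa_def)

lemma proj_form: "proj p \<Longrightarrow> cinner v (blinfun_apply p v) = of_real ((norm (blinfun_apply p v))\<^sup>2)"
  using cinner_self[of "blinfun_apply p v"] by (simp add: projD proj_sa saD)

lemma proj_pos: "proj p \<Longrightarrow> pos p"
  by (auto simp: pos_def proj_sa proj_form)

lemma proj_pythagoras: "proj p \<Longrightarrow>
    (norm v)\<^sup>2 = (norm (blinfun_apply p v))\<^sup>2 + (norm (v - blinfun_apply p v))\<^sup>2"
proof -
  assume p: "proj p"
  have "cinner (p v) (v - p v) = 0"
    using p by (simp add: cinner.diff_right saD[OF proj_sa[OF p]] projD blinfun.diff_right)
  then show ?thesis using norm_add_sq[of "p v" "v - p v"] by simp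
qed

lemma proj_norm_le: "proj p \<Longrightarrow> norm (blinfun_apply p v) \<le> norm v"
  using proj_pythagoras[of p v] zero_le_power2[of "norm (v - blinfun_apply p v)"]
  by (intro power2_le_imp_le[OF _ norm_ge_zero]) linarith

lemma proj_complement: "proj p \<Longrightarrow> proj (id_blinfun - p)"
  by (simp add: proj_def sa_diff[OF sa_id] blinfun.diff_left blinfun.diff_right)

lemma proj_zero: "proj 0"
  by (auto simp: proj_def sa_id sa_zero)

lemma proj_onto:
  fixes S :: "'h::chilbert_space set"
  assumes S: "complex_vector.subspace S" "closed S"
  shows "\<exists>p. proj p \<and> range (blinfun_apply p) = S"
proof -
  obtain P where P: "\<And>v. P v \<in> S" "\<And>v t. t \<in> S \<Longrightarrow> cinner t (v - P v) = 0"
    using closest_point_exists[OF S] by metis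
  have uniq: "P v = s" if "s \<in> S" "\<And>t. t \<in> S \<Longrightarrow> cinner t (v - s) = 0" for v s
  proof -
    have *: "P v - s \<in> S" by (intro complex_vector.subspace_diff S P that(1))
    have "cinner (P v - s) ((v - s) - (v - P v)) = 0"
      by (simp only: cinner.diff_right[of _ "v - s" "v - P v"] that(2)[OF *] P(2)[OF *] diff_zero)
    then show ?thesis by (simp add: cinner_self)
  qed
  have nle: "norm (P x) \<le> 1 * norm x" for x
  proof -
    have "(norm x)\<^sup>2 = (norm (P x))\<^sup>2 + (norm (x - P x))\<^sup>2"
      using norm_add_sq[of "P x" "x - P x"] P by simp
    then have "(norm (P x))\<^sup>2 \<le> (norm x)\<^sup>2" by simp
    then have "norm (P x) \<le> norm x" by (rule power2_le_imp_le) simp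
    then show ?thesis by simp
  qed
  obtain p where p: "p \<in> bounded_ops" "\<And>v. blinfun_apply p v = P v"
  proof -
    have "\<exists>y\<in>bounded_ops. \<forall>v. blinfun_apply y v = P v"
    proof (rule blinfun_from_linear[OF _ _ nle])
      fix x y
      have "x + y - (P x + P y) = (x - P x) + (y - P y)" by simp
      then show "P (x + y) = P x + P y"
        by (intro uniq complex_vector.subspace_add S P) (simp only: cinner_add_right P add_0)
    next
      fix c x
      have "c *\<^sub>C x - c *\<^sub>C P x = c *\<^sub>C (x - P x)"
        by (simp add: complex_vector.scale_right_diff_distrib)
      then show "P (c *\<^sub>C x) = c *\<^sub>C P x"
        by (intro uniq complex_vector.subspace_scale S P) (simp only: cinner_scaleC_right P mult_zero_right)
    qed
    then show ?thesis using that by blast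
  qed
  have fixS: "P s = s" if "s \<in> S" for s
    by (rule uniq[OF that]) (simp add: cinner.zero_right)
  have "cinner (P v) w = cinner v (P w)" for v w
  proof -
    have "cinner (P v) w = cinner (P v) (P w)" using P(2)[OF P(1), of v w] by (simp add: cinner.diff_right)
    moreover have "cinner v (P w) = cinner (P v) (P w)"
    proof -
      have "cinner (P w) (P v) = cinner (P w) v" using P(2)[OF P(1), of w v] by (simp add: cinner.diff_right)
      then show ?thesis by (metis cinner_commute)
    qed
    ultimately show ?thesis by simp
  qed
  then have "proj p" using p fixS P(1) by (auto simp: proj_def sa_def)
  moreover have "range (blinfun_apply p) = S"
  proof
    show "range (blinfun_apply p) \<subseteq> S" using p P(1) by auto
    show "S \<subseteq> range (blinfun_apply p)"
      using p fixS by (metis rangeI subsetI)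
  qed
  ultimately show ?thesis by blast
qed

section \<open>Operators generated by a self-adjoint operator\<close>

text \<open>\<open>n\<close> lies in the bicommutant of \<open>d\<close>. Square roots, resolvents
  and spectral projections of \<open>d\<close> are tracked only through this relation: it makes them
  commute with each other (\<open>dcomm_commutes\<close>) and puts them into every von Neumann
  algebra that contains \<open>d\<close> (\<open>vna_dcomm\<close>).\<close>

definition dcomm :: "('h::chilbert_space \<Rightarrow>\<^sub>L 'h) \<Rightarrow> ('h \<Rightarrow>\<^sub>L 'h) \<Rightarrow> bool" where
  "dcomm d n \<longleftrightarrow> n \<in> bounded_ops \<and>
    (\<forall>c\<in>bounded_ops. (\<forall>v. c (d v) = d (c v)) \<longrightarrow> (\<forall>v. c (n v) = n (c v)))"

lemma dcommD:
  "dcomm d n \<Longrightarrow> c \<in> bounded_ops \<Longrightarrow> (\<And>v. blinfun_apply c (blinfun_apply d v) = blinfun_apply d (blinfun_apply c v)) \<Longrightarrow>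
    blinfun_apply c (blinfun_apply n v) = blinfun_apply n (blinfun_apply c v)"
  by (auto simp: dcomm_def)

lemma dcomm_bounded_ops: "dcomm d n \<Longrightarrow> n \<in> bounded_ops"
  by (simp add: dcomm_def)

lemma dcomm_self: "d \<in> bounded_ops \<Longrightarrow> dcomm d d"
  by (simp add: dcomm_def)

lemma dcomm_id: "dcomm d id_blinfun" and dcomm_zero: "dcomm d 0"
  by (auto simp: dcomm_def blinfun.zero_right)

lemma dcomm_add: "dcomm d x \<Longrightarrow> dcomm d y \<Longrightarrow> dcomm d (x + y)"
  and dcomm_diff: "dcomm d x \<Longrightarrow> dcomm d y \<Longrightarrow> dcomm d (x - y)"
  and dcomm_comp: "dcomm d x \<Longrightarrow> dcomm d y \<Longrightarrow> dcomm d (x o\<^sub>L y)"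
  and dcomm_scaleR: "dcomm d x \<Longrightarrow> dcomm d (r *\<^sub>R x)"
  by (auto simp: dcomm_def blinfun.bilinear_simps)

lemma dcomm_trans: "dcomm d x \<Longrightarrow> dcomm x y \<Longrightarrow> dcomm d y"
  by (simp add: dcomm_def)

lemma dcomm_limit:
  assumes "\<And>n. dcomm d (T n)" "\<And>v. (\<lambda>n. blinfun_apply (T n) v) \<longlonglongrightarrow> blinfun_apply L v" "L \<in> bounded_ops"
  shows "dcomm d L"
  unfolding dcomm_def
proof (intro conjI ballI impI allI assms(3))
  fix c v assume c: "c \<in> bounded_ops" "\<forall>v. c (d v) = d (c v)"
  have "(\<lambda>n. c (T n v)) \<longlonglongrightarrow> c (L v)" by (intro blinfun.tendsto tendsto_const assms(2))
  moreover have "c (T n v) = T n (c v)" for n using assms(1)[of n] c by (simp add: dcomm_def)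
  ultimately show "c (L v) = L (c v)" using assms(2)[of "c v"] LIMSEQ_unique by fastforce
qed

lemma dcomm_commutes:
  assumes "dcomm d x" "dcomm d y" "d \<in> bounded_ops"
  shows "blinfun_apply x (blinfun_apply y v) = blinfun_apply y (blinfun_apply x v)"
proof -
  have "\<And>v. x (d v) = d (x v)" using assms(1,3) by (simp add: dcomm_def)
  then show ?thesis using dcommD[OF assms(2), of x] assms(1) by (simp add: dcomm_def)
qed

section \<open>Monotone sequences, square roots, resolvents, spectral projections\<close>

text \<open>The forms converge as bounded monotone real sequences. For a positive difference
  \<open>y\<close>, \<open>pos_norm_sq_le\<close> bounds |y v|^2 by a multiple of the form of
  \<open>y\<close> at \<open>v\<close>, and this turns convergence of forms into strong
  convergence.\<close>

lemma mono_seq_limit: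
  fixes T :: "nat \<Rightarrow> 'h::chilbert_space \<Rightarrow>\<^sub>L 'h"
  assumes saT: "\<And>n. sa (T n)" and mono: "\<And>n. pos (T (Suc n) - T n)"
    and bound: "\<And>n v. Re (cinner v (T n v)) \<le> C * (norm v)\<^sup>2" and C: "0 \<le> C"
  shows "\<exists>L. sa L \<and> (\<forall>v. (\<lambda>n. T n v) \<longlonglongrightarrow> blinfun_apply L v) \<and> (\<forall>n. pos (L - T n))"
proof -
  have mono': "pos (T m - T n)" if "n \<le> m" for n m
    using that
  proof (induction m rule: dec_induct)
    case (step m)
    have "T (Suc m) - T n = (T (Suc m) - T m) + (T m - T n)" by simp
    then show ?case using mono[of m] step.IH by (metis pos_add)
  qed (simp add: pos_zero)
  define q where "q v n = Re (cinner v (T n v))" for v n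
  have qmono: "q v n \<le> q v m" if "n \<le> m" for n m v
    using posD[OF mono'[OF that], of v] by (simp add: q_def blinfun.diff_left cinner.diff_right)
  define K where "K = C + norm (T 0)"
  have K: "K \<ge> 0" using C by (simp add: K_def)
  have "- (norm (T 0) * (norm v)\<^sup>2) \<le> q v 0" for v
    using Re_cinner_le[of v "- T 0"] by (simp add: q_def blinfun.minus_left cinner.minus_right)
  then have nT: "norm (T m - T n) \<le> K" if "n \<le> m" for n m
  proof (intro pos_norm_le[OF mono'[OF that] _ K])
    fix v
    have "Re (cinner v ((T m - T n) v)) = q v m - q v n"
      by (simp add: q_def blinfun.diff_left cinner.diff_right)
    also have "\<dots> \<le> C * (norm v)\<^sup>2 + norm (T 0) * (norm v)\<^sup>2"
      using bound[of v m] qmono[of 0 n v] \<open>- (norm (T 0) * (norm v)\<^sup>2) \<le> q v 0\<close> by (simp add: q_def)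
    finally show "Re (cinner v ((T m - T n) v)) \<le> K * (norm v)\<^sup>2" by (simp add: K_def algebra_simps)
  qed
  have sq: "(norm (T m v - T n v))\<^sup>2 \<le> K * (q v m - q v n)" if "n \<le> m" for n m v
  proof -
    have "(norm ((T m - T n) v))\<^sup>2 \<le> norm (T m - T n) * Re (cinner v ((T m - T n) v))"
      by (rule pos_norm_sq_le[OF mono'[OF that]])
    also have "\<dots> \<le> K * Re (cinner v ((T m - T n) v))"
      by (intro mult_right_mono nT that posD mono')
    finally show ?thesis by (simp add: q_def blinfun.diff_left cinner.diff_right)
  qed
  have "convergent (\<lambda>n. T n v)" for v
  proof (rule Cauchy_convergent, rule metric_CauchyI)
    fix e :: real assume e: "e > 0"
    have "incseq (q v)" using qmono by (simp add: incseq_def)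
    moreover have "\<forall>n. q v n \<le> C * (norm v)\<^sup>2" using bound by (simp add: q_def)
    ultimately obtain l where "q v \<longlonglongrightarrow> l" by (rule incseq_convergent)
    then have "Cauchy (q v)" by (rule LIMSEQ_imp_Cauchy)
    moreover have "e\<^sup>2 / (K + 1) > 0" using e K by simp
    ultimately obtain N where N: "\<And>m n. m \<ge> N \<Longrightarrow> n \<ge> N \<Longrightarrow> dist (q v m) (q v n) < e\<^sup>2 / (K + 1)"
      unfolding Cauchy_def by blast
    have le: "dist (T m v) (T n v) < e" if "n \<le> m" "n \<ge> N" for m n
    proof -
      have "(norm (T m v - T n v))\<^sup>2 \<le> K * (q v m - q v n)" by (rule sq[OF that(1)])
      also have "\<dots> \<le> (K + 1) * (q v m - q v n)"
        using qmono[OF that(1), of v] by (intro mult_right_mono) auto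
      also have "\<dots> < (K + 1) * (e\<^sup>2 / (K + 1))"
        using N[of m n] that K by (intro mult_strict_left_mono) (auto simp: dist_real_def)
      also have "\<dots> = e\<^sup>2" using K by simp
      finally show ?thesis using e by (simp add: dist_norm power_less_imp_less_base)
    qed
    then have "dist (T m v) (T n v) < e" if "m \<ge> N" "n \<ge> N" for m n
      using that le[of n m] le[of m n] by (cases "n \<le> m") (auto simp: dist_commute)
    then show "\<exists>M. \<forall>m\<ge>M. \<forall>n\<ge>M. dist (T m v) (T n v) < e" by blast
  qed
  then obtain l where l: "\<And>v. (\<lambda>n. T n v) \<longlonglongrightarrow> l v" unfolding convergent_def by metis
  have "\<exists>y\<in>bounded_ops. \<forall>v. blinfun_apply y v = l v"
  proof (rule blinfun_from_linear[where K = "K + norm (T 0)"])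
    show "l (x + y) = l x + l y" for x y
      using LIMSEQ_unique[OF l[of "x + y"]] tendsto_add[OF l[of x] l[of y]]
      by (simp add: blinfun.add_right)
    show "l (c *\<^sub>C x) = c *\<^sub>C l x" for c x
    proof (rule LIMSEQ_unique[OF l[of "c *\<^sub>C x"]])
      show "(\<lambda>n. T n (c *\<^sub>C x)) \<longlonglongrightarrow> c *\<^sub>C l x"
        using bounded_linear.tendsto[OF bounded_linear_scaleC l[of x], of c]
        by (simp add: bounded_opsD[OF sa_bounded_ops[OF saT]])
    qed
    show "norm (l x) \<le> (K + norm (T 0)) * norm x" for x
    proof (rule Lim_bounded[OF tendsto_norm[OF l[of x]], of 0], intro allI impI)
      fix n
      have "T n x = (T n - T 0) x + T 0 x" by (simp add: blinfun.diff_left)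
      also have "norm \<dots> \<le> norm (T n - T 0) * norm x + norm (T 0) * norm x"
        by (intro norm_triangle_le add_mono norm_blinfun)
      also have "\<dots> \<le> (K + norm (T 0)) * norm x"
        using mult_right_mono[OF nT[of 0 n], of "norm x"] by (simp add: algebra_simps)
      finally show "norm (T n x) \<le> (K + norm (T 0)) * norm x" .
    qed
  qed
  then obtain L where L: "L \<in> bounded_ops" "\<And>v. blinfun_apply L v = l v" by blast
  have lim: "(\<lambda>n. T n v) \<longlonglongrightarrow> L v" for v using l by (simp add: L)
  have saL: "sa L"
  proof (rule saI[OF L(1)])
    fix v w
    have "(\<lambda>n. cinner (T n v) w) \<longlonglongrightarrow> cinner (L v) w" by (intro cinner.tendsto lim tendsto_const)
    moreover have "(\<lambda>n. cinner v (T n w)) \<longlonglongrightarrow> cinner v (L w)" by (intro cinner.tendsto lim tendsto_const)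
    ultimately show "cinner (L v) w = cinner v (L w)"
      using LIMSEQ_unique by (simp add: saD[OF saT])
  qed
  have "pos (L - T n)" for n
  proof (rule posI[OF sa_diff[OF saL saT]])
    fix v
    have "(\<lambda>m. Re (cinner v ((T m - T n) v))) \<longlonglongrightarrow> Re (cinner v ((L - T n) v))"
      unfolding blinfun.diff_left by (intro tendsto_intros cinner.tendsto lim)
    then show "0 \<le> Re (cinner v ((L - T n) v))"
      by (rule LIMSEQ_le_const) (use posD[OF mono'] in blast)
  qed
  with saL lim show ?thesis by blast
qed

section \<open>Positive square roots by iteration\<close>

context
  fixes S :: "'h::chilbert_space \<Rightarrow>\<^sub>L 'h"
begin

primrec opow :: "nat \<Rightarrow> 'h \<Rightarrow>\<^sub>L 'h" where
  "opow 0 = id_blinfun"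
| "opow (Suc n) = S o\<^sub>L opow n"

lemma opow_add: "blinfun_apply (opow (m + n)) v = opow m (opow n v)"
  by (induction m) auto

text \<open>Polynomials in \<open>S\<close> with nonnegative coefficients. Powers of a positive
  \<open>S\<close> are positive, so membership is an algebraic certificate of positivity that is
  stable under products.\<close>

inductive_set pcone :: "('h \<Rightarrow>\<^sub>L 'h) set" where
  pcone_pow: "opow n \<in> pcone"
| pcone_add: "x \<in> pcone \<Longrightarrow> y \<in> pcone \<Longrightarrow> x + y \<in> pcone"
| pcone_scale: "x \<in> pcone \<Longrightarrow> 0 \<le> r \<Longrightarrow> r *\<^sub>R x \<in> pcone"

lemma pos_opow: assumes "pos S" shows "pos (opow n)"
proof -
  have saS: "sa S" and bS: "S \<in> bounded_ops" using assms by (auto intro: pos_sa pos_bounded_ops)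
  have b: "opow n \<in> bounded_ops" for n by (induction n) (auto simp: bS)
  have comm: "opow n (S v) = S (opow n v)" for n v by (induction n arbitrary: v) auto
  have self: "cinner (opow n v) w = cinner v (opow n w)" for n v w
    by (induction n arbitrary: v w) (auto simp: saD[OF saS] comm)
  have sa: "sa (opow n)" for n by (rule saI[OF b self])
  show ?thesis
  proof (rule posI[OF sa])
    fix v
    \<comment> \<open>\<open>n\<close> is \<open>2k\<close> or \<open>2k + 1\<close>, and
      \<open>k\<close> factors are moved to the left slot.\<close>
    obtain k where "n = k + k \<or> n = k + (Suc 0 + k)" by (metis add_Suc add_0 add_Suc_right oddE even_two_times_div_two mult_2 plus_1_eq_Suc add.commute)
    then show "0 \<le> Re (cinner v (opow n v))"
    proof
      assume "n = k + k"
      then have "cinner v (opow n v) = cinner (opow k v) (opow k v)" by (simp add: opow_add self)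
      then show ?thesis by (simp flip: norm_sq_cinner)
    next
      assume "n = k + (Suc 0 + k)"
      then have "cinner v (opow n v) = cinner (opow k v) (S (opow k v))"
      proof -
        have "opow n v = opow k (opow (Suc k) v)" using \<open>n = k + (Suc 0 + k)\<close> opow_add[of k "Suc k"] by simp
        then show ?thesis by (simp add: self)
      qed
      then show ?thesis using posD[OF assms] by simp
    qed
  qed
qed

lemma pcone_pos: "x \<in> pcone \<Longrightarrow> pos S \<Longrightarrow> pos x"
  by (induction rule: pcone.induct) (auto intro: pos_opow pos_add pos_scaleR)

lemma pcone_comp_pow: "x \<in> pcone \<Longrightarrow> opow n o\<^sub>L x \<in> pcone"
proof (induction rule: pcone.induct)
  case (pcone_pow m)
  have "opow n o\<^sub>L opow m = opow (n + m)" by (rule blinfun_eqI) (simp add: opow_add)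
  then show ?case using pcone.pcone_pow by simp
next
  case (pcone_add x y)
  then have "(opow n o\<^sub>L x) + (opow n o\<^sub>L y) \<in> pcone" by (intro pcone.pcone_add)
  moreover have "opow n o\<^sub>L (x + y) = (opow n o\<^sub>L x) + (opow n o\<^sub>L y)"
    by (rule blinfun_eqI) (simp add: blinfun.bilinear_simps)
  ultimately show ?case by simp
next
  case (pcone_scale x r)
  then have "r *\<^sub>R (opow n o\<^sub>L x) \<in> pcone" by (intro pcone.pcone_scale)
  moreover have "opow n o\<^sub>L (r *\<^sub>R x) = r *\<^sub>R (opow n o\<^sub>L x)"
    by (rule blinfun_eqI) (simp add: blinfun.bilinear_simps)
  ultimately show ?case by simp
qed

lemma pcone_comp: "x \<in> pcone \<Longrightarrow> y \<in> pcone \<Longrightarrow> x o\<^sub>L y \<in> pcone"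
proof (induction arbitrary: y rule: pcone.induct)
  case (pcone_pow n)
  then show ?case by (rule pcone_comp_pow)
next
  case (pcone_add x x')
  then have "(x o\<^sub>L y) + (x' o\<^sub>L y) \<in> pcone" by (intro pcone.pcone_add) auto
  moreover have "(x + x') o\<^sub>L y = (x o\<^sub>L y) + (x' o\<^sub>L y)"
    by (rule blinfun_eqI) (simp add: blinfun.bilinear_simps)
  ultimately show ?case by simp
next
  case (pcone_scale x r)
  then have "r *\<^sub>R (x o\<^sub>L y) \<in> pcone" by (intro pcone.pcone_scale) auto
  moreover have "(r *\<^sub>R x) o\<^sub>L y = r *\<^sub>R (x o\<^sub>L y)"
    by (rule blinfun_eqI) (simp add: blinfun.bilinear_simps)
  ultimately show ?case by simp
qed

lemma pcone_dcomm: "x \<in> pcone \<Longrightarrow> S \<in> bounded_ops \<Longrightarrow> dcomm S x"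
proof (induction rule: pcone.induct)
  case (pcone_pow n)
  then show ?case by (induction n) (auto intro: dcomm_id dcomm_comp dcomm_self)
qed (auto intro: dcomm_add dcomm_scaleR)

text \<open>A fixed point \<open>L\<close> satisfies \<open>2 L = S + L^2\<close>, that is
  \<open>(1 - L)^2 = 1 - S\<close>: the iteration computes one minus the square root of
  \<open>1 - S\<close>.\<close>

primrec sqrt_iter :: "nat \<Rightarrow> 'h \<Rightarrow>\<^sub>L 'h" where
  "sqrt_iter 0 = 0"
| "sqrt_iter (Suc n) = (1/2) *\<^sub>R (S + (sqrt_iter n o\<^sub>L sqrt_iter n))"

lemma sqrt_iter_pcone: "sqrt_iter n \<in> pcone"
proof (induction n)
  case 0
  show ?case using pcone_scale[OF pcone_pow, of 0 0] by simp
next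
  case (Suc n)
  have "S = opow 1" by (rule blinfun_eqI) simp
  then have "S \<in> pcone" by (metis pcone_pow)
  then show ?case using Suc by (auto intro!: pcone_scale pcone_add pcone_comp)
qed

text \<open>Induction with \<open>a^2 - b^2 = (a - b)(a + b)\<close> for the commuting iterates;
  this is the monotonicity that \<open>mono_seq_limit\<close> asks for.\<close>

lemma sqrt_iter_diff_pcone: "S \<in> bounded_ops \<Longrightarrow> sqrt_iter (Suc n) - sqrt_iter n \<in> pcone"
proof (induction n)
  case 0
  then show ?case using sqrt_iter_pcone[of 1] by simp
next
  case (Suc n)
  let ?a = "sqrt_iter (Suc n)" and ?b = "sqrt_iter n"
  have comm: "?a (?b v) = ?b (?a v)" for v
    by (rule dcomm_commutes[OF pcone_dcomm pcone_dcomm])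
      (use sqrt_iter_pcone Suc.prems in blast)+
  have "sqrt_iter (Suc (Suc n)) - sqrt_iter (Suc n)
      = (1/2) *\<^sub>R ((S + (?a o\<^sub>L ?a)) - (S + (?b o\<^sub>L ?b)))"
    by (simp only: sqrt_iter.simps(2)[of "Suc n"] sqrt_iter.simps(2)[of n] scaleR_diff_right)
  also have "\<dots> = (1/2) *\<^sub>R ((?a - ?b) o\<^sub>L (?a + ?b))"
    by (rule blinfun_eqI) (simp only: blinfun.bilinear_simps blinfun_apply_blinfun_compose comm, simp)
  finally show ?case
    using Suc by (auto intro!: pcone_scale pcone_comp pcone_add sqrt_iter_pcone simp del: sqrt_iter.simps)
qed

end

lemma sqrt_exists_aux:
  fixes S :: "'h::chilbert_space \<Rightarrow>\<^sub>L 'h"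
  assumes S: "pos S" and S1: "norm S \<le> 1"
  shows "\<exists>L. sa L \<and> pos (id_blinfun - L) \<and> dcomm S L \<and> (\<forall>v. 2 *\<^sub>R L v = S v + L (L v))"
proof -
  let ?b = "sqrt_iter S"
  have bS: "S \<in> bounded_ops" using S by (rule pos_bounded_ops)
  have nb: "norm (?b n) \<le> 1" for n
  proof (induction n)
    case (Suc n)
    have "norm (S + (?b n o\<^sub>L ?b n)) \<le> norm S + norm (?b n) * norm (?b n)"
      by (intro norm_triangle_le add_left_mono norm_blinfun_compose)
    also have "\<dots> \<le> 1 + 1 * 1" by (intro add_mono S1 mult_mono Suc) auto
    finally show ?case by simp
  qed simp
  have le1: "Re (cinner v (?b n v)) \<le> 1 * (norm v)\<^sup>2" for n v
    by (rule order_trans[OF Re_cinner_le]) (intro mult_right_mono nb, simp)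
  obtain L where L: "sa L" "\<And>v. (\<lambda>n. ?b n v) \<longlonglongrightarrow> L v"
    using mono_seq_limit[of ?b 1] le1 pcone_pos[OF sqrt_iter_pcone S] pcone_pos[OF sqrt_iter_diff_pcone[OF bS] S]
    by (metis pos_sa zero_le_one)
  have d: "dcomm S L"
    by (rule dcomm_limit[OF _ L(2) sa_bounded_ops[OF L(1)]]) (intro pcone_dcomm sqrt_iter_pcone bS)
  have p: "pos (id_blinfun - L)"
  proof (rule posI[OF sa_diff[OF sa_id L(1)]])
    fix v
    have "(\<lambda>n. Re (cinner v ((id_blinfun - ?b n) v))) \<longlonglongrightarrow> Re (cinner v ((id_blinfun - L) v))"
      unfolding blinfun.diff_left by (intro tendsto_intros cinner.tendsto L)
    moreover have "0 \<le> Re (cinner v ((id_blinfun - ?b n) v))" for n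
      using le1[of v n] by (simp add: blinfun.diff_left cinner.diff_right flip: norm_sq_cinner)
    ultimately show "0 \<le> Re (cinner v ((id_blinfun - L) v))"
      by (intro LIMSEQ_le_const) auto
  qed
  have "2 *\<^sub>R L v = S v + L (L v)" for v
  proof -
    \<comment> \<open>Strong convergence passes to the square because the iterates are uniformly
      bounded in norm.\<close>
    have "(\<lambda>n. ?b n (?b n v) - ?b n (L v)) \<longlonglongrightarrow> 0"
    proof (rule Lim_null_comparison)
      show "\<forall>\<^sub>F n in sequentially. norm (?b n (?b n v) - ?b n (L v)) \<le> norm (?b n v - L v)"
        using order_trans[OF norm_blinfun mult_right_mono[OF nb norm_ge_zero]]
        by (auto simp flip: blinfun.diff_right)
      show "(\<lambda>n. norm (?b n v - L v)) \<longlonglongrightarrow> 0"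
        using L(2)[of v] by (simp add: LIM_zero_iff tendsto_norm_zero)
    qed
    then have "(\<lambda>n. (?b n (?b n v) - ?b n (L v)) + ?b n (L v)) \<longlonglongrightarrow> 0 + L (L v)"
      by (intro tendsto_add L)
    then have "(\<lambda>n. ?b n (?b n v)) \<longlonglongrightarrow> L (L v)" by simp
    then have "(\<lambda>n. S v + ?b n (?b n v)) \<longlonglongrightarrow> S v + L (L v)" by (rule tendsto_add[OF tendsto_const])
    moreover have "(\<lambda>n. 2 *\<^sub>R ?b (Suc n) v) \<longlonglongrightarrow> 2 *\<^sub>R L v"
      by (rule tendsto_scaleR[OF tendsto_const LIMSEQ_Suc[OF L(2)]])
    moreover have "2 *\<^sub>R ?b (Suc n) v = S v + ?b n (?b n v)" for n
      by (simp add: blinfun.bilinear_simps)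
    ultimately show ?thesis using LIMSEQ_unique by simp
  qed
  with L d p show ?thesis by blast
qed

lemma sqrt_exists:
  fixes T :: "'h::chilbert_space \<Rightarrow>\<^sub>L 'h"
  assumes T: "pos T"
  shows "\<exists>n. pos n \<and> (\<forall>v. n (n v) = T v) \<and> dcomm T n"
proof (cases "T = 0")
  case True
  then show ?thesis using pos_zero dcomm_zero by (intro exI[of _ 0]) auto
next
  case False
  define c where "c = norm T"
  have c: "c > 0" using False by (simp add: c_def)
  have bT: "T \<in> bounded_ops" using T by (rule pos_bounded_ops)
  \<comment> \<open>\<open>1 - T/c\<close> is a positive contraction, and
    \<open>2 L = S + L^2\<close> means \<open>(1 - L)^2 = 1 - S = T/c\<close>.\<close>
  define S where "S = id_blinfun - (1/c) *\<^sub>R T"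
  have form: "Re (cinner v (S v)) = (norm v)\<^sup>2 - Re (cinner v (T v)) / c" for v
    by (simp add: S_def blinfun.bilinear_simps cinner.diff_right cinner_scaleR_right norm_sq_cinner)
  have posS: "pos S"
  proof (rule posI)
    show "sa S" unfolding S_def by (intro sa_diff sa_id sa_scaleR pos_sa T)
    show "0 \<le> Re (cinner v (S v))" for v
      using Re_cinner_le[of v T] c by (simp add: form c_def field_simps)
  qed
  have nS: "norm S \<le> 1"
    by (rule pos_norm_le[OF posS]) (use posD[OF T] c in \<open>auto simp: form\<close>)
  obtain L where L: "sa L" "pos (id_blinfun - L)" "dcomm S L" "\<And>v. 2 *\<^sub>R L v = S v + L (L v)"
    using sqrt_exists_aux[OF posS nS] by blast
  define n where "n = sqrt c *\<^sub>R (id_blinfun - L)"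
  have "dcomm T S" unfolding S_def by (intro dcomm_diff dcomm_id dcomm_scaleR dcomm_self bT)
  then have "dcomm T n"
    unfolding n_def by (intro dcomm_scaleR dcomm_diff dcomm_id) (rule dcomm_trans[OF _ L(3)])
  moreover have "pos n" unfolding n_def using c by (intro pos_scaleR L) simp
  moreover have "n (n v) = T v" for v
  proof -
    have "n (n v) = c *\<^sub>R (v - 2 *\<^sub>R L v + L (L v))"
      using c by (simp add: n_def blinfun.bilinear_simps algebra_simps scaleR_2)
    also have "\<dots> = c *\<^sub>R (v - S v)" by (simp add: L(4))
    also have "\<dots> = T v" using c by (simp add: S_def blinfun.bilinear_simps)
    finally show ?thesis .
  qed
  ultimately show ?thesis by blast
qed

text \<open>\<open>g\<close> is the inverse of \<open>1 + T\<close>. Positivity makes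
  \<open>1 + T\<close> bounded below, hence injective with closed range; a vector orthogonal to the
  range is in the kernel of the self-adjoint \<open>1 + T\<close> and so vanishes.\<close>

lemma inv_exists:
  fixes T :: "'h::chilbert_space \<Rightarrow>\<^sub>L 'h"
  assumes T: "pos T"
  shows "\<exists>g. pos g \<and> (\<forall>v. g v + T (g v) = v) \<and> (\<forall>v. g (v + T v) = v) \<and> dcomm T g"
proof -
  have bT: "T \<in> bounded_ops" and saT: "sa T" using T by (auto intro: pos_bounded_ops pos_sa)
  define R where "R = id_blinfun + T"
  have R: "R v = v + T v" for v by (simp add: R_def blinfun.add_left)
  have bR: "R \<in> bounded_ops" and saR: "sa R" unfolding R_def by (auto simp: bT intro!: sa_add sa_id saT)
  have below: "norm v \<le> norm (R v)" for v
  proof (cases "v = 0")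
    case False
    have "norm v * norm v \<le> Re (cinner v (R v))"
      using posD[OF T, of v] by (simp add: R cinner.add_right flip: norm_sq_cinner power2_eq_square)
    also have "\<dots> \<le> norm v * norm (R v)" by (rule CS_Re)
    finally show ?thesis using False by simp
  qed simp
  have inj: "v = w" if "R v = R w" for v w
    using below[of "v - w"] that by (simp add: blinfun.diff_right)
  have clo: "closed (range (blinfun_apply R))"
    unfolding closed_sequential_limits
  proof (intro allI impI, elim conjE)
    fix y l assume y: "\<forall>n. y n \<in> range (blinfun_apply R)" "y \<longlonglongrightarrow> l"
    then have "\<forall>n. \<exists>x. y n = R x" by blast
    then obtain x where x: "\<And>n. y n = R (x n)" by metis
    have "Cauchy y" using y by (simp add: LIMSEQ_imp_Cauchy)
    have "Cauchy x"
    proof (rule metric_CauchyI)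
      fix e :: real assume "e > 0"
      then obtain M where M: "\<And>m n. m \<ge> M \<Longrightarrow> n \<ge> M \<Longrightarrow> dist (y m) (y n) < e"
        using \<open>Cauchy y\<close> unfolding Cauchy_def by blast
      have "dist (x m) (x n) \<le> dist (y m) (y n)" for m n
        using below[of "x m - x n"] by (simp add: dist_norm x blinfun.diff_right)
      then show "\<exists>M. \<forall>m\<ge>M. \<forall>n\<ge>M. dist (x m) (x n) < e"
        using M by (intro exI[of _ M]) (blast intro: le_less_trans)
    qed
    then obtain x0 where "x \<longlonglongrightarrow> x0" using Cauchy_convergent_iff convergent_def by blast
    then have "(\<lambda>n. R (x n)) \<longlonglongrightarrow> R x0" by (intro blinfun.tendsto tendsto_const)
    then have "y \<longlonglongrightarrow> R x0" by (simp flip: x)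
    then show "l \<in> range (blinfun_apply R)" using LIMSEQ_unique y(2) by blast
  qed
  have sub: "complex_vector.subspace (range (blinfun_apply R))"
    unfolding complex_vector.subspace_def
  proof (intro conjI ballI allI)
    show "0 \<in> range (blinfun_apply R)" using blinfun.zero_right[of R] by (metis rangeI)
    show "x + y \<in> range (blinfun_apply R)"
      if xy: "x \<in> range (blinfun_apply R)" "y \<in> range (blinfun_apply R)" for x y
    proof -
      obtain a b where "x = R a" "y = R b" using xy by blast
      then have "x + y = R (a + b)" by (simp add: blinfun.add_right)
      then show ?thesis by simp
    qed
    show "c *\<^sub>C x \<in> range (blinfun_apply R)" if xc: "x \<in> range (blinfun_apply R)" for c x
    proof -
      obtain a where "x = R a" using xc by blast
      then have "c *\<^sub>C x = R (c *\<^sub>C a)" by (simp add: bounded_opsD[OF bR])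
      then show ?thesis by simp
    qed
  qed
  have surj: "\<exists>x. R x = v" for v
  proof -
    obtain s where s: "s \<in> range (blinfun_apply R)" "\<And>t. t \<in> range (blinfun_apply R) \<Longrightarrow> cinner t (v - s) = 0"
      using closest_point_exists[OF sub clo] by metis
    have "R (v - s) = R 0"
      by (rule cinner_eqI) (metis s(2) saD[OF saR] rangeI blinfun.zero_right cinner.zero_right)
    then have "v - s = 0" by (rule inj)
    then have "v = s" by simp
    then show ?thesis using s(1) by auto
  qed
  then obtain gg where gg: "\<And>v. R (gg v) = v" by metis
  have "\<exists>g\<in>bounded_ops. \<forall>v. blinfun_apply g v = gg v"
  proof (rule blinfun_from_linear[where K = 1])
    show "gg (x + y) = gg x + gg y" for x y by (rule inj) (simp add: gg blinfun.add_right)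
    show "gg (c *\<^sub>C x) = c *\<^sub>C gg x" for c x by (rule inj) (simp add: gg bounded_opsD[OF bR])
    show "norm (gg x) \<le> 1 * norm x" for x using below[of "gg x"] by (simp add: gg)
  qed
  then obtain g where g: "g \<in> bounded_ops" "\<And>v. R (blinfun_apply g v) = v" using gg by metis
  have g2: "g (R v) = v" for v by (rule inj) (simp add: g)
  have "sa g"
    by (rule saI[OF g(1)]) (metis g(2) saD[OF saR])
  moreover have "0 \<le> Re (cinner v (g v))" for v
  proof -
    have "cinner v (g v) = cinner (R (g v)) (g v)" by (simp add: g)
    then show ?thesis
      using posD[OF T, of "g v"] by (simp add: R cinner.add_left saD[OF saT] flip: norm_sq_cinner)
  qed
  moreover have "dcomm T g"
    unfolding dcomm_def
  proof (intro conjI ballI impI allI g(1))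
    fix c v assume "c \<in> bounded_ops" "\<forall>v. c (T v) = T (c v)"
    then have "R (c (g v)) = c (R (g v))" for v by (simp add: R blinfun.add_right)
    note this[of v]
    moreover have "R (g (c v)) = c v" "c (R (g v)) = c v" by (simp_all add: g)
    ultimately have "R (c (g v)) = R (g (c v))" by simp
    then show "c (g v) = g (c v)" by (rule inj)
  qed
  ultimately show ?thesis using g g2 by (intro exI[of _ g]) (auto simp: R posI)
qed

text \<open>Invariance of the range of \<open>p\<close> under \<open>adj c\<close> is invariance of
  its complement under \<open>c\<close>.\<close>

lemma proj_commutes:
  assumes p: "proj p" and c: "c \<in> bounded_ops"
    and "\<And>v. blinfun_apply p (blinfun_apply c (blinfun_apply p v)) = blinfun_apply c (blinfun_apply p v)"
    and "\<And>v. blinfun_apply p (blinfun_apply (adj c) (blinfun_apply p v)) = blinfun_apply (adj c) (blinfun_apply p v)"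
  shows "blinfun_apply c (blinfun_apply p v) = blinfun_apply p (blinfun_apply c v)"
proof (rule cinner_eqI)
  fix w
  have "cinner w (p (c v)) = cinner (adj c (p w)) v"
    by (simp add: cinner_adj_left c flip: saD[OF proj_sa[OF p]])
  also have "\<dots> = cinner (p (adj c (p w))) v" by (simp add: assms)
  also have "\<dots> = cinner w (p (c (p v)))" by (simp add: saD[OF proj_sa[OF p]] cinner_adj_left c)
  finally show "cinner w (c (p v)) = cinner w (p (c v))" by (simp add: assms)
qed

text \<open>The clause on \<open>y\<close> is how the closed span is used later: an operator that
  vanishes on the generators vanishes on the whole range of \<open>p\<close>.\<close>

lemma generated_proj:
  fixes S :: "'h::chilbert_space set"
  assumes N: "N \<subseteq> bounded_ops" "\<And>c. c \<in> N \<Longrightarrow> adj c \<in> N"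
    and inv: "\<And>c v. c \<in> N \<Longrightarrow> v \<in> S \<Longrightarrow> blinfun_apply c v \<in> S"
  shows "\<exists>p. proj p \<and> (\<forall>c\<in>N. \<forall>v. c (p v) = p (c v)) \<and> (\<forall>v\<in>S. p v = v) \<and>
    (\<forall>y\<in>bounded_ops. (\<forall>v\<in>S. y v = 0) \<longrightarrow> (\<forall>v. y (p v) = 0)) \<and> (\<forall>v. blinfun_apply p v \<in> closure (cspan S))"
proof -
  have sub: "complex_vector.subspace (closure (cspan S))"
    unfolding complex_vector.subspace_def
  proof (intro conjI ballI allI)
    show "0 \<in> closure (cspan S)" using closure_subset complex_vector.span_zero by blast
    show "x + y \<in> closure (cspan S)" if xy: "x \<in> closure (cspan S)" "y \<in> closure (cspan S)" for x y
    proof -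
      obtain f where f: "\<forall>n. f n \<in> cspan S" "f \<longlonglongrightarrow> x"
        using xy(1) unfolding closure_sequential by blast
      obtain g where "\<forall>n. g n \<in> cspan S" "g \<longlonglongrightarrow> y"
        using xy(2) unfolding closure_sequential by blast
      with f have "(\<lambda>n. f n + g n) \<longlonglongrightarrow> x + y" "\<And>n. f n + g n \<in> cspan S"
        by (auto intro: tendsto_add complex_vector.span_add)
      then show ?thesis unfolding closure_sequential by (intro exI[of _ "\<lambda>n. f n + g n"]) simp
    qed
    show "c *\<^sub>C x \<in> closure (cspan S)" if xc: "x \<in> closure (cspan S)" for c x
    proof -
      obtain f where "\<forall>n. f n \<in> cspan S" "f \<longlonglongrightarrow> x"
        using xc unfolding closure_sequential by blast
      then have "(\<lambda>n. c *\<^sub>C f n) \<longlonglongrightarrow> c *\<^sub>C x" "\<And>n. c *\<^sub>C f n \<in> cspan S"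
        by (auto intro: bounded_linear.tendsto[OF bounded_linear_scaleC] complex_vector.span_scale)
      then show ?thesis unfolding closure_sequential by (intro exI[of _ "\<lambda>n. c *\<^sub>C f n"]) simp
    qed
  qed
  obtain p where p: "proj p" "range (blinfun_apply p) = closure (cspan S)"
    using proj_onto[OF sub closed_closure] by blast
  have fixp: "p v = v" if "v \<in> closure (cspan S)" for v
    using that p by (metis projD rangeE)
  have pin: "p v \<in> closure (cspan S)" for v using p(2) by auto
  have "c v \<in> closure (cspan S)" if c: "c \<in> N" and "v \<in> closure (cspan S)" for c v
  proof -
    have "c w \<in> cspan S" if "w \<in> cspan S" for w
      using that
    proof (induction rule: complex_vector.span_induct_alt)
      case (step a x y)
      then show ?case
        using complex_vector.span_add[OF complex_vector.span_scale[OF complex_vector.span_base[OF inv[OF c]]]]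
          bounded_opsD[OF subsetD[OF N(1) c]]
        by (simp add: blinfun.add_right)
    qed (simp add: blinfun.zero_right complex_vector.span_zero)
    then have "cspan S \<subseteq> blinfun_apply c -` closure (cspan S)"
      using closure_subset by blast
    then have "closure (cspan S) \<subseteq> blinfun_apply c -` closure (cspan S)"
      by (rule closure_minimal) (intro continuous_closed_vimage closed_closure linear_continuous_at blinfun.bounded_linear_right)
    then show ?thesis using that(2) by blast
  qed
  then have inv': "p (c (p v)) = c (p v)" if "c \<in> N" for c v
    using fixp pin that by blast
  have "\<forall>c\<in>N. \<forall>v. c (p v) = p (c v)"
    by (intro ballI allI proj_commutes[OF p(1)] inv') (use N in auto)
  moreover have "\<forall>v\<in>S. p v = v"
    using fixp closure_subset complex_vector.span_base by blast
  moreover have "y (p v) = 0" if y: "y \<in> bounded_ops" "\<forall>v\<in>S. y v = 0" for y v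
  proof -
    have "y w = 0" if "w \<in> cspan S" for w
      using that
      by (induction rule: complex_vector.span_induct_alt)
        (auto simp: blinfun.add_right blinfun.zero_right bounded_opsD[OF y(1)] y(2))
    then have "cspan S \<subseteq> blinfun_apply y -` {0}" by auto
    then have "closure (cspan S) \<subseteq> blinfun_apply y -` {0}"
      by (rule closure_minimal) (intro continuous_closed_vimage closed_singleton linear_continuous_at blinfun.bounded_linear_right)
    then have "y w = 0" if "w \<in> closure (cspan S)" for w using that by auto
    then show ?thesis using pin by blast
  qed
  ultimately show ?thesis using p(1) pin by blast
qed

lemma adj_commutes:
  assumes "c \<in> bounded_ops" "sa d" "\<And>v. blinfun_apply c (blinfun_apply d v) = blinfun_apply d (blinfun_apply c v)"
  shows "blinfun_apply (adj c) (blinfun_apply d v) = blinfun_apply d (blinfun_apply (adj c) v)"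
proof (rule cinner_eqI)
  fix w
  have "cinner w (adj c (d v)) = cinner (d (c w)) v"
    by (simp add: cinner_adj_right assms(1) saD[OF assms(2)])
  also have "\<dots> = cinner w (d (adj c v))"
    by (simp add: assms(3)[symmetric] saD[OF assms(2)] flip: cinner_adj_right[OF assms(1)])
  finally show "cinner w (adj c (d v)) = cinner w (d (adj c v))" .
qed

text \<open>\<open>e\<close> is the spectral projection of \<open>d\<close> for the values above
  \<open>t\<close>. With \<open>a = d - t\<close> and \<open>n\<close> the absolute value of
  \<open>a\<close>, the operator \<open>n + a\<close> is twice the positive part of
  \<open>a\<close>; on its closed range \<open>a = n\<close>, and on the complement
  \<open>a = - n\<close>.\<close>

lemma spectral_cut:
  fixes d :: "'h::chilbert_space \<Rightarrow>\<^sub>L 'h"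
  assumes d: "pos d"
  shows "\<exists>e. proj e \<and> dcomm d e \<and> (\<forall>v. t * (norm (e v))\<^sup>2 \<le> Re (cinner (e v) (d (e v))))
    \<and> (\<forall>v. t * (norm (e v))\<^sup>2 \<le> Re (cinner v (d v)))
    \<and> (\<forall>v. Re (cinner v (d v)) \<le> t * (norm (v - e v))\<^sup>2 + norm d * (norm (e v))\<^sup>2)"
proof -
  have bd: "d \<in> bounded_ops" and sad: "sa d" using d by (auto intro: pos_bounded_ops pos_sa)
  define a where "a = d - t *\<^sub>R id_blinfun"
  have a: "a v = d v - t *\<^sub>R v" for v by (simp add: a_def blinfun.bilinear_simps)
  have saa: "sa a" unfolding a_def by (intro sa_diff sa_scaleR sa_id sad)
  have ba: "a \<in> bounded_ops" using saa by (rule sa_bounded_ops)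
  have da: "dcomm d a" unfolding a_def by (intro dcomm_diff dcomm_self dcomm_scaleR dcomm_id bd)
  have "pos (a o\<^sub>L a)" using pos_adj_comp[OF ba] by (simp add: sa_adj[OF saa])
  then obtain n where n: "pos n" "\<And>v. n (n v) = a (a v)" "dcomm (a o\<^sub>L a) n"
    using sqrt_exists[of "a o\<^sub>L a"] by auto
  have dn: "dcomm d n" by (rule dcomm_trans[OF dcomm_comp[OF da da] n(3)])
  have na: "n (a v) = a (n v)" for v by (rule dcomm_commutes[OF dn da bd])
  have san: "sa n" using n(1) by (rule pos_sa)
  have bn: "n \<in> bounded_ops" using n(1) by (rule pos_bounded_ops)
  define N where "N = {c \<in> bounded_ops. \<forall>v. c (d v) = d (c v)}"
  define S where "S = range (\<lambda>v. n v + a v)"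
  have inv: "c v \<in> S" if cN: "c \<in> N" and vS: "v \<in> S" for c v
  proof -
    obtain w where w: "v = n w + a w" using vS by (auto simp: S_def)
    have "c v = n (c w) + a (c w)"
      using cN dn da by (simp add: w blinfun.add_right N_def dcomm_def)
    then show ?thesis by (auto simp: S_def)
  qed
  obtain e where e: "proj e" "\<And>c v. c \<in> N \<Longrightarrow> c (e v) = e (c v)" "\<And>v. v \<in> S \<Longrightarrow> e v = v"
      "\<And>y v. y \<in> bounded_ops \<Longrightarrow> (\<And>v. v \<in> S \<Longrightarrow> y v = 0) \<Longrightarrow> blinfun_apply y (e v) = 0"
  proof -
    have "N \<subseteq> bounded_ops" "\<And>c. c \<in> N \<Longrightarrow> adj c \<in> N"
      using adj_commutes[OF _ sad] by (auto simp: N_def)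
    from generated_proj[OF this inv] show ?thesis using that by metis
  qed
  have be: "e \<in> bounded_ops" using e(1) by (rule proj_bounded_ops)
  have de: "dcomm d e" unfolding dcomm_def using be e(2) by (auto simp: N_def)
  \<comment> \<open>\<open>(n - a)(n + a) = n^2 - a^2 = 0\<close>, so \<open>n - a\<close> kills the
    generators and hence the range of \<open>e\<close>.\<close>
  have plus: "a (e v) = n (e v)" for v
  proof -
    have "(n - a) (e v) = 0"
    proof (rule e(4))
      show "(n - a) v = 0" if "v \<in> S" for v
        using that n(2) na by (auto simp: S_def blinfun.bilinear_simps)
    qed (simp add: bn ba)
    then show ?thesis by (simp add: blinfun.diff_left)
  qed
  \<comment> \<open>\<open>n + a\<close> is self-adjoint, so it kills the complement of its
    range.\<close>
  have minus: "a (v - e v) = - n (v - e v)" for v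
  proof -
    have "n (v - e v) + a (v - e v) = 0"
    proof (rule cinner_eqI)
      fix w
      have "cinner w (n (v - e v) + a (v - e v)) = cinner (n w + a w) (v - e v)"
        by (simp add: cinner.add_right cinner.add_left saD[OF san] saD[OF saa])
      also have "\<dots> = cinner (e (n w + a w)) (v - e v)" by (simp add: e(3) S_def)
      also have "\<dots> = 0" by (simp add: saD[OF proj_sa[OF e(1)]] blinfun.diff_right projD[OF e(1)] cinner.zero_right)
      finally show "cinner w (n (v - e v) + a (v - e v)) = cinner w 0" by (simp add: cinner.zero_right)
    qed
    then show ?thesis by (simp add: eq_neg_iff_add_eq_0 add.commute)
  qed
  have x: "t * (norm (e v))\<^sup>2 \<le> Re (cinner (e v) (d (e v)))" for v
  proof -
    have "d (e v) = t *\<^sub>R e v + n (e v)" using plus[of v] by (simp add: a algebra_simps)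
    then show ?thesis
      using posD[OF n(1), of "e v"] by (simp add: cinner.add_right cinner_scaleR_right flip: norm_sq_cinner)
  qed
  have y: "Re (cinner (v - e v) (d (v - e v))) \<le> t * (norm (v - e v))\<^sup>2" for v
  proof -
    have "d (v - e v) = t *\<^sub>R (v - e v) - n (v - e v)" using minus[of v] by (simp add: a algebra_simps)
    then show ?thesis
      using posD[OF n(1), of "v - e v"]
      by (simp add: cinner.diff_right[of _ "t *\<^sub>R (v - e v)"] cinner_scaleR_right flip: norm_sq_cinner)
  qed
  have split: "cinner v (d v) = cinner (e v) (d (e v)) + cinner (v - e v) (d (v - e v))" for v
  proof -
    have "d (e v) = e (d v)" using e(2)[of d v] bd by (simp add: N_def)
    moreover have "cinner (e v) w = cinner v (e w)" for w by (rule saD[OF proj_sa[OF e(1)]])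
    ultimately show ?thesis
      by (simp add: blinfun.diff_right cinner.diff_left cinner.diff_right projD[OF e(1)])
  qed
  show ?thesis
  proof (intro exI[of _ e] conjI allI e(1) de x)
    fix v
    show "t * (norm (e v))\<^sup>2 \<le> Re (cinner v (d v))"
      using x[of v] posD[OF d, of "v - e v"] by (simp add: split[of v])
    show "Re (cinner v (d v)) \<le> t * (norm (v - e v))\<^sup>2 + norm d * (norm (e v))\<^sup>2"
      using y[of v] Re_cinner_le[of "e v" d] by (simp add: split[of v])
  qed
qed

section \<open>Von Neumann algebras\<close>

lemma vna_bo: "von_neumann_algebra A \<Longrightarrow> x \<in> A \<Longrightarrow> x \<in> bounded_ops"
  by (auto simp: von_neumann_algebra_def)

lemma vna_adj: "von_neumann_algebra A \<Longrightarrow> x \<in> A \<Longrightarrow> adj x \<in> A"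
  by (simp add: von_neumann_algebra_def)

lemma commutantD:
  "c \<in> commutant A \<Longrightarrow> x \<in> A \<Longrightarrow> blinfun_apply c (blinfun_apply x v) = blinfun_apply x (blinfun_apply c v)"
  unfolding commutant_def by (metis (mono_tags, lifting) blinfun_apply_blinfun_compose mem_Collect_eq)

lemma commutant_bo: "c \<in> commutant A \<Longrightarrow> c \<in> bounded_ops"
  by (simp add: commutant_def)

lemma commutantI:
  "c \<in> bounded_ops \<Longrightarrow> (\<And>x v. x \<in> A \<Longrightarrow> blinfun_apply c (blinfun_apply x v) = blinfun_apply x (blinfun_apply c v)) \<Longrightarrow>
    c \<in> commutant A"
  by (auto simp: commutant_def intro: blinfun_eqI)

lemma vna_memI:
  assumes "von_neumann_algebra A" "x \<in> bounded_ops"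
    "\<And>c v. c \<in> commutant A \<Longrightarrow> blinfun_apply c (blinfun_apply x v) = blinfun_apply x (blinfun_apply c v)"
  shows "x \<in> A"
proof -
  have "x \<in> commutant (commutant A)" using assms(2,3) by (intro commutantI) auto
  then show ?thesis using assms(1) by (simp add: von_neumann_algebra_def)
qed

lemma vna_commutant: assumes A: "von_neumann_algebra A" shows "von_neumann_algebra (commutant A)"
  unfolding von_neumann_algebra_def
proof (intro conjI ballI)
  show "commutant A \<subseteq> bounded_ops" by (auto simp: commutant_def)
  show "commutant (commutant (commutant A)) = commutant A"
    using A by (simp add: von_neumann_algebra_def)
  fix c assume c: "c \<in> commutant A"
  have bc: "c \<in> bounded_ops" using c by (rule commutant_bo)
  show "adj c \<in> commutant A"
  proof (rule commutantI)
    fix x v assume x: "x \<in> A"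
    have bx: "x \<in> bounded_ops" using vna_bo[OF A x] .
    show "adj c (x v) = x (adj c v)"
    proof (rule cinner_eqI)
      fix w
      have "cinner w (adj c (x v)) = cinner (adj x (c w)) v"
        by (simp add: cinner_adj_right cinner_adj_left bc bx)
      also have "\<dots> = cinner (c (adj x w)) v" by (simp add: commutantD[OF c vna_adj[OF A x]])
      also have "\<dots> = cinner w (x (adj c v))"
        by (simp add: cinner_adj_left bx flip: cinner_adj_right[OF bc])
      finally show "cinner w (adj c (x v)) = cinner w (x (adj c v))" .
    qed
  qed (simp add: bc)
qed

lemma vna_id: "von_neumann_algebra A \<Longrightarrow> id_blinfun \<in> A"
  and vna_zero: "von_neumann_algebra A \<Longrightarrow> 0 \<in> A"
  and vna_add: "von_neumann_algebra A \<Longrightarrow> x \<in> A \<Longrightarrow> y \<in> A \<Longrightarrow> x + y \<in> A"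
  and vna_diff: "von_neumann_algebra A \<Longrightarrow> x \<in> A \<Longrightarrow> y \<in> A \<Longrightarrow> x - y \<in> A"
  and vna_comp: "von_neumann_algebra A \<Longrightarrow> x \<in> A \<Longrightarrow> y \<in> A \<Longrightarrow> x o\<^sub>L y \<in> A"
  and vna_scaleC: "von_neumann_algebra A \<Longrightarrow> x \<in> A \<Longrightarrow> c *\<^sub>C x \<in> A"
proof -
  assume A: "von_neumann_algebra A"
  show "id_blinfun \<in> A" "0 \<in> A"
    by (rule vna_memI[OF A]; simp add: blinfun.zero_right)+
  show "x + y \<in> A" if "x \<in> A" "y \<in> A"
    using that by (intro vna_memI[OF A])
      (auto simp: vna_bo[OF A] blinfun.bilinear_simps commutantD[of _ A x] commutantD[of _ A y])
  show "x - y \<in> A" if "x \<in> A" "y \<in> A"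
    using that by (intro vna_memI[OF A])
      (auto simp: vna_bo[OF A] blinfun.bilinear_simps commutantD[of _ A x] commutantD[of _ A y])
  show "x o\<^sub>L y \<in> A" if "x \<in> A" "y \<in> A"
    using that by (intro vna_memI[OF A])
      (auto simp: vna_bo[OF A] commutantD[of _ A x] commutantD[of _ A y])
  show "c *\<^sub>C x \<in> A" if "x \<in> A"
    using that by (intro vna_memI[OF A])
      (auto simp: vna_bo[OF A] commutantD[of _ A x] bounded_opsD[OF commutant_bo])
qed

lemma vna_scaleR: "von_neumann_algebra A \<Longrightarrow> x \<in> A \<Longrightarrow> r *\<^sub>R x \<in> A"
  by (simp add: scaleR_scaleC vna_scaleC)

lemma vna_sum: "von_neumann_algebra A \<Longrightarrow> (\<And>i. i \<in> F \<Longrightarrow> f i \<in> A) \<Longrightarrow> sum f F \<in> A"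
  by (induction F rule: infinite_finite_induct) (auto intro: vna_zero vna_add)

lemma vna_dcomm:
  assumes "von_neumann_algebra A" "d \<in> A" "dcomm d n" shows "n \<in> A"
  by (rule vna_memI[OF assms(1) dcomm_bounded_ops[OF assms(3)]])
    (rule dcommD[OF assms(3) commutant_bo commutantD[OF _ assms(2)]])

lemma vna_limit:
  assumes A: "von_neumann_algebra A" and T: "\<And>n. T n \<in> A"
    and lim: "\<And>v. (\<lambda>n. blinfun_apply (T n) v) \<longlonglongrightarrow> blinfun_apply L v" and L: "L \<in> bounded_ops"
  shows "L \<in> A"
proof (rule vna_memI[OF A L])
  fix c v assume c: "c \<in> commutant A"
  have "(\<lambda>n. c (T n v)) \<longlonglongrightarrow> c (L v)" by (intro blinfun.tendsto tendsto_const lim)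
  moreover have "c (T n v) = T n (c v)" for n by (rule commutantD[OF c T])
  ultimately show "c (L v) = L (c v)" using LIMSEQ_unique[OF lim[of "c v"]] by simp
qed

lemma vna_generated_proj:
  assumes A: "von_neumann_algebra A"
    and inv: "\<And>c v. c \<in> commutant A \<Longrightarrow> v \<in> S \<Longrightarrow> blinfun_apply c v \<in> S"
  shows "\<exists>p\<in>A. proj p \<and> (\<forall>v\<in>S. p v = v) \<and>
    (\<forall>y\<in>bounded_ops. (\<forall>v\<in>S. y v = 0) \<longrightarrow> (\<forall>v. y (p v) = 0)) \<and> (\<forall>v. blinfun_apply p v \<in> closure (cspan S))"
proof -
  have C: "von_neumann_algebra (commutant A)" using A by (rule vna_commutant)
  obtain p where p: "proj p" "\<forall>c\<in>commutant A. \<forall>v. c (p v) = p (c v)" "\<forall>v\<in>S. p v = v"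
    "\<forall>y\<in>bounded_ops. (\<forall>v\<in>S. y v = 0) \<longrightarrow> (\<forall>v. y (p v) = 0)" "\<forall>v. blinfun_apply p v \<in> closure (cspan S)"
    using generated_proj[of "commutant A" S] inv vna_adj[OF C] vna_bo[OF C] by blast
  have "p \<in> A" by (rule vna_memI[OF A proj_bounded_ops[OF p(1)]]) (use p(2) in auto)
  with p show ?thesis by blast
qed

text \<open>\<open>q\<close> is the projection onto the closure of \<open>A'h\<close>; equivalently \<open>h = qh\<close> is separating for \<open>qAq\<close>.\<close>

definition is_supp :: "('h::chilbert_space \<Rightarrow>\<^sub>L 'h) set \<Rightarrow> ('h \<Rightarrow>\<^sub>L 'h) \<Rightarrow> 'h \<Rightarrow> bool" where
  "is_supp A q h \<longleftrightarrow> q \<in> A \<and> proj q \<and> q h = h \<and>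
    (\<forall>v \<epsilon>. \<epsilon> > 0 \<longrightarrow> (\<exists>c\<in>commutant A. norm (q v - blinfun_apply c h) < \<epsilon>))"

lemma is_supp_exists:
  assumes A: "von_neumann_algebra A" shows "\<exists>q. is_supp A q h"
proof -
  have C: "von_neumann_algebra (commutant A)" using A by (rule vna_commutant)
  define S where "S = (\<lambda>c. blinfun_apply c h) ` commutant A"
  have "c v \<in> S" if "c \<in> commutant A" "v \<in> S" for c v
    using that vna_comp[OF C that(1)] by (auto simp: S_def image_iff) (metis blinfun_apply_blinfun_compose)
  then obtain p where p: "p \<in> A" "proj p" "\<forall>v\<in>S. p v = v" "\<forall>v. blinfun_apply p v \<in> closure (cspan S)"
    using vna_generated_proj[OF A, of S] by blast
  have "complex_vector.subspace S"
    unfolding complex_vector.subspace_def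
  proof (intro conjI ballI allI)
    show "0 \<in> S" unfolding S_def by (rule image_eqI[OF _ vna_zero[OF C]]) simp
    show "x + y \<in> S" if x: "x \<in> S" and y: "y \<in> S" for x y
    proof -
      obtain a b where "a \<in> commutant A" "b \<in> commutant A" "x = a h" "y = b h"
        using x y by (auto simp: S_def)
      then show ?thesis
        unfolding S_def by (intro image_eqI[OF _ vna_add[OF C, of a b]]) (auto simp: blinfun.add_left)
    qed
    show "c *\<^sub>C x \<in> S" if x: "x \<in> S" for c x
    proof -
      obtain a where "a \<in> commutant A" "x = a h" using x by (auto simp: S_def)
      then show ?thesis unfolding S_def by (intro image_eqI[OF _ vna_scaleC[OF C]]) auto
    qed
  qed
  then have sp: "cspan S = S" by (rule complex_vector.span_eq_iff[THEN iffD2])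
  have "p h = h" using p(3) vna_id[OF C] by (auto simp: S_def image_iff intro!: bspec[OF p(3)] bexI[of _ id_blinfun])
  moreover have "\<exists>c\<in>commutant A. norm (p v - blinfun_apply c h) < \<epsilon>" if e0: "\<epsilon> > 0" for v \<epsilon>
  proof -
    have "p v \<in> closure S" using p(4) sp by simp
    then obtain y where "y \<in> S" "dist y (p v) < \<epsilon>" using e0 closure_approachable by blast
    then show ?thesis by (auto simp: S_def dist_norm norm_minus_commute)
  qed
  ultimately show ?thesis using p unfolding is_supp_def by blast
qed

lemma is_suppD:
  assumes "is_supp A q h"
  shows "q \<in> A" "proj q" "q h = h"
    and "\<epsilon> > 0 \<Longrightarrow> \<exists>c\<in>commutant A. norm (q v - blinfun_apply c h) < \<epsilon>"
  using assms by (auto simp: is_supp_def)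

text \<open>For \<open>c\<close> in the commutant, \<open>y n\<close> maps \<open>c h\<close> to
  \<open>c (y n h)\<close>, which tends to 0. Such vectors approximate \<open>q v\<close>, and the
  uniform bound \<open>R\<close> controls the error.\<close>

lemma is_supp_tendsto:
  assumes s: "is_supp A q h" and y: "\<And>n. y n \<in> A" and R: "\<And>n. norm (y n) \<le> R"
    and lim: "(\<lambda>n. blinfun_apply (y n) h) \<longlonglongrightarrow> 0"
  shows "(\<lambda>n. blinfun_apply (y n) (q v)) \<longlonglongrightarrow> 0"
proof (rule LIMSEQ_I)
  fix r :: real assume r: "r > 0"
  have R0: "R \<ge> 0" using order_trans[OF norm_ge_zero R] .
  obtain c where c: "c \<in> commutant A" "norm (q v - c h) < r / (2 * (R + 1))"
    using is_suppD(4)[OF s, of "r / (2 * (R + 1))" v] r R0 by auto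
  have "(\<lambda>n. c (y n h)) \<longlonglongrightarrow> c 0" by (intro blinfun.tendsto tendsto_const lim)
  then obtain N where N: "\<And>n. n \<ge> N \<Longrightarrow> norm (c (y n h)) < r / 2"
    using LIMSEQ_D[of "\<lambda>n. c (y n h)" 0 "r/2"] r by (auto simp: blinfun.zero_right)
  have "norm (y n (q v)) < r" if "n \<ge> N" for n
  proof -
    have "y n (q v) = y n (q v - c h) + c (y n h)"
      by (simp add: blinfun.diff_right commutantD[OF c(1) y])
    also have "norm \<dots> \<le> norm (y n) * norm (q v - c h) + norm (c (y n h))"
      by (intro norm_triangle_le add_right_mono norm_blinfun)
    also have "\<dots> \<le> (R + 1) * (r / (2 * (R + 1))) + norm (c (y n h))"
      using c(2) R[of n] R0 by (intro add_right_mono mult_mono) auto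
    also have "(R + 1) * (r / (2 * (R + 1))) = r / 2" using R0 by (simp add: field_simps)
    also have "r / 2 + norm (c (y n h)) < r" using N[OF that] by simp
    finally show ?thesis .
  qed
  then show "\<exists>no. \<forall>n\<ge>no. norm (y n (q v) - 0) < r" by auto
qed

lemma is_supp_zero:
  assumes s: "is_supp A q h" and y: "y \<in> A" "blinfun_apply y h = 0"
  shows "blinfun_apply y (q v) = 0"
proof -
  have "(\<lambda>n. y (q v)) \<longlonglongrightarrow> 0"
    by (rule is_supp_tendsto[OF s, of "\<lambda>_. y" "norm y"]) (auto simp: y)
  then show ?thesis using LIMSEQ_unique tendsto_const by blast
qed

lemma is_supp_le:
  assumes "is_supp A q h" "von_neumann_algebra A" "p \<in> A" "blinfun_apply p h = h"
  shows "blinfun_apply p (blinfun_apply q v) = blinfun_apply q v"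
  using is_supp_zero[OF assms(1), of "id_blinfun - p" v] assms(2-)
  by (auto simp: vna_diff vna_id blinfun.diff_left)

section \<open>Partial isometries\<close>

definition pisom :: "('h::chilbert_space \<Rightarrow>\<^sub>L 'h) \<Rightarrow> bool" where
  "pisom w \<longleftrightarrow> w \<in> bounded_ops \<and> proj (adj w o\<^sub>L w)"

lemma pisomD:
  assumes "pisom w" shows "w \<in> bounded_ops" "proj (adj w o\<^sub>L w)"
    "blinfun_apply w (blinfun_apply (adj w) (blinfun_apply w v)) = blinfun_apply w v"
    "blinfun_apply (adj w) (blinfun_apply w (blinfun_apply (adj w) v)) = blinfun_apply (adj w) v"
    "proj (w o\<^sub>L adj w)"
proof -
  show b: "w \<in> bounded_ops" and p: "proj (adj w o\<^sub>L w)" using assms by (auto simp: pisom_def)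
  have 1: "w (adj w (w v)) = w v" for v
  proof -
    define u where "u = v - adj w (w v)"
    have "adj w (w u) = 0" using projD[OF p, of v] by (simp add: u_def blinfun.diff_right)
    then have "cinner (w u) (w u) = 0"
      using cinner_adj_right[OF b, of u "w u"] by (simp add: cinner.zero_right)
    then have "w u = 0" by (simp add: cinner_self)
    then show ?thesis by (simp add: u_def blinfun.diff_right)
  qed
  show "w (adj w (w v)) = w v" by (rule 1)
  show 2: "adj w (w (adj w v)) = adj w v" for v
  proof (rule cinner_eqI)
    fix u
    have "cinner u (adj w (w (adj w v))) = cinner (w u) (w (adj w v))" by (rule cinner_adj_right[OF b])
    also have "\<dots> = cinner (adj w (w u)) (adj w v)" by (rule cinner_adj_left[OF b, symmetric])
    also have "\<dots> = cinner (w (adj w (w u))) v" by (rule cinner_adj_right[OF b])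
    finally show "cinner u (adj w (w (adj w v))) = cinner u (adj w v)" by (simp add: 1 cinner_adj_right b)
  qed
  show "proj (w o\<^sub>L adj w)"
    unfolding proj_def
  proof (intro conjI allI saI)
    show "cinner ((w o\<^sub>L adj w) v) u = cinner v ((w o\<^sub>L adj w) u)" for v u
      using cinner_adj_right[OF b, of "adj w v" u] cinner_adj_left[OF b, of v "adj w u"] by simp
  qed (simp_all add: b 2)
qed

lemma pisom_adj: "pisom w \<Longrightarrow> pisom (adj w)"
  unfolding pisom_def[of "adj w"] using pisomD(1,5)[of w] by simp

lemma pisom_norm: "pisom w \<Longrightarrow> norm (blinfun_apply w v) = norm (blinfun_apply (adj w) (blinfun_apply w v))"
proof -
  assume w: "pisom w"
  have "(norm (w v))\<^sup>2 = Re (cinner v (adj w (w v)))"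
    by (simp add: norm_sq_cinner cinner_adj_right pisomD(1)[OF w])
  also have "\<dots> = (norm (adj w (w v)))\<^sup>2" using proj_form[OF pisomD(2)[OF w], of v] by simp
  finally show ?thesis by simp
qed

text \<open>A polar decomposition truncated to a spectral subspace where
  \<open>adj b o\<^sub>L b\<close> is bounded away from 0, so that its inverse square root there is
  a bounded operator in \<open>A\<close>. The factorisations through \<open>b\<close> and
  \<open>adj b\<close> record that the final and initial spaces of \<open>w\<close> lie under those
  of \<open>b\<close>.\<close>

lemma polar:
  assumes A: "von_neumann_algebra A" and b: "b \<in> A" "b \<noteq> 0"
  shows "\<exists>w\<in>A. w \<noteq> 0 \<and> pisom w \<and> (\<exists>c\<in>bounded_ops. \<forall>v. w v = b (blinfun_apply c v)) \<and>
    (\<exists>k\<in>bounded_ops. \<forall>v. adj w (w v) = adj b (blinfun_apply k v))"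
proof -
  have bb: "b \<in> bounded_ops" using vna_bo[OF A b(1)] .
  define d where "d = adj b o\<^sub>L b"
  have d: "pos d" unfolding d_def by (rule pos_adj_comp[OF bb])
  have dA: "d \<in> A" unfolding d_def by (intro vna_comp A vna_adj b)
  have bd: "d \<in> bounded_ops" using d by (rule pos_bounded_ops)
  have form: "Re (cinner v (d v)) = (norm (b v))\<^sup>2" for v
    by (simp add: d_def cinner_adj_right bb norm_sq_cinner)
  obtain v0 where v0: "b v0 \<noteq> 0" using b(2) by (metis blinfun_eqI zero_blinfun.rep_eq)
  \<comment> \<open>Half the value of the form of \<open>d\<close> at the normalised
    \<open>v0\<close>, so that the spectral projection above \<open>t\<close> cannot vanish at
    \<open>v0\<close>.\<close>
  define t where "t = (norm (b v0))\<^sup>2 / (2 * (norm v0)\<^sup>2)"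
  have nv0: "norm v0 > 0" using v0 by (metis blinfun.zero_right zero_less_norm_iff)
  have t: "t > 0" using v0 nv0 by (simp add: t_def)
  obtain e where e: "proj e" "dcomm d e" "\<And>v. t * (norm (e v))\<^sup>2 \<le> Re (cinner (e v) (d (e v)))"
      "\<And>v. Re (cinner v (d v)) \<le> t * (norm (v - e v))\<^sup>2 + norm d * (norm (e v))\<^sup>2"
    using spectral_cut[OF d, of t] by blast
  have e0: "e v0 \<noteq> 0"
  proof
    assume "e v0 = 0"
    then have "(norm (b v0))\<^sup>2 \<le> t * (norm v0)\<^sup>2" using e(4)[of v0] by (simp add: form)
    then show False using nv0 v0 by (simp add: t_def)
  qed
  have be: "e \<in> bounded_ops" using e(1) by (rule proj_bounded_ops)
  have ed: "e (d v) = d (e v)" for v by (rule dcomm_commutes[OF e(2) dcomm_self[OF bd] bd])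
  \<comment> \<open>\<open>1 + T\<close> is \<open>d/t\<close> on the range of \<open>e\<close> and
    the identity on its complement; \<open>inv_exists\<close> inverts it.\<close>
  define T where "T = ((1/t) *\<^sub>R d - id_blinfun) o\<^sub>L e"
  have T: "T v = (1/t) *\<^sub>R d (e v) - e v" for v by (simp add: T_def blinfun.bilinear_simps)
  have dT: "dcomm d T"
    unfolding T_def by (intro dcomm_comp dcomm_diff dcomm_scaleR dcomm_self bd dcomm_id e(2))
  have saT: "sa T"
    by (rule saI[OF dcomm_bounded_ops[OF dT]])
      (simp add: T cinner.diff_left cinner.diff_right cinner_scaleR_left cinner_scaleR_right
        saD[OF proj_sa[OF e(1)]] saD[OF pos_sa[OF d]] ed)
  have posT: "pos T"
  proof (rule posI[OF saT])
    fix v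
    have "d (e v) = e (d (e v))" by (simp add: ed projD[OF e(1)])
    then have "cinner v (d (e v)) = cinner (e v) (d (e v))" by (metis saD[OF proj_sa[OF e(1)]])
    then have "Re (cinner v (T v)) = (1/t) * Re (cinner (e v) (d (e v))) - (norm (e v))\<^sup>2"
      by (simp add: T cinner.diff_right cinner_scaleR_right proj_form[OF e(1)])
    moreover have "(norm (e v))\<^sup>2 \<le> (1/t) * Re (cinner (e v) (d (e v)))"
      using e(3)[of v] t by (simp add: field_simps)
    ultimately show "0 \<le> Re (cinner v (T v))" by linarith
  qed
  obtain g where g: "pos g" "\<And>v. g (v + T v) = v" "dcomm T g" using inv_exists[OF posT] by blast
  obtain r where r: "pos r" "\<And>v. r (r v) = g v" "dcomm g r" using sqrt_exists[OF g(1)] by blast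
  have dg: "dcomm d g" by (rule dcomm_trans[OF dT g(3)])
  have dr: "dcomm d r" by (rule dcomm_trans[OF dg r(3)])
  \<comment> \<open>On the range of \<open>e\<close>, \<open>r\<close> is the inverse square root of
    \<open>d/t\<close>. So \<open>c\<close> is that of \<open>d\<close>, cut down by
    \<open>e\<close>, and \<open>w = b c\<close> has
    \<open>adj w o\<^sub>L w = c d c = e\<close>.\<close>
  define c where "c = (1 / sqrt t) *\<^sub>R (r o\<^sub>L e)"
  have dc: "dcomm d c" unfolding c_def by (intro dcomm_scaleR dcomm_comp dr e(2))
  have bc: "c \<in> bounded_ops" using dc by (rule dcomm_bounded_ops)
  have er: "e (r v) = r (e v)" for v by (rule dcomm_commutes[OF e(2) dr bd])
  have sac: "sa c"
    by (rule saI[OF bc]) (simp add: c_def blinfun.scaleR_left cinner_scaleR_left cinner_scaleR_right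
        saD[OF proj_sa[OF e(1)]] saD[OF pos_sa[OF r(1)]] er)
  have cd: "c (d v) = d (c v)" for v by (rule dcomm_commutes[OF dc dcomm_self[OF bd] bd])
  have cdc: "c (d (c v)) = e v" for v
  proof -
    have "c (d (c v)) = c (c (d v))" by (simp add: cd)
    also have "\<dots> = (1/t) *\<^sub>R r (r (e (d v)))"
      using t by (simp add: c_def blinfun.bilinear_simps er projD[OF e(1)])
    also have "\<dots> = g ((1/t) *\<^sub>R d (e v))" by (simp add: r ed blinfun.scaleR_right)
    also have "(1/t) *\<^sub>R d (e v) = e v + T (e v)" by (simp add: T projD[OF e(1)])
    also have "g \<dots> = e v" by (rule g(2))
    finally show ?thesis .
  qed
  define w where "w = b o\<^sub>L c"
  have adjw: "adj w = c o\<^sub>L adj b" unfolding w_def by (simp add: adj_comp bb bc sa_adj[OF sac])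
  have ww: "adj w o\<^sub>L w = e"
    by (rule blinfun_eqI) (simp add: adjw, simp add: w_def cdc[unfolded d_def, simplified])
  have wA: "w \<in> A" unfolding w_def by (intro vna_comp A b vna_dcomm[OF A dA dc])
  have "w \<noteq> 0" using e0 ww by auto
  moreover have "pisom w" unfolding pisom_def ww using vna_bo[OF A wA] e(1) by simp
  moreover have "\<forall>v. w v = b (c v)" by (simp add: w_def)
  moreover have "adj w (w v) = adj b ((b o\<^sub>L c o\<^sub>L c) v)" for v
  proof -
    have "adj w (w v) = e v" using ww by (metis blinfun_apply_blinfun_compose)
    also have "\<dots> = d (c (c v))" by (simp flip: cdc add: cd)
    finally show ?thesis by (simp add: d_def)
  qed
  moreover have "b o\<^sub>L c o\<^sub>L c \<in> bounded_ops" by (simp add: bb bc)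
  ultimately show ?thesis using wA bc by blast
qed

section \<open>The \<open>\<sigma>\<close>-weak topology and the predual\<close>

lemma square_summable_bound:
  assumes "square_summable \<xi>" "square_summable \<eta>"
  shows "summable (\<lambda>n. cinner (\<xi> n) (blinfun_apply x (\<eta> n)))"
    and "cmod (vector_functional \<xi> \<eta> x) \<le> norm x * (\<Sum>n. norm (\<xi> n) * norm (\<eta> n))"
    and "summable (\<lambda>n. norm (\<xi> n) * norm (\<eta> n))"
proof -
  have s: "summable (\<lambda>n. norm (\<xi> n) * norm (\<eta> n))"
  proof (rule summable_comparison_test'[where N = 0])
    show "summable (\<lambda>n. (norm (\<xi> n))\<^sup>2 + (norm (\<eta> n))\<^sup>2)"
      using assms by (intro summable_add) (auto simp: square_summable_def)
    show "norm (norm (\<xi> n) * norm (\<eta> n)) \<le> (norm (\<xi> n))\<^sup>2 + (norm (\<eta> n))\<^sup>2" for n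
    proof -
      have "2 * (norm (\<xi> n) * norm (\<eta> n)) \<le> (norm (\<xi> n))\<^sup>2 + (norm (\<eta> n))\<^sup>2"
        using sum_squares_bound[of "norm (\<xi> n)" "norm (\<eta> n)"] by (simp only: mult.assoc)
      moreover have "0 \<le> norm (\<xi> n) * norm (\<eta> n)" by simp
      ultimately show ?thesis by (simp only: real_norm_def abs_of_nonneg)
    qed
  qed
  then show "summable (\<lambda>n. norm (\<xi> n) * norm (\<eta> n))" .
  have le: "norm (cinner (\<xi> n) (x (\<eta> n))) \<le> norm x * (norm (\<xi> n) * norm (\<eta> n))" for n
  proof -
    have "norm (cinner (\<xi> n) (x (\<eta> n))) \<le> norm (\<xi> n) * norm (x (\<eta> n))" by (rule cinner_CS)
    also have "\<dots> \<le> norm (\<xi> n) * (norm x * norm (\<eta> n))" by (intro mult_left_mono norm_blinfun) simp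
    finally show ?thesis by (simp add: mult_ac)
  qed
  have s2: "summable (\<lambda>n. norm x * (norm (\<xi> n) * norm (\<eta> n)))" by (rule summable_mult[OF s])
  have s3: "summable (\<lambda>n. norm (cinner (\<xi> n) (x (\<eta> n))))"
    by (rule summable_comparison_test'[OF s2, of 0]) (use le in auto)
  then show "summable (\<lambda>n. cinner (\<xi> n) (x (\<eta> n)))" by (rule summable_norm_cancel)
  have "cmod (vector_functional \<xi> \<eta> x) \<le> (\<Sum>n. norm (cinner (\<xi> n) (x (\<eta> n))))"
    unfolding vector_functional_def by (rule summable_norm[OF s3])
  also have "\<dots> \<le> (\<Sum>n. norm x * (norm (\<xi> n) * norm (\<eta> n)))" by (rule suminf_le[OF le s3 s2])
  finally show "cmod (vector_functional \<xi> \<eta> x) \<le> norm x * (\<Sum>n. norm (\<xi> n) * norm (\<eta> n))"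
    by (simp add: suminf_mult s)
qed

lemma vector_functional_add:
  assumes "square_summable \<xi>" "square_summable \<eta>"
  shows "vector_functional \<xi> \<eta> (x + y) = vector_functional \<xi> \<eta> x + vector_functional \<xi> \<eta> y"
  unfolding vector_functional_def
  by (simp add: blinfun.add_left cinner.add_right suminf_add[symmetric] square_summable_bound[OF assms])

lemma vector_functional_scaleC:
  assumes "square_summable \<xi>" "square_summable \<eta>"
  shows "vector_functional \<xi> \<eta> (c *\<^sub>C x) = c * vector_functional \<xi> \<eta> x"
  unfolding vector_functional_def
  by (simp add: cinner_scaleC_right suminf_mult square_summable_bound[OF assms])

definition unit_seq :: "'h::chilbert_space \<Rightarrow> nat \<Rightarrow> 'h" where
  "unit_seq h n = (if n = 0 then h else 0)"

lemma square_summable_unit_seq: "square_summable (unit_seq h)"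
  unfolding square_summable_def
  by (rule summable_finite[of "{0}"]) (auto simp: unit_seq_def)

lemma vector_functional_unit_seq:
  "vector_functional (unit_seq g) (unit_seq h) x = cinner g (blinfun_apply x h)"
proof -
  have "(\<Sum>n. cinner (unit_seq g n) (x (unit_seq h n))) = (\<Sum>n\<in>{0}. cinner (unit_seq g n) (x (unit_seq h n)))"
    by (rule suminf_finite) (auto simp: unit_seq_def cinner.zero_left)
  then show ?thesis by (simp add: vector_functional_def unit_seq_def)
qed

lemma square_summable_add:
  assumes "square_summable \<xi>" "square_summable \<eta>"
  shows "square_summable (\<lambda>n. \<xi> n + \<eta> n)" "square_summable (\<lambda>n. \<xi> n - \<eta> n)"
proof -
  have s: "summable (\<lambda>n. 2 * (norm (\<xi> n))\<^sup>2 + 2 * (norm (\<eta> n))\<^sup>2)"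
    using assms by (intro summable_add summable_mult) (auto simp: square_summable_def)
  have "(norm (\<xi> n + \<eta> n))\<^sup>2 \<le> 2 * (norm (\<xi> n))\<^sup>2 + 2 * (norm (\<eta> n))\<^sup>2"
    "(norm (\<xi> n - \<eta> n))\<^sup>2 \<le> 2 * (norm (\<xi> n))\<^sup>2 + 2 * (norm (\<eta> n))\<^sup>2" for n
    using parallelogram[of "\<xi> n" "\<eta> n"] zero_le_power2[of "norm (\<xi> n + \<eta> n)"]
      zero_le_power2[of "norm (\<xi> n - \<eta> n)"] by linarith+
  then show "square_summable (\<lambda>n. \<xi> n + \<eta> n)" "square_summable (\<lambda>n. \<xi> n - \<eta> n)"
    unfolding square_summable_def by (auto intro!: summable_comparison_test'[OF s, of 0])
qed

lemma square_summable_scaleC: "square_summable \<xi> \<Longrightarrow> square_summable (\<lambda>n. c *\<^sub>C \<xi> n)"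
  by (simp add: square_summable_def norm_scaleC power_mult_distrib summable_mult)

abbreviation sigma_basis :: "('h::chilbert_space \<Rightarrow>\<^sub>L 'h) set set" where
  "sigma_basis \<equiv> {{x \<in> bounded_ops. vector_functional \<xi> \<eta> x \<in> U} | \<xi> \<eta> U.
        square_summable \<xi> \<and> square_summable \<eta> \<and> open U}"

lemma Union_sigma_basis: "\<Union>(sigma_basis :: ('h::chilbert_space \<Rightarrow>\<^sub>L 'h) set set) = bounded_ops"
proof
  show "\<Union>sigma_basis \<subseteq> (bounded_ops :: ('h \<Rightarrow>\<^sub>L 'h) set)" by blast
  have "bounded_ops = {x \<in> bounded_ops. vector_functional (unit_seq 0) (unit_seq (0::'h)) x \<in> UNIV}" by simp
  then have "(bounded_ops :: ('h \<Rightarrow>\<^sub>L 'h) set) \<in> sigma_basis"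
    using square_summable_unit_seq open_UNIV by blast
  then show "(bounded_ops :: ('h \<Rightarrow>\<^sub>L 'h) set) \<subseteq> \<Union>sigma_basis" by blast
qed

lemma topspace_sigma_weak: "M \<subseteq> bounded_ops \<Longrightarrow> topspace (sigma_weak M) = M"
  unfolding sigma_weak_def topspace_subtopology topology_generated_by_topspace Union_sigma_basis by blast

lemma sigma_weak_open:
  assumes "square_summable \<xi>" "square_summable \<eta>" "open U" "M \<subseteq> bounded_ops"
  shows "openin (sigma_weak M) {x \<in> M. vector_functional \<xi> \<eta> x \<in> U}"
proof -
  have "openin (topology_generated_by sigma_basis) {x \<in> bounded_ops. vector_functional \<xi> \<eta> x \<in> U}"
    by (rule topology_generated_by_Basis) (use assms in blast)
  then show ?thesis
    unfolding sigma_weak_def openin_subtopology using assms(4)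
    by (intro exI[of _ "{x \<in> bounded_ops. vector_functional \<xi> \<eta> x \<in> U}"]) auto
qed

text \<open>The generated topology is only given by rules; induction over them recovers the usual
  basic neighbourhoods, cut out by finitely many functionals with one common radius.\<close>

lemma sigma_weak_nbhd:
  fixes M :: "('h::chilbert_space \<Rightarrow>\<^sub>L 'h) set"
  assumes W: "openin (sigma_weak M) W" and x0: "x0 \<in> W" and M: "M \<subseteq> bounded_ops"
  shows "\<exists>P \<delta>. finite P \<and> \<delta> > 0 \<and> (\<forall>(\<xi>, \<eta>)\<in>P. square_summable \<xi> \<and> square_summable \<eta>) \<and>
    (\<forall>x\<in>M. (\<forall>(\<xi>, \<eta>)\<in>P. cmod (vector_functional \<xi> \<eta> x - vector_functional \<xi> \<eta> x0) < \<delta>) \<longrightarrow> x \<in> W)"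
proof -
  obtain V where V: "openin (topology_generated_by sigma_basis) V" "W = V \<inter> M"
    using W unfolding sigma_weak_def openin_subtopology by blast
  have "generate_topology_on sigma_basis V" using V(1) by (simp add: openin_topology_generated_by_iff)
  then have "x0 \<in> V \<Longrightarrow> \<exists>P \<delta>. finite P \<and> \<delta> > 0 \<and> (\<forall>(\<xi>, \<eta>)\<in>P. square_summable \<xi> \<and> square_summable \<eta>) \<and>
    (\<forall>x\<in>M. (\<forall>(\<xi>, \<eta>)\<in>P. cmod (vector_functional \<xi> \<eta> x - vector_functional \<xi> \<eta> x0) < \<delta>) \<longrightarrow> x \<in> V)"
  proof (induction rule: generate_topology_on.induct)
    case Empty
    then show ?case by simp
  next
    case (Int a b)
    then have mem: "x0 \<in> a" "x0 \<in> b" by auto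
    obtain P \<delta> where
      P: "finite P" "\<delta> > 0" "\<forall>(\<xi>, \<eta>)\<in>P. square_summable \<xi> \<and> square_summable \<eta>"
        "\<forall>x\<in>M. (\<forall>(\<xi>, \<eta>)\<in>P. cmod (vector_functional \<xi> \<eta> x - vector_functional \<xi> \<eta> x0) < \<delta>) \<longrightarrow> x \<in> a"
      using Int.IH(1)[OF mem(1)] by (elim exE conjE)
    obtain Q \<epsilon> where Q: "finite Q" "\<epsilon> > 0" "\<forall>(\<xi>, \<eta>)\<in>Q. square_summable \<xi> \<and> square_summable \<eta>"
        "\<forall>x\<in>M. (\<forall>(\<xi>, \<eta>)\<in>Q. cmod (vector_functional \<xi> \<eta> x - vector_functional \<xi> \<eta> x0) < \<epsilon>) \<longrightarrow> x \<in> b"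
      using Int.IH(2)[OF mem(2)] by (elim exE conjE)
    show ?case
      by (rule exI[of _ "P \<union> Q"], rule exI[of _ "min \<delta> \<epsilon>"]) (use P Q in \<open>auto simp: split_beta\<close>)
  next
    case (UN K)
    then obtain k where k: "k \<in> K" "x0 \<in> k" by blast
    obtain P \<delta> where
      "finite P" "\<delta> > 0" "\<forall>(\<xi>, \<eta>)\<in>P. square_summable \<xi> \<and> square_summable \<eta>"
        "\<forall>x\<in>M. (\<forall>(\<xi>, \<eta>)\<in>P. cmod (vector_functional \<xi> \<eta> x - vector_functional \<xi> \<eta> x0) < \<delta>) \<longrightarrow> x \<in> k"
      using UN.IH[OF k] by (elim exE conjE)
    then show ?case using k(1) by (intro exI[of _ P] exI[of _ \<delta>] conjI ballI impI) auto
  next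
    case (Basis s)
    then obtain \<xi> \<eta> U where s: "s = {x \<in> bounded_ops. vector_functional \<xi> \<eta> x \<in> U}"
      "square_summable \<xi>" "square_summable \<eta>" "open U" by blast
    then have "vector_functional \<xi> \<eta> x0 \<in> U" using Basis.prems by simp
    then obtain \<delta> where "\<delta> > 0" "ball (vector_functional \<xi> \<eta> x0) \<delta> \<subseteq> U"
      using s(4) open_contains_ball by blast
    then show ?case
      using s M by (intro exI[of _ "{(\<xi>, \<eta>)}"] exI[of _ \<delta>]) (auto simp: subset_iff dist_norm norm_minus_commute)
  qed
  then show ?thesis using V x0 by blast
qed

text \<open>The default 0 outside \<open>A\<close> matches the representation of elements of the
  predual.\<close>

definition vsum :: "('h::chilbert_space \<Rightarrow>\<^sub>L 'h) set \<Rightarrow> (nat \<Rightarrow> 'h) \<Rightarrow> ('h \<Rightarrow>\<^sub>L 'h) \<Rightarrow> complex" where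
  "vsum A \<xi> x = (if x \<in> A then vector_functional \<xi> \<xi> x else 0)"

definition vecfun :: "('h::chilbert_space \<Rightarrow>\<^sub>L 'h) set \<Rightarrow> 'h \<Rightarrow> ('h \<Rightarrow>\<^sub>L 'h) \<Rightarrow> complex" where
  "vecfun A h x = (if x \<in> A then cinner h (x h) else 0)"

lemma vecfun_vsum: "vecfun A h = vsum A (unit_seq h)"
  by (simp add: fun_eq_iff vecfun_def vsum_def vector_functional_unit_seq)

lemma vsum_predual_pos:
  assumes A: "von_neumann_algebra A" and \<xi>: "square_summable \<xi>"
  shows "vsum A \<xi> \<in> predual_pos A"
proof -
  have Ab: "A \<subseteq> bounded_ops" using vna_bo[OF A] by blast
  have "continuous_map (sigma_weak A) euclidean (vsum A \<xi>)"
    unfolding continuous_map_def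
  proof (intro conjI allI impI)
    fix U :: "complex set" assume "openin euclidean U"
    then have "openin (sigma_weak A) {x \<in> A. vector_functional \<xi> \<xi> x \<in> U}"
      by (intro sigma_weak_open \<xi> Ab) simp
    also have "{x \<in> A. vector_functional \<xi> \<xi> x \<in> U} = {x \<in> topspace (sigma_weak A). vsum A \<xi> x \<in> U}"
      by (auto simp: topspace_sigma_weak[OF Ab] vsum_def)
    finally show "openin (sigma_weak A) {x \<in> topspace (sigma_weak A). vsum A \<xi> x \<in> U}" .
  qed simp
  then have pre: "vsum A \<xi> \<in> predual A"
    unfolding predual_def
    by (auto simp: vsum_def vna_add[OF A] vna_scaleC[OF A] vector_functional_add[OF \<xi> \<xi>] vector_functional_scaleC[OF \<xi> \<xi>])
  have "vsum A \<xi> x \<in> \<real>\<^sub>\<ge>\<^sub>0" if x: "x \<in> positive_cone A" for x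
  proof -
    have xA: "x \<in> A" and p: "op_le 0 x" using x by (auto simp: positive_cone_def)
    have p: "pos x" using p op_le_zero_pos[of x] Ab xA by blast
    have "cinner (\<xi> n) (x (\<xi> n)) = of_real (Re (cinner (\<xi> n) (x (\<xi> n))))" for n
      by (rule sa_cinner_real[OF pos_sa[OF p]])
    moreover have s: "summable (\<lambda>n. Re (cinner (\<xi> n) (x (\<xi> n))))"
      by (rule summable_Re[OF square_summable_bound(1)[OF \<xi> \<xi>]])
    ultimately have "vector_functional \<xi> \<xi> x = of_real (\<Sum>n. Re (cinner (\<xi> n) (x (\<xi> n))))"
      unfolding vector_functional_def suminf_of_real[OF s] by metis
    moreover have "0 \<le> (\<Sum>n. Re (cinner (\<xi> n) (x (\<xi> n))))" by (rule suminf_nonneg[OF s]) (rule posD[OF p])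
    ultimately show ?thesis using xA by (simp add: vsum_def)
  qed
  with pre show ?thesis by (simp add: predual_pos_def)
qed

lemma vecfun_predual_pos: "von_neumann_algebra A \<Longrightarrow> vecfun A h \<in> predual_pos A"
  by (simp add: vecfun_vsum vsum_predual_pos square_summable_unit_seq)

lemma predual_pos_add:
  assumes "\<phi> \<in> predual_pos A" "\<psi> \<in> predual_pos A"
  shows "(\<lambda>x. \<phi> x + \<psi> x) \<in> predual_pos A"
  using assms unfolding predual_pos_def predual_def
  by (auto simp: algebra_simps intro: continuous_map_add)

lemma predual_pos_scale:
  assumes "\<phi> \<in> predual_pos A" "0 \<le> r"
  shows "(\<lambda>x. complex_of_real r * \<phi> x) \<in> predual_pos A"
proof -
  have "continuous_map (sigma_weak A) euclidean (((*) (complex_of_real r)) \<circ> \<phi>)"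
    using assms(1) by (intro continuous_map_compose[of _ euclidean])
      (auto simp: predual_pos_def predual_def intro!: continuous_intros)
  then show ?thesis
    using assms unfolding predual_pos_def predual_def
    by (auto simp: algebra_simps complex_nonneg_Reals_iff o_def)
qed

lemma predual_pos_zero: "(\<lambda>x. 0) \<in> predual_pos A"
  unfolding predual_pos_def predual_def by auto

lemma predual_pos_sum:
  "(\<And>i. i \<in> F \<Longrightarrow> f i \<in> predual_pos A) \<Longrightarrow> (\<lambda>x. \<Sum>i\<in>F. f i x) \<in> predual_pos A"
proof (induction F rule: infinite_finite_induct)
  case (insert i F)
  then show ?case using predual_pos_add[of "f i" A "\<lambda>x. \<Sum>i\<in>F. f i x"] by simp
qed (auto simp: predual_pos_zero)

lemma predual_norm_le:
  assumes A: "von_neumann_algebra A" and "\<And>x. x \<in> A \<Longrightarrow> norm x \<le> 1 \<Longrightarrow> cmod (\<phi> x) \<le> c"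
  shows "predual_norm A \<phi> \<le> c"
  unfolding predual_norm_def
proof (rule cSUP_least)
  show "{x \<in> A. norm x \<le> 1} \<noteq> {}" using vna_zero[OF A] by (auto intro!: exI[of _ 0])
qed (use assms in auto)

text \<open>Induction on the set of functionals: restrict to the kernel of one of them and correct
  its coefficient afterwards. The claim is relative to a subspace \<open>V\<close> to make this
  restriction possible.\<close>

lemma linear_combination_if_kernel:
  fixes f :: "'i \<Rightarrow> 'v::complex_vector \<Rightarrow> complex"
  assumes "finite F" "complex_vector.subspace V"
    and "\<And>i x y. i \<in> F \<Longrightarrow> x \<in> V \<Longrightarrow> y \<in> V \<Longrightarrow> f i (x + y) = f i x + f i y"
    and "\<And>i c x. i \<in> F \<Longrightarrow> x \<in> V \<Longrightarrow> f i (c *\<^sub>C x) = c * f i x"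
    and "\<And>x y. x \<in> V \<Longrightarrow> y \<in> V \<Longrightarrow> \<phi> (x + y) = \<phi> x + (\<phi> y :: complex)"
    and "\<And>c x. x \<in> V \<Longrightarrow> \<phi> (c *\<^sub>C x) = c * \<phi> x"
    and "\<And>x. x \<in> V \<Longrightarrow> (\<And>i. i \<in> F \<Longrightarrow> f i x = 0) \<Longrightarrow> \<phi> x = 0"
  shows "\<exists>c. \<forall>x\<in>V. \<phi> x = (\<Sum>i\<in>F. c i * f i x)"
  using assms
proof (induction F arbitrary: V rule: finite_induct)
  case empty
  then show ?case by auto
next
  case (insert j F)
  note V = insert.prems(1) and fadd = insert.prems(2) and fsc = insert.prems(3)
    and padd = insert.prems(4) and psc = insert.prems(5) and ker = insert.prems(6)
  define V' where "V' = {x \<in> V. f j x = 0}"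
  have V': "complex_vector.subspace V'"
    unfolding complex_vector.subspace_def V'_def
    using V fadd[of j] fsc[of j] fsc[of j 0 0]
    by (auto simp: complex_vector.subspace_0 complex_vector.subspace_add complex_vector.subspace_scale)
  have "\<exists>c. \<forall>x\<in>V'. \<phi> x = (\<Sum>i\<in>F. c i * f i x)"
  proof (rule insert.IH[OF V'])
    show "\<phi> x = 0" if "x \<in> V'" "\<And>i. i \<in> F \<Longrightarrow> f i x = 0" for x
      using that ker[of x] by (auto simp: V'_def)
  qed (use fadd fsc padd psc in \<open>auto simp: V'_def\<close>)
  then obtain c where c: "\<And>x. x \<in> V' \<Longrightarrow> \<phi> x = (\<Sum>i\<in>F. c i * f i x)" by blast
  show ?case
  proof (cases "\<forall>x\<in>V. f j x = 0")
    case True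
    then show ?thesis using c insert.hyps by (intro exI[of _ c]) (auto simp: V'_def)
  next
    case False
    then obtain a where a: "a \<in> V" "f j a \<noteq> 0" by blast
    define b where "b = (1 / f j a) *\<^sub>C a"
    have b: "b \<in> V" "f j b = 1"
      using a V fsc[of j a] by (auto simp: b_def complex_vector.subspace_scale)
    define c' where "c' = c(j := \<phi> b - (\<Sum>i\<in>F. c i * f i b))"
    have "\<phi> x = (\<Sum>i\<in>insert j F. c' i * f i x)" if x: "x \<in> V" for x
    proof -
      define y where "y = x + (- f j x) *\<^sub>C b"
      have sb: "(- f j x) *\<^sub>C b \<in> V" using b V by (intro complex_vector.subspace_scale)
      have fy: "f i y = f i x - f j x * f i b" if "i \<in> insert j F" for i
        using fadd[OF that x sb] fsc[OF that b(1), of "- f j x"] unfolding y_def by simp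
      have py: "\<phi> y = \<phi> x - f j x * \<phi> b"
        using padd[OF x sb] psc[OF b(1), of "- f j x"] unfolding y_def by simp
      have "y \<in> V" unfolding y_def by (rule complex_vector.subspace_add[OF V x sb])
      then have "y \<in> V'" using fy[of j] b by (simp add: V'_def)
      from c[OF this] have "\<phi> x = f j x * \<phi> b + (\<Sum>i\<in>F. c i * (f i x - f j x * f i b))"
        using py fy by (simp add: algebra_simps)
      also have "(\<Sum>i\<in>F. c i * (f i x - f j x * f i b))
          = (\<Sum>i\<in>F. c i * f i x) - f j x * (\<Sum>i\<in>F. c i * f i b)"
        by (simp add: algebra_simps sum_subtractf sum_distrib_left)
      also have "(\<Sum>i\<in>F. c i * f i x) = (\<Sum>i\<in>F. c' i * f i x)"
        using insert.hyps by (intro sum.cong) (auto simp: c'_def)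
      finally show ?thesis using insert.hyps by (simp add: c'_def algebra_simps)
    qed
    then show ?thesis by blast
  qed
qed

lemma predual_pos_sa_real:
  assumes A: "von_neumann_algebra A" and \<phi>: "\<phi> \<in> predual_pos A" and a: "a \<in> A" "sa a"
  shows "Im (\<phi> a) = 0"
proof -
  have lin: "\<phi> (x + y) = \<phi> x + \<phi> y" "\<phi> (c *\<^sub>C x) = c * \<phi> x" if "x \<in> A" "y \<in> A" for x y c
    using \<phi> that by (auto simp: predual_pos_def predual_def)
  have po: "Im (\<phi> x) = 0" if "x \<in> A" "pos x" for x
    using \<phi> that op_le_zero_pos[of x] pos_bounded_ops
    by (auto simp: predual_pos_def positive_cone_def complex_nonneg_Reals_iff)
  \<comment> \<open>A multiple of the identity above \<open>a\<close>; it exhibits \<open>a\<close>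
    as a difference of two positive elements of \<open>A\<close>.\<close>
  define t where "t = norm a *\<^sub>R (id_blinfun :: 'a \<Rightarrow>\<^sub>L 'a)"
  have t: "t \<in> A" unfolding t_def by (intro vna_scaleR A vna_id)
  have pt: "pos t" unfolding t_def by (intro pos_scaleR pos_id) simp
  have "pos (t - a)"
  proof (rule posI)
    show "sa (t - a)" by (intro sa_diff a pos_sa[OF pt])
    show "0 \<le> Re (cinner v ((t - a) v))" for v
      using Re_cinner_le[of v a]
      by (simp add: t_def blinfun.bilinear_simps cinner.diff_right cinner_scaleR_right flip: norm_sq_cinner)
  qed
  moreover have ta: "t - a \<in> A" by (intro vna_diff A t a)
  ultimately have "Im (\<phi> (t - a)) = 0" by (intro po)
  moreover have "\<phi> t = \<phi> (t - a) + \<phi> a" using lin(1)[OF ta a(1)] by simp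
  ultimately show ?thesis using po[OF t pt] by simp
qed

lemma predual_pos_adj:
  assumes A: "von_neumann_algebra A" and \<phi>: "\<phi> \<in> predual_pos A" and a: "a \<in> A"
  shows "\<phi> (adj a) = cnj (\<phi> a)"
proof -
  have lin: "\<phi> (x + y) = \<phi> x + \<phi> y" "\<phi> (c *\<^sub>C x) = c * \<phi> x" if "x \<in> A" "y \<in> A" for x y c
    using \<phi> that by (auto simp: predual_pos_def predual_def)
  have ba: "a \<in> bounded_ops" using vna_bo[OF A a] .
  have aa: "adj a \<in> A" by (rule vna_adj[OF A a])
  have "sa (a + adj a)" unfolding sa_iff_adj by (simp add: ba adj_add add.commute)
  then have 1: "Im (\<phi> (a + adj a)) = 0" by (intro predual_pos_sa_real[OF A \<phi>] vna_add A a aa)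
  have "sa (\<i> *\<^sub>C (a - adj a))"
    unfolding sa_iff_adj
    by (simp add: ba adj_scaleC adj_diff complex_vector.scale_right_diff_distrib)
  then have 2: "Im (\<phi> (\<i> *\<^sub>C (a - adj a))) = 0"
    by (intro predual_pos_sa_real[OF A \<phi>] vna_scaleC vna_diff A a aa)
  have "\<phi> (a - adj a) = \<phi> a - \<phi> (adj a)"
    using lin(1)[OF vna_diff[OF A a aa] aa] by simp
  then show ?thesis
    using 1 2 lin(1)[OF a aa] lin(2)[OF vna_diff[OF A a aa] a, of \<i>] by (simp add: complex_eq_iff)
qed

lemma vector_functional_adj:
  assumes "x \<in> bounded_ops" "square_summable \<xi>" "square_summable \<eta>"
  shows "vector_functional \<xi> \<eta> (adj x) = cnj (vector_functional \<eta> \<xi> x)"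
proof -
  have "cinner (\<xi> n) (adj x (\<eta> n)) = cnj (cinner (\<eta> n) (x (\<xi> n)))" for n
    by (metis cinner_adj_right[OF assms(1)] cinner_commute)
  then show ?thesis
    unfolding vector_functional_def
    using bounded_linear.suminf[OF bounded_linear_cnj square_summable_bound(1)[OF assms(3,2), of x]] by simp
qed

text \<open>Polarisation makes a positive normal functional a difference of sums of vector states, stated
  additively because elements of the extended positive cone only see sums.\<close>

lemma predual_pos_decomp:
  fixes A :: "('h::chilbert_space \<Rightarrow>\<^sub>L 'h) set"
  assumes A: "von_neumann_algebra A" and \<phi>: "\<phi> \<in> predual_pos A"
  shows "\<exists>(F :: ((nat \<Rightarrow> 'h) \<times> (nat \<Rightarrow> 'h)) set) \<xi> \<eta>. finite F \<and>
    (\<forall>i\<in>F. square_summable (\<xi> i) \<and> square_summable (\<eta> i)) \<and>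
    (\<forall>x. 4 * \<phi> x + (\<Sum>i\<in>F. vsum A (\<eta> i) x) = (\<Sum>i\<in>F. vsum A (\<xi> i) x))"
proof -
  have Ab: "A \<subseteq> bounded_ops" using vna_bo[OF A] by blast
  have pre: "\<phi> \<in> predual A" using \<phi> by (simp add: predual_pos_def)
  have lin: "\<phi> (x + y) = \<phi> x + \<phi> y" "\<phi> (c *\<^sub>C x) = c * \<phi> x" if "x \<in> A" "y \<in> A" for x y c
    using pre that by (auto simp: predual_def)
  have sub: "complex_vector.subspace A"
    unfolding complex_vector.subspace_def by (auto simp: vna_zero[OF A] vna_add[OF A] vna_scaleC[OF A])
  define W where "W = {x \<in> topspace (sigma_weak A). \<phi> x \<in> ball 0 1}"
  have W: "openin (sigma_weak A) W"
    unfolding W_def using pre by (intro openin_continuous_map_preimage[of _ euclidean]) (auto simp: predual_def)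
  have W0: "0 \<in> W"
    using vna_zero[OF A] lin(2)[of 0 0 0] by (simp add: W_def topspace_sigma_weak[OF Ab])
  obtain P \<delta> where P: "finite P" "\<delta> > 0"
      "\<forall>(\<xi>, \<eta>)\<in>P. square_summable \<xi> \<and> square_summable \<eta>"
      "\<forall>x\<in>A. (\<forall>(\<xi>, \<eta>)\<in>P. cmod (vector_functional \<xi> \<eta> x - vector_functional \<xi> \<eta> 0) < \<delta>) \<longrightarrow> x \<in> W"
    using sigma_weak_nbhd[OF W W0 Ab] by (elim exE conjE)
  have P4: "cmod (\<phi> x) < 1"
    if "x \<in> A" "\<forall>(\<xi>, \<eta>)\<in>P. cmod (vector_functional \<xi> \<eta> x - vector_functional \<xi> \<eta> 0) < \<delta>" for x
    using P(4) that by (auto simp: W_def)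
  define f where "f i = vector_functional (fst i) (snd i)" for i :: "(nat \<Rightarrow> 'h) \<times> (nat \<Rightarrow> 'h)"
  have ss: "square_summable (fst i)" "square_summable (snd i)" if "i \<in> P" for i
    using P(3) that by auto
  have "\<exists>c. \<forall>x\<in>A. \<phi> x = (\<Sum>i\<in>P. c i * f i x)"
  proof (rule linear_combination_if_kernel[OF P(1) sub])
    fix x assume x: "x \<in> A" "\<And>i. i \<in> P \<Longrightarrow> f i x = 0"
    \<comment> \<open>All multiples of \<open>x\<close> stay in the neighbourhood, and a linear
      functional that is bounded on a line vanishes on it.\<close>
    have small: "cmod (c * \<phi> x) < 1" for c
    proof -
      have "cmod (\<phi> (c *\<^sub>C x)) < 1"
      proof (rule P4[OF vna_scaleC[OF A x(1)]], clarify)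
        fix \<xi> \<eta> assume "(\<xi>, \<eta>) \<in> P"
        then show "cmod (vector_functional \<xi> \<eta> (c *\<^sub>C x) - vector_functional \<xi> \<eta> 0) < \<delta>"
          using x(2)[of "(\<xi>, \<eta>)"] ss[of "(\<xi>, \<eta>)"] P(2) vector_functional_scaleC[of \<xi> \<eta> 0 0]
          by (simp add: f_def vector_functional_scaleC)
      qed
      then show ?thesis using lin(2)[OF x(1) x(1)] by simp
    qed
    show "\<phi> x = 0"
    proof (rule ccontr)
      assume "\<phi> x \<noteq> 0"
      then show False using small[of "1 / \<phi> x"] by simp
    qed
  qed (auto simp: f_def vector_functional_add vector_functional_scaleC ss lin)
  then obtain c where c: "\<And>x. x \<in> A \<Longrightarrow> \<phi> x = (\<Sum>i\<in>P. c i * f i x)" by blast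
  define \<xi> where "\<xi> i n = fst i n + c i *\<^sub>C snd i n" for i and n :: nat
  define \<eta> where "\<eta> i n = fst i n - c i *\<^sub>C snd i n" for i and n :: nat
  have sse: "square_summable (\<xi> i)" "square_summable (\<eta> i)" if "i \<in> P" for i
    unfolding \<xi>_def[abs_def] \<eta>_def[abs_def]
    by (intro square_summable_add square_summable_scaleC ss that)+
  have main: "4 * \<phi> x + (\<Sum>i\<in>P. vsum A (\<eta> i) x) = (\<Sum>i\<in>P. vsum A (\<xi> i) x)" for x
  proof (cases "x \<in> A")
    case True
    have bx: "x \<in> bounded_ops" using True Ab by blast
    have d: "vector_functional (\<xi> i) (\<xi> i) x - vector_functional (\<eta> i) (\<eta> i) x
        = 2 * (c i * f i x) + 2 * cnj (c i * f i (adj x))" if i: "i \<in> P" for i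
    proof -
      let ?g = "\<lambda>n. c i *\<^sub>C snd i n"
      note s1 = ss(1)[OF i] and s2 = square_summable_scaleC[OF ss(2)[OF i], of "c i"]
      have e1: "vector_functional (fst i) ?g x = c i * f i x"
        unfolding vector_functional_def f_def
        by (simp add: bounded_opsD[OF bx] cinner_scaleC_right suminf_mult square_summable_bound(1)[OF ss[OF i]])
      have "vector_functional (fst i) ?g (adj x) = c i * f i (adj x)"
        unfolding vector_functional_def f_def
        by (simp add: bounded_opsD[OF adj_bounded_ops[OF bx]] cinner_scaleC_right suminf_mult square_summable_bound(1)[OF ss[OF i]])
      then have e2: "vector_functional ?g (fst i) x = cnj (c i * f i (adj x))"
        using vector_functional_adj[OF bx s1 s2] by (metis complex_cnj_cnj)
      have "vector_functional (\<xi> i) (\<xi> i) x - vector_functional (\<eta> i) (\<eta> i) x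
        = (\<Sum>n. 2 * cinner (fst i n) (x (?g n)) + 2 * cinner (?g n) (x (fst i n)))"
      proof -
        have "cinner (\<xi> i n) (x (\<xi> i n)) - cinner (\<eta> i n) (x (\<eta> i n))
          = 2 * cinner (fst i n) (x (?g n)) + 2 * cinner (?g n) (x (fst i n))" for n
          unfolding \<xi>_def \<eta>_def cinner.add_left cinner.add_right cinner.diff_left cinner.diff_right
            blinfun.add_right blinfun.diff_right by simp
        then show ?thesis
          unfolding vector_functional_def
          by (simp only: suminf_diff[OF square_summable_bound(1)[OF sse(1)[OF i] sse(1)[OF i]]
                square_summable_bound(1)[OF sse(2)[OF i] sse(2)[OF i]]])
      qed
      also have "\<dots> = 2 * vector_functional (fst i) ?g x + 2 * vector_functional ?g (fst i) x"
        unfolding vector_functional_def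
        by (subst suminf_add[symmetric])
          (auto intro!: summable_mult square_summable_bound(1) s1 s2 simp: suminf_mult square_summable_bound(1)[OF s1 s2] square_summable_bound(1)[OF s2 s1])
      finally show ?thesis by (simp add: e1 e2)
    qed
    have "(\<Sum>i\<in>P. vsum A (\<xi> i) x) - (\<Sum>i\<in>P. vsum A (\<eta> i) x)
        = (\<Sum>i\<in>P. 2 * (c i * f i x) + 2 * cnj (c i * f i (adj x)))"
      unfolding sum_subtractf[symmetric] by (rule sum.cong) (auto simp: vsum_def True d)
    also have "\<dots> = 2 * \<phi> x + 2 * cnj (\<phi> (adj x))"
      by (simp add: c True vna_adj[OF A True] sum.distrib sum_distrib_left)
    also have "\<dots> = 4 * \<phi> x" by (simp add: predual_pos_adj[OF A \<phi> True])
    finally show ?thesis by (simp add: algebra_simps)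
  next
    case False
    then have "\<phi> x = 0" using pre by (simp add: predual_def)
    then show ?thesis using False by (simp add: vsum_def)
  qed
  show ?thesis using P(1) sse main by (intro exI[of _ P] exI[of _ \<xi>] exI[of _ \<eta>]) auto
qed

section \<open>The extended positive cone\<close>

context
  fixes A :: "('h::chilbert_space \<Rightarrow>\<^sub>L 'h) set" and m :: "'h ext_pos"
  assumes A: "von_neumann_algebra A" and m: "m \<in> extended_positive_cone A"
begin

lemma econe_add:
  "\<phi> \<in> predual_pos A \<Longrightarrow> \<psi> \<in> predual_pos A \<Longrightarrow> m (\<lambda>x. \<phi> x + \<psi> x) = m \<phi> + m \<psi>"
  using m unfolding extended_positive_cone_def by blast

lemma econe_scale:
  "0 \<le> r \<Longrightarrow> \<phi> \<in> predual_pos A \<Longrightarrow> m (\<lambda>x. complex_of_real r * \<phi> x) = ennreal r * m \<phi>"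
  using m unfolding extended_positive_cone_def by blast

lemma econe_lsc:
  "\<phi> \<in> predual_pos A \<Longrightarrow> c < m \<phi> \<Longrightarrow>
    \<exists>\<epsilon>>0. \<forall>\<psi>\<in>predual_pos A. predual_norm A (\<lambda>x. \<psi> x - \<phi> x) < \<epsilon> \<longrightarrow> c < m \<psi>"
  using m unfolding extended_positive_cone_def by blast

lemma econe_outside: "\<phi> \<notin> predual_pos A \<Longrightarrow> m \<phi> = 0"
  using m unfolding extended_positive_cone_def by blast

lemma econe_zero: "m (\<lambda>x. 0) = 0"
  using econe_scale[of 0 "\<lambda>x. 0"] predual_pos_zero[of A] by simp

lemma econe_sum:
  "(\<And>i. i \<in> F \<Longrightarrow> f i \<in> predual_pos A) \<Longrightarrow> m (\<lambda>x. \<Sum>i\<in>F. f i x) = (\<Sum>i\<in>F. m (f i))"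
proof (induction F rule: infinite_finite_induct)
  case (insert i F)
  then show ?case
    using econe_add[of "f i" "\<lambda>x. \<Sum>i\<in>F. f i x"] predual_pos_sum[of F f A] by simp
qed (auto simp: econe_zero)

lemma vsum_split:
  assumes "square_summable \<xi>"
  shows "vsum A \<xi> x = (\<Sum>n<N. vecfun A (\<xi> n) x) + vsum A (\<lambda>n. \<xi> (n + N)) x"
  using suminf_split_initial_segment[OF square_summable_bound(1)[OF assms assms], of x N]
  by (simp add: vsum_def vecfun_def vector_functional_def add.commute)

lemma square_summable_shift: "square_summable \<xi> \<Longrightarrow> square_summable (\<lambda>n. \<xi> (n + N))"
  unfolding square_summable_def by (rule summable_ignore_initial_segment)

text \<open>Additivity handles finite sums and gives one inequality. For the other, the partial sums
  approximate \<open>vsum A \<xi>\<close> in the predual norm, and \<open>m\<close> is lower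
  semicontinuous. Together with \<open>predual_pos_decomp\<close> this reduces questions about
  \<open>m\<close> to its values at vector states.\<close>

lemma econe_vsum:
  assumes \<xi>: "square_summable \<xi>"
  shows "m (vsum A \<xi>) = (\<Sum>n. m (vecfun A (\<xi> n)))"
proof (rule antisym)
  have part: "(\<lambda>x. \<Sum>n<N. vecfun A (\<xi> n) x) \<in> predual_pos A" for N
    by (intro predual_pos_sum vecfun_predual_pos A)
  have mpart: "m (\<lambda>x. \<Sum>n<N. vecfun A (\<xi> n) x) = (\<Sum>n<N. m (vecfun A (\<xi> n)))" for N
    by (intro econe_sum vecfun_predual_pos A)
  show "(\<Sum>n. m (vecfun A (\<xi> n))) \<le> m (vsum A \<xi>)"
  proof (rule suminf_le_const)
    fix N
    have "vsum A \<xi> = (\<lambda>x. (\<Sum>n<N. vecfun A (\<xi> n) x) + vsum A (\<lambda>n. \<xi> (n + N)) x)"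
      by (rule ext) (rule vsum_split[OF \<xi>])
    then have "m (vsum A \<xi>) = m (\<lambda>x. \<Sum>n<N. vecfun A (\<xi> n) x) + m (vsum A (\<lambda>n. \<xi> (n + N)))"
      using econe_add[OF part vsum_predual_pos[OF A square_summable_shift[OF \<xi>]]] by simp
    then show "(\<Sum>n<N. m (vecfun A (\<xi> n))) \<le> m (vsum A \<xi>)" by (simp add: mpart)
  qed simp
  show "m (vsum A \<xi>) \<le> (\<Sum>n. m (vecfun A (\<xi> n)))"
  proof (rule dense_le)
    fix c assume "c < m (vsum A \<xi>)"
    then obtain \<epsilon> where \<epsilon>: "\<epsilon> > 0" "\<And>\<psi>. \<psi> \<in> predual_pos A \<Longrightarrow>
        predual_norm A (\<lambda>x. \<psi> x - vsum A \<xi> x) < \<epsilon> \<Longrightarrow> c < m \<psi>"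
      using econe_lsc[OF vsum_predual_pos[OF A \<xi>]] by blast
    have s: "summable (\<lambda>n. (norm (\<xi> n))\<^sup>2)" using \<xi> by (simp add: square_summable_def)
    obtain N where N: "norm (\<Sum>i. (norm (\<xi> (i + N)))\<^sup>2) < \<epsilon>"
      using suminf_exist_split[OF \<epsilon>(1) s] by blast
    have "predual_norm A (\<lambda>x. (\<Sum>n<N. vecfun A (\<xi> n) x) - vsum A \<xi> x) \<le> (\<Sum>i. (norm (\<xi> (i + N)))\<^sup>2)"
    proof (rule predual_norm_le[OF A])
      fix x :: "'h \<Rightarrow>\<^sub>L 'h" assume x: "x \<in> A" "norm x \<le> 1"
      note sh = square_summable_shift[OF \<xi>, of N]
      have "cmod ((\<Sum>n<N. vecfun A (\<xi> n) x) - vsum A \<xi> x) = cmod (vector_functional (\<lambda>n. \<xi> (n + N)) (\<lambda>n. \<xi> (n + N)) x)"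
        by (simp add: vsum_split[OF \<xi>, of x N]) (simp add: vsum_def x)
      also have "\<dots> \<le> norm x * (\<Sum>n. norm (\<xi> (n + N)) * norm (\<xi> (n + N)))"
        by (rule square_summable_bound(2)[OF sh sh])
      also have "\<dots> \<le> 1 * (\<Sum>n. norm (\<xi> (n + N)) * norm (\<xi> (n + N)))"
        by (intro mult_right_mono x suminf_nonneg square_summable_bound(3)[OF sh sh]) simp
      finally show "cmod ((\<Sum>n<N. vecfun A (\<xi> n) x) - vsum A \<xi> x) \<le> (\<Sum>i. (norm (\<xi> (i + N)))\<^sup>2)"
        by (simp add: power2_eq_square)
    qed
    then have "predual_norm A (\<lambda>x. (\<Sum>n<N. vecfun A (\<xi> n) x) - vsum A \<xi> x) < \<epsilon>" using N by simp
    then have "c < m (\<lambda>x. \<Sum>n<N. vecfun A (\<xi> n) x)" by (rule \<epsilon>(2)[OF part])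
    also have "\<dots> \<le> (\<Sum>n. m (vecfun A (\<xi> n)))"
      unfolding mpart by (rule sum_le_suminf) auto
    finally show "c \<le> (\<Sum>n. m (vecfun A (\<xi> n)))" by simp
  qed
qed

text \<open>The vector state of a vector depends norm continuously on it, so lower semicontinuity on
  the predual becomes lower semicontinuity in the vector.\<close>

lemma econe_vec_limit:
  assumes lim: "h \<longlonglongrightarrow> g" and le: "\<And>n. m (vecfun A (h n)) \<le> C"
  shows "m (vecfun A g) \<le> C"
proof (rule dense_le)
  fix c assume "c < m (vecfun A g)"
  then obtain \<epsilon> where \<epsilon>: "\<epsilon> > 0" "\<And>\<psi>. \<psi> \<in> predual_pos A \<Longrightarrow>
      predual_norm A (\<lambda>x. \<psi> x - vecfun A g x) < \<epsilon> \<Longrightarrow> c < m \<psi>"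
    using econe_lsc[OF vecfun_predual_pos[OF A]] by blast
  have "(\<lambda>n. norm (h n - g) * (norm (h n) + norm g)) \<longlonglongrightarrow> norm (g - g) * (norm g + norm g)"
    by (intro tendsto_intros lim)
  then have "(\<lambda>n. norm (h n - g) * (norm (h n) + norm g)) \<longlonglongrightarrow> 0" by simp
  then have "eventually (\<lambda>n. norm (h n - g) * (norm (h n) + norm g) < \<epsilon>) sequentially"
    using \<epsilon>(1) by (rule order_tendstoD(2))
  then obtain n where n: "norm (h n - g) * (norm (h n) + norm g) < \<epsilon>"
    by (auto simp: eventually_sequentially)
  have "predual_norm A (\<lambda>x. vecfun A (h n) x - vecfun A g x) \<le> norm (h n - g) * (norm (h n) + norm g)"
  proof (rule predual_norm_le[OF A])
    fix x :: "'h \<Rightarrow>\<^sub>L 'h" assume x: "x \<in> A" "norm x \<le> 1"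
    have nx: "norm (x v) \<le> norm v" for v
      using order_trans[OF norm_blinfun mult_right_mono[OF x(2)]] by simp
    have "vecfun A (h n) x - vecfun A g x = cinner (h n - g) (x (h n)) + cinner g (x (h n - g))"
      by (simp add: vecfun_def x cinner.diff_left cinner.diff_right blinfun.diff_right)
    also have "cmod \<dots> \<le> norm (h n - g) * norm (x (h n)) + norm g * norm (x (h n - g))"
      by (intro norm_triangle_le add_mono cinner_CS)
    also have "\<dots> \<le> norm (h n - g) * norm (h n) + norm g * norm (h n - g)"
      by (intro add_mono mult_left_mono nx) auto
    finally show "cmod (vecfun A (h n) x - vecfun A g x) \<le> norm (h n - g) * (norm (h n) + norm g)"
      by (simp add: algebra_simps)
  qed
  then have "c < m (vecfun A (h n))" using n by (intro \<epsilon>(2) vecfun_predual_pos A) simp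
  then show "c \<le> C" using le[of n] by simp
qed

text \<open>By \<open>econe_vsum\<close> the element vanishes at every \<open>vsum\<close>, and
  \<open>predual_pos_decomp\<close> dominates four times a positive functional by a finite sum of
  these.\<close>

lemma econe_eq_zero:
  assumes z: "\<And>h. m (vecfun A h) = 0"
  shows "m = (\<lambda>\<phi>. 0)"
proof
  fix \<phi>
  show "m \<phi> = 0"
  proof (cases "\<phi> \<in> predual_pos A")
    case True
    then obtain F :: "((nat \<Rightarrow> 'h) \<times> (nat \<Rightarrow> 'h)) set" and \<xi> \<eta> where F: "finite F"
      "\<And>i. i \<in> F \<Longrightarrow> square_summable (\<xi> i)" "\<And>i. i \<in> F \<Longrightarrow> square_summable (\<eta> i)"
      "\<And>x. 4 * \<phi> x + (\<Sum>i\<in>F. vsum A (\<eta> i) x) = (\<Sum>i\<in>F. vsum A (\<xi> i) x)"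
      using predual_pos_decomp[OF A True] by metis
    have "m (\<lambda>x. complex_of_real 4 * \<phi> x + (\<Sum>i\<in>F. vsum A (\<eta> i) x)) =
        ennreal 4 * m \<phi> + (\<Sum>i\<in>F. m (vsum A (\<eta> i)))"
      using econe_add[OF predual_pos_scale[OF True, of 4] predual_pos_sum[of F "\<lambda>i. vsum A (\<eta> i)"]]
        econe_scale[OF _ True, of 4] econe_sum[of F "\<lambda>i. vsum A (\<eta> i)"] vsum_predual_pos[OF A F(3)] by simp
    moreover have "(\<lambda>x. complex_of_real 4 * \<phi> x + (\<Sum>i\<in>F. vsum A (\<eta> i) x)) = (\<lambda>x. \<Sum>i\<in>F. vsum A (\<xi> i) x)"
      using F(4) by (intro ext) simp
    moreover have "m (\<lambda>x. \<Sum>i\<in>F. vsum A (\<xi> i) x) = 0"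
      using econe_sum[of F "\<lambda>i. vsum A (\<xi> i)"] vsum_predual_pos[OF A F(2)] econe_vsum[OF F(2)]
      by (simp add: z)
    ultimately show ?thesis by simp
  qed (rule econe_outside)
qed

text \<open>Additivity of \<open>m\<close> makes \<open>Q h\<close>, its value at the vector state
  of \<open>h\<close>, satisfy the identities of a quadratic form, and polarisation yields
  \<open>b\<close>. The value at a general functional follows by cancelling finite terms in
  \<open>predual_pos_decomp\<close>.\<close>

lemma econe_bounded_op:
  assumes bd: "\<And>h. m (vecfun A h) \<le> ennreal (C * (norm h)\<^sup>2)" and C: "C \<ge> 0"
  shows "\<exists>b\<in>positive_cone A. m = evaluation A b"
proof -
  define Q where "Q h = enn2real (m (vecfun A h))" for h
  have Qm: "m (vecfun A h) = ennreal (Q h)" for h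
  proof -
    have "m (vecfun A h) < top" using bd[of h] ennreal_less_top by (rule le_less_trans)
    then show ?thesis by (simp add: Q_def)
  qed
  have Q0: "Q h \<ge> 0" for h by (simp add: Q_def)
  have QC: "Q h \<le> C * (norm h)\<^sup>2" for h
    using bd[of h] C by (simp add: Qm ennreal_le_iff)
  have Ab: "A \<subseteq> bounded_ops" using vna_bo[OF A] by blast
  have vp: "vecfun A h \<in> predual_pos A" for h by (rule vecfun_predual_pos[OF A])
  \<comment> \<open>\<open>Q\<close> inherits every identity between sums of vector functionals on
    \<open>A\<close>. Such an identity may fail for operators outside \<open>A\<close>, which is
    what later puts \<open>b\<close> into \<open>A\<close>.\<close>
  have Q2: "Q a + Q b = Q c + Q d"
    if "\<And>x. x \<in> A \<Longrightarrow> cinner a (x a) + cinner b (x b) = cinner c (x c) + cinner d (x d)" for a b c d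
  proof -
    have "(\<lambda>x. vecfun A a x + vecfun A b x) = (\<lambda>x. vecfun A c x + vecfun A d x)"
      using that by (auto simp: vecfun_def)
    then have "m (vecfun A a) + m (vecfun A b) = m (vecfun A c) + m (vecfun A d)"
      using econe_add[OF vp vp, of a b] econe_add[OF vp vp, of c d] by simp
    then show ?thesis by (simp add: Qm Q0 flip: ennreal_plus)
  qed
  have Q3: "Q a + Q b + Q b' = Q c + Q d + Q d'"
    if "\<And>x. x \<in> A \<Longrightarrow> cinner a (x a) + cinner b (x b) + cinner b' (x b')
      = cinner c (x c) + cinner d (x d) + cinner d' (x d')" for a b c d b' d'
  proof -
    have "(\<lambda>x. vecfun A a x + vecfun A b x + vecfun A b' x) = (\<lambda>x. vecfun A c x + vecfun A d x + vecfun A d' x)"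
      using that by (auto simp: vecfun_def)
    then have "m (vecfun A a) + m (vecfun A b) + m (vecfun A b') = m (vecfun A c) + m (vecfun A d) + m (vecfun A d')"
      using econe_add[OF predual_pos_add[OF vp vp] vp, of a b b'] econe_add[OF vp vp, of c d]
        econe_add[OF predual_pos_add[OF vp vp] vp, of c d d'] econe_add[OF vp vp, of a b] by simp
    then show ?thesis by (simp add: Qm Q0 flip: ennreal_plus)
  qed
  have Qr: "Q (c *\<^sub>C a) = (cmod c)\<^sup>2 * Q a" for c a
  proof -
    have "vecfun A (c *\<^sub>C a) = (\<lambda>x. complex_of_real ((cmod c)\<^sup>2) * vecfun A a x)"
    proof
      fix x
      show "vecfun A (c *\<^sub>C a) x = complex_of_real ((cmod c)\<^sup>2) * vecfun A a x"
      proof (cases "x \<in> A")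
        case True
        then have "x \<in> bounded_ops" using Ab by blast
        moreover have "c * cnj c = complex_of_real ((cmod c)\<^sup>2)" by (simp only: complex_norm_square)
        ultimately show ?thesis using True
          by (simp add: vecfun_def bounded_opsD cinner_scaleC_left cinner_scaleC_right flip: mult.assoc)
      qed (simp add: vecfun_def)
    qed
    then have "m (vecfun A (c *\<^sub>C a)) = ennreal ((cmod c)\<^sup>2) * m (vecfun A a)"
      using econe_scale[OF _ vp, of "(cmod c)\<^sup>2" a] by simp
    then show ?thesis by (simp add: Qm Q0 flip: ennreal_mult)
  qed
  \<comment> \<open>Four times the real part of the sesquilinear form to be constructed.\<close>
  define D where "D v w = Q (v + w) - Q (v - w)" for v w
  have Dsym: "D v w = D w v" for v w
    using Qr[of "-1" "v - w"] by (simp add: D_def add.commute)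
  have Dadd: "D v (w + w') = D v w + D v w'" for v w w'
  proof -
    have "Q (v + (w + w')) + Q (v - w) + Q (v - w') = Q (v - (w + w')) + Q (v + w) + Q (v + w')"
      by (rule Q3) (simp add: blinfun.add_right blinfun.diff_right cinner.add_left cinner.add_right
          cinner.diff_left cinner.diff_right)
    then show ?thesis by (simp add: D_def)
  qed
  have Dminus: "D v (- w) = - D v w" for v w by (simp add: D_def)
  have Dscale0: "D v (r *\<^sub>R w) = r * D v w" if r: "r \<ge> 0" for r v w
  proof -
    \<comment> \<open>The square root absorbs the factor \<open>r\<close> into the vectors, so that
      homogeneity is again an instance of \<open>Q2\<close>.\<close>
    define s where "s = complex_of_real (sqrt r)"
    have s2: "s * cnj s = of_real r" "(cmod s)\<^sup>2 = r" using r by (auto simp: s_def simp flip: of_real_mult)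
    have "Q (v + r *\<^sub>R w) + Q (s *\<^sub>C (v - w)) = Q (v - r *\<^sub>R w) + Q (s *\<^sub>C (v + w))"
    proof (rule Q2)
      fix x assume "x \<in> A"
      then have bx: "x \<in> bounded_ops" using Ab by blast
      have ss: "cinner (s *\<^sub>C u) (x (s *\<^sub>C u)) = of_real r * cinner u (x u)" for u
        using s2(1) by (simp add: bounded_opsD[OF bx] cinner_scaleC_left cinner_scaleC_right flip: mult.assoc)
      show "cinner (v + r *\<^sub>R w) (x (v + r *\<^sub>R w)) + cinner (s *\<^sub>C (v - w)) (x (s *\<^sub>C (v - w)))
        = cinner (v - r *\<^sub>R w) (x (v - r *\<^sub>R w)) + cinner (s *\<^sub>C (v + w)) (x (s *\<^sub>C (v + w)))"
        unfolding ss by (simp add: blinfun.bilinear_simps cinner.add_left cinner.add_right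
            cinner.diff_left cinner.diff_right cinner_scaleR_left cinner_scaleR_right scaleR_conv_of_real algebra_simps)
    qed
    then show ?thesis unfolding Qr s2(2) by (simp add: D_def algebra_simps)
  qed
  have Dscale: "D v (r *\<^sub>R w) = r * D v w" for r v w
  proof (cases "r \<ge> 0")
    case False
    then have "D v ((- r) *\<^sub>R w) = (- r) * D v w" by (intro Dscale0) simp
    then show ?thesis using Dminus[of v "r *\<^sub>R w"] by simp
  qed (rule Dscale0)
  have Di: "D (\<i> *\<^sub>C v) (\<i> *\<^sub>C w) = D v w" for v w
    using Qr[of \<i> "v + w"] Qr[of \<i> "v - w"]
    by (simp add: D_def complex_vector.scale_right_distrib complex_vector.scale_right_diff_distrib)
  have Dbound: "\<bar>D v w\<bar> \<le> (4 * C) * norm v * norm w" for v w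
  proof (cases "v = 0 \<or> w = 0")
    case True
    then show ?thesis using Dscale[of v 0 w] Dscale[of w 0 v] Dsym[of v w] by auto
  next
    case False
    define v' where "v' = (1 / norm v) *\<^sub>R v"
    define w' where "w' = (1 / norm w) *\<^sub>R w"
    have n1: "norm v' = 1" "norm w' = 1" using False by (auto simp: v'_def w'_def)
    have le4: "Q u \<le> 4 * C" if "norm u \<le> 2" for u
    proof -
      have "(norm u)\<^sup>2 \<le> 2\<^sup>2" using that by (intro power_mono) auto
      then show ?thesis using QC[of u] mult_left_mono[of "(norm u)\<^sup>2" 4 C] C by simp
    qed
    have "Q (v' + w') \<le> 4 * C" "Q (v' - w') \<le> 4 * C"
      using norm_triangle_ineq[of v' w'] norm_triangle_ineq4[of v' w'] n1 by (auto intro!: le4)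
    then have "\<bar>D v' w'\<bar> \<le> 4 * C" using Q0[of "v' + w'"] Q0[of "v' - w'"] by (simp add: D_def)
    moreover have "D v w = norm v * norm w * D v' w'"
    proof -
      have "D v w = D (norm v *\<^sub>R v') (norm w *\<^sub>R w')" using False by (simp add: v'_def w'_def)
      then show ?thesis by (simp add: Dscale Dsym[of "norm v *\<^sub>R v'"] Dsym[of w'])
    qed
    ultimately show ?thesis
      using mult_left_mono[of "\<bar>D v' w'\<bar>" "4 * C" "norm v * norm w"] by (simp add: abs_mult mult_ac)
  qed
  define B where "B v w = (complex_of_real (D v w) - \<i> * complex_of_real (D v (\<i> *\<^sub>C w))) / 4" for v w
  have cs: "c *\<^sub>C w = Re c *\<^sub>R w + Im c *\<^sub>R (\<i> *\<^sub>C w)" for c and w :: 'h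
  proof -
    have "c *\<^sub>C w = (of_real (Re c) + of_real (Im c) * \<i>) *\<^sub>C w" by (simp add: complex_eq[of c, symmetric] mult.commute)
    then show ?thesis by (simp add: scaleC_add_left scaleR_scaleC scaleC_scaleC)
  qed
  have Dc: "D v (c *\<^sub>C w) = Re c * D v w + Im c * D v (\<i> *\<^sub>C w)" for c v w
    by (subst cs) (simp only: Dadd Dscale)
  have Dc': "D v (\<i> *\<^sub>C (c *\<^sub>C w)) = Re c * D v (\<i> *\<^sub>C w) - Im c * D v w" for c v w
    using Dc[of v "\<i> * c" w] by (simp add: scaleC_scaleC)
  have Dci: "D (\<i> *\<^sub>C v) w = - D v (\<i> *\<^sub>C w)" for v w
    using Di[of v "\<i> *\<^sub>C w"] Dminus[of "\<i> *\<^sub>C v" w] by (simp add: scaleC_scaleC)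
  have Dcl: "D (c *\<^sub>C v) w = Re c * D v w - Im c * D v (\<i> *\<^sub>C w)" for c v w
    using Dc[of w c v] Dci[of v w] by (simp add: Dsym[of w])
  have "\<exists>b\<in>bounded_ops. \<forall>x y. B x y = cinner x (blinfun_apply b y)"
  proof (rule op_from_form[where K = "2 * C"])
    show "B x (y + z) = B x y + B x z" for x y z
      by (simp add: B_def Dadd complex_vector.scale_right_distrib field_simps)
    show "B (x + y) z = B x z + B y z" for x y z
    proof -
      have "D (x + y) u = D x u + D y u" for u
        using Dadd[of u x y] by (simp add: Dsym[of u])
      then show ?thesis by (simp add: B_def field_simps)
    qed
    show "B x (c *\<^sub>C y) = c * B x y" for c x y
      unfolding B_def Dc[of x c y] Dc' by (simp add: complex_eq_iff algebra_simps)
    show "B (c *\<^sub>C x) y = cnj c * B x y" for c x y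
      unfolding B_def Dcl by (simp add: complex_eq_iff scaleC_scaleC Dminus algebra_simps)
    show "cmod (B x y) \<le> 2 * C * norm x * norm y" for x y
    proof -
      have "cmod (complex_of_real (D x y) - \<i> * complex_of_real (D x (\<i> *\<^sub>C y))) \<le> \<bar>D x y\<bar> + \<bar>D x (\<i> *\<^sub>C y)\<bar>"
        by (rule order_trans[OF norm_triangle_ineq4]) (simp add: norm_mult)
      also have "\<dots> \<le> 4 * C * norm x * norm y + 4 * C * norm x * norm (\<i> *\<^sub>C y)" by (intro add_mono Dbound)
      finally show ?thesis by (simp add: B_def norm_divide norm_scaleC)
    qed
    show "0 \<le> 2 * C" using C by simp
  qed
  then obtain b where b: "b \<in> bounded_ops" "\<And>x y. B x y = cinner x (b y)" by blast
  have bQ: "cinner h (b h) = of_real (Q h)" for h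
  proof -
    have "Q (h + \<i> *\<^sub>C h) = Q (h - \<i> *\<^sub>C h)"
      using Qr[of "1 + \<i>" h] Qr[of "1 - \<i>" h] by (simp add: scaleC_add_left complex_vector.scale_left_diff_distrib scaleC_one cmod_def)
    then have "D h (\<i> *\<^sub>C h) = 0" by (simp add: D_def)
    moreover have "D h h = 4 * Q h"
      using Qr[of 2 h] Qr[of 0 h] scaleC_add_left[of 1 1 h] by (simp add: D_def scaleC_one)
    ultimately show ?thesis using b(2)[of h h] by (simp add: B_def)
  qed
  have posb: "pos b"
    by (intro posI sa_if_form_real b) (simp_all add: bQ Q0)
  have bA: "b \<in> A"
  proof (rule vna_memI[OF A b(1)], rule cinner_eqI)
    fix c w v assume c: "c \<in> commutant A"
    have bc: "c \<in> bounded_ops" using c by (rule commutant_bo)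
    \<comment> \<open>As \<open>c\<close> commutes with \<open>A\<close>, the four vectors below
      satisfy an identity of functionals on \<open>A\<close>. So \<open>c\<close> moves across the
      form as its adjoint, and hence commutes with \<open>b\<close>.\<close>
    have Dcomm: "D v (c w) = D (adj c v) w" for v w
    proof -
      have "Q (v + c w) + Q (adj c v - w) = Q (v - c w) + Q (adj c v + w)"
      proof (rule Q2)
        fix x assume x: "x \<in> A"
        have 1: "cinner v (x (c w)) = cinner (adj c v) (x w)" for v w
          by (simp add: cinner_adj_left bc commutantD[OF c x])
        have "adj c \<in> commutant A" by (rule vna_adj[OF vna_commutant[OF A] c])
        then have 2: "cinner (c w) (x v) = cinner w (x (adj c v))" for v w
          using commutantD[of "adj c" A x v] x by (simp flip: cinner_adj_right[OF bc])
        show "cinner (v + c w) (x (v + c w)) + cinner (adj c v - w) (x (adj c v - w))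
          = cinner (v - c w) (x (v - c w)) + cinner (adj c v + w) (x (adj c v + w))"
          by (simp add: blinfun.add_right blinfun.diff_right cinner.add_left cinner.add_right
              cinner.diff_left cinner.diff_right 1 2)
      qed
      then show ?thesis by (simp add: D_def)
    qed
    have "B v (c w) = B (adj c v) w"
      using Dcomm[of v w] Dcomm[of v "\<i> *\<^sub>C w"] by (simp add: B_def bounded_opsD[OF bc])
    then show "cinner v (c (b w)) = cinner v (b (c w))" by (simp add: b(2) cinner_adj_left bc)
  qed
  have mv: "m (vsum A \<xi>) = ennreal (Re (vsum A \<xi> b))" "0 \<le> Re (vsum A \<xi> b)" if \<xi>: "square_summable \<xi>" for \<xi>
  proof -
    have s: "summable (\<lambda>n. Q (\<xi> n))"
      using summable_Re[OF square_summable_bound(1)[OF \<xi> \<xi>, of b]] by (simp add: bQ)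
    have "m (vsum A \<xi>) = (\<Sum>n. ennreal (Q (\<xi> n)))" by (simp add: econe_vsum[OF \<xi>] Qm)
    also have "\<dots> = ennreal (\<Sum>n. Q (\<xi> n))" by (rule suminf_ennreal2[OF Q0 s])
    finally have 1: "m (vsum A \<xi>) = ennreal (\<Sum>n. Q (\<xi> n))" .
    have "vsum A \<xi> b = of_real (\<Sum>n. Q (\<xi> n))"
      by (simp add: vsum_def bA vector_functional_def bQ suminf_of_real[OF s])
    then show "m (vsum A \<xi>) = ennreal (Re (vsum A \<xi> b))" "0 \<le> Re (vsum A \<xi> b)"
      using 1 suminf_nonneg[OF s Q0] by auto
  qed
  have "m \<phi> = evaluation A b \<phi>" for \<phi>
  proof (cases "\<phi> \<in> predual_pos A")
    case True
    then obtain F :: "((nat \<Rightarrow> 'h) \<times> (nat \<Rightarrow> 'h)) set" and \<xi> \<eta> where F: "finite F"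
      "\<And>i. i \<in> F \<Longrightarrow> square_summable (\<xi> i)" "\<And>i. i \<in> F \<Longrightarrow> square_summable (\<eta> i)"
      "\<And>x. 4 * \<phi> x + (\<Sum>i\<in>F. vsum A (\<eta> i) x) = (\<Sum>i\<in>F. vsum A (\<xi> i) x)"
      using predual_pos_decomp[OF A True] by metis
    have "m (\<lambda>x. complex_of_real 4 * \<phi> x + (\<Sum>i\<in>F. vsum A (\<eta> i) x)) =
        ennreal 4 * m \<phi> + (\<Sum>i\<in>F. m (vsum A (\<eta> i)))"
      using econe_add[OF predual_pos_scale[OF True, of 4] predual_pos_sum[of F "\<lambda>i. vsum A (\<eta> i)"]]
        econe_scale[OF _ True, of 4] econe_sum[of F "\<lambda>i. vsum A (\<eta> i)"] vsum_predual_pos[OF A F(3)] by simp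
    moreover have "(\<lambda>x. complex_of_real 4 * \<phi> x + (\<Sum>i\<in>F. vsum A (\<eta> i) x)) = (\<lambda>x. \<Sum>i\<in>F. vsum A (\<xi> i) x)"
      using F(4) by (intro ext) simp
    moreover have "m (\<lambda>x. \<Sum>i\<in>F. vsum A (\<xi> i) x) = (\<Sum>i\<in>F. m (vsum A (\<xi> i)))"
      by (rule econe_sum) (rule vsum_predual_pos[OF A F(2)])
    ultimately have eq: "ennreal 4 * m \<phi> + (\<Sum>i\<in>F. m (vsum A (\<eta> i))) = (\<Sum>i\<in>F. m (vsum A (\<xi> i)))" by simp
    \<comment> \<open>Finiteness of this sum is what allows the cancellation below.\<close>
    have se: "(\<Sum>i\<in>F. m (vsum A (\<eta> i))) = ennreal (\<Sum>i\<in>F. Re (vsum A (\<eta> i) b))"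
      using mv F(3) by (simp add: sum_ennreal)
    have sx: "(\<Sum>i\<in>F. m (vsum A (\<xi> i))) = ennreal (\<Sum>i\<in>F. Re (vsum A (\<xi> i) b))"
      using mv F(2) by (simp add: sum_ennreal)
    have p: "0 \<le> Re (\<phi> b)"
      using True bA posb b(1) op_le_zero_pos[of b]
      by (auto simp: predual_pos_def positive_cone_def complex_nonneg_Reals_iff)
    have "4 * Re (\<phi> b) + (\<Sum>i\<in>F. Re (vsum A (\<eta> i) b)) = (\<Sum>i\<in>F. Re (vsum A (\<xi> i) b))"
      using arg_cong[OF F(4)[of b], of Re] by simp
    moreover have s0: "0 \<le> (\<Sum>i\<in>F. Re (vsum A (\<eta> i) b))" using mv(2) F(3) by (intro sum_nonneg) auto
    ultimately have "(\<Sum>i\<in>F. m (vsum A (\<xi> i))) = ennreal (4 * Re (\<phi> b) + (\<Sum>i\<in>F. Re (vsum A (\<eta> i) b)))"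
      by (simp add: sx)
    then have "(\<Sum>i\<in>F. m (vsum A (\<xi> i))) = ennreal 4 * ennreal (Re (\<phi> b)) + (\<Sum>i\<in>F. m (vsum A (\<eta> i)))"
      unfolding se by (subst (asm) ennreal_plus) (use p s0 in \<open>auto simp: ennreal_mult simp del: ennreal_plus\<close>)
    then have "ennreal 4 * m \<phi> = ennreal 4 * ennreal (Re (\<phi> b))"
      using eq se by (metis ennreal_add_left_cancel ennreal_neq_top add.commute infinity_ennreal_def)
    then have "m \<phi> = ennreal (Re (\<phi> b))"
      by (simp add: ennreal_mult_cancel_left)
    then show ?thesis using True by (simp add: evaluation_def)
  qed (simp add: evaluation_def econe_outside)
  then have "m = evaluation A b" by (rule ext)
  moreover have "b \<in> positive_cone A" using bA posb op_le_zero_pos[OF b(1)] by (simp add: positive_cone_def)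
  ultimately show ?thesis by blast
qed

end

section \<open>The operator monotone function \<open>t / (1 + t)\<close>\<close>

definition resolv :: "('h::chilbert_space \<Rightarrow>\<^sub>L 'h) \<Rightarrow> 'h \<Rightarrow>\<^sub>L 'h" where
  "resolv T = (SOME g. pos g \<and> (\<forall>v. g v + T (g v) = v) \<and> (\<forall>v. g (v + T v) = v) \<and> dcomm T g)"

lemma resolv:
  assumes "pos T"
  shows "pos (resolv T)" "resolv T v + blinfun_apply T (resolv T v) = v"
    "resolv T (v + blinfun_apply T v) = v" "dcomm T (resolv T)"
  using someI_ex[OF inv_exists[OF assms]] unfolding resolv_def by auto

text \<open>This is \<open>T (1 + T)^-1\<close>. It compresses increasing sequences without a common
  bound below the identity; \<open>rf_lower\<close> recovers an operator of controlled norm from its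
  compression.\<close>

definition rf :: "('h::chilbert_space \<Rightarrow>\<^sub>L 'h) \<Rightarrow> 'h \<Rightarrow>\<^sub>L 'h" where
  "rf T = id_blinfun - resolv T"

lemma rf_apply: "pos T \<Longrightarrow> blinfun_apply (rf T) v = blinfun_apply T (resolv T v)"
  using resolv(2)[of T v] by (simp add: rf_def blinfun.diff_left diff_eq_eq add.commute)

lemma rf_form:
  assumes T: "pos T"
  shows "Re (cinner v (rf T v)) = Re (cinner (resolv T v) (T (resolv T v))) + (norm (T (resolv T v)))\<^sup>2"
proof -
  have "cinner v (rf T v) = cinner (resolv T v + T (resolv T v)) (T (resolv T v))"
    by (simp add: rf_apply[OF T] resolv(2)[OF T])
  then show ?thesis by (simp add: cinner.add_left norm_sq_cinner)
qed

lemma rf_sa: "pos T \<Longrightarrow> sa (rf T)"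
  unfolding rf_def by (intro sa_diff sa_id pos_sa resolv)

lemma rf_pos: "pos T \<Longrightarrow> pos (rf T)"
  by (rule posI[OF rf_sa]) (simp_all add: rf_form posD)

lemma rf_le_id: "pos T \<Longrightarrow> pos (id_blinfun - rf T)"
  by (simp add: rf_def resolv)

lemma rf_le: assumes T: "pos T" shows "pos (T - rf T)"
proof (rule posI)
  show "sa (T - rf T)" by (intro sa_diff pos_sa T rf_pos)
  fix v
  let ?w = "resolv T v"
  have "(T - rf T) v = T (T ?w)"
    by (simp add: blinfun.diff_left rf_apply[OF T] flip: blinfun.diff_right)
      (metis T add_diff_cancel_left' resolv(2))
  then have "cinner v ((T - rf T) v) = cinner (?w + T ?w) (T (T ?w))" by (simp add: resolv(2)[OF T])
  also have "\<dots> = cinner (T ?w) (T ?w) + cinner (T ?w) (T (T ?w))"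
    by (simp add: cinner.add_left saD[OF pos_sa[OF T]])
  finally show "0 \<le> Re (cinner v ((T - rf T) v))" using posD[OF T] by (simp flip: norm_sq_cinner)
qed

text \<open>Inversion reverses the order, by Cauchy-Schwarz for \<open>P = 1 + T\<close>: with
  \<open>a\<close> and \<open>b\<close> the forms of the resolvents of \<open>T\<close> and
  \<open>S\<close> at \<open>v\<close>, one gets b^2 \<le> b a.\<close>

lemma rf_mono:
  assumes T: "pos T" and ST: "pos (S - T)"
  shows "pos (rf S - rf T)"
proof -
  have "S = T + (S - T)" by simp
  then have S: "pos S" using pos_add[OF T ST] by simp
  have sa: "sa (rf S - rf T)" by (intro sa_diff rf_sa S T)
  show ?thesis
  proof (rule posI[OF sa])
    fix v
    define u w where "u = resolv T v" and "w = resolv S v"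
    have u: "u + T u = v" and w: "w + S w = v" by (auto simp: u_def w_def resolv(2)[OF T] resolv(2)[OF S])
    define P where "P = id_blinfun + T"
    have P: "pos P" unfolding P_def by (intro pos_add pos_id T)
    have Pu: "P u = v" using u by (simp add: P_def blinfun.add_left)
    define a b where "a = Re (cinner v u)" and "b = Re (cinner v w)"
    have a: "a = Re (cinner u (P u))" by (simp add: a_def Pu Re_cinner_commute)
    have "b = Re (cinner w (w + S w))" by (simp add: b_def w Re_cinner_commute)
    also have "\<dots> = Re (cinner w (P w)) + Re (cinner w ((S - T) w))"
      by (simp add: P_def blinfun.bilinear_simps cinner.add_right cinner.diff_right)
    finally have b: "Re (cinner w (P w)) \<le> b" using posD[OF ST] by simp
    have a0: "0 \<le> a" unfolding a by (rule posD[OF P])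
    have b0: "0 \<le> b" using b posD[OF P, of w] by linarith
    have "\<bar>b\<bar> \<le> cmod (cinner w (P u))"
      unfolding b_def Pu using abs_Re_le_cmod[of "cinner w v"] by (simp add: Re_cinner_commute)
    then have "b\<^sup>2 \<le> (cmod (cinner w (P u)))\<^sup>2" using b0 by (intro power_mono) auto
    also have "\<dots> \<le> Re (cinner w (P w)) * a" unfolding a by (rule pos_CS[OF P])
    also have "\<dots> \<le> b * a" by (rule mult_right_mono[OF b a0])
    finally have "b \<le> a" using b0 a0 by (cases "b = 0") (auto simp: power2_eq_square)
    then show "0 \<le> Re (cinner v ((rf S - rf T) v))"
      by (simp add: rf_def blinfun.bilinear_simps cinner.diff_right a_def b_def u_def w_def)
  qed
qed

text \<open>The scalar inequality t \<le> (1 + r) t/(1 + t) on [0, r], checked on vectors written as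
  \<open>v = w + T w\<close>.\<close>

lemma rf_lower:
  assumes T: "pos T" and r: "norm T \<le> r"
  shows "Re (cinner v (T v)) \<le> (1 + r) * Re (cinner v (rf T v))"
proof -
  define w where "w = resolv T v"
  have v: "w + T w = v" by (simp add: w_def resolv(2)[OF T])
  have c: "cinner (T x) y = cinner x (T y)" for x y by (rule saD[OF pos_sa[OF T]])
  have "cinner v (T v) = cinner w (T w) + 2 * cinner (T w) (T w) + cinner (T w) (T (T w))"
    unfolding v[symmetric] by (simp add: blinfun.add_right cinner.add_left cinner.add_right c)
  then have e: "Re (cinner v (T v)) = Re (cinner w (T w)) + 2 * (norm (T w))\<^sup>2 + Re (cinner (T w) (T (T w)))"
    by (simp add: norm_sq_cinner)
  have "Re (cinner (T w) (T (T w))) \<le> norm T * (norm (T w))\<^sup>2" by (rule Re_cinner_le)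
  also have "\<dots> \<le> r * (norm (T w))\<^sup>2" by (intro mult_right_mono r) simp
  finally have 1: "Re (cinner (T w) (T (T w))) \<le> r * (norm (T w))\<^sup>2" .
  have "(norm (T w))\<^sup>2 \<le> norm T * Re (cinner w (T w))" by (rule pos_norm_sq_le[OF T])
  also have "\<dots> \<le> r * Re (cinner w (T w))" by (intro mult_right_mono r posD[OF T])
  finally have 2: "(norm (T w))\<^sup>2 \<le> r * Re (cinner w (T w))" .
  have "Re (cinner v (rf T v)) = Re (cinner w (T w)) + (norm (T w))\<^sup>2"
    by (simp add: rf_form[OF T] w_def)
  then show ?thesis using e 1 2 by (simp add: algebra_simps)
qed

lemma rf_dcomm: "pos T \<Longrightarrow> dcomm T (rf T)"
  unfolding rf_def by (intro dcomm_diff dcomm_id resolv)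

lemma rf_kernel: "pos T \<Longrightarrow> blinfun_apply T v = 0 \<Longrightarrow> blinfun_apply (rf T) v = 0"
  using resolv(3)[of T v] by (simp add: rf_def blinfun.diff_left)

section \<open>Operator valued weights as families of quadratic forms\<close>

locale weight =
  fixes M A :: "('h::chilbert_space \<Rightarrow>\<^sub>L 'h) set" and E :: "('h \<Rightarrow>\<^sub>L 'h) \<Rightarrow> 'h ext_pos"
  assumes M: "von_neumann_algebra M" and A: "von_neumann_algebra A" and AM: "A \<subseteq> M"
    and ovw: "operator_valued_weight M A E" and faithful: "weight_faithful M E"
    and normal: "weight_normal M A E"
begin

definition e :: "('h \<Rightarrow>\<^sub>L 'h) \<Rightarrow> 'h \<Rightarrow> ennreal" where
  "e x h = E x (vecfun A h)"

lemma Mbo: "x \<in> M \<Longrightarrow> x \<in> bounded_ops" by (rule vna_bo[OF M])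
lemma Abo: "x \<in> A \<Longrightarrow> x \<in> bounded_ops" by (rule vna_bo[OF A])
lemma AMD: "x \<in> A \<Longrightarrow> x \<in> M" using AM by blast

lemma cone_iff: "x \<in> positive_cone M \<longleftrightarrow> x \<in> M \<and> pos x"
  using op_le_zero_pos[of x] Mbo by (auto simp: positive_cone_def)

lemma E_cone: "x \<in> M \<Longrightarrow> pos x \<Longrightarrow> E x \<in> extended_positive_cone A"
  using ovw cone_iff unfolding operator_valued_weight_def by blast

lemma e_add: "x \<in> M \<Longrightarrow> pos x \<Longrightarrow> y \<in> M \<Longrightarrow> pos y \<Longrightarrow> e (x + y) h = e x h + e y h"
  using ovw unfolding operator_valued_weight_def by (simp add: e_def cone_iff)

lemma e_scale: "0 \<le> r \<Longrightarrow> x \<in> M \<Longrightarrow> pos x \<Longrightarrow> e (r *\<^sub>R x) h = ennreal r * e x h"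
  using ovw unfolding operator_valued_weight_def by (simp add: e_def cone_iff)

lemma e_mono: "x \<in> M \<Longrightarrow> pos x \<Longrightarrow> y \<in> M \<Longrightarrow> pos (y - x) \<Longrightarrow> e x h \<le> e y h"
  using e_add[of x "y - x" h] vna_diff[OF M, of y x] by simp

lemma e_zero: "e 0 h = 0"
  using e_scale[of 0 0 h] vna_zero[OF M] pos_zero by simp

lemma e_sum: "(\<And>i. i \<in> F \<Longrightarrow> f i \<in> M \<and> pos (f i)) \<Longrightarrow> e (sum f F) h = (\<Sum>i\<in>F. e (f i) h)"
proof (induction F rule: infinite_finite_induct)
  case (insert i F)
  then have "e (f i + sum f F) h = e (f i) h + e (sum f F) h"
    by (intro e_add vna_sum[OF M] pos_sum) auto
  then show ?case using insert by simp
qed (auto simp: e_zero)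

lemma e_conj:
  assumes x: "x \<in> M" "pos x" and a: "a \<in> A"
  shows "e (adj a o\<^sub>L x o\<^sub>L a) h = e x (a h)"
proof -
  have ba: "a \<in> bounded_ops" using Abo[OF a] .
  have "E (adj a o\<^sub>L x o\<^sub>L a) = ext_conj A a (E x)"
    using ovw x a cone_iff unfolding operator_valued_weight_def by blast
  moreover have "(\<lambda>y. if y \<in> A then vecfun A h (adj a o\<^sub>L y o\<^sub>L a) else 0) = vecfun A (a h)"
    using vna_comp[OF A vna_comp[OF A vna_adj[OF A a]] a]
    by (auto simp: vecfun_def fun_eq_iff cinner_adj_right ba)
  ultimately show ?thesis by (simp add: e_def ext_conj_def vecfun_predual_pos[OF A])
qed

lemma e_vec_limit:
  "x \<in> M \<Longrightarrow> pos x \<Longrightarrow> h \<longlonglongrightarrow> g \<Longrightarrow> (\<And>n. e x (h n) \<le> C) \<Longrightarrow> e x g \<le> C"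
  unfolding e_def by (rule econe_vec_limit[OF A E_cone])

text \<open>Let \<open>r\<close> be the square root of |c|^2 minus \<open>adj c o\<^sub>L c\<close>,
  which is also in the commutant. On \<open>A\<close>, |c|^2 times the vector state of
  \<open>h\<close> is the sum of those of \<open>c h\<close> and \<open>r h\<close>; additivity of
  \<open>E x\<close> finishes.\<close>

lemma e_commutant:
  assumes x: "x \<in> M" "pos x" and c: "c \<in> commutant A"
  shows "e x (c h) \<le> ennreal ((norm c)\<^sup>2) * e x h"
proof -
  note C = vna_commutant[OF A]
  have bc: "c \<in> bounded_ops" using c by (rule commutant_bo)
  define d where "d = (norm c)\<^sup>2 *\<^sub>R id_blinfun - (adj c o\<^sub>L c)"
  have dC: "d \<in> commutant A"
    unfolding d_def by (intro vna_diff[OF C] vna_scaleR[OF C] vna_id[OF C] vna_comp[OF C] vna_adj[OF C] c)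
  have pd: "pos d"
  proof (rule posI)
    show "sa d" unfolding d_def by (intro sa_diff sa_scaleR sa_id pos_sa pos_adj_comp bc)
    fix v
    have "(norm (c v))\<^sup>2 \<le> (norm c * norm v)\<^sup>2" by (intro power_mono norm_blinfun) simp
    then show "0 \<le> Re (cinner v (d v))"
      by (simp add: d_def blinfun.bilinear_simps cinner.diff_right cinner_scaleR_right cinner_adj_right bc
          power_mult_distrib flip: norm_sq_cinner)
  qed
  obtain r where r: "pos r" "\<And>v. r (r v) = d v" "dcomm d r" using sqrt_exists[OF pd] by blast
  have rC: "r \<in> commutant A" by (rule vna_dcomm[OF C dC r(3)])
  have sar: "sa r" using r(1) by (rule pos_sa)
  have "(\<lambda>a. complex_of_real ((norm c)\<^sup>2) * vecfun A h a) = (\<lambda>a. vecfun A (c h) a + vecfun A (r h) a)"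
  proof
    fix a
    show "complex_of_real ((norm c)\<^sup>2) * vecfun A h a = vecfun A (c h) a + vecfun A (r h) a"
    proof (cases "a \<in> A")
      case True
      have 1: "cinner (c h) (a (c h)) = cinner h (adj c (c (a h)))"
        by (simp add: cinner_adj_right bc commutantD[OF c True])
      have "cinner (r h) (a (r h)) = cinner h (r (r (a h)))"
        by (simp add: saD[OF sar] commutantD[OF rC True])
      also have "r (r (a h)) = (norm c)\<^sup>2 *\<^sub>R a h - adj c (c (a h))"
        unfolding r(2) by (simp add: d_def blinfun.bilinear_simps)
      finally show ?thesis using True
        by (simp add: vecfun_def 1 cinner.diff_right cinner_scaleR_right)
    qed (simp add: vecfun_def)
  qed
  then have "ennreal ((norm c)\<^sup>2) * e x h = e x (c h) + e x (r h)"
    using econe_scale[OF A E_cone[OF x], of "(norm c)\<^sup>2" "vecfun A h"]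
      econe_add[OF A E_cone[OF x], of "vecfun A (c h)" "vecfun A (r h)"] vecfun_predual_pos[OF A]
    by (simp add: e_def)
  then show ?thesis by simp
qed

lemma e_eq_zero:
  assumes x: "x \<in> M" "pos x" and z: "\<And>h. e x h = 0" shows "x = 0"
proof -
  have "E x = (\<lambda>\<phi>. 0)"
    by (rule econe_eq_zero[OF A E_cone[OF x]]) (use z in \<open>simp add: e_def\<close>)
  then show ?thesis using faithful x cone_iff unfolding weight_faithful_def by blast
qed

text \<open>\<open>e_commutant\<close> spreads the zero from \<open>h\<close> to the vectors
  \<open>c h\<close>, semicontinuity spreads it to the range of \<open>p\<close>, and
  \<open>x\<close> lives there. Faithfulness then gives \<open>x = 0\<close>.\<close>

lemma e_supp_zero:
  assumes x: "x \<in> M" "pos x" and p: "is_supp A p h" and xp: "\<And>v. x (p v) = x v" and z: "e x h = 0"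
  shows "x = 0"
proof (rule e_eq_zero[OF x])
  fix g
  have pA: "p \<in> A" and pp: "proj p" using is_suppD[OF p] by auto
  have "\<exists>c\<in>commutant A. norm (p g - blinfun_apply c h) < 1 / real (Suc n)" for n
    by (rule is_suppD(4)[OF p]) simp
  then obtain c where c: "\<And>n. c n \<in> commutant A" "\<And>n. norm (p g - blinfun_apply (c n) h) < 1 / real (Suc n)" by metis
  have "(\<lambda>n. c n h) \<longlonglongrightarrow> p g"
    unfolding LIMSEQ_iff
  proof (intro allI impI)
    fix r :: real assume "r > 0"
    then obtain N where N: "1 / real (Suc N) < r" using nat_approx_posE by blast
    have "norm (c n h - p g) < r" if "n \<ge> N" for n
    proof -
      have "1 / real (Suc n) \<le> 1 / real (Suc N)" using that by (simp add: frac_le)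
      then show ?thesis using c(2)[of n] N by (simp add: norm_minus_commute)
    qed
    then show "\<exists>no. \<forall>n\<ge>no. norm (c n h - p g) < r" by blast
  qed
  moreover have "e x (c n h) \<le> 0" for n
    using e_commutant[OF x c(1)[of n], of h] z by simp
  ultimately have "e x (p g) \<le> 0" by (rule e_vec_limit[OF x])
  moreover have "adj p o\<^sub>L x o\<^sub>L p = x"
  proof (rule blinfun_eqI, rule cinner_eqI)
    fix v w
    have "cinner w ((adj p o\<^sub>L x o\<^sub>L p) v) = cinner (p w) (x v)"
      by (simp add: cinner_adj_right Abo[OF pA] xp)
    also have "\<dots> = cinner (x (p w)) v" by (simp add: saD[OF pos_sa[OF x(2)]])
    finally show "cinner w ((adj p o\<^sub>L x o\<^sub>L p) v) = cinner w (x v)"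
      by (simp add: xp saD[OF pos_sa[OF x(2)]])
  qed
  ultimately show "e x g = 0" using e_conj[OF x pA, of g] by simp
qed

text \<open>Normality in the form in which it is used: the supremum in the operator order is
  recognised by approximation of quadratic forms, one vector at a time.\<close>

lemma e_sup:
  assumes D: "D \<subseteq> {y \<in> M. pos y}" "D \<noteq> {}" "\<And>y z. y \<in> D \<Longrightarrow> z \<in> D \<Longrightarrow> \<exists>w\<in>D. pos (w - y) \<and> pos (w - z)"
    and x: "x \<in> M" "\<And>y. y \<in> D \<Longrightarrow> pos (x - y)"
    and least: "\<And>v \<epsilon>. \<epsilon> > 0 \<Longrightarrow> \<exists>y\<in>D. Re (cinner v (x v)) < Re (cinner v (blinfun_apply y v)) + \<epsilon>"
  shows "e x h = (SUP y\<in>D. e y h)"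
proof -
  have bD: "y \<in> bounded_ops" if "y \<in> D" for y using D(1) Mbo that by blast
  have px: "pos x"
  proof -
    obtain y where y: "y \<in> D" using D(2) by blast
    then have "pos (y + (x - y))" using D(1) x(2) by (intro pos_add) auto
    then show ?thesis by simp
  qed
  have "is_sup_in (positive_cone M) D x"
    unfolding is_sup_in_def
  proof (intro conjI ballI impI)
    show "x \<in> positive_cone M" using cone_iff x px by simp
    show "op_le y x" if "y \<in> D" for y using op_le_pos[OF bD[OF that] Mbo[OF x(1)]] x(2)[OF that] by simp
    fix z assume z: "z \<in> positive_cone M" "\<forall>y\<in>D. op_le y z"
    have zM: "z \<in> M" "pos z" using z(1) cone_iff by auto
    have "pos (z - x)"
    proof (rule posI)
      show "sa (z - x)" by (intro sa_diff pos_sa zM px)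
      fix v
      have "Re (cinner v (x v)) \<le> Re (cinner v (z v)) + \<epsilon>" if e0: "\<epsilon> > 0" for \<epsilon>
      proof -
        obtain y where y: "y \<in> D" "Re (cinner v (x v)) < Re (cinner v (y v)) + \<epsilon>" using least[OF e0] by blast
        have "pos (z - y)" using op_le_pos[OF bD[OF y(1)] Mbo[OF zM(1)]] z(2) y(1) by simp
        from posD[OF this, of v] y(2) show ?thesis by (simp add: blinfun.diff_left cinner.diff_right)
      qed
      then have "Re (cinner v (x v)) \<le> Re (cinner v (z v))" by (rule field_le_epsilon)
      then show "0 \<le> Re (cinner v ((z - x) v))" by (simp add: blinfun.diff_left cinner.diff_right)
    qed
    then show "op_le x z" using op_le_pos[OF Mbo[OF x(1)] Mbo[OF zM(1)]] by simp
  qed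
  moreover have "D \<subseteq> positive_cone M" using D(1) cone_iff by blast
  moreover have "\<forall>y\<in>D. \<forall>z\<in>D. \<exists>w\<in>D. op_le y w \<and> op_le z w"
    using D(3) op_le_pos bD by metis
  ultimately show ?thesis
    using normal D(2) vecfun_predual_pos[OF A, of h] unfolding weight_normal_def e_def by blast
qed

lemma e_seq_sup:
  assumes T: "\<And>n. T n \<in> M" "\<And>n. pos (T n)" "\<And>n. pos (T (Suc n) - T n)"
    and L: "L \<in> M" "\<And>n. pos (L - T n)" "\<And>v. (\<lambda>n. blinfun_apply (T n) v) \<longlonglongrightarrow> blinfun_apply L v"
  shows "e L h = (SUP n. e (T n) h)"
proof -
  have mono: "pos (T m - T n)" if "n \<le> m" for n m
    using that
  proof (induction m rule: dec_induct)
    case (step m)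
    have "T (Suc m) - T n = (T (Suc m) - T m) + (T m - T n)" by simp
    then show ?case using pos_add[OF T(3)[of m] step.IH] by simp
  qed (simp add: pos_zero)
  have "e L h = (SUP y\<in>range T. e y h)"
  proof (rule e_sup)
    show "\<exists>w\<in>range T. pos (w - y) \<and> pos (w - z)" if yz: "y \<in> range T" "z \<in> range T" for y z
    proof -
      obtain i j where "y = T i" "z = T j" using yz by blast
      then show ?thesis using mono[of i "max i j"] mono[of j "max i j"] by (intro bexI[of _ "T (max i j)"]) auto
    qed
    fix v and \<epsilon> :: real assume "\<epsilon> > 0"
    moreover have "(\<lambda>n. Re (cinner v (T n v))) \<longlonglongrightarrow> Re (cinner v (L v))"
      by (intro tendsto_intros cinner.tendsto L)
    ultimately obtain n where "norm (Re (cinner v (T n v)) - Re (cinner v (L v))) < \<epsilon>"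
      using LIMSEQ_D by blast
    then show "\<exists>y\<in>range T. Re (cinner v (L v)) < Re (cinner v (blinfun_apply y v)) + \<epsilon>"
      by (intro bexI[of _ "T n"]) auto
  qed (use T L in auto)
  then show ?thesis by (simp add: image_image)
qed

lemma finite_if_bounded:
  assumes x: "x \<in> M" "pos x" and bd: "\<And>h. e x h \<le> ennreal (C * (norm h)\<^sup>2)" and C: "0 \<le> C"
  shows "weight_finite_at A E x" and "\<exists>d\<in>A. pos d \<and> (\<forall>h. e x h = ennreal (Re (cinner h (d h))))"
proof -
  obtain b where b: "b \<in> positive_cone A" "E x = evaluation A b"
    using econe_bounded_op[OF A E_cone[OF x], of C] bd C by (auto simp: e_def)
  then show "weight_finite_at A E x" by (auto simp: weight_finite_at_def)
  have "b \<in> A" "pos b" using b(1) op_le_zero_pos[of b] Abo by (auto simp: positive_cone_def)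
  then show "\<exists>d\<in>A. pos d \<and> (\<forall>h. e x h = ennreal (Re (cinner h (d h))))"
    using b(2) vecfun_predual_pos[OF A] by (intro bexI[of _ b]) (auto simp: e_def evaluation_def vecfun_def)
qed

lemma bounded_if_finite:
  assumes "weight_finite_at A E x"
  shows "\<exists>C\<ge>0. \<forall>h. e x h \<le> ennreal (C * (norm h)\<^sup>2)"
proof -
  obtain b where b: "b \<in> positive_cone A" "E x = evaluation A b"
    using assms by (auto simp: weight_finite_at_def)
  then have "b \<in> A" by (simp add: positive_cone_def)
  then have "e x h = ennreal (Re (cinner h (b h)))" for h
    using b(2) vecfun_predual_pos[OF A] by (simp add: e_def evaluation_def vecfun_def)
  then show ?thesis by (intro exI[of _ "norm b"]) (auto intro: ennreal_leI Re_cinner_le)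
qed

section \<open>The \<open>L\<^sup>2\<close>-seminorms and completeness\<close>

text \<open>The square of the seminorm defined on \<open>M\<close> by the weight that composes
  \<open>E\<close> with the vector state of \<open>h\<close>.\<close>

definition e2 :: "('h \<Rightarrow>\<^sub>L 'h) \<Rightarrow> 'h \<Rightarrow> ennreal" where
  "e2 z h = e (adj z o\<^sub>L z) h"

lemma sq_M: "z \<in> M \<Longrightarrow> adj z o\<^sub>L z \<in> M" "z \<in> M \<Longrightarrow> pos (adj z o\<^sub>L z)"
  by (auto intro: vna_comp[OF M] vna_adj[OF M] pos_adj_comp Mbo)

lemma sq_form: "z \<in> bounded_ops \<Longrightarrow> Re (cinner v ((adj z o\<^sub>L z) v)) = (norm (blinfun_apply z v))\<^sup>2"
  by (simp add: cinner_adj_right norm_sq_cinner)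

lemma pos_by_form:
  "sa x \<Longrightarrow> sa y \<Longrightarrow> (\<And>v. Re (cinner v (blinfun_apply x v)) \<le> Re (cinner v (blinfun_apply y v))) \<Longrightarrow> pos (y - x)"
  by (intro posI sa_diff) (auto simp: blinfun.diff_left cinner.diff_right)

lemma e2_parallelogram:
  assumes "x \<in> M" "y \<in> M"
  shows "e2 (x + y) h + e2 (x - y) h = 2 * e2 x h + 2 * e2 y h"
proof -
  have b: "x \<in> bounded_ops" "y \<in> bounded_ops" using assms Mbo by auto
  have "(adj (x + y) o\<^sub>L (x + y)) + (adj (x - y) o\<^sub>L (x - y))
      = 2 *\<^sub>R (adj x o\<^sub>L x) + 2 *\<^sub>R (adj y o\<^sub>L y)"
    by (rule blinfun_eqI) (simp add: adj_add adj_diff b blinfun.bilinear_simps algebra_simps scaleR_2)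
  moreover have "e ((adj (x + y) o\<^sub>L (x + y)) + (adj (x - y) o\<^sub>L (x - y))) h = e2 (x + y) h + e2 (x - y) h"
    unfolding e2_def using assms by (intro e_add sq_M vna_add[OF M] vna_diff[OF M])
  moreover have "e (2 *\<^sub>R (adj x o\<^sub>L x) + 2 *\<^sub>R (adj y o\<^sub>L y)) h = ennreal 2 * e2 x h + ennreal 2 * e2 y h"
    unfolding e2_def using assms
    by (subst e_add) (auto simp: e_scale sq_M intro!: vna_scaleR[OF M] pos_scaleR sq_M)
  ultimately show ?thesis by simp
qed

lemma e2_add_le: "x \<in> M \<Longrightarrow> y \<in> M \<Longrightarrow> e2 (x + y) h \<le> 2 * e2 x h + 2 * e2 y h"
  using e2_parallelogram[of x y h] by (metis le_iff_add)

lemma e2_comp_right: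
  assumes z: "z \<in> M" and a: "a \<in> A"
  shows "e2 (z o\<^sub>L a) h = e2 z (a h)"
proof -
  have "adj (z o\<^sub>L a) o\<^sub>L (z o\<^sub>L a) = adj a o\<^sub>L (adj z o\<^sub>L z) o\<^sub>L a"
    by (rule blinfun_eqI) (simp add: adj_comp Mbo z Abo a)
  then show ?thesis using e_conj[OF sq_M[OF z] a, of h] by (simp add: e2_def)
qed

text \<open>If \<open>d\<^sub>n\<close> is a sequence that is summable in \<open>L\<^sup>2\<close>, the suprema of \<open>rf (\<Sum> 2\<^sup>n d\<^sub>n\<^sup>* d\<^sub>n)\<close> over
  tails decrease to an element on which the faithful weight vanishes; this upgrades convergence in
  \<open>L\<^sup>2\<close> to strong convergence without any semicontinuity of the weight.\<close>

lemma tail_dominator: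
  assumes u: "\<And>n. u n \<in> M" and p: "is_supp A p h" and up: "\<And>n v. blinfun_apply (u n) (p v) = u n v"
    and small: "\<And>n. e2 (u n) h \<le> ennreal ((1/8)^n)"
  shows "\<exists>L. (\<forall>N. L N \<in> M \<and> pos (L N) \<and> e (L N) h \<le> ennreal (2 * (1/4)^N)) \<and>
    (\<forall>v. (\<lambda>N. blinfun_apply (L N) v) \<longlonglongrightarrow> 0) \<and>
    (\<forall>N k. pos (L N - rf (\<Sum>i<k. 2^(N + i) *\<^sub>R (adj (u (N + i)) o\<^sub>L u (N + i)))))"
proof -
  \<comment> \<open>The factor \<open>2^n\<close> is what Cauchy-Schwarz in
    \<open>L2_complete\<close> needs to bound a sum of the \<open>u n\<close> by the sum of the
    \<open>D n\<close>. Of the decay \<open>(1/8)^n\<close> it leaves \<open>(1/4)^n\<close>, still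
    summable.\<close>
  define D where "D n = 2^n *\<^sub>R (adj (u n) o\<^sub>L u n)" for n
  have DM: "D n \<in> M" and pD: "pos (D n)" for n
    unfolding D_def by (auto intro!: vna_scaleR[OF M] sq_M u pos_scaleR)
  have eD: "e (D n) h \<le> ennreal ((1/4)^n)" for n
  proof -
    have "e (D n) h = ennreal (2^n) * e2 (u n) h"
      unfolding D_def e2_def by (rule e_scale) (auto intro: sq_M u)
    also have "\<dots> \<le> ennreal (2^n) * ennreal ((1/8)^n)" by (intro mult_left_mono small) simp
    also have "\<dots> = ennreal ((1/4)^n)"
      by (simp add: power_one_over field_simps flip: ennreal_mult power_mult_distrib)
    finally show ?thesis .
  qed
  define T where "T N k = (\<Sum>i<k. D (N + i))" for N k
  have TM: "T N k \<in> M" and pT: "pos (T N k)" for N k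
    unfolding T_def by (auto intro!: vna_sum[OF M] pos_sum DM pD)
  have Tstep: "pos (T N (Suc k) - T N k)" for N k by (simp add: T_def pD)
  have Tshift: "pos (T N (Suc k) - T (Suc N) k)" for N k
    by (simp add: T_def sum.lessThan_Suc_shift pD del: sum.lessThan_Suc)
  have eT: "e (T N k) h \<le> ennreal (2 * (1/4)^N)" for N k
  proof -
    have "e (T N k) h = (\<Sum>i<k. e (D (N + i)) h)" unfolding T_def by (rule e_sum) (simp add: DM pD)
    also have "\<dots> \<le> (\<Sum>i<k. ennreal ((1/4)^(N + i)))" by (intro sum_mono eD)
    also have "\<dots> = ennreal (\<Sum>i<k. (1/4)^(N + i))" by (rule sum_ennreal) simp
    also have "(\<Sum>i<k. (1/4)^(N + i)) = (1/4)^N * (\<Sum>i<k. (1/4::real)^i)"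
      by (simp add: power_add sum_distrib_left)
    also have "(\<Sum>i<k. (1/4::real)^i) \<le> 2"
    proof -
      have "(\<Sum>i<k. (1/4::real)^i) = ((1/4)^k - 1) / (1/4 - 1)" by (rule geometric_sum) simp
      moreover have "(q - 1) / (1/4 - 1) \<le> 2" if "0 \<le> q" for q :: real using that by (auto simp: field_simps)
      ultimately show ?thesis by simp
    qed
    finally show ?thesis by (simp add: mult.commute ennreal_leI mult_left_mono)
  qed
  have rfM: "rf (T N k) \<in> M" for N k by (rule vna_dcomm[OF M TM rf_dcomm[OF pT]])
  have "\<exists>L. sa L \<and> (\<forall>v. (\<lambda>k. rf (T N k) v) \<longlonglongrightarrow> blinfun_apply L v) \<and> (\<forall>k. pos (L - rf (T N k)))" for N
  proof (rule mono_seq_limit)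
    show "Re (cinner v (rf (T N k) v)) \<le> 1 * (norm v)\<^sup>2" for k v
      using posD[OF rf_le_id[OF pT], of v N k] by (simp add: blinfun.diff_left cinner.diff_right flip: norm_sq_cinner)
  qed (auto intro: rf_sa pT rf_mono Tstep)
  then obtain L where L: "\<And>N. sa (L N)" "\<And>N v. (\<lambda>k. rf (T N k) v) \<longlonglongrightarrow> blinfun_apply (L N) v"
      "\<And>N k. pos (L N - rf (T N k))" by metis
  have LM: "L N \<in> M" for N by (rule vna_limit[OF M rfM L(2) sa_bounded_ops[OF L(1)]])
  have pL: "pos (L N)" for N
    using pos_add[OF L(3)[of N 0] rf_pos[OF pT[of N 0]]] by simp
  have "e (L N) h = (SUP k. e (rf (T N k)) h)" for N
    by (rule e_seq_sup) (auto intro: rfM rf_pos pT rf_mono Tstep LM L)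
  moreover have "e (rf (T N k)) h \<le> ennreal (2 * (1/4)^N)" for N k
    by (rule order_trans[OF e_mono eT]) (auto intro: rfM rf_pos pT TM rf_le)
  ultimately have eL: "e (L N) h \<le> ennreal (2 * (1/4)^N)" for N
    by (simp add: SUP_least)
  have Ldec: "pos (L N - L (Suc N))" for N
  proof (rule posI[OF sa_diff[OF L(1) L(1)]])
    fix v
    have "Re (cinner v (rf (T (Suc N) k) v)) \<le> Re (cinner v (L N v))" for k
      using posD[OF rf_mono[OF pT Tshift], of v N k] posD[OF L(3), of v N "Suc k"]
      by (simp add: blinfun.diff_left cinner.diff_right)
    moreover have "(\<lambda>k. Re (cinner v (rf (T (Suc N) k) v))) \<longlonglongrightarrow> Re (cinner v (L (Suc N) v))"
      by (intro tendsto_intros cinner.tendsto L)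
    ultimately have "Re (cinner v (L (Suc N) v)) \<le> Re (cinner v (L N v))"
      by (intro LIMSEQ_le_const2) auto
    then show "0 \<le> Re (cinner v ((L N - L (Suc N)) v))" by (simp add: blinfun.diff_left cinner.diff_right)
  qed
  \<comment> \<open>\<open>mono_seq_limit\<close> is about increasing sequences, hence the
    sign.\<close>
  have "\<exists>S. sa S \<and> (\<forall>v. (\<lambda>N. (- L N) v) \<longlonglongrightarrow> blinfun_apply S v) \<and> (\<forall>N. pos (S - (- L N)))"
  proof (rule mono_seq_limit)
    show "sa (- L N)" for N using sa_scaleR[OF L(1)[of N], of "-1"] by simp
    show "pos (- L (Suc N) - - L N)" for N using Ldec[of N] by simp
    show "Re (cinner v ((- L N) v)) \<le> 0 * (norm v)\<^sup>2" for N v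
      using posD[OF pL, of v N] by (simp add: blinfun.minus_left cinner.minus_right)
  qed simp
  then obtain S where S: "sa S" "\<And>v. (\<lambda>N. (- L N) v) \<longlonglongrightarrow> blinfun_apply S v" "\<And>N. pos (S + L N)" by auto
  define Z where "Z = - S"
  have lim: "(\<lambda>N. L N v) \<longlonglongrightarrow> Z v" for v
    using tendsto_minus[OF S(2)[of v]] by (simp add: Z_def blinfun.minus_left)
  have saZ: "sa Z" using sa_scaleR[OF S(1), of "-1"] by (simp add: Z_def)
  have ZM: "Z \<in> M" by (rule vna_limit[OF M LM lim sa_bounded_ops[OF saZ]])
  have pZ: "pos Z"
  proof (rule posI[OF saZ])
    fix v
    have "(\<lambda>N. Re (cinner v (L N v))) \<longlonglongrightarrow> Re (cinner v (Z v))"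
      by (intro tendsto_intros cinner.tendsto lim)
    then show "0 \<le> Re (cinner v (Z v))" by (rule LIMSEQ_le_const) (use posD[OF pL] in blast)
  qed
  have ZL: "pos (L N - Z)" for N using S(3)[of N] by (simp add: Z_def add.commute)
  have pp: "p (p v) = p v" for v using is_suppD(2)[OF p] by (rule projD)
  \<comment> \<open>All terms vanish on the complement of \<open>p\<close>, hence so does the limit;
    this lets \<open>e_supp_zero\<close> conclude from the single vector \<open>h\<close>.\<close>
  have Zp: "Z (p v) = Z v" for v
  proof -
    have Tv: "T N k (v - p v) = 0" for N k
      by (simp add: T_def D_def blinfun.sum_left blinfun.bilinear_simps up)
    have "L N (v - p v) = 0" for N
      using L(2)[of N "v - p v"] by (simp add: rf_kernel[OF pT Tv] LIMSEQ_const_iff)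
    then have "Z (v - p v) = 0" using lim[of "v - p v"] by (simp add: LIMSEQ_const_iff)
    then show ?thesis by (simp add: blinfun.diff_right)
  qed
  have "e Z h \<le> ennreal (2 * (1/4)^N)" for N
    by (rule order_trans[OF e_mono eL]) (use ZM pZ LM ZL in auto)
  moreover have "(\<lambda>N. ennreal (2 * (1/4)^N)) \<longlonglongrightarrow> ennreal (2 * 0)"
    by (intro tendsto_ennrealI tendsto_mult tendsto_const LIMSEQ_power_zero) simp
  ultimately have "e Z h \<le> 0" by (intro LIMSEQ_le_const[where a = "e Z h"]) auto
  then have "Z = 0" by (intro e_supp_zero[OF ZM pZ p Zp]) simp
  with LM pL eL lim L(3) show ?thesis by (intro exI[of _ L]) (auto simp: T_def D_def)
qed

end

section \<open>Completeness of the seminorms on norm-bounded sets\<close>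

lemma norm_proj_le_1: "proj p \<Longrightarrow> norm p \<le> 1"
  by (rule norm_blinfun_bound) (auto simp: proj_norm_le)

context weight
begin

text \<open>The tail dominators \<open>L N\<close> tend strongly to 0, so it suffices to bound the
  squared norm of a difference \<open>y (N + k) - y N\<close> on \<open>p v\<close> by a multiple of
  the form of \<open>L N\<close> at \<open>v\<close>. Half the square of this difference lies below
  the tail sum by Cauchy-Schwarz; \<open>rf_mono\<close> compresses both sides, and the norm bound
  lets \<open>rf_lower\<close> undo this on the smaller one.\<close>

lemma L2_complete:
  assumes y: "\<And>n. y n \<in> M" and R: "\<And>n. norm (y n) \<le> R" and p: "is_supp A p h"
    and small: "\<And>n. e2 (y (Suc n) - y n) h \<le> ennreal ((1/8)^n)"
  shows "\<exists>z\<in>M. (\<forall>v. (\<lambda>n. y n (p v)) \<longlonglongrightarrow> blinfun_apply z v) \<and>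
    (\<forall>N. e2 (z - (y N o\<^sub>L p)) h \<le> ennreal (4 * (1 + 2 * R\<^sup>2) * (1/4)^N))"
proof -
  have pA: "p \<in> A" and pp: "proj p" and ph: "p h = h" using is_suppD[OF p] by auto
  have pM: "p \<in> M" using AMD[OF pA] .
  have bp: "p \<in> bounded_ops" using Abo[OF pA] .
  have R0: "R \<ge> 0" using order_trans[OF norm_ge_zero R] .
  define u where "u n = (y (Suc n) - y n) o\<^sub>L p" for n
  have uM: "u n \<in> M" for n unfolding u_def by (intro vna_comp[OF M] vna_diff[OF M] y pM)
  have up: "u n (p v) = u n v" for n v by (simp add: u_def projD[OF pp])
  have us: "e2 (u n) h \<le> ennreal ((1/8)^n)" for n
    unfolding u_def using e2_comp_right[OF vna_diff[OF M y y] pA, of "Suc n" n h] small[of n] by (simp add: ph)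
  obtain L where L: "\<And>N. L N \<in> M" "\<And>N. pos (L N)" "\<And>N. e (L N) h \<le> ennreal (2 * (1/4)^N)"
      "\<And>v. (\<lambda>N. blinfun_apply (L N) v) \<longlonglongrightarrow> 0"
      "\<And>N k. pos (L N - rf (\<Sum>i<k. 2^(N + i) *\<^sub>R (adj (u (N + i)) o\<^sub>L u (N + i))))"
    using tail_dominator[OF uM p up us] by blast
  \<comment> \<open>The 2 undoes the half in \<open>B\<close>, and \<open>1 + 2 * R\<^sup>2\<close>
    is the constant of \<open>rf_lower\<close>, as \<open>B\<close> has norm at most
    \<open>2 * R\<^sup>2\<close>.\<close>
  define c where "c = 2 * (1 + 2 * R\<^sup>2)"
  have c0: "c \<ge> 0" by (simp add: c_def)
  have key: "(norm ((y (N + k) - y N) (p v)))\<^sup>2 \<le> c * Re (cinner v (L N v))" for N k v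
  proof -
    define z where "z = (y (N + k) - y N) o\<^sub>L p"
    have zM: "z \<in> M" unfolding z_def by (intro vna_comp[OF M] vna_diff[OF M] y pM)
    have bz: "z \<in> bounded_ops" using Mbo[OF zM] .
    define T where "T = (\<Sum>i<k. 2^(N + i) *\<^sub>R (adj (u (N + i)) o\<^sub>L u (N + i)))"
    have pT: "pos T" unfolding T_def by (intro pos_sum pos_scaleR sq_M uM) simp
    define B where "B = (1/2) *\<^sub>R (adj z o\<^sub>L z)"
    have pB: "pos B" unfolding B_def by (intro pos_scaleR pos_adj_comp bz) simp
    have formB: "Re (cinner w (B w)) = (1/2) * (norm (z w))\<^sup>2" for w
      by (simp add: B_def blinfun.scaleR_left cinner_scaleR_right cinner_adj_right bz norm_sq_cinner)
    have formT: "Re (cinner w (T w)) = (\<Sum>i<k. 2^(N + i) * (norm (u (N + i) w))\<^sup>2)" for w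
      by (simp add: T_def blinfun.sum_left blinfun.scaleR_left cinner.sum_right cinner_scaleR_right
          cinner_adj_right Mbo[OF uM] norm_sq_cinner del: of_real_power of_real_numeral)
    have zT: "(norm (z w))\<^sup>2 \<le> 2 * Re (cinner w (T w))" for w
    proof -
      have "z w = (\<Sum>i<k. u (N + i) w)"
      proof -
        have "(\<Sum>i<k. y (Suc (N + i)) (p w) - y (N + i) (p w)) = y (N + k) (p w) - y N (p w)"
          using sum_lessThan_telescope[of "\<lambda>i. y (N + i) (p w)" k] by simp
        then show ?thesis by (simp add: z_def u_def blinfun.diff_left)
      qed
      then have "norm (z w) \<le> (\<Sum>i<k. norm (u (N + i) w))" by (simp add: norm_sum)
      then have "(norm (z w))\<^sup>2 \<le> (\<Sum>i<k. norm (u (N + i) w))\<^sup>2" by (intro power_mono) auto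
      \<comment> \<open>Weights 2^-i and 2^i are inserted for Cauchy-Schwarz: the sum of the former
        is at most 2, the latter produce the tail sum.\<close>
      also have "(\<Sum>i<k. norm (u (N + i) w)) = (\<Sum>i<k. sqrt ((1/2)^i) * (sqrt (2^i) * norm (u (N + i) w)))"
        by (intro sum.cong refl) (simp add: real_sqrt_mult[symmetric] power_mult_distrib[symmetric] flip: mult.assoc)
      also have "\<dots>\<^sup>2 \<le> (\<Sum>i<k. (sqrt ((1/2)^i))\<^sup>2) * (\<Sum>i<k. (sqrt (2^i) * norm (u (N + i) w))\<^sup>2)"
        by (rule Cauchy_Schwarz_ineq_sum)
      also have "(\<Sum>i<k. (sqrt ((1/2)^i))\<^sup>2) = (\<Sum>i<k. (1/2::real)^i)" by simp
      also have "(\<Sum>i<k. (sqrt (2^i) * norm (u (N + i) w))\<^sup>2) = (\<Sum>i<k. 2^i * (norm (u (N + i) w))\<^sup>2)"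
        by (simp add: power_mult_distrib)
      also have "(\<Sum>i<k. (1/2::real)^i) * (\<Sum>i<k. 2^i * (norm (u (N + i) w))\<^sup>2)
          \<le> 2 * (\<Sum>i<k. 2^(N + i) * (norm (u (N + i) w))\<^sup>2)"
      proof (rule mult_mono)
        have "(\<Sum>i<k. (1/2::real)^i) = ((1/2)^k - 1) / (1/2 - 1)" by (rule geometric_sum) simp
        moreover have "(q - 1) / (1/2 - 1) \<le> 2" if "0 \<le> q" for q :: real using that by (auto simp: field_simps)
        ultimately show "(\<Sum>i<k. (1/2::real)^i) \<le> 2" by simp
        show "(\<Sum>i<k. 2^i * (norm (u (N + i) w))\<^sup>2) \<le> (\<Sum>i<k. 2^(N + i) * (norm (u (N + i) w))\<^sup>2)"
          by (intro sum_mono mult_right_mono power_increasing) auto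
      qed (auto intro: sum_nonneg)
      finally show ?thesis by (simp add: formT)
    qed
    have TB: "pos (T - B)"
    proof (rule pos_by_form[OF pos_sa[OF pB] pos_sa[OF pT]])
      show "Re (cinner w (B w)) \<le> Re (cinner w (T w))" for w using zT[of w] formB[of w] by linarith
    qed
    have nz: "norm z \<le> 2 * R"
    proof -
      have "norm z \<le> norm (y (N + k) - y N) * norm p" unfolding z_def by (rule norm_blinfun_compose)
      also have "\<dots> \<le> (R + R) * 1"
        using norm_triangle_ineq4[of "y (N + k)" "y N"] R[of "N + k"] R[of N] R0
        by (intro mult_mono norm_proj_le_1 pp) auto
      finally show ?thesis by simp
    qed
    have nB: "norm B \<le> 2 * R\<^sup>2"
    proof (rule pos_norm_le[OF pB])
      fix w
      have "(norm (z w))\<^sup>2 \<le> (2 * R * norm w)\<^sup>2"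
        by (intro power_mono order_trans[OF norm_blinfun] mult_right_mono nz) auto
      then show "Re (cinner w (B w)) \<le> 2 * R\<^sup>2 * (norm w)\<^sup>2" by (simp add: formB power_mult_distrib)
    qed simp
    have "Re (cinner v (B v)) \<le> (1 + 2 * R\<^sup>2) * Re (cinner v (rf B v))" by (rule rf_lower[OF pB nB])
    also have "\<dots> \<le> (1 + 2 * R\<^sup>2) * Re (cinner v (L N v))"
      using posD[OF rf_mono[OF pB TB], of v] posD[OF L(5)[of N k], of v]
      by (intro mult_left_mono) (auto simp: T_def blinfun.diff_left cinner.diff_right)
    finally show ?thesis by (simp add: formB z_def c_def algebra_simps)
  qed
  have conv: "convergent (\<lambda>n. y n (p v))" for v
  proof (rule Cauchy_convergent, rule metric_CauchyI)
    fix r :: real assume r: "r > 0"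
    have "(\<lambda>N. c * Re (cinner v (L N v))) \<longlonglongrightarrow> c * Re (cinner v 0)"
      by (intro tendsto_intros cinner.tendsto L)
    then have "(\<lambda>N. c * Re (cinner v (L N v))) \<longlonglongrightarrow> 0" by (simp add: cinner.zero_right)
    from LIMSEQ_D[OF this, of "(r/2)\<^sup>2"] obtain N where
      N: "\<forall>n\<ge>N. norm (c * Re (cinner v (L n v)) - 0) < (r/2)\<^sup>2"
      using r by auto
    have near: "norm (y m (p v) - y N (p v)) < r/2" if mN: "m \<ge> N" for m
    proof -
      have "(norm (y m (p v) - y N (p v)))\<^sup>2 < (r/2)\<^sup>2"
      proof -
        have "c * Re (cinner v (L N v)) < (r/2)\<^sup>2" using spec[OF N, of N] by auto
        then have "(norm ((y (N + (m - N)) - y N) (p v)))\<^sup>2 < (r/2)\<^sup>2" using key[of N "m - N" v] by linarith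
        then show ?thesis using mN by (simp only: blinfun.diff_left le_add_diff_inverse)
      qed
      then show ?thesis by (rule power2_less_imp_less) (use r in simp)
    qed
    have "dist (y m (p v)) (y n (p v)) < r" if "m \<ge> N" "n \<ge> N" for m n
    proof (rule dist_triangle_half_l[of _ "y N (p v)"])
      show "dist (y m (p v)) (y N (p v)) < r/2" unfolding dist_norm by (rule near[OF that(1)])
      show "dist (y n (p v)) (y N (p v)) < r/2" unfolding dist_norm by (rule near[OF that(2)])
    qed
    then show "\<exists>M. \<forall>m\<ge>M. \<forall>n\<ge>M. dist (y m (p v)) (y n (p v)) < r" by blast
  qed
  then obtain l where l: "\<And>v. (\<lambda>n. y n (p v)) \<longlonglongrightarrow> l v" unfolding convergent_def by metis
  have "\<exists>z\<in>bounded_ops. \<forall>v. blinfun_apply z v = l v"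
  proof (rule blinfun_from_linear[where K = R])
    show "l (a + b) = l a + l b" for a b
      using LIMSEQ_unique[OF l[of "a + b"]] tendsto_add[OF l[of a] l[of b]]
      by (simp add: blinfun.add_right)
    show "l (k *\<^sub>C a) = k *\<^sub>C l a" for k a
      using LIMSEQ_unique[OF l[of "k *\<^sub>C a"]] bounded_linear.tendsto[OF bounded_linear_scaleC l[of a], of k]
      by (simp add: bounded_opsD[OF bp] bounded_opsD[OF Mbo[OF y]])
    show "norm (l a) \<le> R * norm a" for a
    proof (rule Lim_bounded[OF tendsto_norm[OF l[of a]], of 0], intro allI impI)
      fix n
      have "norm (y n (p a)) \<le> norm (y n) * norm (p a)" by (rule norm_blinfun)
      also have "\<dots> \<le> R * norm a" by (intro mult_mono R proj_norm_le pp R0) simp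
      finally show "norm (y n (p a)) \<le> R * norm a" .
    qed
  qed
  then obtain z where z: "z \<in> bounded_ops" "\<And>v. blinfun_apply z v = l v" by blast
  have zl: "(\<lambda>n. y n (p v)) \<longlonglongrightarrow> z v" for v using l by (simp add: z)
  have zM: "z \<in> M"
    by (rule vna_limit[OF M, of "\<lambda>n. y n o\<^sub>L p"]) (auto intro: vna_comp[OF M] y pM zl z)
  have "e2 (z - (y N o\<^sub>L p)) h \<le> ennreal (4 * (1 + 2 * R\<^sup>2) * (1/4)^N)" for N
  proof -
    define x where "x = z - (y N o\<^sub>L p)"
    have xM: "x \<in> M" unfolding x_def by (intro vna_comp[OF M] vna_diff[OF M] y pM zM)
    have bx: "x \<in> bounded_ops" using Mbo[OF xM] .
    have "(norm (x v))\<^sup>2 \<le> c * Re (cinner v (L N v))" for v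
    proof -
      have "(\<lambda>k. y (k + N) (p v)) \<longlonglongrightarrow> z v" by (rule LIMSEQ_ignore_initial_segment[OF zl])
      then have "(\<lambda>k. (norm (y (k + N) (p v) - y N (p v)))\<^sup>2) \<longlonglongrightarrow> (norm (z v - y N (p v)))\<^sup>2"
        by (intro tendsto_power tendsto_norm tendsto_diff tendsto_const)
      moreover have "(norm (y (k + N) (p v) - y N (p v)))\<^sup>2 \<le> c * Re (cinner v (L N v))" for k
        using key[of N k v] by (simp add: blinfun.diff_left add.commute)
      ultimately show ?thesis by (intro LIMSEQ_le_const2) (auto simp: x_def blinfun.diff_left)
    qed
    then have "pos (c *\<^sub>R L N - (adj x o\<^sub>L x))"
      by (intro pos_by_form pos_sa pos_adj_comp bx pos_scaleR c0 L)
        (simp add: blinfun.scaleR_left cinner_scaleR_right cinner_adj_right bx flip: norm_sq_cinner)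
    then have "e2 x h \<le> e (c *\<^sub>R L N) h"
      unfolding e2_def by (intro e_mono sq_M xM vna_scaleR[OF M] L)
    also have "\<dots> = ennreal c * e (L N) h" by (rule e_scale[OF c0 L(1,2)])
    also have "\<dots> \<le> ennreal c * ennreal (2 * (1/4)^N)" by (intro mult_left_mono L) simp
    also have "\<dots> = ennreal (c * (2 * (1/4)^N))" by (rule ennreal_mult[symmetric]) (use c0 in auto)
    also have "c * (2 * (1/4)^N) = 4 * (1 + 2 * R\<^sup>2) * (1/4)^N" by (simp add: c_def)
    finally show ?thesis by (simp add: x_def)
  qed
  with zM zl show ?thesis by blast
qed

text \<open>Used only where \<open>e2\<close> is known to be finite, so that the default value 0 at
  infinity never enters.\<close>

definition q2 :: "('h \<Rightarrow>\<^sub>L 'h) \<Rightarrow> 'h \<Rightarrow> real" where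
  "q2 z h = enn2real (e2 z h)"

lemma q2: "e2 z h \<le> ennreal K \<Longrightarrow> e2 z h = ennreal (q2 z h)"
  "e2 z h \<le> ennreal K \<Longrightarrow> 0 \<le> K \<Longrightarrow> q2 z h \<le> K" "0 \<le> q2 z h"
proof -
  show "0 \<le> q2 z h" by (simp add: q2_def)
  assume le: "e2 z h \<le> ennreal K"
  then have "e2 z h < top" using ennreal_less_top by (rule le_less_trans)
  then show 1: "e2 z h = ennreal (q2 z h)" by (simp add: q2_def)
  assume "0 \<le> K" then show "q2 z h \<le> K" using le unfolding 1 by (simp add: ennreal_le_iff)
qed

text \<open>\<open>8 * \<delta>\<close> is 4 (m + \<delta>) - 4 (m - \<delta>): by the parallelogram
  law, twice the two values minus four times the value at the midpoint.\<close>

lemma e2_near_minimisers: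
  assumes w: "a \<in> M" "b \<in> M" and K: "e2 a h \<le> ennreal K" "e2 b h \<le> ennreal K"
    and le: "q2 a h \<le> m + \<delta>" "q2 b h \<le> m + \<delta>" and ge: "m - \<delta> \<le> q2 ((1/2) *\<^sub>R (a + b)) h"
    and K0: "0 \<le> K"
  shows "e2 (a - b) h \<le> ennreal (8 * \<delta>)"
proof -
  have s: "e2 (a + b) h + e2 (a - b) h = ennreal (2 * q2 a h + 2 * q2 b h)"
    using e2_parallelogram[OF w, of h] unfolding q2(1)[OF K(1)] q2(1)[OF K(2)]
    by (simp add: q2(3) ennreal_mult)
  have f1: "e2 (a + b) h \<le> ennreal (2 * q2 a h + 2 * q2 b h)"
    and f2: "e2 (a - b) h \<le> ennreal (2 * q2 a h + 2 * q2 b h)"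
    unfolding s[symmetric] by simp_all
  have b: "a \<in> bounded_ops" "b \<in> bounded_ops" using w Mbo by auto
  have "e2 ((1/2) *\<^sub>R (a + b)) h = ennreal (1/4) * e2 (a + b) h"
  proof -
    have "adj ((1/2) *\<^sub>R (a + b)) o\<^sub>L ((1/2) *\<^sub>R (a + b)) = (1/4) *\<^sub>R (adj (a + b) o\<^sub>L (a + b))"
      by (rule blinfun_eqI) (simp add: scaleR_scaleC adj_scaleC b scaleC_scaleC blinfun_scaleC_apply
          bounded_opsD[OF adj_bounded_ops] bounded_opsD blinfun.bilinear_simps)
    then show ?thesis unfolding e2_def using e_scale[of "1/4" "adj (a + b) o\<^sub>L (a + b)" h] sq_M[OF vna_add[OF M w]] by simp
  qed
  then have "q2 ((1/2) *\<^sub>R (a + b)) h = (1/4) * q2 (a + b) h"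
    by (simp add: q2_def enn2real_mult)
  moreover have "q2 (a + b) h + q2 (a - b) h = 2 * q2 a h + 2 * q2 b h"
    using s unfolding q2(1)[OF f1] q2(1)[OF f2] by (simp add: q2(3) flip: ennreal_plus)
  ultimately have "q2 (a - b) h \<le> 8 * \<delta>" using le ge by simp
  then show ?thesis unfolding q2(1)[OF f2] by (rule ennreal_leI)
qed

text \<open>Lower semicontinuity of the \<open>L\<^sup>2\<close>-seminorms up to a factor 2: near minimisers over the
  neighbourhoods of \<open>y\<close> form a sequence that is Cauchy in \<open>L\<^sup>2\<close> and hence converges strongly. Its limit is
  \<open>y\<close>, because it can be interlaced with near minimisers over smaller neighbourhoods.\<close>

lemma e2_lsc:
  assumes conv: "convex C" and CM: "C \<subseteq> M" and R: "\<And>w. w \<in> C \<Longrightarrow> norm w \<le> R"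
    and K: "\<And>w. w \<in> C \<Longrightarrow> e2 w h \<le> ennreal K" "0 \<le> K" and y: "y \<in> M"
    and approx: "\<And>G \<epsilon>. finite G \<Longrightarrow> \<epsilon> > 0 \<Longrightarrow> \<exists>w\<in>C. \<forall>g\<in>G. \<forall>g'\<in>G. cmod (cinner g ((w - y) g')) < \<epsilon>"
  shows "e2 y h \<le> ennreal (2 * K)"
proof -
  obtain p where p: "is_supp A p h" using is_supp_exists[OF A] by blast
  have pA: "p \<in> A" and ph: "p h = h" using is_suppD[OF p] by auto
  define Nb where "Nb G \<epsilon> = {w \<in> C. \<forall>g\<in>G. \<forall>g'\<in>G. cmod (cinner g ((w - y) g')) < \<epsilon>}" for G \<epsilon>
  have One: "Nb G \<epsilon> \<noteq> {}" if "finite G" "\<epsilon> > 0" for G \<epsilon> using approx[OF that] by (auto simp: Nb_def)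
  have OC: "w \<in> C" if "w \<in> Nb G \<epsilon>" for w G \<epsilon> using that by (simp add: Nb_def)
  have Omono: "Nb G' \<epsilon>' \<subseteq> Nb G \<epsilon>" if "G \<subseteq> G'" "\<epsilon>' \<le> \<epsilon>" for G G' \<epsilon> \<epsilon>' using that by (force simp: Nb_def)
  have Omid: "(1/2) *\<^sub>R (a + b) \<in> Nb G \<epsilon>" if a: "a \<in> Nb G \<epsilon>" and b: "b \<in> Nb G \<epsilon>" for a b G \<epsilon>
  proof -
    have "(1/2) *\<^sub>R a + (1/2) *\<^sub>R b \<in> C" using conv OC[OF a] OC[OF b] by (intro convexD) auto
    moreover have "cmod (cinner g (((1/2) *\<^sub>R (a + b) - y) g')) < \<epsilon>" if g: "g \<in> G" "g' \<in> G" for g g'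
    proof -
      have "((1/2) *\<^sub>R (a + b) - y) g' = (1/2) *\<^sub>R ((a - y) g' + (b - y) g')"
        by (simp add: blinfun.bilinear_simps algebra_simps flip: scaleR_2)
      then have "cinner g (((1/2) *\<^sub>R (a + b) - y) g') = (cinner g ((a - y) g') + cinner g ((b - y) g')) / 2"
        by (simp add: cinner_scaleR_right cinner.add_right)
      also have "cmod \<dots> \<le> (cmod (cinner g ((a - y) g')) + cmod (cinner g ((b - y) g'))) / 2"
        by (simp add: norm_divide norm_triangle_ineq)
      also have "\<dots> < \<epsilon>"
      proof -
        have "cmod (cinner g ((a - y) g')) < \<epsilon>" "cmod (cinner g ((b - y) g')) < \<epsilon>"
          using a b g unfolding Nb_def by blast+
        then show ?thesis by simp
      qed
      finally show ?thesis .
    qed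
    ultimately show ?thesis by (simp add: Nb_def scaleR_add_right)
  qed
  have qK: "q2 w h \<le> K" if "w \<in> C" for w using q2(2)[OF K(1)[OF that] K(2)] .
  define \<mu> where "\<mu> G \<epsilon> = (INF w\<in>Nb G \<epsilon>. q2 w h)" for G \<epsilon>
  have bdd: "bdd_below ((\<lambda>w. q2 w h) ` Nb G \<epsilon>)" for G \<epsilon> by (rule bdd_belowI[of _ 0]) (auto simp: q2(3))
  have mu_le: "\<mu> G \<epsilon> \<le> q2 w h" if "w \<in> Nb G \<epsilon>" for w G \<epsilon>
    unfolding \<mu>_def by (rule cINF_lower[OF bdd that])
  have mu_near: "\<exists>w\<in>Nb G \<epsilon>. q2 w h < \<mu> G \<epsilon> + \<delta>" if "finite G" "\<epsilon> > 0" "\<delta> > 0" for G \<epsilon> \<delta>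
    using cINF_less_iff[OF One[OF that(1,2)] bdd, of "\<mu> G \<epsilon> + \<delta>"] that(3) unfolding \<mu>_def by simp
  have mu_mono: "\<mu> G \<epsilon> \<le> \<mu> G' \<epsilon>'" if "G \<subseteq> G'" "\<epsilon>' \<le> \<epsilon>" "finite G'" "\<epsilon>' > 0" for G G' \<epsilon> \<epsilon>'
    unfolding \<mu>_def using that by (intro cINF_superset_mono One bdd Omono) auto
  define I where "I = {(G :: 'h set, \<epsilon> :: real). finite G \<and> \<epsilon> > 0}"
  \<comment> \<open>The infima over the weak neighbourhoods of \<open>y\<close> increase as these
    shrink. Near their supremum \<open>m\<close>, a midpoint within the neighbourhood cannot fall
    far below the endpoints.\<close>
  define m where "m = (SUP i\<in>I. \<mu> (fst i) (snd i))"
  have muK: "\<mu> G \<epsilon> \<le> K" if G\<epsilon>: "finite G" "\<epsilon> > 0" for G \<epsilon>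
  proof -
    obtain w where w: "w \<in> Nb G \<epsilon>" using One[OF G\<epsilon>] by blast
    show ?thesis using mu_le[OF w] qK[OF OC[OF w]] by simp
  qed
  have Ine: "I \<noteq> {}" by (auto simp: I_def intro!: exI[of _ "{}"] exI[of _ 1])
  have bdd2: "bdd_above ((\<lambda>i. \<mu> (fst i) (snd i)) ` I)"
    by (rule bdd_aboveI[of _ K]) (auto simp: I_def muK)
  have mu_m: "\<mu> G \<epsilon> \<le> m" if "finite G" "\<epsilon> > 0" for G \<epsilon>
    unfolding m_def using cSUP_upper[OF _ bdd2, of "(G, \<epsilon>)"] that by (simp add: I_def)
  \<comment> \<open>Chosen so that the bound \<open>8 * \<delta> n\<close> is the
    \<open>(1/8)^n\<close> that \<open>L2_complete\<close> asks for.\<close>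
  define \<delta> where "\<delta> n = (1/8::real)^(Suc n)" for n
  have d0: "\<delta> n > 0" for n by (simp add: \<delta>_def)
  have dmono: "\<delta> k \<le> \<delta> n" if "n \<le> k" for n k
    unfolding \<delta>_def using that by (intro power_decreasing) auto
  have "\<exists>i\<in>I. m - \<delta> n < \<mu> (fst i) (snd i)" for n
    using less_cSUP_iff[OF Ine bdd2, of "m - \<delta> n"] d0[of n] unfolding m_def by simp
  then obtain i where i: "\<And>n. i n \<in> I" "\<And>n. m - \<delta> n < \<mu> (fst (i n)) (snd (i n))" by metis
  \<comment> \<open>Accumulated, so that the neighbourhoods decrease along the sequence.\<close>
  define G where "G n = (\<Union>k\<le>n. fst (i k))" for n
  define \<epsilon> where "\<epsilon> n = Min ((\<lambda>k. snd (i k)) ` {..n})" for n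
  have finG: "finite (G n)" and eps0: "\<epsilon> n > 0" for n
  proof -
    have "finite (fst (i k))" "snd (i k) > 0" for k using i(1)[of k] by (auto simp: I_def)
    then show "finite (G n)" "\<epsilon> n > 0" by (auto simp: G_def \<epsilon>_def)
  qed
  have Gmono: "G n \<subseteq> G k" if "n \<le> k" for n k
    unfolding G_def using that by (intro UN_mono) auto
  have emono: "\<epsilon> k \<le> \<epsilon> n" if "n \<le> k" for n k
    unfolding \<epsilon>_def using that by (intro Min_antimono image_mono) auto
  have mun: "m - \<delta> n < \<mu> (G n) (\<epsilon> n)" for n
  proof -
    have "\<mu> (fst (i n)) (snd (i n)) \<le> \<mu> (G n) (\<epsilon> n)"
      by (rule mu_mono) (auto simp: finG eps0, auto simp: G_def \<epsilon>_def)
    then show ?thesis using i(2)[of n] by simp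
  qed
  have close: "e2 (a - b) h \<le> ennreal ((1/8)^n)"
    if a: "a \<in> Nb (G n) (\<epsilon> n)" "q2 a h \<le> m + \<delta> n" and b: "b \<in> Nb (G n) (\<epsilon> n)" "q2 b h \<le> m + \<delta> n" for a b n
  proof -
    have "m - \<delta> n \<le> q2 ((1/2) *\<^sub>R (a + b)) h"
      using mun[of n] mu_le[OF Omid[OF a(1) b(1)]] by simp
    then have "e2 (a - b) h \<le> ennreal (8 * \<delta> n)"
      using a b OC CM by (intro e2_near_minimisers[where K = K and m = m] K) auto
    then show ?thesis by (simp add: \<delta>_def)
  qed
  have seq: "\<exists>z\<in>M. (\<forall>v. (\<lambda>n. x n (p v)) \<longlonglongrightarrow> blinfun_apply z v) \<and>
      (\<forall>N. e2 (z - (x N o\<^sub>L p)) h \<le> ennreal (4 * (1 + 2 * R\<^sup>2) * (1/4)^N))"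
    if x: "\<And>n. x n \<in> Nb (G n) (\<epsilon> n)" "\<And>n. q2 (x n) h \<le> m + \<delta> n" for x
  proof (rule L2_complete[OF _ _ p])
    show "x n \<in> M" "norm (x n) \<le> R" for n using OC[OF x(1)] CM R by auto
    show "e2 (x (Suc n) - x n) h \<le> ennreal ((1/8)^n)" for n
    proof (rule close)
      show "x (Suc n) \<in> Nb (G n) (\<epsilon> n)"
        using x(1)[of "Suc n"] Omono[OF Gmono emono, of n "Suc n" n "Suc n"] by auto
      show "q2 (x (Suc n)) h \<le> m + \<delta> n" using x(2)[of "Suc n"] dmono[of n "Suc n"] by simp
    qed (use x in auto)
  qed
  have "\<exists>w\<in>Nb (G n) (\<epsilon> n). q2 w h < \<mu> (G n) (\<epsilon> n) + \<delta> n" for n by (rule mu_near[OF finG eps0 d0])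
  then obtain w where w: "\<And>n. w n \<in> Nb (G n) (\<epsilon> n)" "\<And>n. q2 (w n) h < \<mu> (G n) (\<epsilon> n) + \<delta> n" by metis
  have wm: "q2 (w n) h \<le> m + \<delta> n" for n using w(2)[of n] mu_m[OF finG eps0, of n n] by simp
  obtain z where z: "z \<in> M" "\<And>v. (\<lambda>n. w n (p v)) \<longlonglongrightarrow> blinfun_apply z v"
      "\<And>N. e2 (z - (w N o\<^sub>L p)) h \<le> ennreal (4 * (1 + 2 * R\<^sup>2) * (1/4)^N)"
    using seq[OF w(1) wm] by blast
  have zy: "z = y o\<^sub>L p"
  proof (rule blinfun_eqI, rule cinner_eqI)
    fix v g
    \<comment> \<open>The countably many neighbourhoods used so far need not determine the weak
      limit, so the pair \<open>g\<close>, \<open>p v\<close> under test is added. The new sequence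
      has the same limit as \<open>w\<close>, because alternating the two gives a sequence to which
      \<open>seq\<close> still applies.\<close>
    define H where "H n = G n \<union> {g, p v}" for n
    define \<eta> where "\<eta> n = min (\<epsilon> n) (1 / real (Suc n))" for n
    have H: "finite (H n)" "\<eta> n > 0" for n using finG eps0 by (auto simp: H_def \<eta>_def)
    have "\<exists>w\<in>Nb (H n) (\<eta> n). q2 w h < \<mu> (H n) (\<eta> n) + \<delta> n" for n by (rule mu_near[OF H d0])
    then obtain w' where w': "\<And>n. w' n \<in> Nb (H n) (\<eta> n)" "\<And>n. q2 (w' n) h < \<mu> (H n) (\<eta> n) + \<delta> n" by metis
    have w'm: "q2 (w' n) h \<le> m + \<delta> n" for n using w'(2)[of n] mu_m[OF H, of n n] by simp
    have w'O: "w' n \<in> Nb (G n) (\<epsilon> n)" for n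
      using w'(1)[of n] Omono[of "G n" "H n" "\<eta> n" "\<epsilon> n"] by (auto simp: H_def \<eta>_def)
    define x where "x n = (if even n then w n else w' n)" for n
    have xN: "x n \<in> Nb (G n) (\<epsilon> n)" and xm: "q2 (x n) h \<le> m + \<delta> n" for n
      using w(1)[of n] wm[of n] w'O[of n] w'm[of n] by (simp_all add: x_def)
    obtain z' where z': "\<And>v. (\<lambda>n. x n (p v)) \<longlonglongrightarrow> blinfun_apply z' v"
      using seq[OF xN xm] by blast
    have even: "(\<lambda>n. x (2 * n) (p v)) \<longlonglongrightarrow> z' v"
      using LIMSEQ_subseq_LIMSEQ[OF z'[of v], of "\<lambda>n. 2 * n"] by (simp add: strict_mono_def o_def)
    have "(\<lambda>n. w (2 * n) (p v)) \<longlonglongrightarrow> z v"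
      using LIMSEQ_subseq_LIMSEQ[OF z(2)[of v], of "\<lambda>n. 2 * n"] by (simp add: strict_mono_def o_def)
    then have "z' v = z v" using even LIMSEQ_unique by (simp add: x_def) blast
    moreover have "(\<lambda>n. x (2 * n + 1) (p v)) \<longlonglongrightarrow> z' v"
      using LIMSEQ_subseq_LIMSEQ[OF z'[of v], of "\<lambda>n. 2 * n + 1"] by (simp add: strict_mono_def o_def)
    ultimately have odd: "(\<lambda>n. w' (2 * n + 1) (p v)) \<longlonglongrightarrow> z v" by (simp add: x_def)
    have "(\<lambda>n. cinner g ((w' (2 * n + 1) - y) (p v))) \<longlonglongrightarrow> cinner g (z v - y (p v))"
      unfolding blinfun.diff_left by (intro cinner.tendsto tendsto_diff odd tendsto_const)
    moreover have "(\<lambda>n. cinner g ((w' (2 * n + 1) - y) (p v))) \<longlonglongrightarrow> 0"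
    proof (rule Lim_null_comparison)
      show "\<forall>\<^sub>F n in sequentially. norm (cinner g ((w' (2 * n + 1) - y) (p v))) \<le> 1 / real (Suc n)"
      proof (rule always_eventually, rule allI)
        fix n
        have "norm (cinner g ((w' (2 * n + 1) - y) (p v))) < \<eta> (2 * n + 1)"
          using w'(1)[of "2 * n + 1"] by (auto simp: Nb_def H_def)
        also have "\<dots> \<le> 1 / real (Suc (2 * n + 1))" by (simp add: \<eta>_def)
        also have "\<dots> \<le> 1 / real (Suc n)" by (simp add: frac_le)
        finally show "norm (cinner g ((w' (2 * n + 1) - y) (p v))) \<le> 1 / real (Suc n)" by simp
      qed
      show "(\<lambda>n. 1 / real (Suc n)) \<longlonglongrightarrow> 0" by (rule LIMSEQ_inverse_real_of_nat[unfolded inverse_eq_divide])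
    qed
    ultimately have "cinner g (z v - y (p v)) = 0" using LIMSEQ_unique by blast
    then show "cinner g (z v) = cinner g ((y o\<^sub>L p) v)" by (simp add: cinner.diff_right)
  qed
  \<comment> \<open>\<open>y\<close> and \<open>z\<close> have the same seminorm at
    \<open>h\<close>, and the factor 2 is that of \<open>e2_add_le\<close>.\<close>
  have "e2 y h \<le> ennreal (2 * K + 2 * (4 * (1 + 2 * R\<^sup>2) * (1/4)^N))" for N
  proof -
    have wM: "w N \<in> M" using OC[OF w(1)] CM by blast
    have wpM: "w N o\<^sub>L p \<in> M" by (intro vna_comp[OF M] wM AMD pA)
    have "e2 y h = e2 z h" unfolding zy by (simp add: e2_comp_right[OF y pA] ph)
    also have "\<dots> = e2 ((w N o\<^sub>L p) + (z - (w N o\<^sub>L p))) h" by simp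
    also have "\<dots> \<le> 2 * e2 (w N o\<^sub>L p) h + 2 * e2 (z - (w N o\<^sub>L p)) h"
      by (intro e2_add_le wpM vna_diff[OF M] z)
    also have "e2 (w N o\<^sub>L p) h = e2 (w N) h" by (simp add: e2_comp_right[OF wM pA] ph)
    also have "2 * e2 (w N) h + 2 * e2 (z - (w N o\<^sub>L p)) h \<le> 2 * ennreal K + 2 * ennreal (4 * (1 + 2 * R\<^sup>2) * (1/4)^N)"
      by (intro add_mono mult_left_mono z K OC[OF w(1)]) auto
    also have "\<dots> = ennreal (2 * K + 2 * (4 * (1 + 2 * R\<^sup>2) * (1/4)^N))"
      using K(2) by (simp add: ennreal_mult ennreal_plus)
    finally show ?thesis .
  qed
  then have ev: "\<exists>N. \<forall>n\<ge>N. e2 y h \<le> ennreal (2 * K + 2 * (4 * (1 + 2 * R\<^sup>2) * (1/4)^n))" by blast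
  have "(\<lambda>N. ennreal (2 * K + 2 * (4 * (1 + 2 * R\<^sup>2) * (1/4)^N))) \<longlonglongrightarrow> ennreal (2 * K + 2 * (4 * (1 + 2 * R\<^sup>2) * 0))"
    by (intro tendsto_ennrealI tendsto_add tendsto_mult tendsto_const LIMSEQ_power_zero) simp
  from LIMSEQ_le_const[OF this ev] show ?thesis by simp
qed

end

section \<open>Orthogonal families of projections\<close>

lemma orth_sum_proj:
  assumes "finite F" "\<And>f. f \<in> F \<Longrightarrow> proj f" "\<And>f g v. f \<in> F \<Longrightarrow> g \<in> F \<Longrightarrow> f \<noteq> g \<Longrightarrow> blinfun_apply f (blinfun_apply g v) = 0"
  shows "proj (\<Sum>F)" "(\<Sum>f\<in>F. (norm (blinfun_apply f v))\<^sup>2) = (norm ((\<Sum>F) v))\<^sup>2"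
    "f \<in> F \<Longrightarrow> blinfun_apply f ((\<Sum>F) v) = f v" "f \<in> F \<Longrightarrow> (\<Sum>F) (blinfun_apply f v) = f v"
proof -
  show l: "blinfun_apply f ((\<Sum>F) v) = f v" if "f \<in> F" for f v
  proof -
    have "f ((\<Sum>F) v) = (\<Sum>g\<in>F. f (blinfun_apply g v))" by (simp add: blinfun.sum_left blinfun.sum_right)
    also have "\<dots> = (\<Sum>g\<in>F. if g = f then f v else 0)"
      using assms(3) that projD[OF assms(2)[OF that]] by (intro sum.cong refl) auto
    finally show ?thesis using assms(1) that by simp
  qed
  show "(\<Sum>F) (blinfun_apply f v) = f v" if "f \<in> F" for f
  proof -
    have "(\<Sum>F) (f v) = (\<Sum>g\<in>F. blinfun_apply g (f v))" by (simp add: blinfun.sum_left)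
    also have "\<dots> = (\<Sum>g\<in>F. if g = f then f v else 0)"
      using assms(3) that projD[OF assms(2)[OF that]] by (intro sum.cong refl) auto
    finally show ?thesis using assms(1) that by simp
  qed
  have sa: "sa (\<Sum>F)"
  proof (rule saI)
    show "\<Sum>F \<in> bounded_ops" by (intro bounded_ops_sum proj_bounded_ops assms(2))
    show "cinner ((\<Sum>F) v) w = cinner v ((\<Sum>F) w)" for v w
      unfolding blinfun.sum_left cinner.sum_left cinner.sum_right
      by (intro sum.cong refl saD proj_sa assms(2))
  qed
  have idem: "(\<Sum>F) ((\<Sum>F) v) = (\<Sum>F) v" for v
    using l by (subst (1 3) blinfun.sum_left) simp
  show p: "proj (\<Sum>F)" using sa idem by (simp add: proj_def)
  have "complex_of_real ((norm ((\<Sum>F) v))\<^sup>2) = cinner v ((\<Sum>F) v)" using proj_form[OF p, of v] by simp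
  also have "\<dots> = (\<Sum>f\<in>F. cinner v (blinfun_apply f v))" by (simp add: blinfun.sum_left cinner.sum_right)
  also have "\<dots> = (\<Sum>f\<in>F. complex_of_real ((norm (blinfun_apply f v))\<^sup>2))"
    by (intro sum.cong refl proj_form assms(2))
  finally show "(\<Sum>f\<in>F. (norm (blinfun_apply f v))\<^sup>2) = (norm ((\<Sum>F) v))\<^sup>2"
    by (simp only: of_real_sum[symmetric] of_real_eq_iff)
qed

text \<open>Zorn gives a maximal orthogonal family in \<open>Q\<close>; the complement of its closed
  span, if not 0, would dominate a further member. The conclusion expresses that the family sums
  strongly to the identity, through finite subfamilies and finitely many vectors.\<close>

lemma exhaustion:
  fixes A Q :: "('h::chilbert_space \<Rightarrow>\<^sub>L 'h) set"
  assumes A: "von_neumann_algebra A" and Q: "\<And>f. f \<in> Q \<Longrightarrow> f \<in> A \<and> proj f"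
    and dom: "\<And>p. p \<in> A \<Longrightarrow> proj p \<Longrightarrow> p \<noteq> 0 \<Longrightarrow> \<exists>f\<in>Q. f \<noteq> 0 \<and> (\<forall>v. p (blinfun_apply f v) = f v)"
  shows "\<exists>S\<subseteq>Q. (\<forall>f\<in>S. \<forall>g\<in>S. f \<noteq> g \<longrightarrow> (\<forall>v. f (blinfun_apply g v) = 0)) \<and>
    (\<forall>G \<epsilon>. finite G \<and> \<epsilon> > 0 \<longrightarrow> (\<exists>F\<subseteq>S. finite F \<and> (\<forall>g\<in>G. norm (g - (\<Sum>F) g) < \<epsilon>)))"
proof -
  define orth where "orth S \<longleftrightarrow> (\<forall>f\<in>S. \<forall>g\<in>S. f \<noteq> g \<longrightarrow> (\<forall>v. f (blinfun_apply g v) = 0))" for S :: "('h \<Rightarrow>\<^sub>L 'h) set"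
  define \<A> where "\<A> = {S. S \<subseteq> Q \<and> orth S}"
  have "\<exists>S\<in>\<A>. \<forall>X\<in>\<A>. S \<subseteq> X \<longrightarrow> X = S"
  proof (rule subset_Zorn')
    fix \<C> assume c: "subset.chain \<A> \<C>"
    have "orth (\<Union>\<C>)"
      unfolding orth_def
    proof (intro ballI impI allI)
      fix f g v assume f: "f \<in> \<Union>\<C>" and g: "g \<in> \<Union>\<C>" and ne: "f \<noteq> g"
      obtain X Y where X: "X \<in> \<C>" "f \<in> X" and Y: "Y \<in> \<C>" "g \<in> Y" using f g by blast
      have "X \<subseteq> Y \<or> Y \<subseteq> X" using c X Y by (auto simp: subset.chain_def)
      then obtain Z where "Z \<in> \<C>" "f \<in> Z" "g \<in> Z" using X Y by blast
      moreover have "orth Z" using c \<open>Z \<in> \<C>\<close> by (auto simp: subset.chain_def \<A>_def)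
      ultimately show "f (g v) = 0" using ne by (simp add: orth_def)
    qed
    moreover have "\<Union>\<C> \<subseteq> Q" using c by (auto simp: subset.chain_def \<A>_def)
    ultimately show "\<Union>\<C> \<in> \<A>" by (simp add: \<A>_def)
  qed
  then obtain S where S: "S \<subseteq> Q" "orth S" and max: "\<And>X. X \<subseteq> Q \<Longrightarrow> orth X \<Longrightarrow> S \<subseteq> X \<Longrightarrow> X = S"
    by (auto simp: \<A>_def)
  define V where "V = (\<Union>f\<in>S. range (blinfun_apply f))"
  have "c v \<in> V" if "c \<in> commutant A" "v \<in> V" for c v
    using that S(1) Q commutantD[of c A] by (auto simp: V_def) (metis rangeI subsetD)
  then obtain P where P: "P \<in> A" "proj P" "\<forall>v\<in>V. P v = v" "\<forall>v. blinfun_apply P v \<in> closure (cspan V)"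
    using vna_generated_proj[OF A, of V] by blast
  have PS: "P (blinfun_apply s v) = s v" if "s \<in> S" for s v using P(3) that by (auto simp: V_def)
  have P1: "id_blinfun - P = 0"
  proof (rule ccontr)
    assume "id_blinfun - P \<noteq> 0"
    then obtain f where f: "f \<in> Q" "f \<noteq> 0" "\<And>v. (id_blinfun - P) (f v) = f v"
      using dom[of "id_blinfun - P"] vna_diff[OF A vna_id[OF A] P(1)] proj_complement[OF P(2)] by blast
    have Pf: "P (f v) = 0" for v using f(3)[of v] by (simp add: blinfun.diff_left)
    have pf: "proj f" using Q f(1) by blast
    have sf: "s (f v) = 0" and fs: "f (blinfun_apply s v) = 0" if s: "s \<in> S" for s v
    proof -
      have ps: "proj s" using s S(1) Q by blast
      show fs: "f (s v) = 0" for v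
      proof (rule cinner_eqI)
        fix w
        have "cinner w (f (s v)) = cinner (f w) (P (s v))" by (simp add: PS[OF s] saD[OF proj_sa[OF pf]])
        also have "\<dots> = cinner (P (f w)) (s v)" by (simp add: saD[OF proj_sa[OF P(2)]])
        finally show "cinner w (f (s v)) = cinner w 0" by (simp add: Pf cinner.zero_left cinner.zero_right)
      qed
      show "s (f v) = 0"
      proof (rule cinner_eqI)
        fix w
        have "cinner w (s (f v)) = cinner (f (s w)) v" by (simp add: saD[OF proj_sa[OF pf]] saD[OF proj_sa[OF ps]])
        then show "cinner w (s (f v)) = cinner w 0" by (simp add: fs cinner.zero_left cinner.zero_right)
      qed
    qed
    have "orth (insert f S)" using S(2) sf fs unfolding orth_def by auto
    then have "insert f S = S" using S(1) f(1) by (intro max) auto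
    then have "f \<in> S" by blast
    then have "f v = 0" for v using PS[of f v] Pf[of v] by simp
    then have "f = 0" by (intro blinfun_eqI) simp
    then show False using f(2) by simp
  qed
  have Pv: "P v = v" for v
  proof -
    have "(id_blinfun - P) v = 0" unfolding P1 by simp
    then show ?thesis by (simp add: blinfun.diff_left)
  qed
  have pF: "proj (\<Sum>F)" "f \<in> F \<Longrightarrow> (\<Sum>F) (blinfun_apply f v) = f v" if F: "finite F" "F \<subseteq> S" for F f v
    using orth_sum_proj[OF F(1)] F(2) S Q unfolding orth_def by (metis subsetD)+
  \<comment> \<open>Stability under enlarging \<open>F\<close> lets the finite sets found for
    different vectors be united.\<close>
  have fin: "\<exists>F\<subseteq>S. finite F \<and> (\<forall>F'. finite F' \<longrightarrow> F \<subseteq> F' \<longrightarrow> F' \<subseteq> S \<longrightarrow> (\<Sum>F') x = x)" if "x \<in> cspan V" for x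
    using that
  proof (induction rule: complex_vector.span_induct_alt)
    case base
    show ?case by (intro exI[of _ "{}"]) (auto simp: blinfun.zero_right)
  next
    case (step c x y)
    obtain f w where f: "f \<in> S" "x = f w" using step(1) by (auto simp: V_def)
    obtain F where F: "F \<subseteq> S" "finite F" "\<And>F'. finite F' \<Longrightarrow> F \<subseteq> F' \<Longrightarrow> F' \<subseteq> S \<Longrightarrow> (\<Sum>F') y = y"
      using step(2) by blast
    have "(\<Sum>F') (c *\<^sub>C x + y) = c *\<^sub>C x + y" if F': "finite F'" "insert f F \<subseteq> F'" "F' \<subseteq> S" for F'
      using F(3)[of F'] F' pF(2)[OF F'(1,3), of f w] f(2)
        bounded_opsD[OF proj_bounded_ops[OF pF(1)[OF F'(1,3)]], of c x] by (simp add: blinfun.add_right)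
    then show ?case using F f(1) by (intro exI[of _ "insert f F"]) auto
  qed
  have one: "\<exists>F\<subseteq>S. finite F \<and> (\<forall>F'. finite F' \<longrightarrow> F \<subseteq> F' \<longrightarrow> F' \<subseteq> S \<longrightarrow> norm (g - (\<Sum>F') g) < \<epsilon>)" if e0: "\<epsilon> > 0" for g \<epsilon>
  proof -
    have "g \<in> closure (cspan V)" using P(4) Pv by metis
    then obtain x where x: "x \<in> cspan V" "dist x g < \<epsilon> / 2" using e0 closure_approachable[of g "cspan V"] by (metis half_gt_zero)
    obtain F where F: "F \<subseteq> S" "finite F" "\<And>F'. finite F' \<Longrightarrow> F \<subseteq> F' \<Longrightarrow> F' \<subseteq> S \<Longrightarrow> (\<Sum>F') x = x"
      using fin[OF x(1)] by blast
    have "norm (g - (\<Sum>F') g) < \<epsilon>" if F': "finite F'" "F \<subseteq> F'" "F' \<subseteq> S" for F'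
    proof -
      have "g - (\<Sum>F') g = (g - x) - (\<Sum>F') (g - x)" using F(3)[OF F'] by (simp add: blinfun.diff_right)
      also have "norm \<dots> \<le> norm (g - x) + norm ((\<Sum>F') (g - x))" by (rule norm_triangle_ineq4)
      also have "\<dots> \<le> norm (g - x) + norm (g - x)"
        by (intro add_left_mono proj_norm_le pF(1)[OF F'(1,3)])
      also have "\<dots> < \<epsilon>" using x(2) by (simp add: dist_norm norm_minus_commute)
      finally show ?thesis .
    qed
    then show ?thesis using F by blast
  qed
  have "\<exists>F\<subseteq>S. finite F \<and> (\<forall>g\<in>G. norm (g - (\<Sum>F) g) < \<epsilon>)" if G: "finite G" "\<epsilon> > 0" for G \<epsilon>
  proof -
    obtain Fg where Fg: "\<And>g. Fg g \<subseteq> S" "\<And>g. finite (Fg g)"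
        "\<And>g F'. finite F' \<Longrightarrow> Fg g \<subseteq> F' \<Longrightarrow> F' \<subseteq> S \<Longrightarrow> norm (g - (\<Sum>F') g) < \<epsilon>"
      using one[OF G(2)] by metis
    have "norm (g - (\<Sum>(\<Union>(Fg ` G))) g) < \<epsilon>" if "g \<in> G" for g
      using that G(1) Fg by (intro Fg(3)) auto
    then show ?thesis using G(1) Fg by (intro exI[of _ "\<Union>(Fg ` G)"]) auto
  qed
  then show ?thesis using S unfolding orth_def by (intro exI[of _ S]) auto
qed

section \<open>Averaging over the unitary group of a corner\<close>

lemma blinfun_eq_iff: "x = y \<longleftrightarrow> (\<forall>v. blinfun_apply x v = blinfun_apply y v)"
  by (auto intro: blinfun_eqI)

context weight
begin

text \<open>The unitary group of the corner \<open>q A q\<close>, each element extended by the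
  identity on the complement, so that its members are unitaries of \<open>A\<close>.\<close>

definition Uq :: "('h \<Rightarrow>\<^sub>L 'h) \<Rightarrow> ('h \<Rightarrow>\<^sub>L 'h) set" where
  "Uq q = {u \<in> unitary_group A. \<forall>v. u (v - q v) = v - q v}"

lemma unitaryD:
  assumes "u \<in> unitary_group A"
  shows "u \<in> A" "blinfun_apply (adj u) (blinfun_apply u v) = v" "blinfun_apply u (blinfun_apply (adj u) v) = v"
    "norm (blinfun_apply u v) = norm v" "u \<in> bounded_ops"
proof -
  show uA: "u \<in> A" and 1: "adj u (u v) = v" and "u (adj u v) = v" for v
    using assms unfolding unitary_group_def
    by (auto simp flip: blinfun_apply_blinfun_compose)
  show bu: "u \<in> bounded_ops" by (rule Abo[OF uA])
  have "(norm (u v))\<^sup>2 = (norm v)\<^sup>2"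
    using cinner_adj_right[OF bu, of v "u v"] by (simp add: norm_sq_cinner 1)
  then show "norm (u v) = norm v" by simp
qed

lemma unitary_adj: "u \<in> unitary_group A \<Longrightarrow> adj u \<in> unitary_group A"
  using unitaryD[of u] vna_adj[OF A] by (auto simp: unitary_group_def)

lemma unitary_comp: "u \<in> unitary_group A \<Longrightarrow> w \<in> unitary_group A \<Longrightarrow> u o\<^sub>L w \<in> unitary_group A"
  unfolding unitary_group_def[of A]
  by (auto simp: vna_comp[OF A] adj_comp Abo blinfun_eq_iff)

lemma unitary_id: "id_blinfun \<in> unitary_group A"
  using vna_id[OF A] by (simp add: unitary_group_def sa_adj[OF sa_id] blinfun_eq_iff)

lemma UqD:
  assumes "u \<in> Uq q"
  shows "u \<in> unitary_group A" "blinfun_apply u (v - q v) = v - blinfun_apply q v"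
  using assms by (auto simp: Uq_def)

lemma Uq_A: "u \<in> Uq q \<Longrightarrow> u \<in> A"
  by (simp add: Uq_def unitary_group_def)

lemma Uq_id: "id_blinfun \<in> Uq q"
  by (simp add: Uq_def unitary_id)

lemma Uq_adj: assumes "u \<in> Uq q" shows "adj u \<in> Uq q"
  unfolding Uq_def
proof (intro CollectI conjI allI)
  show "adj u \<in> unitary_group A" by (rule unitary_adj[OF UqD(1)[OF assms]])
  show "adj u (v - q v) = v - q v" for v
    using unitaryD(2)[OF UqD(1)[OF assms], of "v - q v"] by (simp add: UqD(2)[OF assms])
qed

lemma Uq_comp: "u \<in> Uq q \<Longrightarrow> w \<in> Uq q \<Longrightarrow> u o\<^sub>L w \<in> Uq q"
  by (simp add: Uq_def unitary_comp)

lemma Uq_commutes: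
  assumes u: "u \<in> Uq q" and q: "proj q"
  shows "blinfun_apply u (q v) = blinfun_apply q (u v)"
proof -
  note uu = UqD(1)[OF u]
  have "u v - q (u v) = v - q v"
  proof (rule cinner_eqI)
    fix w
    have "cinner w (u v - q (u v)) = cinner (w - q w) (u v)"
      by (simp add: cinner.diff_left cinner.diff_right saD[OF proj_sa[OF q]])
    also have "\<dots> = cinner (adj u (w - q w)) v" by (simp add: cinner_adj_left unitaryD(5)[OF uu])
    also have "\<dots> = cinner (w - q w) v" by (simp add: UqD(2)[OF Uq_adj[OF u]])
    finally show "cinner w (u v - q (u v)) = cinner w (v - q v)"
      by (simp add: cinner.diff_left cinner.diff_right saD[OF proj_sa[OF q]])
  qed
  also have "\<dots> = u v - u (q v)" using UqD(2)[OF u, of v] by (simp add: blinfun.diff_right)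
  finally show ?thesis by simp
qed

text \<open>Averages are kept as maps, not as points of a convex hull: one and the same average must
  act on \<open>x\<close>, on squares and on the operator representing a value of \<open>E\<close>,
  and averages must compose.\<close>

inductive_set avg :: "('h \<Rightarrow>\<^sub>L 'h) \<Rightarrow> (('h \<Rightarrow>\<^sub>L 'h) \<Rightarrow> ('h \<Rightarrow>\<^sub>L 'h)) set" for q where
  avg_Ad: "u \<in> Uq q \<Longrightarrow> (\<lambda>x. u o\<^sub>L x o\<^sub>L adj u) \<in> avg q"
| avg_mix: "\<Phi> \<in> avg q \<Longrightarrow> \<Psi> \<in> avg q \<Longrightarrow> 0 \<le> t \<Longrightarrow> t \<le> 1 \<Longrightarrow> (\<lambda>x. t *\<^sub>R \<Phi> x + (1 - t) *\<^sub>R \<Psi> x) \<in> avg q"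

lemma avg_id: "(\<lambda>x. x) \<in> avg q"
proof -
  have "(\<lambda>x. id_blinfun o\<^sub>L x o\<^sub>L adj id_blinfun) = (\<lambda>x :: 'h \<Rightarrow>\<^sub>L 'h. x)"
    by (auto simp: sa_adj[OF sa_id] intro!: ext blinfun_eqI)
  then show ?thesis using avg_Ad[OF Uq_id, of q] by simp
qed

lemma avg_add: "\<Phi> \<in> avg q \<Longrightarrow> \<Phi> (x + y) = \<Phi> x + \<Phi> y"
  by (induction rule: avg.induct) (auto intro!: blinfun_eqI simp: blinfun.bilinear_simps algebra_simps)

lemma avg_scaleR: "\<Phi> \<in> avg q \<Longrightarrow> \<Phi> (r *\<^sub>R x) = r *\<^sub>R \<Phi> x"
  by (induction rule: avg.induct) (auto intro!: blinfun_eqI simp: blinfun.bilinear_simps algebra_simps)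

lemma avg_M: "\<Phi> \<in> avg q \<Longrightarrow> x \<in> M \<Longrightarrow> \<Phi> x \<in> M"
  by (induction rule: avg.induct)
    (auto intro!: vna_comp[OF M] vna_add[OF M] vna_scaleR[OF M] intro: AMD vna_adj[OF A] Uq_A)

lemma avg_pos: "\<Phi> \<in> avg q \<Longrightarrow> pos x \<Longrightarrow> pos (\<Phi> x)"
proof (induction rule: avg.induct)
  case (avg_Ad u)
  have bu: "u \<in> bounded_ops" using unitaryD(5)[OF UqD(1)[OF avg_Ad(1)]] .
  show ?case using pos_conj[OF avg_Ad(2) adj_bounded_ops[OF bu]] by (simp add: bu)
next
  case (avg_mix \<Phi> \<Psi> t)
  then show ?case by (intro pos_add pos_scaleR) auto
qed

lemma avg_norm: "\<Phi> \<in> avg q \<Longrightarrow> norm (\<Phi> x) \<le> norm x"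
proof (induction rule: avg.induct)
  case (avg_Ad u)
  note uu = UqD(1)[OF avg_Ad]
  show ?case
  proof (rule norm_blinfun_bound)
    fix v
    have "norm ((u o\<^sub>L x o\<^sub>L adj u) v) = norm (x (adj u v))" by (simp add: unitaryD(4)[OF uu])
    also have "\<dots> \<le> norm x * norm (adj u v)" by (rule norm_blinfun)
    finally show "norm ((u o\<^sub>L x o\<^sub>L adj u) v) \<le> norm x * norm v" by (simp add: unitaryD(4)[OF unitary_adj[OF uu]])
  qed simp
next
  case (avg_mix \<Phi> \<Psi> t)
  have "norm (t *\<^sub>R \<Phi> x + (1 - t) *\<^sub>R \<Psi> x) \<le> t * norm (\<Phi> x) + (1 - t) * norm (\<Psi> x)"
    using avg_mix(3,4) by (intro norm_triangle_le) simp
  also have "\<dots> \<le> t * norm x + (1 - t) * norm x"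
    using avg_mix by (intro add_mono mult_left_mono) auto
  finally show ?case by (simp add: algebra_simps)
qed

lemma avg_comp: "\<Phi> \<in> avg q \<Longrightarrow> \<Psi> \<in> avg q \<Longrightarrow> (\<lambda>x. \<Phi> (\<Psi> x)) \<in> avg q"
proof (induction rule: avg.induct)
  case (avg_Ad u)
  note u = avg_Ad(1)
  from avg_Ad(2) show ?case
  proof (induction rule: avg.induct)
    case (avg_Ad w)
    have b: "u \<in> bounded_ops" "w \<in> bounded_ops" using unitaryD(5) UqD(1) u avg_Ad by auto
    have "(\<lambda>x. u o\<^sub>L (w o\<^sub>L x o\<^sub>L adj w) o\<^sub>L adj u) = (\<lambda>x. (u o\<^sub>L w) o\<^sub>L x o\<^sub>L adj (u o\<^sub>L w))"
      by (auto simp: adj_comp b intro!: ext blinfun_eqI)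
    then show ?case using avg.avg_Ad[OF Uq_comp[OF u avg_Ad]] by simp
  next
    case (avg_mix \<Phi> \<Psi> t)
    have "(\<lambda>x. u o\<^sub>L (t *\<^sub>R \<Phi> x + (1 - t) *\<^sub>R \<Psi> x) o\<^sub>L adj u)
        = (\<lambda>x. t *\<^sub>R (u o\<^sub>L \<Phi> x o\<^sub>L adj u) + (1 - t) *\<^sub>R (u o\<^sub>L \<Psi> x o\<^sub>L adj u))"
      by (auto simp: blinfun.bilinear_simps intro!: ext blinfun_eqI)
    then show ?case using avg.avg_mix[OF avg_mix(5,6,3,4)] by simp
  qed
next
  case (avg_mix \<Phi> \<Phi>' t)
  then show ?case by (intro avg.avg_mix) auto
qed

lemma avg_corner:
  assumes \<Phi>: "\<Phi> \<in> avg q" and q: "proj q"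
    and x: "\<And>v. blinfun_apply x (q v) = x v" "\<And>v. blinfun_apply q (x v) = x v"
  shows "blinfun_apply (\<Phi> x) (q v) = \<Phi> x v" "blinfun_apply q (\<Phi> x v) = \<Phi> x v"
  using \<Phi>
proof (induction arbitrary: v rule: avg.induct)
  case (avg_Ad u)
  { case 1 then show ?case by (simp add: Uq_commutes[OF Uq_adj[OF avg_Ad] q] x)
  next
    case 2 then show ?case by (simp add: x flip: Uq_commutes[OF avg_Ad q]) }
qed (auto simp: blinfun.bilinear_simps)

text \<open>Kadison's inequality; for averages of unitary conjugations it is convexity of the
  squared norm.\<close>

lemma avg_kadison:
  "\<Phi> \<in> avg q \<Longrightarrow> x \<in> bounded_ops \<Longrightarrow> (norm (blinfun_apply (\<Phi> x) v))\<^sup>2 \<le> Re (cinner v (\<Phi> (adj x o\<^sub>L x) v))"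
proof (induction rule: avg.induct)
  case (avg_Ad u)
  note uu = UqD(1)[OF avg_Ad(1)]
  have "cinner v ((u o\<^sub>L (adj x o\<^sub>L x) o\<^sub>L adj u) v) = cinner (adj u v) (adj x (x (adj u v)))"
    by (simp add: cinner_adj_left unitaryD(5)[OF uu])
  also have "\<dots> = of_real ((norm (x (adj u v)))\<^sup>2)" by (simp add: cinner_adj_right avg_Ad(2) cinner_self)
  finally show ?case by (simp add: unitaryD(4)[OF uu])
next
  case (avg_mix \<Phi> \<Psi> t)
  let ?a = "\<Phi> x v" and ?b = "\<Psi> x v"
  have "norm (t *\<^sub>R ?a + (1 - t) *\<^sub>R ?b) \<le> t * norm ?a + (1 - t) * norm ?b"
    using avg_mix(3,4) by (intro norm_triangle_le) simp
  then have "(norm (t *\<^sub>R ?a + (1 - t) *\<^sub>R ?b))\<^sup>2 \<le> (t * norm ?a + (1 - t) * norm ?b)\<^sup>2"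
    by (intro power_mono) auto
  also have "\<dots> = t * (norm ?a)\<^sup>2 + (1 - t) * (norm ?b)\<^sup>2 - (t * (1 - t)) * (norm ?a - norm ?b)\<^sup>2"
    by (simp add: power2_eq_square algebra_simps)
  also have "\<dots> \<le> t * (norm ?a)\<^sup>2 + (1 - t) * (norm ?b)\<^sup>2" using avg_mix(3,4) by simp
  also have "\<dots> \<le> t * Re (cinner v (\<Phi> (adj x o\<^sub>L x) v)) + (1 - t) * Re (cinner v (\<Psi> (adj x o\<^sub>L x) v))"
    using avg_mix by (intro add_mono mult_left_mono) auto
  finally show ?case
    by (simp add: blinfun.bilinear_simps cinner.add_right cinner_scaleR_right)
qed

lemma e_Ad:
  assumes x: "x \<in> M" "pos x" and u: "u \<in> Uq q"
  shows "e (u o\<^sub>L x o\<^sub>L adj u) g = e x (adj u g)"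
  using e_conj[OF x vna_adj[OF A unitaryD(1)[OF UqD(1)[OF u]]], of g] unitaryD(5)[OF UqD(1)[OF u]] by simp

lemma avg_e_le:
  assumes "\<Phi> \<in> avg q" and x: "x \<in> M" "pos x" and le: "\<And>u. u \<in> Uq q \<Longrightarrow> e x (blinfun_apply u g) \<le> c"
  shows "e (\<Phi> x) g \<le> c"
  using assms(1)
proof (induction rule: avg.induct)
  case (avg_Ad u)
  then show ?case using le[OF Uq_adj] by (simp add: e_Ad[OF x])
next
  case (avg_mix \<Phi> \<Psi> t)
  have "e (t *\<^sub>R \<Phi> x + (1 - t) *\<^sub>R \<Psi> x) g = ennreal t * e (\<Phi> x) g + ennreal (1 - t) * e (\<Psi> x) g"
    using avg_mix x by (subst e_add) (auto simp: e_scale avg_M avg_pos intro!: vna_scaleR[OF M] pos_scaleR)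
  also have "\<dots> \<le> ennreal t * c + ennreal (1 - t) * c" using avg_mix by (intro add_mono mult_left_mono) auto
  also have "\<dots> = c" using avg_mix(3,4) by (simp flip: distrib_right ennreal_plus)
  finally show ?case .
qed

text \<open>\<open>E\<close> intertwines conjugation by elements of \<open>A\<close>, so averaging
  \<open>x\<close> averages the operator \<open>d\<close> that represents
  \<open>E x\<close>.\<close>

lemma avg_e_op:
  assumes \<Phi>: "\<Phi> \<in> avg q" and x: "x \<in> M" "pos x" and d: "pos d" "\<And>g. e x g = ennreal (Re (cinner g (blinfun_apply d g)))"
  shows "e (\<Phi> x) g = ennreal (Re (cinner g (\<Phi> d g)))"
  using \<Phi>
proof (induction rule: avg.induct)
  case (avg_Ad u)
  have bu: "u \<in> bounded_ops" using unitaryD(5)[OF UqD(1)[OF avg_Ad]] .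
  show ?case by (simp add: e_Ad[OF x avg_Ad] d cinner_adj_left[OF bu])
next
  case (avg_mix \<Phi> \<Psi> t)
  have "e (t *\<^sub>R \<Phi> x + (1 - t) *\<^sub>R \<Psi> x) g = ennreal t * e (\<Phi> x) g + ennreal (1 - t) * e (\<Psi> x) g"
    using avg_mix x by (subst e_add) (auto simp: e_scale avg_M avg_pos intro!: vna_scaleR[OF M] pos_scaleR)
  also have "\<dots> = ennreal (t * Re (cinner g (\<Phi> d g)) + (1 - t) * Re (cinner g (\<Psi> d g)))"
    using avg_mix posD[OF avg_pos[OF avg_mix(1) d(1)]] posD[OF avg_pos[OF avg_mix(2) d(1)]]
    by (simp add: ennreal_mult)
  finally show ?case by (simp add: blinfun.bilinear_simps cinner.add_right cinner_scaleR_right)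
qed

lemma avg_hull: "\<Phi> \<in> avg q \<Longrightarrow> \<Phi> x \<in> convex hull {u o\<^sub>L x o\<^sub>L adj u |u. u \<in> Uq q}"
proof (induction rule: avg.induct)
  case (avg_Ad u)
  then show ?case by (intro hull_inc) auto
next
  case (avg_mix \<Phi> \<Psi> t)
  then show ?case by (intro convexD[OF convex_convex_hull]) auto
qed

lemma avg_convex: "convex {\<Phi> x |\<Phi>. \<Phi> \<in> avg q}"
proof (rule convexI)
  fix a b and s t :: real assume a: "a \<in> {\<Phi> x |\<Phi>. \<Phi> \<in> avg q}" "b \<in> {\<Phi> x |\<Phi>. \<Phi> \<in> avg q}"
    and st: "0 \<le> s" "0 \<le> t" "s + t = 1"
  obtain \<Phi> \<Psi> where "a = \<Phi> x" "b = \<Psi> x" "\<Phi> \<in> avg q" "\<Psi> \<in> avg q" using a by blast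
  moreover have "t = 1 - s" using st by simp
  moreover have "(\<lambda>x. s *\<^sub>R \<Phi> x + (1 - s) *\<^sub>R \<Psi> x) \<in> avg q"
    using calculation st by (intro avg_mix) auto
  ultimately show "s *\<^sub>R a + t *\<^sub>R b \<in> {\<Phi> x |\<Phi>. \<Phi> \<in> avg q}"
    by (intro CollectI exI[of _ "\<lambda>x. s *\<^sub>R \<Phi> x + (1 - s) *\<^sub>R \<Psi> x"]) simp
qed

section \<open>Minimising over averages in a good corner\<close>

lemma e2_le_e:
  assumes "y \<in> M" "pos y" shows "e2 y g \<le> ennreal (norm y) * e y g"
proof -
  have "pos (norm y *\<^sub>R y - (adj y o\<^sub>L y))"
    using pos_norm_sq_le[OF assms(2)] Mbo[OF assms(1)]
    by (intro pos_by_form pos_sa pos_adj_comp pos_scaleR assms)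
      (simp_all add: blinfun.scaleR_left cinner_scaleR_right cinner_adj_right flip: norm_sq_cinner)
  then have "e2 y g \<le> e (norm y *\<^sub>R y) g"
    unfolding e2_def by (intro e_mono sq_M assms vna_scaleR[OF M])
  then show ?thesis by (simp add: e_scale assms)
qed

text \<open>\<open>good q h\<close>: for positive \<open>d \<in> qAq\<close>, if no average of \<open>d\<close> is bounded away from zero at all
  conjugates of the vector state of \<open>h\<close>, then \<open>d\<close> is small at all of them.\<close>

definition good :: "('h \<Rightarrow>\<^sub>L 'h) \<Rightarrow> 'h \<Rightarrow> bool" where
  "good q h \<longleftrightarrow> (\<forall>\<epsilon>>0. \<exists>\<delta>>0. \<forall>d\<in>A. pos d \<longrightarrow> norm d \<le> 1 \<longrightarrow> (\<forall>v. d (q v) = d v \<and> q (d v) = d v) \<longrightarrow>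
    (\<forall>\<Phi>\<in>avg q. \<exists>u\<in>Uq q. Re (cinner (u h) (\<Phi> d (u h))) < \<delta>) \<longrightarrow>
    (\<forall>u\<in>Uq q. Re (cinner (u h) (d (u h))) \<le> \<epsilon>))"

text \<open>\<open>\<gamma>\<close> is the infimum of \<open>\<nu>\<close> over the averages of
  \<open>x\<close>. For near minimisers \<open>a\<close>, \<open>b\<close> with midpoint
  \<open>m\<close>, every \<open>\<Phi> m\<close> is again an average of \<open>x\<close>, so its
  \<open>\<nu>\<close> is at least \<open>\<gamma>\<close>; the parallelogram identity under
  \<open>\<Phi>\<close> then makes \<open>\<Phi> D\<close>, with \<open>D\<close> the square of
  \<open>a - b\<close>, small at some conjugate of \<open>h\<close>. Goodness makes \<open>D\<close>
  small at \<open>h\<close>, and \<open>L2_complete\<close> provides a strong limit.\<close>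

lemma near_min:
  assumes s: "is_supp A q h" and good: "good q h" and x: "x \<in> M" "pos x"
    and xq: "\<And>v. blinfun_apply x (q v) = x v" "\<And>v. blinfun_apply q (x v) = x v"
    and bd: "\<And>g. e x g \<le> ennreal (C * (norm g)\<^sup>2)" and C: "0 \<le> C"
  shows "\<exists>y\<in>M. pos y \<and> (\<forall>v. y (q v) = y v) \<and> (\<forall>v. q (y v) = y v) \<and>
    (\<forall>u\<in>Uq q. \<forall>v. blinfun_apply u (y v) = y (blinfun_apply u v)) \<and>
    (\<exists>\<Phi>. (\<forall>n. \<Phi> n \<in> avg q) \<and> (\<forall>v. (\<lambda>n. \<Phi> n x v) \<longlonglongrightarrow> y v)) \<and>
    (\<forall>g. e2 y g \<le> ennreal (2 * (norm x * C * (norm g)\<^sup>2)))"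
proof -
  have qA: "q \<in> A" and pq: "proj q" and qh: "q h = h" using is_suppD[OF s] by auto
  define Y where "Y = {\<Phi> x |\<Phi>. \<Phi> \<in> avg q}"
  define K where "K = norm x * C"
  have K0: "K \<ge> 0" using C by (simp add: K_def)
  have YM: "y \<in> M" and Ypos: "pos y" and Ynorm: "norm y \<le> norm x"
    and Yq: "blinfun_apply y (q v) = y v" "blinfun_apply q (y v) = y v"
    and Ye: "e y g \<le> ennreal (C * (norm g)\<^sup>2)" if "y \<in> Y" for y v g
  proof -
    obtain \<Phi> where \<Phi>: "\<Phi> \<in> avg q" "y = \<Phi> x" using \<open>y \<in> Y\<close> by (auto simp: Y_def)
    show "y \<in> M" "pos y" "norm y \<le> norm x" "y (q v) = y v" "q (y v) = y v"
      using \<Phi> x avg_corner[OF \<Phi>(1) pq xq] by (auto simp: avg_M avg_pos avg_norm)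
    show "e y g \<le> ennreal (C * (norm g)\<^sup>2)"
      unfolding \<Phi>(2)
    proof (rule avg_e_le[OF \<Phi>(1) x])
      fix u assume "u \<in> Uq q"
      then show "e x (u g) \<le> ennreal (C * (norm g)\<^sup>2)" using bd[of "u g"] by (simp add: unitaryD(4)[OF UqD(1)])
    qed
  qed
  have Ye2: "e2 y g \<le> ennreal (K * (norm g)\<^sup>2)" if "y \<in> Y" for y g
  proof -
    have "e2 y g \<le> ennreal (norm y) * e y g" by (rule e2_le_e[OF YM Ypos]) (rule that)+
    also have "\<dots> \<le> ennreal (norm x) * ennreal (C * (norm g)\<^sup>2)"
      by (intro mult_mono Ye that ennreal_leI Ynorm) auto
    also have "\<dots> = ennreal (K * (norm g)\<^sup>2)" using C by (simp add: K_def mult.assoc flip: ennreal_mult)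
    finally show ?thesis .
  qed
  define K1 where "K1 = K * (norm h)\<^sup>2"
  have K10: "K1 \<ge> 0" using K0 by (simp add: K1_def)
  have Yu: "e2 y (u h) \<le> ennreal K1" if "y \<in> Y" "u \<in> Uq q" for y u
    using Ye2[OF that(1), of "u h"] by (simp add: K1_def unitaryD(4)[OF UqD(1)[OF that(2)]])
  \<comment> \<open>Unlike \<open>q2 y h\<close> alone, the supremum over the orbit does not change
    when \<open>y\<close> is conjugated by a member of \<open>Uq q\<close>.\<close>
  define \<nu> where "\<nu> y = (SUP u\<in>Uq q. q2 y (blinfun_apply u h))" for y
  have Une: "Uq q \<noteq> {}" using Uq_id by blast
  have bddu: "bdd_above ((\<lambda>u. q2 y (blinfun_apply u h)) ` Uq q)" if "y \<in> Y" for y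
    by (rule bdd_aboveI[of _ K1]) (use q2(2)[OF Yu[OF that] K10] in auto)
  have nu_ge: "q2 y (u h) \<le> \<nu> y" if "y \<in> Y" "u \<in> Uq q" for y u
    unfolding \<nu>_def by (rule cSUP_upper[OF that(2) bddu[OF that(1)]])
  have nu0: "0 \<le> \<nu> y" if "y \<in> Y" for y using nu_ge[OF that Uq_id] q2(3) order_trans by blast
  define \<gamma> where "\<gamma> = (INF y\<in>Y. \<nu> y)"
  have Yne: "Y \<noteq> {}" using avg_id by (auto simp: Y_def)
  have bddY: "bdd_below (\<nu> ` Y)" by (rule bdd_belowI[of _ 0]) (use nu0 in auto)
  have gam_le: "\<gamma> \<le> \<nu> y" if "y \<in> Y" for y unfolding \<gamma>_def by (rule cINF_lower[OF bddY that])
  have gam0: "0 \<le> \<gamma>" unfolding \<gamma>_def by (rule cINF_greatest[OF Yne nu0])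
  have close: "\<exists>\<epsilon>>0. \<forall>a\<in>Y. \<forall>b\<in>Y. \<nu> a \<le> \<gamma> + \<epsilon> \<longrightarrow> \<nu> b \<le> \<gamma> + \<epsilon> \<longrightarrow> e2 (a - b) h \<le> ennreal \<eta>"
    if eta: "\<eta> > 0" for \<eta>
  proof -
    \<comment> \<open>Rescales \<open>d\<close> to norm at most 1, as \<open>good\<close> requires;
      the summand 1 avoids division by 0.\<close>
    define K2 where "K2 = 4 * K + 1"
    have K2: "K2 > 0" using K0 by (simp add: K2_def)
    have "\<eta> / K2 > 0" using eta K2 by simp
    then obtain \<delta> where \<delta>: "\<delta> > 0" "\<And>d. d \<in> A \<Longrightarrow> pos d \<Longrightarrow> norm d \<le> 1 \<Longrightarrow> (\<forall>v. d (q v) = d v \<and> q (d v) = d v) \<Longrightarrow>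
        (\<forall>\<Phi>\<in>avg q. \<exists>u\<in>Uq q. Re (cinner (u h) (\<Phi> d (u h))) < \<delta>) \<Longrightarrow>
        (\<forall>u\<in>Uq q. Re (cinner (u h) (d (u h))) \<le> \<eta> / K2)"
      using good unfolding good_def by meson
    \<comment> \<open>The parallelogram identity will give \<open>r < 8 * \<epsilon>\<close>, hence
      \<open>r / K2 < \<delta>\<close>; the 16 leaves a factor 2 to spare.\<close>
    define \<epsilon> where "\<epsilon> = \<delta> * K2 / 16"
    have eps: "\<epsilon> > 0" using \<delta>(1) K2 by (simp add: \<epsilon>_def)
    have "e2 (a - b) h \<le> ennreal \<eta>" if a: "a \<in> Y" "\<nu> a \<le> \<gamma> + \<epsilon>" and b: "b \<in> Y" "\<nu> b \<le> \<gamma> + \<epsilon>" for a b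
    proof -
      have aM: "a \<in> M" "b \<in> M" using a b YM by auto
      have ba: "a \<in> bounded_ops" "b \<in> bounded_ops" using aM Mbo by auto
      have abM: "a - b \<in> M" by (intro vna_diff[OF M] aM)
      define D where "D = adj (a - b) o\<^sub>L (a - b)"
      have DM: "D \<in> M" "pos D" unfolding D_def by (intro sq_M abM)+
      have De: "e D g = e2 (a - b) g" for g by (simp add: D_def e2_def)
      have Dbd: "e D g \<le> ennreal (4 * K * (norm g)\<^sup>2)" for g
      proof -
        have "e2 (a - b) g \<le> 2 * e2 a g + 2 * e2 b g"
          using e2_parallelogram[OF aM, of g] by (metis le_iff_add add.commute)
        also have "\<dots> \<le> 2 * ennreal (K * (norm g)\<^sup>2) + 2 * ennreal (K * (norm g)\<^sup>2)"
          by (intro add_mono mult_left_mono Ye2 a b) auto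
        also have "\<dots> = ennreal (4 * K * (norm g)\<^sup>2)"
        proof -
          have "2 * ennreal r + 2 * ennreal r = ennreal (4 * r)" if "0 \<le> r" for r
            using that by (simp add: ennreal_mult flip: distrib_right)
          then show ?thesis using K0 by (simp add: mult.assoc)
        qed
        finally show ?thesis by (simp add: De)
      qed
      obtain d where d: "d \<in> A" "pos d" "\<And>g. e D g = ennreal (Re (cinner g (d g)))"
        using finite_if_bounded(2)[OF DM Dbd] K0 by auto
      have nd: "norm d \<le> 4 * K"
        using Dbd K0 by (intro pos_norm_le[OF d(2)]) (auto simp: d(3) ennreal_le_iff)
      have dq: "d (q v) = d v" "q (d v) = d v" for v
      proof -
        have "(a - b) o\<^sub>L q = a - b" using Yq(1)[OF a(1)] Yq(1)[OF b(1)] by (intro blinfun_eqI) (simp add: blinfun.diff_left)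
        then have "e D g = e D (q g)" for g using e2_comp_right[OF abM qA, of g] by (simp add: De)
        then have eq: "Re (cinner g (d g)) = Re (cinner (q g) (d (q g)))" for g
          using posD[OF d(2)] by (simp add: d(3))
        define w where "w = d - (q o\<^sub>L d o\<^sub>L q)"
        have "sa (q o\<^sub>L d o\<^sub>L q)"
          using pos_sa[OF pos_conj[OF d(2) Abo[OF qA]]] by (simp add: sa_adj[OF proj_sa[OF pq]])
        then have "w = 0"
          unfolding w_def by (intro sa_zero_form sa_diff pos_sa[OF d(2)])
            (simp_all add: blinfun.diff_left cinner.diff_right eq saD[OF proj_sa[OF pq]])
        then have deq: "d = q o\<^sub>L d o\<^sub>L q" by (simp add: w_def)
        have dqq: "d v = q (d (q v))" for v by (subst deq) simp
        have "d (q v) = q (d (q (q v)))" by (rule dqq)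
        also have "\<dots> = q (d (q v))" by (simp only: projD[OF pq])
        also have "\<dots> = d v" by (rule dqq[symmetric])
        finally show "d (q v) = d v" .
        have "q (d v) = q (q (d (q v)))" by (rule arg_cong[OF dqq])
        also have "\<dots> = q (d (q v))" by (rule projD[OF pq])
        also have "\<dots> = d v" by (rule dqq[symmetric])
        finally show "q (d v) = d v" .
      qed
      define d' where "d' = (1 / K2) *\<^sub>R d"
      have d'A: "d' \<in> A" "pos d'" unfolding d'_def using K2 by (auto intro!: vna_scaleR[OF A] d pos_scaleR)
      have "norm d' \<le> 1" using nd K2 K0 by (simp add: d'_def K2_def field_simps)
      moreover have "\<forall>v. d' (q v) = d' v \<and> q (d' v) = d' v"
        by (simp add: d'_def blinfun.bilinear_simps dq)
      moreover have "\<exists>u\<in>Uq q. Re (cinner (u h) (\<Phi> d' (u h))) < \<delta>" if \<Phi>: "\<Phi> \<in> avg q" for \<Phi>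
      proof -
        define m where "m = (1/2) *\<^sub>R (a + b)"
        have mM: "m \<in> M" unfolding m_def by (intro vna_scaleR[OF M] vna_add[OF M] aM)
        have bm: "m \<in> bounded_ops" using Mbo[OF mM] .
        have mY: "m \<in> Y"
          using convexD[OF avg_convex[of x q], of a b "1/2" "1/2"] a(1) b(1) by (simp add: Y_def m_def scaleR_add_right)
        have \<Phi>m: "\<Phi> m \<in> Y" using mY avg_comp[OF \<Phi>] by (auto simp: Y_def)
        \<comment> \<open>The near-extremal \<open>u\<close> depends on \<open>\<Phi>\<close>; this
          is why \<open>good\<close> lets the conjugate vary with the average.\<close>
        have "\<gamma> - \<epsilon> < \<nu> (\<Phi> m)" using gam_le[OF \<Phi>m] eps by simp
        then obtain u where u: "u \<in> Uq q" "\<gamma> - \<epsilon> < q2 (\<Phi> m) (u h)"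
          unfolding \<nu>_def using less_cSUP_iff[OF Une bddu[OF \<Phi>m]] by blast
        define g where "g = u h"
        have sqa: "e (\<Phi> (adj c o\<^sub>L c)) g \<le> ennreal (\<nu> c)" if c: "c \<in> Y" for c
        proof (rule avg_e_le[OF \<Phi> sq_M[OF YM[OF c]]])
          fix w assume w: "w \<in> Uq q"
          have "e (adj c o\<^sub>L c) (w g) = e2 c ((w o\<^sub>L u) h)" by (simp add: g_def e2_def)
          also have "\<dots> = ennreal (q2 c ((w o\<^sub>L u) h))" by (rule q2(1)[OF Yu[OF c Uq_comp[OF w u(1)]]])
          also have "\<dots> \<le> ennreal (\<nu> c)" by (intro ennreal_leI nu_ge c Uq_comp w u)
          finally show "e (adj c o\<^sub>L c) (w g) \<le> ennreal (\<nu> c)" .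
        qed
        \<comment> \<open>The parallelogram identity for operators, divided by 2.\<close>
        have id: "(adj m o\<^sub>L m) + (1/4) *\<^sub>R D = (1/2) *\<^sub>R (adj a o\<^sub>L a) + (1/2) *\<^sub>R (adj b o\<^sub>L b)"
        proof (rule blinfun_eqI)
          fix v
          have am: "adj m = (1/2) *\<^sub>R (adj a + adj b)"
            unfolding m_def by (simp add: scaleR_scaleC adj_scaleC adj_add ba)
          have "((adj m o\<^sub>L m) + (1/4) *\<^sub>R D) v
            = (1/4) *\<^sub>R ((adj a (a v) + adj a (b v) + adj b (a v) + adj b (b v)) + (adj a (a v) - adj a (b v) - adj b (a v) + adj b (b v)))"
            unfolding am D_def adj_diff[OF ba] by (simp add: m_def blinfun.bilinear_simps algebra_simps)
          also have "\<dots> = (1/4) *\<^sub>R (2 *\<^sub>R adj a (a v) + 2 *\<^sub>R adj b (b v))" by (simp add: scaleR_2)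
          finally show "((adj m o\<^sub>L m) + (1/4) *\<^sub>R D) v = ((1/2) *\<^sub>R (adj a o\<^sub>L a) + (1/2) *\<^sub>R (adj b o\<^sub>L b)) v"
            by (simp add: blinfun.bilinear_simps scaleR_add_right)
        qed
        have pM: "\<Phi> (adj m o\<^sub>L m) \<in> M" "pos (\<Phi> (adj m o\<^sub>L m))" "\<Phi> D \<in> M" "pos (\<Phi> D)"
          "\<Phi> (adj a o\<^sub>L a) \<in> M" "pos (\<Phi> (adj a o\<^sub>L a))" "\<Phi> (adj b o\<^sub>L b) \<in> M" "pos (\<Phi> (adj b o\<^sub>L b))"
          by (auto intro!: avg_M[OF \<Phi>] avg_pos[OF \<Phi>] sq_M mM DM aM)
        define r where "r = Re (cinner g (\<Phi> d g))"
        have r0: "0 \<le> r" unfolding r_def by (rule posD[OF avg_pos[OF \<Phi> d(2)]])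
        have eD: "e (\<Phi> D) g = ennreal r" unfolding r_def by (rule avg_e_op[OF \<Phi> DM d(2,3)])
        \<comment> \<open>Kadison's inequality replaces the average of the square of
          \<open>m\<close> by the square of \<open>\<Phi> m\<close>, an element of \<open>Y\<close>,
          where the lower bound \<open>\<gamma>\<close> is available.\<close>
        have "e2 (\<Phi> m) g \<le> e (\<Phi> (adj m o\<^sub>L m)) g"
          unfolding e2_def
        proof (intro e_mono sq_M YM[OF \<Phi>m] pM)
          show "pos (\<Phi> (adj m o\<^sub>L m) - (adj (\<Phi> m) o\<^sub>L \<Phi> m))"
            using avg_kadison[OF \<Phi> bm] Mbo[OF YM[OF \<Phi>m]]
            by (intro pos_by_form pos_sa pM pos_adj_comp)
              (auto simp: sq_form simp del: blinfun_apply_blinfun_compose)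
        qed
        then have "ennreal (q2 (\<Phi> m) g) + ennreal (r / 4) \<le> e (\<Phi> (adj m o\<^sub>L m)) g + e ((1/4) *\<^sub>R \<Phi> D) g"
          using q2(1)[OF Yu[OF \<Phi>m u(1)]] r0 e_scale[OF _ pM(3,4), of "1/4" g]
          by (intro add_mono) (auto simp: g_def[symmetric] eD simp flip: ennreal_mult)
        also have "\<dots> = e (\<Phi> (adj m o\<^sub>L m) + (1/4) *\<^sub>R \<Phi> D) g"
          by (intro e_add[symmetric] pM vna_scaleR[OF M] pos_scaleR) simp
        also have "\<Phi> (adj m o\<^sub>L m) + (1/4) *\<^sub>R \<Phi> D = (1/2) *\<^sub>R \<Phi> (adj a o\<^sub>L a) + (1/2) *\<^sub>R \<Phi> (adj b o\<^sub>L b)"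
          using arg_cong[OF id, of \<Phi>] by (simp add: avg_add[OF \<Phi>] avg_scaleR[OF \<Phi>])
        also have "e \<dots> g = ennreal (1/2) * e (\<Phi> (adj a o\<^sub>L a)) g + ennreal (1/2) * e (\<Phi> (adj b o\<^sub>L b)) g"
          by (subst e_add) (auto simp: e_scale pM intro!: vna_scaleR[OF M] pos_scaleR pM)
        also have "\<dots> \<le> ennreal (1/2) * ennreal (\<gamma> + \<epsilon>) + ennreal (1/2) * ennreal (\<gamma> + \<epsilon>)"
          using sqa[OF a(1)] sqa[OF b(1)] ennreal_leI[OF a(2)] ennreal_leI[OF b(2)]
          by (intro add_mono mult_left_mono) (auto elim: order_trans)
        also have "\<dots> = ennreal (\<gamma> + \<epsilon>)"
        proof -
          have "ennreal (1/2) * ennreal k + ennreal (1/2) * ennreal k = ennreal k" if "0 \<le> k" for k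
            using that by (metis ennreal_mult ennreal_plus field_sum_of_halves mult_2 times_divide_eq_left
                divide_nonneg_nonneg zero_le_numeral mult_1 zero_le_one)
          then show ?thesis using gam0 eps by (meson add_nonneg_nonneg less_imp_le)
        qed
        finally have "q2 (\<Phi> m) g + r / 4 \<le> \<gamma> + \<epsilon>"
          using r0 q2(3) gam0 eps by (simp add: ennreal_le_iff flip: ennreal_plus)
        then have "r < 8 * \<epsilon>" using u(2) by (simp add: g_def)
        then have "r / K2 < \<delta>" using K2 \<delta>(1) r0 by (simp add: \<epsilon>_def field_simps)
        then have "Re (cinner (u h) (\<Phi> d' (u h))) < \<delta>"
          unfolding d'_def by (simp add: avg_scaleR[OF \<Phi>] blinfun.scaleR_left cinner_scaleR_right r_def g_def)
        then show ?thesis using u(1) by blast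
      qed
      ultimately have "\<forall>u\<in>Uq q. Re (cinner (u h) (d' (u h))) \<le> \<eta> / K2" by (intro \<delta>(2) d'A) auto
      from bspec[OF this Uq_id] have "Re (cinner h (d h)) \<le> \<eta>"
        using K2 by (simp add: d'_def blinfun.scaleR_left cinner_scaleR_right field_simps)
      then show ?thesis using d(3)[of h] De[of h] by (simp add: ennreal_leI)
    qed
    then show ?thesis using eps by blast
  qed
  have "\<exists>\<epsilon>>0. \<forall>a\<in>Y. \<forall>b\<in>Y. \<nu> a \<le> \<gamma> + \<epsilon> \<longrightarrow> \<nu> b \<le> \<gamma> + \<epsilon> \<longrightarrow> e2 (a - b) h \<le> ennreal ((1/8)^n)" for n :: nat
    by (rule close) simp
  then obtain \<epsilon> where \<epsilon>: "\<And>n::nat. \<epsilon> n > 0" "\<And>n a b. a \<in> Y \<Longrightarrow> b \<in> Y \<Longrightarrow> \<nu> a \<le> \<gamma> + \<epsilon> n \<Longrightarrow> \<nu> b \<le> \<gamma> + \<epsilon> n \<Longrightarrow> e2 (a - b) h \<le> ennreal ((1/8)^n)"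
    by metis
  \<comment> \<open>Decreasing thresholds, so that two consecutive terms are both within the
    tolerance \<open>\<epsilon> n\<close>.\<close>
  define \<epsilon>' where "\<epsilon>' n = Min (\<epsilon> ` {..n})" for n
  have eps': "\<epsilon>' n > 0" "\<epsilon>' n \<le> \<epsilon> n" "\<epsilon>' (Suc n) \<le> \<epsilon> n" for n
    unfolding \<epsilon>'_def using \<epsilon>(1) by auto
  have seq: "\<exists>z\<in>M. \<forall>v. (\<lambda>n. y n v) \<longlonglongrightarrow> blinfun_apply z v"
    if y: "\<And>n. y n \<in> Y" "\<And>n. \<nu> (y n) \<le> \<gamma> + \<epsilon>' n" for y
  proof -
    have "e2 (y (Suc n) - y n) h \<le> ennreal ((1/8)^n)" for n
      using y(2)[of n] y(2)[of "Suc n"] eps'(2,3)[of n] by (intro \<epsilon>(2) y) auto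
    then obtain z where "z \<in> M" "\<forall>v. (\<lambda>n. y n (q v)) \<longlonglongrightarrow> blinfun_apply z v"
      using L2_complete[of y "norm x", OF YM[OF y(1)] Ynorm[OF y(1)] s] by blast
    then show ?thesis using Yq(1)[OF y(1)] by auto
  qed
  have "\<exists>y\<in>Y. \<nu> y < \<gamma> + \<epsilon>' n" for n
    using cINF_less_iff[OF Yne bddY, of "\<gamma> + \<epsilon>' n"] eps'(1)[of n] unfolding \<gamma>_def by simp
  then obtain y where y: "\<And>n. y n \<in> Y" "\<And>n. \<nu> (y n) < \<gamma> + \<epsilon>' n" by metis
  obtain z where z: "z \<in> M" "\<And>v. (\<lambda>n. y n v) \<longlonglongrightarrow> blinfun_apply z v"
    using seq[of y] y less_imp_le by metis
  have comm: "u (z v) = z (u v)" if u: "u \<in> Uq q" for u v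
  proof -
    note uu = UqD(1)[OF u]
    have bu: "u \<in> bounded_ops" using unitaryD(5)[OF uu] .
    define Ad where "Ad w = u o\<^sub>L w o\<^sub>L adj u" for w
    have AdY: "Ad w \<in> Y" if "w \<in> Y" for w using that avg_comp[OF avg_Ad[OF u]] by (auto simp: Y_def Ad_def)
    have "\<nu> (Ad w) \<le> \<nu> w" if w: "w \<in> Y" for w
      unfolding \<nu>_def[of "Ad w"]
    proof (rule cSUP_least[OF Une])
      fix k assume k: "k \<in> Uq q"
      have bw: "w \<in> bounded_ops" using Mbo[OF YM[OF w]] .
      have "adj (Ad w) o\<^sub>L Ad w = u o\<^sub>L (adj w o\<^sub>L w) o\<^sub>L adj u"
        by (rule blinfun_eqI) (simp add: Ad_def adj_comp bu bw unitaryD(2)[OF uu])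
      then have "e2 (Ad w) (k h) = e2 w ((adj u o\<^sub>L k) h)"
        by (simp add: e2_def e_Ad[OF sq_M[OF YM[OF w]] u])
      then show "q2 (Ad w) (k h) \<le> \<nu> w" using nu_ge[OF w Uq_comp[OF Uq_adj[OF u] k]] by (simp add: q2_def)
    qed
    \<comment> \<open>Conjugates of near minimisers are near minimisers. So the alternating sequence
      converges too, which identifies the limits of its two halves and makes \<open>z\<close>
      commute with \<open>u\<close>.\<close>
    define x' where "x' n = (if even n then y n else Ad (y n))" for n
    have "x' n \<in> Y" "\<nu> (x' n) \<le> \<gamma> + \<epsilon>' n" for n
      using y(1)[of n] y(2)[of n] AdY[OF y(1)[of n]] \<open>\<And>w. w \<in> Y \<Longrightarrow> \<nu> (Ad w) \<le> \<nu> w\<close>[OF y(1)[of n]] by (auto simp: x'_def)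
    then obtain z' where z': "\<And>v. (\<lambda>n. x' n v) \<longlonglongrightarrow> blinfun_apply z' v" using seq[of x'] by blast
    have lim: "u (z (adj u v)) = z v" for v
    proof -
      have "(\<lambda>n. x' (2 * n) v) \<longlonglongrightarrow> z' v"
        using LIMSEQ_subseq_LIMSEQ[OF z'[of v], of "\<lambda>n. 2 * n"] by (simp add: strict_mono_def o_def)
      moreover have "(\<lambda>n. y (2 * n) v) \<longlonglongrightarrow> z v"
        using LIMSEQ_subseq_LIMSEQ[OF z(2)[of v], of "\<lambda>n. 2 * n"] by (simp add: strict_mono_def o_def)
      ultimately have "z' v = z v" using LIMSEQ_unique by (simp add: x'_def) blast
      moreover have "(\<lambda>n. x' (2 * n + 1) v) \<longlonglongrightarrow> z' v"
        using LIMSEQ_subseq_LIMSEQ[OF z'[of v], of "\<lambda>n. 2 * n + 1"] by (simp add: strict_mono_def o_def)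
      moreover have "(\<lambda>n. u (y (2 * n + 1) (adj u v))) \<longlonglongrightarrow> u (z (adj u v))"
        using LIMSEQ_subseq_LIMSEQ[OF z(2)[of "adj u v"], of "\<lambda>n. 2 * n + 1"]
        by (intro bounded_linear.tendsto[OF blinfun.bounded_linear_right]) (simp add: strict_mono_def o_def)
      ultimately show ?thesis using LIMSEQ_unique by (simp add: x'_def Ad_def) blast
    qed
    show ?thesis using lim[of "u v"] by (simp add: unitaryD(2)[OF uu])
  qed
  have saz: "sa z"
  proof (rule saI[OF Mbo[OF z(1)]])
    fix v w
    have "(\<lambda>n. cinner (y n v) w) \<longlonglongrightarrow> cinner (z v) w" by (intro cinner.tendsto z tendsto_const)
    moreover have "(\<lambda>n. cinner v (y n w)) \<longlonglongrightarrow> cinner v (z w)" by (intro cinner.tendsto z tendsto_const)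
    ultimately show "cinner (z v) w = cinner v (z w)"
      using LIMSEQ_unique by (simp add: saD[OF pos_sa[OF Ypos[OF y(1)]]])
  qed
  have posz: "pos z"
  proof (rule posI[OF saz])
    fix v
    have "(\<lambda>n. Re (cinner v (y n v))) \<longlonglongrightarrow> Re (cinner v (z v))" by (intro tendsto_Re cinner.tendsto tendsto_const z)
    then show "0 \<le> Re (cinner v (z v))" by (rule LIMSEQ_le_const) (use posD[OF Ypos[OF y(1)]] in blast)
  qed
  have zq: "z (q v) = z v" "q (z v) = z v" for v
  proof -
    have "(\<lambda>n. y n v) \<longlonglongrightarrow> z (q v)" using z(2)[of "q v"] by (simp add: Yq[OF y(1)])
    then show "z (q v) = z v" using z(2)[of v] LIMSEQ_unique by blast
    have "(\<lambda>n. q (y n v)) \<longlonglongrightarrow> q (z v)" by (intro bounded_linear.tendsto[OF blinfun.bounded_linear_right] z)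
    then show "q (z v) = z v" using z(2)[of v] LIMSEQ_unique by (simp add: Yq[OF y(1)]) blast
  qed
  \<comment> \<open>Strong limits are weak limits, so \<open>e2_lsc\<close> bounds \<open>z\<close>
    at every vector \<open>g\<close>, not only at \<open>h\<close>.\<close>
  have e2z: "e2 z g \<le> ennreal (2 * (norm x * C * (norm g)\<^sup>2))" for g
  proof (rule e2_lsc[where C = Y and R = "norm x"])
    show "convex Y" unfolding Y_def by (rule avg_convex)
    show "Y \<subseteq> M" using YM by blast
    show "e2 w g \<le> ennreal (norm x * C * (norm g)\<^sup>2)" if "w \<in> Y" for w using Ye2[OF that, of g] by (simp add: K_def)
    show "0 \<le> norm x * C * (norm g)\<^sup>2" using C by simp
    fix G :: "'h set" and \<epsilon> :: real assume G: "finite G" "\<epsilon> > 0"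
    have "\<forall>\<^sub>F n in sequentially. \<forall>g\<in>G. \<forall>g'\<in>G. cmod (cinner g ((y n - z) g')) < \<epsilon>"
    proof (intro eventually_ball_finite G ballI)
      fix a b
      have "(\<lambda>n. cmod (cinner a ((y n - z) b))) \<longlonglongrightarrow> cmod (cinner a (z b - z b))"
        unfolding blinfun.diff_left by (intro tendsto_norm cinner.tendsto tendsto_diff tendsto_const z)
      then show "\<forall>\<^sub>F n in sequentially. cmod (cinner a ((y n - z) b)) < \<epsilon>"
        using G(2) by (intro order_tendstoD(2)[where y = 0]) (simp_all add: cinner.zero_right)
    qed
    then obtain n where "\<forall>g\<in>G. \<forall>g'\<in>G. cmod (cinner g ((y n - z) g')) < \<epsilon>"
      by (auto simp: eventually_sequentially)
    then show "\<exists>w\<in>Y. \<forall>g\<in>G. \<forall>g'\<in>G. cmod (cinner g ((w - z) g')) < \<epsilon>" using y(1) by blast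
  qed (use Ynorm z in auto)
  have "\<forall>n. \<exists>\<Phi>. \<Phi> \<in> avg q \<and> y n = \<Phi> x" using y(1) by (auto simp: Y_def)
  then obtain \<Phi> where \<Phi>: "\<And>n. \<Phi> n \<in> avg q" "\<And>n. y n = \<Phi> n x" by metis
  have ex: "\<exists>\<Phi>. (\<forall>n. \<Phi> n \<in> avg q) \<and> (\<forall>v. (\<lambda>n. \<Phi> n x v) \<longlonglongrightarrow> z v)"
    using \<Phi> z(2) by (intro exI[of _ \<Phi>]) auto
  show ?thesis
    by (rule bexI[of _ z]) (use posz zq comm ex e2z z(1) in blast)+
qed

end

section \<open>From a corner to the relative commutant\<close>

lemma exhaust_bound_aux:
  assumes "finite F" "finite F'" "\<And>f. f \<in> F \<union> F' \<Longrightarrow> pos (T o\<^sub>L f)"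
  shows "pos ((T o\<^sub>L \<Sum>(F \<union> F')) - (T o\<^sub>L \<Sum>F))"
proof -
  have "\<Sum>(F \<union> F') = \<Sum>F + \<Sum>(F' - F)"
    using assms(1,2) sum.union_disjoint[of F "F' - F" "\<lambda>x. x"] by (simp add: Un_Diff_cancel)
  then have "(T o\<^sub>L \<Sum>(F \<union> F')) - (T o\<^sub>L \<Sum>F) = (\<Sum>f\<in>F' - F. T o\<^sub>L f)"
    by (intro blinfun_eqI) (simp add: blinfun.bilinear_simps blinfun.sum_left blinfun.sum_right)
  also have "pos \<dots>" using assms(3) by (intro pos_sum) auto
  finally show ?thesis .
qed

context weight
begin

text \<open>With \<open>s\<close> the square root of \<open>q - b^2\<close>, the operator
  \<open>u = b + i s + (1 - q)\<close> is in \<open>Uq q\<close>, and half of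
  \<open>u + adj u\<close> is \<open>b + (1 - q)\<close>. The summand \<open>1 - q\<close>
  disappears because \<open>y\<close> lives in the corner.\<close>

lemma commutes_sa_contraction:
  assumes qA: "q \<in> A" and pq: "proj q" and b: "b \<in> A" "sa b" "norm b \<le> 1"
    and bq: "\<And>v. blinfun_apply b (q v) = b v" "\<And>v. blinfun_apply q (b v) = b v"
    and comm: "\<And>u v. u \<in> Uq q \<Longrightarrow> blinfun_apply y (u v) = blinfun_apply u (y v)"
    and yq: "\<And>v. blinfun_apply y (q v) = y v" "\<And>v. blinfun_apply q (y v) = y v"
  shows "blinfun_apply y (b v) = b (y v)"
proof -
  have saq: "sa q" using proj_sa[OF pq] .
  define T where "T = q - (b o\<^sub>L b)"
  have T: "T v = q v - b (b v)" for v by (simp add: T_def blinfun.diff_left)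
  have TA: "T \<in> A" unfolding T_def by (intro vna_diff[OF A] vna_comp[OF A] qA b)
  have posT: "pos T"
  proof (rule posI)
    show "sa T" using pos_sa[OF pos_adj_comp[OF Abo[OF b(1)]]] unfolding T_def
      by (intro sa_diff saq) (simp add: sa_adj[OF b(2)])
    fix v
    have "norm (b v) \<le> norm b * norm (q v)" using norm_blinfun[of b "q v"] by (simp add: bq)
    also have "\<dots> \<le> 1 * norm (q v)" by (intro mult_right_mono b) simp
    finally have "(norm (b v))\<^sup>2 \<le> (norm (q v))\<^sup>2" by (intro power_mono) auto
    moreover have "cinner v (b (b v)) = of_real ((norm (b v))\<^sup>2)" by (simp add: cinner_self flip: saD[OF b(2)])
    ultimately show "0 \<le> Re (cinner v (T v))" by (simp add: T cinner.diff_right proj_form[OF pq])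
  qed
  obtain s where s: "pos s" "\<And>v. s (s v) = T v" "dcomm T s" using sqrt_exists[OF posT] by blast
  have sas: "sa s" using s(1) by (rule pos_sa)
  have sA: "s \<in> A" by (rule vna_dcomm[OF A TA s(3)])
  have sb: "b (s v) = s (b v)" for v
    by (rule dcommD[OF s(3) Abo[OF b(1)]]) (simp add: T blinfun.diff_right bq)
  have s0: "s (v - q v) = 0" for v
  proof -
    have "T (v - q v) = 0" by (simp add: T blinfun.diff_right projD[OF pq] bq)
    then have "cinner (s (v - q v)) (s (v - q v)) = 0"
      by (simp add: saD[OF sas] s(2) cinner.zero_right)
    then show ?thesis by (simp add: cinner_self)
  qed
  have sq: "s (q v) = s v" for v using s0[of v] by (simp add: blinfun.diff_right)
  have qs: "q (s v) = s v" for v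
    by (rule cinner_eqI) (simp add: sq flip: saD[OF saq] saD[OF sas])
  define u where "u = b + \<i> *\<^sub>C s + (id_blinfun - q)"
  have bb: "b \<in> bounded_ops" "s \<in> bounded_ops" "q \<in> bounded_ops" using Abo b sA qA by auto
  have au: "adj u = b - \<i> *\<^sub>C s + (id_blinfun - q)"
    unfolding u_def
    by (simp add: adj_add adj_diff adj_scaleC bb sa_adj[OF b(2)] sa_adj[OF sas] sa_adj[OF saq] sa_adj[OF sa_id])
  have u: "u v = b v + \<i> *\<^sub>C s v + (v - q v)" and au': "adj u v = b v - \<i> *\<^sub>C s v + (v - q v)" for v
    unfolding au by (simp_all add: u_def blinfun.add_left blinfun.diff_left)
  have uA: "u \<in> A" unfolding u_def by (intro vna_add[OF A] vna_diff[OF A] vna_scaleC[OF A] vna_id[OF A] b sA qA)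
  have ii: "\<i> *\<^sub>C (\<i> *\<^sub>C w) = - w" for w :: 'h by (simp add: scaleC_scaleC scaleC_one)
  have ext: "b (b v) + s (s v) = q v" for v by (simp add: s(2) T)
  have sc: "x \<in> bounded_ops \<Longrightarrow> blinfun_apply x (\<i> *\<^sub>C w) = \<i> *\<^sub>C x w" for x :: "'h \<Rightarrow>\<^sub>L 'h" and w
    by (rule bounded_opsD)
  have bu: "b (u v) = b (b v) + \<i> *\<^sub>C s (b v)" and su: "s (u v) = s (b v) + \<i> *\<^sub>C s (s v)"
    and qu: "q (u v) = b v + \<i> *\<^sub>C s v" for v
    unfolding u blinfun.add_right blinfun.diff_right sc[OF bb(1)] sc[OF bb(2)] sc[OF bb(3)] bq sq qs sb projD[OF pq] by simp_all
  have bu': "b (adj u v) = b (b v) - \<i> *\<^sub>C s (b v)" and su': "s (adj u v) = s (b v) - \<i> *\<^sub>C s (s v)"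
    and qu': "q (adj u v) = b v - \<i> *\<^sub>C s v" for v
    unfolding au' blinfun.add_right blinfun.diff_right sc[OF bb(1)] sc[OF bb(2)] sc[OF bb(3)] bq sq qs sb projD[OF pq] by simp_all
  have "adj u (u v) = b (b v) + s (s v) + (v - q v)" for v
    unfolding au'[of "u v"] bu su qu complex_vector.scale_right_distrib ii by (simp add: u)
  moreover have "u (adj u v) = b (b v) + s (s v) + (v - q v)" for v
    unfolding u[of "adj u v"] bu' su' qu' complex_vector.scale_right_diff_distrib ii by (simp add: au')
  ultimately have uu: "adj u (u v) = v" "u (adj u v) = v" for v by (simp_all add: ext)
  have "adj u o\<^sub>L u = id_blinfun" "u o\<^sub>L adj u = id_blinfun" by (simp_all add: blinfun_eq_iff uu)
  moreover have "u (v - q v) = v - q v" for v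
    by (simp add: u blinfun.diff_right bq sq projD[OF pq] complex_vector.scale_zero_right)
  ultimately have "u \<in> Uq q" using uA by (simp add: Uq_def unitary_group_def)
  then have "y (u v + adj u v) = u (y v) + adj u (y v)" using comm[OF _ ] Uq_adj by (simp add: blinfun.add_right)
  moreover have "u w + adj u w = 2 *\<^sub>R b w + 2 *\<^sub>R (w - q w)" for w
    unfolding u au' by (simp add: scaleR_2)
  ultimately show ?thesis
    by (simp add: blinfun.add_right blinfun.diff_right blinfun.scaleR_right yq)
qed

text \<open>Splits the corner of \<open>a\<close> into self-adjoint parts and rescales each of them
  to a contraction.\<close>

lemma commutes_corner:
  assumes qA: "q \<in> A" and pq: "proj q" and by_: "y \<in> bounded_ops"
    and comm: "\<And>u v. u \<in> Uq q \<Longrightarrow> blinfun_apply y (u v) = blinfun_apply u (y v)"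
    and yq: "\<And>v. blinfun_apply y (q v) = y v" "\<And>v. blinfun_apply q (y v) = y v"
    and a: "a \<in> A"
  shows "blinfun_apply y (q (a (q v))) = q (blinfun_apply a (q (y v)))"
proof -
  have sacomm: "y (b v) = b (y v)" if b: "b \<in> A" "sa b"
    and bq: "\<And>v. blinfun_apply b (q v) = b v" "\<And>v. blinfun_apply q (b v) = b v" for b v
  proof -
    define n where "n = norm b + 1"
    have n: "n > 0" by (simp add: n_def add_nonneg_pos)
    have "y (((1/n) *\<^sub>R b) v) = ((1/n) *\<^sub>R b) (y v)"
    proof (rule commutes_sa_contraction[OF qA pq _ _ _ _ _ comm yq])
      show "(1/n) *\<^sub>R b \<in> A" "sa ((1/n) *\<^sub>R b)" by (auto intro: vna_scaleR[OF A] b sa_scaleR)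
      show "norm ((1/n) *\<^sub>R b) \<le> 1" using n by (simp add: n_def divide_simps)
    qed (simp_all add: blinfun.bilinear_simps bq)
    then have "(1/n) *\<^sub>R y (b v) = (1/n) *\<^sub>R b (y v)" by (simp add: blinfun.bilinear_simps)
    then show ?thesis using n by simp
  qed
  define c where "c = q o\<^sub>L a o\<^sub>L q"
  have cA: "c \<in> A" unfolding c_def by (intro vna_comp[OF A] a qA)
  have bc: "c \<in> bounded_ops" using Abo[OF cA] .
  have acA: "adj c \<in> A" by (rule vna_adj[OF A cA])
  have cq: "c (q v) = c v" "q (c v) = c v" for v by (simp_all add: c_def projD[OF pq])
  have adjc: "adj c = q o\<^sub>L adj a o\<^sub>L q"
    unfolding c_def by (rule blinfun_eqI) (simp add: adj_comp Abo a qA sa_adj[OF proj_sa[OF pq]])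
  have acq: "adj c (q v) = adj c v" "q (adj c v) = adj c v" for v by (simp_all add: adjc projD[OF pq])
  have 1: "y ((c + adj c) v) = (c + adj c) (y v)"
    by (rule sacomm) (auto simp: sa_iff_adj adj_add bc add.commute blinfun.bilinear_simps cq acq intro!: vna_add[OF A] cA acA)
  have "y ((\<i> *\<^sub>C (c - adj c)) v) = (\<i> *\<^sub>C (c - adj c)) (y v)"
    by (rule sacomm) (auto simp: sa_iff_adj adj_diff adj_scaleC bc blinfun.bilinear_simps cq acq
        bounded_opsD[OF Abo[OF qA]] complex_vector.scale_right_diff_distrib intro!: vna_scaleC[OF A] vna_diff[OF A] cA acA)
  then have "\<i> *\<^sub>C y ((c - adj c) v) = \<i> *\<^sub>C ((c - adj c) (y v))" by (simp add: bounded_opsD[OF by_])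
  then have "(- \<i>) *\<^sub>C (\<i> *\<^sub>C y ((c - adj c) v)) = (- \<i>) *\<^sub>C (\<i> *\<^sub>C ((c - adj c) (y v)))" by simp
  then have 2: "y ((c - adj c) v) = (c - adj c) (y v)" by (simp add: scaleC_scaleC scaleC_one)
  have p1: "y (c v) + y (adj c v) = c (y v) + adj c (y v)" using 1 by (simp add: blinfun.bilinear_simps)
  have p2: "y (c v) - y (adj c v) = c (y v) - adj c (y v)" using 2 by (simp add: blinfun.bilinear_simps)
  have "2 *\<^sub>R y (c v) = (y (c v) + y (adj c v)) + (y (c v) - y (adj c v))" by (simp add: scaleR_2)
  also have "\<dots> = 2 *\<^sub>R c (y v)" unfolding p1 p2 by (simp add: scaleR_2)
  finally show ?thesis by (simp add: c_def)
qed

text \<open>For an orthogonal family of such \<open>f\<close> that exhausts the identity, the finite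
  sums of \<open>T o\<^sub>L f\<close> increase to \<open>T\<close>, so normality applies. As
  \<open>T\<close> commutes with \<open>f\<close>, the weight of \<open>T o\<^sub>L f\<close> at
  \<open>h\<close> is that of \<open>T\<close> at \<open>f h\<close>, and the bounds add up by
  Pythagoras.\<close>

lemma exhaust_bound:
  assumes T: "T \<in> M" "pos T" "T \<in> commutant A" and C: "0 \<le> C"
    and dom: "\<And>p. p \<in> A \<Longrightarrow> proj p \<Longrightarrow> p \<noteq> 0 \<Longrightarrow> \<exists>f\<in>A. proj f \<and> f \<noteq> 0 \<and> (\<forall>v. p (f v) = f v) \<and>
      (\<forall>g. e T (f g) \<le> ennreal (C * (norm (blinfun_apply f g))\<^sup>2))"
  shows "e T h \<le> ennreal (C * (norm h)\<^sup>2)"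
proof -
  define Q where "Q = {f \<in> A. proj f \<and> (\<forall>g. e T (f g) \<le> ennreal (C * (norm (blinfun_apply f g))\<^sup>2))}"
  have "\<exists>S\<subseteq>Q. (\<forall>f\<in>S. \<forall>g\<in>S. f \<noteq> g \<longrightarrow> (\<forall>v. f (blinfun_apply g v) = 0)) \<and>
    (\<forall>G \<epsilon>. finite G \<and> \<epsilon> > 0 \<longrightarrow> (\<exists>F\<subseteq>S. finite F \<and> (\<forall>g\<in>G. norm (g - (\<Sum>F) g) < \<epsilon>)))"
    by (rule exhaustion[OF A]) (use dom in \<open>auto simp: Q_def\<close>, blast)
  then obtain S where S: "S \<subseteq> Q" "\<And>f g v. f \<in> S \<Longrightarrow> g \<in> S \<Longrightarrow> f \<noteq> g \<Longrightarrow> blinfun_apply f (g v) = 0"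
    "\<And>G \<epsilon>. finite G \<Longrightarrow> \<epsilon> > 0 \<Longrightarrow> \<exists>F\<subseteq>S. finite F \<and> (\<forall>g\<in>G. norm (g - (\<Sum>F) g) < \<epsilon>)" by metis
  have SA: "f \<in> A" "proj f" "e T (f g) \<le> ennreal (C * (norm (blinfun_apply f g))\<^sup>2)" if "f \<in> S" for f g
    using S(1) that by (auto simp: Q_def)
  have Tc: "T (f v) = f (T v)" if "f \<in> A" for f v by (rule commutantD[OF T(3) that])
  have bT: "T \<in> bounded_ops" and saT: "sa T" using T Mbo pos_sa by auto
  have Tf: "adj f o\<^sub>L T o\<^sub>L f = T o\<^sub>L f" if "f \<in> S" for f
    by (rule blinfun_eqI) (simp add: sa_adj[OF proj_sa[OF SA(2)[OF that]]] Tc[OF SA(1)[OF that]] projD[OF SA(2)[OF that]])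
  have TfM: "T o\<^sub>L f \<in> M" "pos (T o\<^sub>L f)" if "f \<in> S" for f
    using vna_comp[OF M T(1) AMD[OF SA(1)[OF that]]] pos_conj[OF T(2) Abo[OF SA(1)[OF that]]] Tf[OF that] by auto
  define D where "D = {T o\<^sub>L \<Sum>F |F. finite F \<and> F \<subseteq> S}"
  have TF: "T o\<^sub>L \<Sum>F = (\<Sum>f\<in>F. T o\<^sub>L f)" if "finite F" for F
    by (rule blinfun_eqI) (simp add: blinfun.sum_left blinfun.sum_right)
  have os: "proj (\<Sum>F)" "(\<Sum>f\<in>F. (norm (blinfun_apply f v))\<^sup>2) = (norm ((\<Sum>F) v))\<^sup>2" if "finite F" "F \<subseteq> S" for F v
    using orth_sum_proj(1,2)[of F] SA(2) S(2) that by (auto simp: subset_iff)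
  have sumA: "\<Sum>F \<in> A" if "F \<subseteq> S" for F using that SA(1) by (intro vna_sum[OF A]) auto
  have le: "e y h \<le> ennreal (C * (norm h)\<^sup>2)" if yD: "y \<in> D" for y
  proof -
    obtain F where F: "finite F" "F \<subseteq> S" "y = T o\<^sub>L \<Sum>F" using yD by (auto simp: D_def)
    have "e y h = (\<Sum>f\<in>F. e (T o\<^sub>L f) h)" unfolding F(3) TF[OF F(1)] using TfM F(2) by (intro e_sum) auto
    also have "\<dots> = (\<Sum>f\<in>F. e T (blinfun_apply f h))"
    proof (rule sum.cong[OF refl])
      fix f assume "f \<in> F"
      then have f: "f \<in> S" using F(2) by blast
      show "e (T o\<^sub>L f) h = e T (f h)" using e_conj[OF T(1,2) SA(1)[OF f], of h] by (simp only: Tf[OF f])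
    qed
    also have "\<dots> \<le> (\<Sum>f\<in>F. ennreal (C * (norm (blinfun_apply f h))\<^sup>2))" using SA(3) F(2) by (intro sum_mono) auto
    also have "\<dots> = ennreal (C * (norm ((\<Sum>F) h))\<^sup>2)"
      using C by (simp add: sum_ennreal os(2)[OF F(1,2), symmetric] sum_distrib_left)
    also have "\<dots> \<le> ennreal (C * (norm h)\<^sup>2)"
      using C os(1)[OF F(1,2)] by (intro ennreal_leI mult_left_mono power_mono proj_norm_le) auto
    finally show ?thesis .
  qed
  have "e T h = (SUP y\<in>D. e y h)"
  proof (rule e_sup)
    show "D \<subseteq> {y \<in> M. pos y}"
    proof
      fix y assume "y \<in> D"
      then obtain F where F: "finite F" "F \<subseteq> S" "y = T o\<^sub>L \<Sum>F" by (auto simp: D_def)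
      show "y \<in> {y \<in> M. pos y}" unfolding F(3) TF[OF F(1)] using TfM F(2) by (auto intro!: vna_sum[OF M] pos_sum)
    qed
    show "D \<noteq> {}" by (auto simp: D_def intro!: exI[of _ "{}"])
    show "\<exists>w\<in>D. pos (w - y) \<and> pos (w - z)" if yz: "y \<in> D" "z \<in> D" for y z
    proof -
      obtain F F' where F: "finite F" "F \<subseteq> S" "y = T o\<^sub>L \<Sum>F" "finite F'" "F' \<subseteq> S" "z = T o\<^sub>L \<Sum>F'"
        using yz by (auto simp: D_def)
      have "pos ((T o\<^sub>L \<Sum>(F \<union> F')) - y)" "pos ((T o\<^sub>L \<Sum>(F' \<union> F)) - z)"
        unfolding F(3,6) using F TfM(2) by (intro exhaust_bound_aux; auto)+
      then show ?thesis using F by (intro bexI[of _ "T o\<^sub>L \<Sum>(F \<union> F')"]) (auto simp: D_def Un_commute intro!: exI[of _ "F \<union> F'"])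
    qed
    show "T \<in> M" by (rule T(1))
    show "pos (T - y)" if yD: "y \<in> D" for y
    proof -
      obtain F where F: "finite F" "F \<subseteq> S" "y = T o\<^sub>L \<Sum>F" using yD by (auto simp: D_def)
      define r where "r = id_blinfun - \<Sum>F"
      have pr: "proj r" unfolding r_def by (rule proj_complement[OF os(1)[OF F(1,2)]])
      have rA: "r \<in> A" unfolding r_def by (intro vna_diff[OF A] vna_id[OF A] sumA F)
      have "adj r o\<^sub>L T o\<^sub>L r = T - y"
        by (rule blinfun_eqI) (simp add: sa_adj[OF proj_sa[OF pr]] Tc[OF rA] projD[OF pr] F(3),
          simp add: r_def blinfun.diff_left Tc[OF sumA[OF F(2)]])
      then show ?thesis using pos_conj[OF T(2) proj_bounded_ops[OF pr]] by simp
    qed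
    fix v and \<epsilon> :: real assume eps: "\<epsilon> > 0"
    have "\<epsilon> / (norm (T v) + 1) > 0" using eps by (simp add: add_nonneg_pos)
    then obtain F where F: "F \<subseteq> S" "finite F" "norm (v - (\<Sum>F) v) < \<epsilon> / (norm (T v) + 1)"
      using S(3)[of "{v}"] by auto
    have "Re (cinner v (T v)) - Re (cinner v ((T o\<^sub>L \<Sum>F) v)) = Re (cinner (T v) (v - (\<Sum>F) v))"
      by (simp add: cinner.diff_right saD[OF saT])
    also have "\<dots> \<le> norm (T v) * norm (v - (\<Sum>F) v)" by (rule CS_Re)
    also have "\<dots> \<le> norm (T v) * (\<epsilon> / (norm (T v) + 1))" using F(3) by (intro mult_left_mono) auto
    also have "\<dots> < \<epsilon>" using eps by (simp add: field_simps add_pos_nonneg)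
    finally show "\<exists>y\<in>D. Re (cinner v (T v)) < Re (cinner v (blinfun_apply y v)) + \<epsilon>"
      using F by (intro bexI[of _ "T o\<^sub>L \<Sum>F"]) (auto simp: D_def)
  qed
  then show ?thesis using le by (simp add: SUP_least)
qed

text \<open>A bounded element of \<open>(qAq)' \<inter> qMq\<close> has a spectral projection \<open>s\<close>; the projection onto the
  closed span of \<open>A s H\<close> lies in \<open>A' \<inter> M\<close>, has \<open>s\<close> as its corner at \<open>q\<close>, and is again bounded.\<close>

lemma central_extension:
  assumes qA: "q \<in> A" and pq: "proj q" and y: "y \<in> M" "pos y" "y \<noteq> 0"
    and comm: "\<And>u v. u \<in> Uq q \<Longrightarrow> blinfun_apply y (u v) = blinfun_apply u (y v)"
    and yq: "\<And>v. blinfun_apply y (q v) = y v" "\<And>v. blinfun_apply q (y v) = y v"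
    and bd: "\<And>g. e2 y g \<le> ennreal (C * (norm g)\<^sup>2)" and C: "0 \<le> C"
  shows "\<exists>T\<in>M. T \<in> commutant A \<and> pos T \<and> T \<noteq> 0 \<and> weight_finite_at A E T"
proof -
  have by_: "y \<in> bounded_ops" and say: "sa y" using y Mbo pos_sa by auto
  have saq: "sa q" using proj_sa[OF pq] .
  define w where "w = adj y o\<^sub>L y"
  have w: "w v = y (y v)" for v by (simp add: w_def sa_adj[OF say])
  have wM: "w \<in> M" and pw: "pos w" unfolding w_def by (intro sq_M y)+
  have form: "Re (cinner v (w v)) = (norm (y v))\<^sup>2" for v unfolding w_def by (rule sq_form[OF by_])
  obtain v0 where v0: "y v0 \<noteq> 0" using y(3) by (metis blinfun_eqI zero_blinfun.rep_eq)
  have nv0: "norm v0 > 0" using v0 by (metis blinfun.zero_right zero_less_norm_iff)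
  \<comment> \<open>Half the value of the form of \<open>w\<close> at the normalised
    \<open>v0\<close>, which keeps the spectral projection \<open>s\<close> nonzero.\<close>
  define t where "t = (norm (y v0))\<^sup>2 / (2 * (norm v0)\<^sup>2)"
  have t: "t > 0" using v0 nv0 by (simp add: t_def)
  obtain s where s: "proj s" "dcomm w s" "\<And>v. t * (norm (s v))\<^sup>2 \<le> Re (cinner v (w v))"
      "\<And>v. Re (cinner v (w v)) \<le> t * (norm (v - s v))\<^sup>2 + norm w * (norm (s v))\<^sup>2"
    using spectral_cut[OF pw, of t] by blast
  have s0: "s v0 \<noteq> 0"
  proof
    assume "s v0 = 0"
    then have "(norm (y v0))\<^sup>2 \<le> t * (norm v0)\<^sup>2" using s(4)[of v0] by (simp add: form)
    then show False using nv0 v0 by (simp add: t_def)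
  qed
  have sM: "s \<in> M" by (rule vna_dcomm[OF M wM s(2)])
  have sas: "sa s" using proj_sa[OF s(1)] .
  have sq: "s (q v) = s v" for v
  proof -
    have "w (v - q v) = 0" by (simp add: w blinfun.diff_right yq blinfun.zero_right)
    then have "t * (norm (s (v - q v)))\<^sup>2 \<le> 0" using s(3)[of "v - q v"] by (simp add: cinner.zero_right)
    then have "s (v - q v) = 0" using t by (simp add: mult_le_0_iff)
    then show ?thesis by (simp add: blinfun.diff_right)
  qed
  have qs: "q (s v) = s v" for v
    by (rule cinner_eqI) (simp add: sq flip: saD[OF saq] saD[OF sas])
  \<comment> \<open>\<open>y\<close> commutes with the corner \<open>q A q\<close>, hence so does
    its spectral projection \<open>s\<close>.\<close>
  have scomm: "s (q (a (q v))) = q (a (q (s v)))" if a: "a \<in> A" for a v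
  proof -
    define c where "c = q o\<^sub>L a o\<^sub>L q"
    have bc: "c \<in> bounded_ops" using Abo a qA by (simp add: c_def)
    have yc: "y (c v) = c (y v)" for v
      using commutes_corner[OF qA pq by_ comm yq a, of v] by (simp add: c_def)
    have "c (s v) = s (c v)" by (rule dcommD[OF s(2) bc]) (simp add: w yc)
    then show ?thesis by (simp add: c_def)
  qed
  have es: "e s g \<le> ennreal (C / t * (norm g)\<^sup>2)" for g
  proof -
    have ps: "pos s" by (rule proj_pos[OF s(1)])
    have "pos (w - t *\<^sub>R s)"
      using s(3) by (intro pos_by_form sa_scaleR sas pos_sa pw)
        (simp add: blinfun.scaleR_left cinner_scaleR_right proj_form[OF s(1)])
    then have "e (t *\<^sub>R s) g \<le> e w g" using t by (intro e_mono vna_scaleR[OF M] sM wM pos_scaleR ps) auto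
    also have "e w g = e2 y g" by (simp add: e2_def w_def)
    finally have le: "ennreal t * e s g \<le> ennreal (C * (norm g)\<^sup>2)"
      using bd[of g] t by (simp add: e_scale sM ps)
    have "e s g = ennreal (1/t) * (ennreal t * e s g)"
      using t by (simp add: mult.assoc[symmetric] flip: ennreal_mult)
    also have "\<dots> \<le> ennreal (1/t) * ennreal (C * (norm g)\<^sup>2)" by (intro mult_left_mono le) simp
    also have "\<dots> = ennreal (C / t * (norm g)\<^sup>2)" using t C by (simp flip: ennreal_mult)
    finally show ?thesis .
  qed
  define S where "S = {blinfun_apply a (s v) |a v. a \<in> A}"
  have CM: "von_neumann_algebra (commutant M)" by (rule vna_commutant[OF M])
  define N where "N = A \<union> commutant M"
  have N: "N \<subseteq> bounded_ops" "\<And>c. c \<in> N \<Longrightarrow> adj c \<in> N"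
    using Abo commutant_bo vna_adj[OF A] vna_adj[OF CM] by (auto simp: N_def)
  have invS: "c x \<in> S" if c: "c \<in> N" and x: "x \<in> S" for c x
  proof -
    obtain a v where a: "a \<in> A" "x = a (s v)" using x by (auto simp: S_def)
    show ?thesis
    proof (cases "c \<in> A")
      case True
      then have "c o\<^sub>L a \<in> A" by (intro vna_comp[OF A] a)
      then show ?thesis unfolding S_def a(2) by (intro CollectI exI[of _ "c o\<^sub>L a"] exI[of _ v]) simp
    next
      case False
      then have "c \<in> commutant M" using c by (simp add: N_def)
      then have "c x = a (s (c v))" using commutantD[of c M] AMD[OF a(1)] sM by (simp add: a(2))
      then show ?thesis using a(1) by (auto simp: S_def)
    qed
  qed
  obtain T where T: "proj T" "\<And>c v. c \<in> N \<Longrightarrow> c (T v) = T (c v)" "\<And>v. v \<in> S \<Longrightarrow> T v = v"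
    "\<And>y v. y \<in> bounded_ops \<Longrightarrow> (\<And>v. v \<in> S \<Longrightarrow> y v = 0) \<Longrightarrow> blinfun_apply y (T v) = 0"
    using generated_proj[OF N invS] by metis
  have bT: "T \<in> bounded_ops" using proj_bounded_ops[OF T(1)] .
  have saT: "sa T" using proj_sa[OF T(1)] .
  have pT: "pos T" by (rule proj_pos[OF T(1)])
  have TA: "T (a v) = a (T v)" if "a \<in> A" for a v using T(2)[of a v] that by (simp add: N_def)
  have TC: "T \<in> commutant A" by (rule commutantI[OF bT]) (rule TA)
  have TM: "T \<in> M" by (rule vna_memI[OF M bT]) (use T(2) in \<open>auto simp: N_def\<close>)
  have Ts: "T (s v) = s v" for v
    using T(3)[of "s v"] vna_id[OF A] by (force simp: S_def)
  have T0: "T \<noteq> 0" using Ts[of v0] s0 by auto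
  have sT: "s (T v) = s v" for v
    by (rule cinner_eqI) (simp add: Ts flip: saD[OF saT] saD[OF sas])
  \<comment> \<open>Since \<open>s\<close> commutes with \<open>q A q\<close>, the operator
    \<open>k\<close> kills every generator \<open>a (s v)\<close> and hence the range of
    \<open>T\<close>.\<close>
  have Tq: "T (q v) = s v" for v
  proof -
    define k where "k = (id_blinfun - s) o\<^sub>L q"
    have bk: "k \<in> bounded_ops" using Abo[OF qA] Mbo[OF sM] by (simp add: k_def)
    have "k (T v) = 0"
    proof (rule T(4)[OF bk])
      fix x assume "x \<in> S"
      then obtain a v where a: "a \<in> A" "x = a (s v)" by (auto simp: S_def)
      have "s (q (a (s v))) = q (a (s v))"
        using scomm[OF a(1), of "s v"] by (simp add: qs projD[OF s(1)])
      then show "k x = 0" by (simp add: k_def a(2) blinfun.diff_left)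
    qed
    then have "q (T v) = s (q (T v))" by (simp add: k_def blinfun.diff_left)
    then show ?thesis by (simp add: sq sT TA[OF qA])
  qed
  define C' where "C' = C / t"
  have C': "0 \<le> C'" using C t by (simp add: C'_def)
  have "\<exists>f\<in>A. proj f \<and> f \<noteq> 0 \<and> (\<forall>v. p (f v) = f v) \<and>
      (\<forall>g. e T (f g) \<le> ennreal (C' * (norm (blinfun_apply f g))\<^sup>2))" if p: "p \<in> A" "proj p" "p \<noteq> 0" for p
  proof (cases "\<forall>a\<in>A. \<forall>v. p (blinfun_apply a (q v)) = 0")
    \<comment> \<open>\<open>p\<close> is orthogonal to everything that \<open>A\<close> reaches
      from \<open>q\<close>, so it annihilates \<open>T\<close> and can itself serve as
      \<open>f\<close>.\<close>
    case True
    have "p (T v) = 0" for v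
    proof (rule T(4)[OF Abo[OF p(1)]])
      fix x assume "x \<in> S"
      then obtain a v where a: "a \<in> A" "x = a (s v)" by (auto simp: S_def)
      have "p (a (q (s v))) = 0" using True a(1) by blast
      then show "p x = 0" by (simp add: a(2) qs)
    qed
    then have "adj p o\<^sub>L T o\<^sub>L p = 0"
      by (intro blinfun_eqI) (simp add: sa_adj[OF proj_sa[OF p(2)]])
    then have "e T (p g) = 0" for g using e_conj[OF TM pT p(1), of g] by (simp add: e_zero)
    then show ?thesis using p by (intro bexI[of _ p]) (auto simp: projD)
  next
    \<comment> \<open>A partial isometry \<open>x\<close> in \<open>A\<close> from below
      \<open>q\<close> to below \<open>p\<close> carries the bound for \<open>s\<close> from its
      initial projection \<open>r\<close> to its final projection \<open>f\<close>.\<close>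
    case False
    then obtain a v1 where a: "a \<in> A" "p (blinfun_apply a (q v1)) \<noteq> 0" by blast
    define b where "b = p o\<^sub>L a o\<^sub>L q"
    have bA: "b \<in> A" unfolding b_def by (intro vna_comp[OF A] p a qA)
    have "b v1 \<noteq> 0" using a(2) by (simp add: b_def)
    then have b0: "b \<noteq> 0" by auto
    obtain x c k where x: "x \<in> A" "x \<noteq> 0" "pisom x" "\<And>v. x v = b (blinfun_apply c v)"
        "\<And>v. adj x (x v) = adj b (blinfun_apply k v)"
      using polar[OF A bA b0] by blast
    have bx: "x \<in> bounded_ops" using Abo[OF x(1)] .
    have px: "p (x v) = x v" for v by (simp add: x(4) b_def projD[OF p(2)])
    have adjb: "adj b v = q (adj a (p v))" for v
      by (simp add: b_def adj_comp Abo p a qA sa_adj[OF saq] sa_adj[OF proj_sa[OF p(2)]])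
    have qx: "q (adj x (x v)) = adj x (x v)" for v by (simp add: x(5) adjb projD[OF pq])
    have axA: "adj x \<in> A" by (rule vna_adj[OF A x(1)])
    define f where "f = x o\<^sub>L adj x"
    have fA: "f \<in> A" unfolding f_def by (intro vna_comp[OF A] x axA)
    have pf: "proj f" unfolding f_def by (rule pisomD(5)[OF x(3)])
    have f0: "f \<noteq> 0"
    proof
      assume "f = 0"
      then have "x (adj x (x v)) = 0" for v by (metis f_def blinfun_apply_blinfun_compose zero_blinfun.rep_eq)
      then have "x v = 0" for v by (simp add: pisomD(3)[OF x(3)])
      then show False using x(2) by (metis blinfun_eqI zero_blinfun.rep_eq)
    qed
    define r where "r = adj x o\<^sub>L x"
    have rA: "r \<in> A" unfolding r_def by (intro vna_comp[OF A] x axA)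
    have pr: "proj r" unfolding r_def by (rule pisomD(2)[OF x(3)])
    have sar: "sa r" using proj_sa[OF pr] .
    have qr: "q (r v) = r v" for v by (simp add: r_def qx)
    have rq: "r (q v) = r v" for v by (rule cinner_eqI) (simp add: qr flip: saD[OF saq] saD[OF sar])
    have rs: "s (r v) = r (s v)" for v using scomm[OF rA, of v] by (simp add: qr rq)
    have eT: "e T (x g) \<le> ennreal (C' * (norm (x g))\<^sup>2)" for g
    proof -
      have "adj x o\<^sub>L T o\<^sub>L x = adj r o\<^sub>L s o\<^sub>L r"
      proof (rule blinfun_eqI)
        fix v
        have "adj x (T (x v)) = T (r v)" by (simp add: r_def TA[OF x(1), symmetric] TA[OF axA])
        also have "\<dots> = s (r v)" using Tq[of "r v"] by (simp add: qr)
        also have "\<dots> = r (s (r v))" using rs[of "r v"] by (simp add: projD[OF pr])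
        finally show "(adj x o\<^sub>L T o\<^sub>L x) v = (adj r o\<^sub>L s o\<^sub>L r) v" by (simp add: sa_adj[OF sar])
      qed
      then have "e T (x g) = e s (r g)"
        using e_conj[OF TM pT x(1), of g] e_conj[OF sM proj_pos[OF s(1)] rA, of g] by simp
      also have "\<dots> \<le> ennreal (C' * (norm (r g))\<^sup>2)" using es[of "r g"] by (simp add: C'_def)
      also have "norm (r g) = norm (x g)" using pisom_norm[OF x(3), of g] by (simp add: r_def)
      finally show ?thesis .
    qed
    have "e T (f g) \<le> ennreal (C' * (norm (f g))\<^sup>2)" for g using eT[of "adj x g"] by (simp add: f_def)
    moreover have "p (f v) = f v" for v by (simp add: f_def px)
    ultimately show ?thesis using fA pf f0 by blast
  qed
  then have "e T h \<le> ennreal (C' * (norm h)\<^sup>2)" for h by (rule exhaust_bound[OF TM pT TC C'])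
  then have "weight_finite_at A E T" by (rule finite_if_bounded(1)[OF TM pT _ C'])
  then show ?thesis using TM TC pT T0 by blast
qed

end

section \<open>Every projection dominates a good corner\<close>

lemma proj_conj:
  assumes p: "proj p" and u: "u \<in> bounded_ops" and uu: "\<And>v. blinfun_apply u (adj u v) = v"
  shows "proj (adj u o\<^sub>L p o\<^sub>L u)"
  unfolding proj_def using pos_sa[OF pos_conj[OF proj_pos[OF p] u]] by (simp add: uu projD[OF p])

lemma proj_le_commute:
  assumes "proj p" "proj q" "\<And>v. blinfun_apply q (p v) = p v" shows "blinfun_apply p (q v) = p v"
  by (rule cinner_eqI) (simp add: assms(3) flip: saD[OF proj_sa[OF assms(1)]] saD[OF proj_sa[OF assms(2)]])

lemma proj_le_commute':
  assumes "proj p" "proj q" "\<And>v. blinfun_apply p (q v) = p v" shows "blinfun_apply q (p v) = p v"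
proof (rule cinner_eqI)
  fix w
  have "cinner w (q (p v)) = cinner (p (q w)) v"
    by (simp only: saD[OF proj_sa[OF assms(1)]] saD[OF proj_sa[OF assms(2)]])
  then show "cinner w (q (p v)) = cinner w (p v)"
    by (simp only: assms(3) saD[OF proj_sa[OF assms(1)]])
qed

section \<open>Sums of orthogonal partial isometries\<close>

lemma orth_series:
  fixes x :: "nat \<Rightarrow> 'h::chilbert_space \<Rightarrow>\<^sub>L 'h"
  assumes x: "\<And>i. pisom (x i)"
    and orth: "\<And>i j v. i \<noteq> j \<Longrightarrow> adj (x i) (x j v) = 0" "\<And>i j v. i \<noteq> j \<Longrightarrow> x i (adj (x j) v) = 0"
  shows "\<exists>L\<in>bounded_ops. \<forall>v. (\<lambda>n. \<Sum>i<n. x i v) \<longlonglongrightarrow> blinfun_apply L v"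
    "(norm (\<Sum>i\<in>F. x i v))\<^sup>2 = (\<Sum>i\<in>F. (norm (x i v))\<^sup>2)"
    "summable (\<lambda>i. (norm (x i v))\<^sup>2)"
proof -
  have bx: "x i \<in> bounded_ops" for i using pisomD(1)[OF x] .
  show nsq: "(norm (\<Sum>i\<in>F. x i v))\<^sup>2 = (\<Sum>i\<in>F. (norm (x i v))\<^sup>2)" for F v
  proof (cases "finite F")
    case True
    have "cinner (x i v) (x j v) = (if i = j then of_real ((norm (x i v))\<^sup>2) else 0)" for i j
      using cinner_adj_right[OF bx, of v i "x j v"] orth(1)[of i j v] by (auto simp: cinner_self cinner.zero_right)
    then have "cinner (\<Sum>i\<in>F. x i v) (\<Sum>j\<in>F. x j v) = (\<Sum>i\<in>F. of_real ((norm (x i v))\<^sup>2))"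
      using True by (simp add: cinner.sum_left cinner.sum_right)
    then show ?thesis by (simp add: norm_sq_cinner)
  qed simp
  define f where "f i = adj (x i) o\<^sub>L x i" for i
  have pf: "proj (f i)" for i unfolding f_def by (rule pisomD(2)[OF x])
  have fn: "norm (f i v) = norm (x i v)" for i v using pisom_norm[OF x, of i v] by (simp add: f_def)
  have fo: "f i (f j v) = 0" if "i \<noteq> j" for i j v using orth(2)[OF that] by (simp add: f_def blinfun.zero_right)
  have bessel: "(\<Sum>i<n. (norm (x i v))\<^sup>2) \<le> (norm v)\<^sup>2" for n v
  proof -
    have "cinner (f i v) (f j v) = (if i = j then of_real ((norm (x i v))\<^sup>2) else 0)" for i j
    proof (cases "i = j")
      case True then show ?thesis by (simp add: cinner_self fn)
    next
      case False then show ?thesis by (simp add: saD[OF proj_sa[OF pf]] fo cinner.zero_right)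
    qed
    then have "cinner (\<Sum>i<n. f i v) (\<Sum>j<n. f j v) = (\<Sum>i<n. of_real ((norm (x i v))\<^sup>2))"
      by (simp add: cinner.sum_left cinner.sum_right)
    then have 1: "(norm (\<Sum>i<n. f i v))\<^sup>2 = (\<Sum>i<n. (norm (x i v))\<^sup>2)" by (simp add: norm_sq_cinner)
    have "Re (cinner v (\<Sum>i<n. f i v)) = (\<Sum>i<n. (norm (x i v))\<^sup>2)"
      by (simp add: cinner.sum_right proj_form[OF pf] fn)
    then have "(norm (\<Sum>i<n. f i v))\<^sup>2 \<le> norm v * norm (\<Sum>i<n. f i v)" using CS_Re[of v "\<Sum>i<n. f i v"] 1 by simp
    then have "norm (\<Sum>i<n. f i v) \<le> norm v"
      by (cases "norm (\<Sum>i<n. f i v) = 0") (auto simp: power2_eq_square)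
    then show ?thesis using 1 by (metis norm_ge_zero power_mono)
  qed
  show sm: "summable (\<lambda>i. (norm (x i v))\<^sup>2)" for v
    by (rule bounded_imp_summable[where B = "(norm v)\<^sup>2"])
      (use bessel[of v "Suc _"] in \<open>auto simp: lessThan_Suc_atMost\<close>)
  have "convergent (\<lambda>n. \<Sum>i<n. x i v)" for v
  proof (rule Cauchy_convergent, rule metric_CauchyI)
    fix r :: real assume r: "r > 0"
    obtain N where N: "\<And>m n. m \<ge> N \<Longrightarrow> norm (\<Sum>i\<in>{m..<n}. (norm (x i v))\<^sup>2) < r\<^sup>2"
      using sm[of v] r unfolding summable_Cauchy by (metis zero_less_power)
    have less: "dist (\<Sum>i<m. x i v) (\<Sum>i<n. x i v) < r" if "N \<le> m" "m \<le> n" for m n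
    proof -
      have "(\<Sum>i<n. x i v) = (\<Sum>i<m. x i v) + (\<Sum>i\<in>{m..<n}. x i v)"
        using that(2) by (simp add: lessThan_atLeast0 sum.atLeastLessThan_concat)
      then have "dist (\<Sum>i<m. x i v) (\<Sum>i<n. x i v) = norm (\<Sum>i\<in>{m..<n}. x i v)" by (simp add: dist_norm)
      moreover have "(norm (\<Sum>i\<in>{m..<n}. x i v))\<^sup>2 < r\<^sup>2"
        unfolding nsq using N[OF that(1), of n] by simp
      then have "norm (\<Sum>i\<in>{m..<n}. x i v) < r" by (rule power2_less_imp_less) (use r in simp)
      ultimately show ?thesis by simp
    qed
    have "dist (\<Sum>i<m. x i v) (\<Sum>i<n. x i v) < r" if "N \<le> m" "N \<le> n" for m n
      using less[of m n] less[of n m] that by (cases "m \<le> n") (auto simp: dist_commute)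
    then show "\<exists>M. \<forall>m\<ge>M. \<forall>n\<ge>M. dist (\<Sum>i<m. x i v) (\<Sum>i<n. x i v) < r" by blast
  qed
  then obtain l where l: "\<And>v. (\<lambda>n. \<Sum>i<n. x i v) \<longlonglongrightarrow> l v" unfolding convergent_def by metis
  have "\<exists>y\<in>bounded_ops. \<forall>v. blinfun_apply y v = l v"
  proof (rule blinfun_from_linear[where K = 1])
    show "l (a + b) = l a + l b" for a b
      using LIMSEQ_unique[OF l[of "a + b"]] tendsto_add[OF l[of a] l[of b]]
      by (simp add: blinfun.add_right sum.distrib)
    show "l (k *\<^sub>C a) = k *\<^sub>C l a" for k a
    proof -
      have "(\<lambda>n. \<Sum>i<n. x i (k *\<^sub>C a)) = (\<lambda>n. k *\<^sub>C (\<Sum>i<n. x i a))"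
        by (simp add: bounded_opsD[OF bx] complex_vector.scale_sum_right)
      then show ?thesis
        using LIMSEQ_unique[OF l[of "k *\<^sub>C a"]] bounded_linear.tendsto[OF bounded_linear_scaleC l[of a], of k] by simp
    qed
    show "norm (l a) \<le> 1 * norm a" for a
    proof (rule LIMSEQ_le_const2[OF tendsto_norm[OF l[of a]]])
      have "norm (\<Sum>i<n. x i a) \<le> norm a" for n
        by (rule power2_le_imp_le) (simp_all add: nsq bessel)
      then show "\<exists>N. \<forall>n\<ge>N. norm (\<Sum>i<n. x i a) \<le> 1 * norm a" by simp
    qed
  qed
  then obtain L where L: "L \<in> bounded_ops" "\<And>v. blinfun_apply L v = l v" by blast
  have "(\<lambda>n. \<Sum>i<n. x i v) \<longlonglongrightarrow> blinfun_apply L v" for v unfolding L(2) by (rule l)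
  then show "\<exists>L\<in>bounded_ops. \<forall>v. (\<lambda>n. \<Sum>i<n. x i v) \<longlonglongrightarrow> blinfun_apply L v"
    using L(1) by blast
qed

text \<open>The series of adjoints converges as well, to \<open>adj L\<close>, and from this
  \<open>L\<close> is seen to be a partial isometry. The two norm identities let an inequality
  between squared norms pass from the terms to the sum.\<close>

lemma orth_series_pisom:
  fixes x :: "nat \<Rightarrow> 'h::chilbert_space \<Rightarrow>\<^sub>L 'h"
  assumes x: "\<And>i. pisom (x i)"
    and orth: "\<And>i j v. i \<noteq> j \<Longrightarrow> adj (x i) (x j v) = 0" "\<And>i j v. i \<noteq> j \<Longrightarrow> x i (adj (x j) v) = 0"
  shows "\<exists>L. pisom L \<and> (\<forall>v. (\<lambda>n. \<Sum>i<n. x i v) \<longlonglongrightarrow> blinfun_apply L v) \<and>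
    (\<forall>v. (\<lambda>n. \<Sum>i<n. adj (x i) v) \<longlonglongrightarrow> adj L v) \<and>
    (\<forall>i v. L (adj L (x i v)) = x i v) \<and> (\<forall>i v. adj L (L (adj (x i) v)) = adj (x i) v) \<and>
    (\<forall>v. (norm (L v))\<^sup>2 = (\<Sum>i. (norm (x i v))\<^sup>2)) \<and> (\<forall>v. (norm (adj L v))\<^sup>2 = (\<Sum>i. (norm (adj (x i) v))\<^sup>2))"
proof -
  have bx: "x i \<in> bounded_ops" for i using pisomD(1)[OF x] .
  have xa: "pisom (adj (x i))" for i by (rule pisom_adj[OF x])
  have orth': "i \<noteq> j \<Longrightarrow> adj (adj (x i)) (adj (x j) v) = 0" "i \<noteq> j \<Longrightarrow> adj (x i) (adj (adj (x j)) v) = 0" for i j v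
    using orth by (simp_all add: bx)
  obtain L where L: "L \<in> bounded_ops" "\<And>v. (\<lambda>n. \<Sum>i<n. x i v) \<longlonglongrightarrow> blinfun_apply L v"
    using orth_series(1)[where x = x, OF x orth] by blast
  obtain L' where L': "L' \<in> bounded_ops" "\<And>v. (\<lambda>n. \<Sum>i<n. adj (x i) v) \<longlonglongrightarrow> blinfun_apply L' v"
    using orth_series(1)[where x = "\<lambda>i. adj (x i)", OF xa orth'] by blast
  have aL: "adj L = L'"
  proof (rule adj_unique)
    fix v w
    have "(\<lambda>n. cinner (\<Sum>i<n. adj (x i) v) w) \<longlonglongrightarrow> cinner (L' v) w" by (intro cinner.tendsto L' tendsto_const)
    moreover have "(\<lambda>n. cinner (\<Sum>i<n. adj (x i) v) w) = (\<lambda>n. cinner v (\<Sum>i<n. x i w))"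
      by (simp add: cinner.sum_left cinner.sum_right cinner_adj_left bx)
    moreover have "(\<lambda>n. cinner v (\<Sum>i<n. x i w)) \<longlonglongrightarrow> cinner v (L w)" by (intro cinner.tendsto L tendsto_const)
    ultimately show "cinner (L' v) w = cinner v (L w)" using LIMSEQ_unique by metis
  qed
  have lim1: "blinfun_apply K v = z" if lim: "(\<lambda>n. \<Sum>i<n. y i) \<longlonglongrightarrow> blinfun_apply K v" and y: "\<And>i. y i = (if i = j then z else 0)"
    for K :: "'h \<Rightarrow>\<^sub>L 'h" and v z j and y :: "nat \<Rightarrow> 'h"
  proof -
    have "(\<lambda>n. \<Sum>i<Suc (n + j). y i) \<longlonglongrightarrow> K v"
      using LIMSEQ_ignore_initial_segment[OF lim, of "Suc j"] by simp
    moreover have "(\<Sum>i<Suc (n + j). y i) = z" for n unfolding y by (subst sum.delta) auto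
    ultimately have "(\<lambda>n::nat. z) \<longlonglongrightarrow> K v" by (simp only:)
    from LIMSEQ_unique[OF this tendsto_const] show ?thesis .
  qed
  have Lx: "L (adj (x j) v) = x j (adj (x j) v)" for j v
    by (rule lim1[OF L(2), where j = j]) (simp add: orth(2))
  have Lx': "L' (x j v) = adj (x j) (x j v)" for j v
    by (rule lim1[OF L'(2), where j = j]) (simp add: orth(1))
  have r1: "L (L' (x i v)) = x i v" for i v by (simp add: Lx Lx' pisomD(3)[OF x])
  have r2: "L' (L (adj (x i) v)) = adj (x i) v" for i v by (simp add: Lx Lx' pisomD(4)[OF x])
  have r3: "L' (L (L' v)) = L' v" for v
  proof -
    have "(\<lambda>n. L' (L (\<Sum>i<n. adj (x i) v))) \<longlonglongrightarrow> L' (L (L' v))"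
      by (intro bounded_linear.tendsto[OF blinfun.bounded_linear_right] L'(2))
    moreover have "L' (L (\<Sum>i<n. adj (x i) v)) = (\<Sum>i<n. adj (x i) v)" for n
      by (simp add: blinfun.sum_right r2)
    ultimately have "(\<lambda>n. \<Sum>i<n. adj (x i) v) \<longlonglongrightarrow> L' (L (L' v))" by (simp only:)
    from LIMSEQ_unique[OF this L'(2)] show ?thesis .
  qed
  have pL: "pisom L"
    unfolding pisom_def proj_def using L(1) pos_sa[OF pos_adj_comp[OF L(1)]] by (simp add: aL r3)
  have n: "(norm (blinfun_apply K v))\<^sup>2 = (\<Sum>i. (norm (y i v))\<^sup>2)"
    if "(\<lambda>n. \<Sum>i<n. blinfun_apply (y i) v) \<longlonglongrightarrow> blinfun_apply K v"
      "\<And>n. (norm (\<Sum>i<n. blinfun_apply (y i) v))\<^sup>2 = (\<Sum>i<n. (norm (y i v))\<^sup>2)" for K :: "'h \<Rightarrow>\<^sub>L 'h" and y v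
  proof -
    have "(\<lambda>i. (norm (y i v))\<^sup>2) sums (norm (K v))\<^sup>2"
      unfolding sums_def that(2)[symmetric] by (intro tendsto_power tendsto_norm that(1))
    then show ?thesis by (rule sums_unique)
  qed
  have nL: "(norm (L v))\<^sup>2 = (\<Sum>i. (norm (x i v))\<^sup>2)" for v by (rule n[OF L(2) orth_series(2)[where x = x, OF x orth]])
  have nL': "(norm (L' v))\<^sup>2 = (\<Sum>i. (norm (adj (x i) v))\<^sup>2)" for v
    by (rule n[OF L'(2) orth_series(2)[where x = "\<lambda>i. adj (x i)", OF xa orth']])
  show ?thesis
    by (rule exI[of _ L], unfold aL, intro conjI allI)
      (rule pL, rule L(2), rule L'(2), rule r1, rule r2, rule nL, rule nL')
qed

context weight
begin

section \<open>Two sufficient conditions for a good corner\<close>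

lemma avg_Ad_right: "\<Phi> \<in> avg q \<Longrightarrow> u \<in> Uq q \<Longrightarrow> (\<lambda>x. \<Phi> (u o\<^sub>L x o\<^sub>L adj u)) \<in> avg q"
  by (rule avg_comp[OF _ avg_Ad])

text \<open>It suffices to test \<open>good\<close> on projections, as \<open>d\<close> is comparable to its spectral projections,
  and at \<open>h\<close> itself, as \<open>p\<close> may be conjugated.\<close>

lemma good_by_proj:
  assumes qA: "q \<in> A" and pq: "proj q"
    and *: "\<And>\<epsilon>. \<epsilon> > 0 \<Longrightarrow> \<exists>\<delta>>0. \<forall>p\<in>A. proj p \<longrightarrow> (\<forall>v. q (p v) = p v) \<longrightarrow>
      (\<forall>\<Phi>\<in>avg q. \<exists>u\<in>Uq q. Re (cinner (u h) (\<Phi> p (u h))) < \<delta>) \<longrightarrow> (norm (p h))\<^sup>2 \<le> \<epsilon>"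
  shows "good q h"
  unfolding good_def
proof (intro allI impI)
  fix \<epsilon> :: real assume eps: "\<epsilon> > 0"
  \<comment> \<open>The part of \<open>d\<close> below the level \<open>t\<close> contributes at
    most \<open>\<epsilon> / 2\<close> at any conjugate of \<open>h\<close>; the summand 1 allows
    \<open>h = 0\<close>.\<close>
  define t where "t = \<epsilon> / (2 * ((norm h)\<^sup>2 + 1))"
  have t: "t > 0" using eps by (simp add: t_def add_nonneg_pos)
  have "t * (norm h)\<^sup>2 \<le> t * ((norm h)\<^sup>2 + 1)" using t by (intro mult_left_mono) auto
  also have "\<dots> = \<epsilon> / 2"
  proof -
    have "(norm h)\<^sup>2 + 1 > 0" by (simp add: add_nonneg_pos)
    then show ?thesis by (simp add: t_def field_simps)
  qed
  finally have th: "t * (norm h)\<^sup>2 \<le> \<epsilon> / 2" .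
  obtain \<delta> where \<delta>: "\<delta> > 0" "\<And>p. p \<in> A \<Longrightarrow> proj p \<Longrightarrow> (\<forall>v. q (p v) = p v) \<Longrightarrow>
      (\<forall>\<Phi>\<in>avg q. \<exists>u\<in>Uq q. Re (cinner (u h) (\<Phi> p (u h))) < \<delta>) \<Longrightarrow> (norm (p h))\<^sup>2 \<le> \<epsilon> / 2"
    using *[of "\<epsilon> / 2"] eps by auto
  show "\<exists>\<delta>>0. \<forall>d\<in>A. pos d \<longrightarrow> norm d \<le> 1 \<longrightarrow> (\<forall>v. d (q v) = d v \<and> q (d v) = d v) \<longrightarrow>
    (\<forall>\<Phi>\<in>avg q. \<exists>u\<in>Uq q. Re (cinner (u h) (\<Phi> d (u h))) < \<delta>) \<longrightarrow>
    (\<forall>u\<in>Uq q. Re (cinner (u h) (d (u h))) \<le> \<epsilon>)"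
  \<comment> \<open>\<open>d\<close> dominates \<open>t\<close> times its spectral projection, so a
    threshold \<open>\<delta>\<close> for projections becomes \<open>t * \<delta>\<close> for
    \<open>d\<close>.\<close>
  proof (intro exI[of _ "t * \<delta>"] conjI ballI impI)
    show "t * \<delta> > 0" using t \<delta>(1) by simp
    fix d w assume d: "d \<in> A" "pos d" "norm d \<le> 1" and dq: "\<forall>v. d (q v) = d v \<and> q (d v) = d v"
      and small: "\<forall>\<Phi>\<in>avg q. \<exists>u\<in>Uq q. Re (cinner (u h) (\<Phi> d (u h))) < t * \<delta>" and w: "w \<in> Uq q"
    obtain p where p: "proj p" "dcomm d p" "\<And>v. t * (norm (p v))\<^sup>2 \<le> Re (cinner v (d v))"
      "\<And>v. Re (cinner v (d v)) \<le> t * (norm (v - p v))\<^sup>2 + norm d * (norm (p v))\<^sup>2"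
      using spectral_cut[OF d(2), of t] by blast
    have pA: "p \<in> A" by (rule vna_dcomm[OF A d(1) p(2)])
    have qp: "q (p v) = p v" for v
    proof -
      have "p (z - q z) = 0" for z
      proof -
        have "d (z - q z) = 0" using dq by (simp add: blinfun.diff_right)
        then have "t * (norm (p (z - q z)))\<^sup>2 \<le> 0" using p(3)[of "z - q z"] by (simp add: cinner.zero_right)
        then show ?thesis using t by (simp add: mult_le_0_iff)
      qed
      then have "p (q z) = p z" for z by (simp add: blinfun.diff_right)
      then show ?thesis by (rule proj_le_commute'[OF p(1) pq])
    qed
    note wu = UqD(1)[OF w]
    have bw: "w \<in> bounded_ops" using unitaryD(5)[OF wu] .
    \<comment> \<open>Conjugating by \<open>w\<close> moves the test vector \<open>w h\<close> back
      to \<open>h\<close>; the averages absorb the conjugation.\<close>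
    define p' where "p' = adj w o\<^sub>L p o\<^sub>L w"
    have p'A: "p' \<in> A" unfolding p'_def by (intro vna_comp[OF A] vna_adj[OF A] Uq_A[OF w] pA)
    have pp': "proj p'" unfolding p'_def by (rule proj_conj[OF p(1) bw unitaryD(3)[OF wu]])
    have qp': "q (p' v) = p' v" for v
      by (simp add: p'_def qp flip: Uq_commutes[OF Uq_adj[OF w] pq])
    have "\<exists>u\<in>Uq q. Re (cinner (u h) (\<Phi> p' (u h))) < \<delta>" if \<Phi>: "\<Phi> \<in> avg q" for \<Phi>
    proof -
      define \<Psi> where "\<Psi> x = \<Phi> (adj w o\<^sub>L x o\<^sub>L w)" for x
      have \<Psi>: "\<Psi> \<in> avg q" using avg_Ad_right[OF \<Phi> Uq_adj[OF w]] bw by (simp add: \<Psi>_def[abs_def])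
      obtain u where u: "u \<in> Uq q" "Re (cinner (u h) (\<Psi> d (u h))) < t * \<delta>" using small \<Psi> by blast
      have "pos (d - t *\<^sub>R p)"
        by (rule pos_by_form[OF sa_scaleR[OF proj_sa[OF p(1)]] pos_sa[OF d(2)]])
          (use p(3) in \<open>simp add: blinfun.scaleR_left cinner_scaleR_right proj_form[OF p(1)]\<close>)
      then have "pos (\<Psi> (d - t *\<^sub>R p))" by (rule avg_pos[OF \<Psi>])
      also have "\<Psi> (d - t *\<^sub>R p) = \<Psi> d - t *\<^sub>R \<Psi> p"
        using avg_add[OF \<Psi>, of d "(- t) *\<^sub>R p"] avg_scaleR[OF \<Psi>, of "- t" p] by simp
      finally have "t * Re (cinner (u h) (\<Psi> p (u h))) \<le> Re (cinner (u h) (\<Psi> d (u h)))"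
        using posD[of "\<Psi> d - t *\<^sub>R \<Psi> p" "u h"]
        by (simp add: blinfun.diff_left cinner.diff_right blinfun.scaleR_left cinner_scaleR_right)
      then have "t * Re (cinner (u h) (\<Psi> p (u h))) < t * \<delta>" using u(2) by simp
      then have "Re (cinner (u h) (\<Phi> p' (u h))) < \<delta>" using t by (simp add: \<Psi>_def p'_def)
      then show ?thesis using u(1) by blast
    qed
    then have "(norm (p' h))\<^sup>2 \<le> \<epsilon> / 2" by (intro \<delta>(2) p'A pp') (use qp' in auto)
    also have "norm (p' h) = norm (p (w h))" by (simp add: p'_def unitaryD(4)[OF unitary_adj[OF wu]])
    finally have pw: "(norm (p (w h)))\<^sup>2 \<le> \<epsilon> / 2" .
    have "Re (cinner (w h) (d (w h))) \<le> t * (norm (w h - p (w h)))\<^sup>2 + norm d * (norm (p (w h)))\<^sup>2" by (rule p(4))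
    also have "\<dots> \<le> t * (norm h)\<^sup>2 + 1 * (norm (p (w h)))\<^sup>2"
    proof (intro add_mono mult_left_mono mult_right_mono d(3))
      show "(norm (w h - p (w h)))\<^sup>2 \<le> (norm h)\<^sup>2"
        using proj_pythagoras[OF p(1), of "w h"] by (simp add: unitaryD(4)[OF wu])
    qed (use t in auto)
    also have "\<dots> \<le> \<epsilon>" using th pw by simp
    finally show "Re (cinner (w h) (d (w h))) \<le> \<epsilon>" .
  qed
qed

text \<open>Already the identity average does it. If a conjugate \<open>p'\<close> of
  \<open>p\<close> is small at \<open>h\<close>, it is small at \<open>k\<close>, because
  \<open>q k\<close> is nearly \<open>c h\<close> with \<open>c\<close> in the commutant, and
  \<open>p'\<close> commutes with \<open>c\<close>. Domination by \<open>k\<close> makes it small at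
  all conjugates of \<open>h\<close>.\<close>

lemma good_if_dominated:
  assumes s: "is_supp A q h"
    and T: "\<And>p u. p \<in> A \<Longrightarrow> proj p \<Longrightarrow> (\<forall>v. q (blinfun_apply p v) = p v) \<Longrightarrow> u \<in> Uq q \<Longrightarrow>
      norm (blinfun_apply p (blinfun_apply u h)) \<le> norm (p k)"
  shows "good q h"
proof (rule good_by_proj)
  show qA: "q \<in> A" and pq: "proj q" using is_suppD[OF s] by auto
  fix \<epsilon> :: real assume eps: "\<epsilon> > 0"
  \<comment> \<open>One \<open>\<eta>\<close> is spent on approximating \<open>q k\<close> by
    \<open>c h\<close>, a second one on \<open>c (p' h)\<close>; \<open>\<kappa>\<close> is the
    latter divided by a bound for \<open>c\<close>.\<close>
  define \<eta> where "\<eta> = sqrt (\<epsilon> / 4)"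
  have \<eta>: "\<eta> > 0" "(2 * \<eta>)\<^sup>2 = \<epsilon>" using eps by (simp_all add: \<eta>_def power_mult_distrib)
  obtain c where c: "c \<in> commutant A" "norm (q k - c h) < \<eta>" using is_suppD(4)[OF s \<eta>(1)] by blast
  define \<kappa> where "\<kappa> = \<eta> / (norm c + 1)"
  have nc: "norm c + 1 > 0" by (simp add: add_nonneg_pos)
  have \<kappa>: "\<kappa> > 0" using \<eta>(1) nc by (simp add: \<kappa>_def)
  show "\<exists>\<delta>>0. \<forall>p\<in>A. proj p \<longrightarrow> (\<forall>v. q (p v) = p v) \<longrightarrow>
      (\<forall>\<Phi>\<in>avg q. \<exists>u\<in>Uq q. Re (cinner (u h) (\<Phi> p (u h))) < \<delta>) \<longrightarrow> (norm (p h))\<^sup>2 \<le> \<epsilon>"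
  proof (intro exI[of _ "\<kappa>\<^sup>2"] conjI ballI impI)
    show "\<kappa>\<^sup>2 > 0" using \<kappa> by simp
    fix p assume p: "p \<in> A" "proj p" and qp: "\<forall>v. q (p v) = p v"
      and small: "\<forall>\<Phi>\<in>avg q. \<exists>u\<in>Uq q. Re (cinner (u h) (\<Phi> p (u h))) < \<kappa>\<^sup>2"
    obtain u where u: "u \<in> Uq q" "Re (cinner (u h) (p (u h))) < \<kappa>\<^sup>2" using bspec[OF small avg_id] by blast
    note uu = UqD(1)[OF u(1)]
    define p' where "p' = adj u o\<^sub>L p o\<^sub>L u"
    have p'A: "p' \<in> A" unfolding p'_def by (intro vna_comp[OF A] vna_adj[OF A] Uq_A[OF u(1)] p)
    have pp': "proj p'" unfolding p'_def by (rule proj_conj[OF p(2) unitaryD(5)[OF uu] unitaryD(3)[OF uu]])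
    have qp': "q (p' v) = p' v" for v
      using qp by (simp add: p'_def flip: Uq_commutes[OF Uq_adj[OF u(1)] pq])
    have "norm (p' h) = norm (p (u h))" by (simp add: p'_def unitaryD(4)[OF unitary_adj[OF uu]])
    then have "(norm (p' h))\<^sup>2 < \<kappa>\<^sup>2" using u(2) by (simp add: proj_form[OF p(2)])
    then have p'h: "norm (p' h) < \<kappa>" by (rule power2_less_imp_less) (use \<kappa> in simp)
    have "p' k = p' (q k - c h) + c (p' h)"
      using proj_le_commute[OF pp' pq qp', of k] commutantD[OF c(1) p'A, of h] by (simp add: blinfun.diff_right)
    then have "norm (p' k) \<le> norm (p' (q k - c h)) + norm (c (p' h))" by (metis norm_triangle_ineq)
    also have "\<dots> \<le> norm (q k - c h) + norm c * norm (p' h)"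
      by (intro add_mono proj_norm_le[OF pp'] norm_blinfun)
    also have "\<dots> \<le> \<eta> + (norm c + 1) * \<kappa>"
      using c(2) p'h by (intro add_mono mult_mono) auto
    also have "\<dots> = 2 * \<eta>" using nc by (simp add: \<kappa>_def)
    finally have p'k: "norm (p' k) \<le> 2 * \<eta>" .
    have "norm (p h) = norm (p' (adj u h))"
      by (simp add: p'_def unitaryD(3)[OF uu] unitaryD(4)[OF unitary_adj[OF uu]])
    also have "\<dots> \<le> norm (p' k)" using T[OF p'A pp' _ Uq_adj[OF u(1)]] qp' by blast
    also have "\<dots> \<le> 2 * \<eta>" by (rule p'k)
    finally have "(norm (p h))\<^sup>2 \<le> (2 * \<eta>)\<^sup>2" by (intro power_mono) auto
    then show "(norm (p h))\<^sup>2 \<le> \<epsilon>" by (simp only: \<eta>)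
  qed
qed

text \<open>The initial space of \<open>c\<close> is orthogonal to \<open>p\<close> and the final
  space lies under \<open>p\<close>, so \<open>c\<close> has square 0 and \<open>w\<close> below is
  a self-adjoint unitary that exchanges the two spaces and fixes the rest.\<close>

lemma swap_unitary:
  assumes c: "c \<in> A" "pisom c" and q: "proj q" "\<And>v. blinfun_apply q (c v) = c v" "\<And>v. blinfun_apply c (q v) = c v"
    and p: "proj p" "\<And>v. blinfun_apply p (c v) = c v" "\<And>v. blinfun_apply c (p v) = 0"
  shows "\<exists>w\<in>Uq q. \<forall>v. w (p (adj w v)) = p v - c (adj c v) + adj c (c v)"
proof -
  have bc: "c \<in> bounded_ops" using Abo[OF c(1)] .
  have aqc: "q (adj c v) = adj c v" "adj c (q v) = adj c v" "adj c (p v) = adj c v" "p (adj c v) = 0" for v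
  proof -
    have sw: "cinner x (r (adj c v)) = cinner (c (r x)) v" "cinner x (adj c (r v)) = cinner (r (c x)) v"
      if "proj r" for r x by (simp_all add: cinner_adj_right bc saD[OF proj_sa[OF that]] flip: saD[OF proj_sa[OF that]])
    show "q (adj c v) = adj c v" by (rule cinner_eqI) (simp add: sw[OF q(1)] q cinner_adj_right bc)
    show "adj c (q v) = adj c v" by (rule cinner_eqI) (simp add: sw[OF q(1)] q cinner_adj_right bc)
    show "adj c (p v) = adj c v" by (rule cinner_eqI) (simp add: sw[OF p(1)] p cinner_adj_right bc)
    show "p (adj c v) = 0" by (rule cinner_eqI) (simp add: sw[OF p(1)] p cinner.zero_left cinner.zero_right)
  qed
  have cc: "c (c v) = 0" for v using p(3)[of "c v"] by (simp add: p(2))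
  have aa: "adj c (adj c v) = 0" for v using aqc(3)[of "adj c v"] aqc(4)[of v] by (simp add: blinfun.zero_right)
  define w where "w = c + adj c + id_blinfun - (adj c o\<^sub>L c) - (c o\<^sub>L adj c)"
  have w: "w v = c v + adj c v + v - adj c (c v) - c (adj c v)" for v
    by (simp add: w_def blinfun.add_left blinfun.diff_left)
  have wA: "w \<in> A" unfolding w_def by (intro vna_add[OF A] vna_diff[OF A] vna_comp[OF A] vna_id[OF A] vna_adj[OF A] c)
  have saw: "sa w"
    unfolding w_def
  proof (intro sa_diff)
    have "sa (c + adj c)" using bc by (simp add: sa_iff_adj adj_add add.commute)
    then show "sa (c + adj c + id_blinfun)" by (rule sa_add[OF _ sa_id])
    show "sa (adj c o\<^sub>L c)" by (rule pos_sa[OF pos_adj_comp[OF bc]])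
    show "sa (c o\<^sub>L adj c)" using pos_sa[OF pos_adj_comp[OF adj_bounded_ops[OF bc]]] bc by simp
  qed
  have wc: "w (c v) = adj c (c v)" "w (adj c v) = c (adj c v)" for v
    by (simp_all add: w cc aa pisomD(3,4)[OF c(2)] blinfun.zero_right)
  have ww: "w (w v) = v" for v
  proof -
    have "w (w v) = w (c v) + w (adj c v) + w v - w (adj c (c v)) - w (c (adj c v))"
      by (subst (2) w) (simp add: blinfun.add_right blinfun.diff_right)
    then show ?thesis by (simp add: wc pisomD(3,4)[OF c(2)], simp add: w)
  qed
  have wq: "w (v - q v) = v - q v" for v
    by (simp add: w blinfun.diff_right q aqc)
  have "w \<in> Uq q"
    unfolding Uq_def unitary_group_def using wA wq ww by (simp add: sa_adj[OF saw] blinfun_eq_iff)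
  moreover have "w (p (adj w v)) = p v - c (adj c v) + adj c (c v)" for v
  proof -
    have "p (w v) = c v + p v - c (adj c v)"
      by (simp add: w blinfun.add_right blinfun.diff_right p aqc)
    then have "w (p (w v)) = w (c v) + w (p v) - w (c (adj c v))" by (simp add: blinfun.add_right blinfun.diff_right)
    also have "w (p v) = adj c v + p v - c (adj c v)" by (simp add: w p aqc blinfun.zero_right)
    finally show ?thesis by (simp add: sa_adj[OF saw] wc pisomD(3,4)[OF c(2)])
  qed
  ultimately show ?thesis by blast
qed

text \<open>\<open>c h0\<close> with \<open>c\<close> in the commutant approximates
  \<open>w v\<close>; applying \<open>adj w\<close>, which commutes with \<open>c\<close>, gives
  approximations by \<open>c (adj w h0)\<close>.\<close>

lemma compress_supp:
  assumes s: "is_supp A q0 h0" and w: "w \<in> A" "pisom w" "\<And>v. blinfun_apply q0 (w v) = w v"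
  shows "is_supp A (adj w o\<^sub>L w) (adj w h0)"
  unfolding is_supp_def
proof (intro conjI allI impI)
  have bw: "w \<in> bounded_ops" using Abo[OF w(1)] .
  have awA: "adj w \<in> A" by (rule vna_adj[OF A w(1)])
  show "adj w o\<^sub>L w \<in> A" by (intro vna_comp[OF A] awA w)
  show "proj (adj w o\<^sub>L w)" by (rule pisomD(2)[OF w(2)])
  show "(adj w o\<^sub>L w) (adj w h0) = adj w h0" by (simp add: pisomD(4)[OF w(2)])
  fix v and \<epsilon> :: real assume eps: "\<epsilon> > 0"
  have n: "norm (adj w) + 1 > 0" by (simp add: add_nonneg_pos)
  obtain c where c: "c \<in> commutant A" "norm (q0 (w v) - c h0) < \<epsilon> / (norm (adj w) + 1)"
    using is_suppD(4)[OF s, of "\<epsilon> / (norm (adj w) + 1)" "w v"] eps n by auto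
  have "(adj w o\<^sub>L w) v - c (adj w h0) = adj w (q0 (w v) - c h0)"
    by (simp add: w(3) blinfun.diff_right commutantD[OF c(1) awA])
  then have "norm ((adj w o\<^sub>L w) v - c (adj w h0)) \<le> norm (adj w) * norm (q0 (w v) - c h0)"
    by (simp only: norm_blinfun)
  also have "\<dots> \<le> (norm (adj w) + 1) * norm (q0 (w v) - c h0)" by (intro mult_right_mono) auto
  also have "\<dots> < \<epsilon>" using c(2) n by (simp add: field_simps)
  finally show "\<exists>c\<in>commutant A. norm ((adj w o\<^sub>L w) v - c (adj w h0)) < \<epsilon>" using c(1) by blast
qed

text \<open>\<open>PI\<close> denies domination in every subcorner of \<open>q0\<close>. It is
  applied to the initial projection of a partial isometry \<open>w\<close> from below
  \<open>r\<close> to below \<open>s\<close>, with the vector \<open>adj w h0\<close> and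
  \<open>k = sqrt K *\<^sub>R h0\<close>. From the resulting \<open>p\<close> and \<open>u\<close>
  one forms \<open>x = p u adj w\<close>: then \<open>x h0\<close> is long compared with
  \<open>adj x h0\<close>, whose norm is that of \<open>p h0\<close>.\<close>

lemma pisom_extension:
  assumes s0: "is_supp A q0 h0"
    and PI: "\<And>q h k. is_supp A q h \<Longrightarrow> (\<forall>v. q0 (blinfun_apply q v) = q v) \<Longrightarrow> q \<noteq> 0 \<Longrightarrow>
      \<exists>p u. p \<in> A \<and> proj p \<and> (\<forall>v. q (blinfun_apply p v) = p v) \<and> u \<in> Uq q \<and>
        norm (blinfun_apply p k) < norm (p (blinfun_apply u h))"
    and r: "r \<in> A" "proj r" "\<And>v. blinfun_apply q0 (r v) = r v"
    and s: "s \<in> A" "proj s" "\<And>v. blinfun_apply q0 (s v) = s v"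
    and a: "a \<in> A" "blinfun_apply s (blinfun_apply a (r v0)) \<noteq> 0" and K: "0 \<le> K"
  shows "\<exists>x\<in>A. pisom x \<and> (\<forall>v. r (x v) = x v) \<and> (\<forall>v. x (s v) = x v) \<and>
    blinfun_apply x h0 \<noteq> 0 \<and> K * (norm (adj x h0))\<^sup>2 \<le> (norm (x h0))\<^sup>2"
proof -
  have saa: "adj r = r" "adj s = s" by (simp_all add: sa_adj proj_sa r s)
  define b where "b = s o\<^sub>L a o\<^sub>L r"
  have bA: "b \<in> A" unfolding b_def by (intro vna_comp[OF A] r s a)
  have "b v0 \<noteq> 0" using a(2) by (simp add: b_def)
  then have b0: "b \<noteq> 0" by auto
  have adjb: "adj b v = r (adj a (s v))" for v by (simp add: b_def adj_comp Abo r s a saa)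
  obtain w c k where w: "w \<in> A" "w \<noteq> 0" "pisom w" and wc: "\<And>v. w v = b (blinfun_apply c v)"
      and wk: "\<And>v. adj w (w v) = adj b (blinfun_apply k v)"
    using polar[OF A bA b0] by blast
  have bw: "w \<in> bounded_ops" using Abo[OF w(1)] .
  have sw: "s (w v) = w v" for v by (simp add: wc b_def projD[OF s(2)])
  have q0w: "q0 (w v) = w v" for v using s(3)[of "w v"] by (simp add: sw)
  have rw: "r (adj w (w v)) = adj w (w v)" for v by (simp add: wk adjb projD[OF r(2)])
  have ws: "adj w (s v) = adj w v" for v
    by (rule cinner_eqI) (simp add: cinner_adj_right bw sw flip: saD[OF proj_sa[OF s(2)]])
  have awA: "adj w \<in> A" by (rule vna_adj[OF A w(1)])
  define r0 where "r0 = adj w o\<^sub>L w"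
  have r0A: "r0 \<in> A" unfolding r0_def by (intro vna_comp[OF A] awA w)
  have pr0: "proj r0" unfolding r0_def by (rule pisomD(2)[OF w(3)])
  have supp: "is_supp A r0 (adj w h0)" unfolding r0_def by (rule compress_supp[OF s0 w(1,3) q0w])
  have rr0: "r (r0 v) = r0 v" for v by (simp add: r0_def rw)
  have q0r0: "\<forall>v. q0 (r0 v) = r0 v" using r(3)[of "r0 _"] by (simp add: rr0)
  have "r0 \<noteq> 0"
  proof
    assume "r0 = 0"
    then have "adj w (w v) = 0" for v by (metis r0_def blinfun_apply_blinfun_compose zero_blinfun.rep_eq)
    then have "norm (w v) = 0" for v using pisom_norm[OF w(3), of v] by simp
    then show False using w(2) by (simp add: blinfun_eq_iff)
  qed
  then obtain p u where p: "p \<in> A" "proj p" "\<And>v. r0 (blinfun_apply p v) = p v" and u: "u \<in> Uq r0"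
      and lt: "norm (blinfun_apply p (sqrt K *\<^sub>R h0)) < norm (p (blinfun_apply u (adj w h0)))"
    using PI[OF supp q0r0, of "sqrt K *\<^sub>R h0"] by blast
  note uu = UqD(1)[OF u]
  have bu: "u \<in> bounded_ops" using unitaryD(5)[OF uu] .
  define x where "x = p o\<^sub>L u o\<^sub>L adj w"
  have xA: "x \<in> A" unfolding x_def by (intro vna_comp[OF A] p Uq_A[OF u] awA)
  have bx: "x \<in> bounded_ops" using Abo[OF xA] .
  have ax: "adj x v = w (adj u (p v))" for v
    by (simp add: x_def adj_comp bu bw proj_bounded_ops[OF p(2)] sa_adj[OF proj_sa[OF p(2)]])
  have pr: "p (r0 v) = p v" for v by (rule proj_le_commute[OF p(2) pr0 p(3)])
  have xax: "x (adj x v) = p v" for v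
  proof -
    have "x (adj x v) = p (u (r0 (adj u (p v))))" by (simp add: x_def ax[unfolded x_def] r0_def)
    also have "\<dots> = p (r0 (u (adj u (p v))))" by (simp only: Uq_commutes[OF u pr0])
    finally show ?thesis by (simp add: pr unitaryD(3)[OF uu] projD[OF p(2)])
  qed
  have "adj (adj x) o\<^sub>L adj x = p" by (rule blinfun_eqI) (simp add: bx xax)
  then have "pisom (adj x)" using p(2) bx by (simp add: pisom_def)
  from pisom_adj[OF this] have px: "pisom x" by (simp add: bx)
  have "r (p v) = p v" for v using rr0[of "p v"] by (simp add: p(3))
  then have rx: "r (x v) = x v" for v by (simp add: x_def)
  have xs: "x (s v) = x v" for v by (simp add: x_def ws)
  have "norm (adj x h0) = norm (p h0)" using pisom_norm[OF pisom_adj[OF px], of h0] by (simp add: bx xax)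
  then have "sqrt K * norm (adj x h0) < norm (x h0)"
    using lt K by (simp add: x_def blinfun.scaleR_right)
  then have "x h0 \<noteq> 0" "(sqrt K * norm (adj x h0))\<^sup>2 \<le> (norm (x h0))\<^sup>2"
    using K by (auto intro!: power_mono mult_nonneg_nonneg dest: order.strict_trans1[rotated])
      (metis mult_nonneg_nonneg norm_ge_zero not_less real_sqrt_ge_zero)
  then show ?thesis
    using xA px rx xs K by (intro bexI[of _ x]) (auto simp: power_mult_distrib)
qed

text \<open>Partial isometries are chosen greedily, each orthogonal to the earlier ones and with |x
  h0|^2 at least half of the supremum. These squares are summable and so tend to 0; an admissible
  partial isometry between the remainders would have to vanish at \<open>h0\<close>, contrary to
  \<open>pisom_extension\<close>. The inequality with \<open>K\<close> compares squared norms and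
  hence passes to the orthogonal sum.\<close>

lemma maximal_pisom:
  assumes s0: "is_supp A q0 h0"
    and PI: "\<And>q h k. is_supp A q h \<Longrightarrow> (\<forall>v. q0 (blinfun_apply q v) = q v) \<Longrightarrow> q \<noteq> 0 \<Longrightarrow>
      \<exists>p u. p \<in> A \<and> proj p \<and> (\<forall>v. q (blinfun_apply p v) = p v) \<and> u \<in> Uq q \<and>
        norm (blinfun_apply p k) < norm (p (blinfun_apply u h))"
    and p: "p \<in> A" "proj p" "\<And>v. blinfun_apply q0 (p v) = p v" and K: "0 \<le> K"
  shows "\<exists>x\<in>A. pisom x \<and> (\<forall>v. p (x v) = x v) \<and> (\<forall>v. x (q0 v) = x v) \<and>
    K * (norm (adj x h0))\<^sup>2 \<le> (norm (x h0))\<^sup>2 \<and>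
    (\<forall>a\<in>A. \<forall>v. (q0 - (adj x o\<^sub>L x)) (blinfun_apply a ((p - (x o\<^sub>L adj x)) v)) = 0)"
proof -
  have q0A: "q0 \<in> A" and pq0: "proj q0" using is_suppD[OF s0] by auto
  define Adm where "Adm = {x \<in> A. pisom x \<and> (\<forall>v. p (x v) = x v) \<and> (\<forall>v. x (q0 v) = x v) \<and>
    K * (norm (adj x h0))\<^sup>2 \<le> (norm (x h0))\<^sup>2}"
  define ort where "ort f n y \<longleftrightarrow> (\<forall>i<n::nat. \<forall>v. adj (f i) (blinfun_apply y v) = 0 \<and> blinfun_apply (f i) (adj y v) = 0)"
    for f :: "nat \<Rightarrow> 'h \<Rightarrow>\<^sub>L 'h" and n y
  define P where "P f n y \<longleftrightarrow> y \<in> Adm \<and> ort f n y \<and>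
    (\<forall>z\<in>Adm. ort f n z \<longrightarrow> (norm (blinfun_apply z h0))\<^sup>2 \<le> 2 * (norm (blinfun_apply y h0))\<^sup>2)" for f n y
  have a0: "adj 0 = (0 :: 'h \<Rightarrow>\<^sub>L 'h)" by (rule sa_adj[OF sa_zero])
  have "\<exists>y. P f n y" for f n
  proof -
    define V where "V = {(norm (blinfun_apply z h0))\<^sup>2 |z. z \<in> Adm \<and> ort f n z}"
    have "0 \<in> Adm" using vna_zero[OF A] proj_zero by (simp add: Adm_def pisom_def a0 blinfun.zero_right)
    moreover have "ort f n 0" by (simp add: ort_def a0 blinfun.zero_right)
    ultimately have V0: "0 \<in> V" unfolding V_def by (intro CollectI exI[of _ 0]) simp
    have "bdd_above V"
    proof (rule bdd_aboveI[of _ "(norm h0)\<^sup>2"])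
      fix y assume "y \<in> V"
      then obtain z where z: "y = (norm (blinfun_apply z h0))\<^sup>2" "z \<in> Adm" by (auto simp: V_def)
      then have pz: "pisom z" by (simp add: Adm_def)
      have "norm (z h0) \<le> norm h0"
        using pisom_norm[OF pz, of h0] proj_norm_le[OF pisomD(2)[OF pz], of h0] by simp
      then show "y \<le> (norm h0)\<^sup>2" unfolding z(1) by (intro power_mono) auto
    qed
    then have up: "y \<le> Sup V" if "y \<in> V" for y by (rule cSup_upper[OF that])
    have "\<exists>y\<in>V. Sup V \<le> 2 * y"
    proof (cases "Sup V > 0")
      case True
      then have "Sup V / 2 < Sup V" by simp
      then obtain y where "y \<in> V" "Sup V / 2 < y" using less_cSupE[of "Sup V / 2" V] V0 by blast
      then show ?thesis by (intro bexI[of _ y]) auto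
    next
      case False then show ?thesis using V0 by (intro bexI[of _ 0]) auto
    qed
    then obtain y where y: "y \<in> Adm" "ort f n y" "Sup V \<le> 2 * (norm (y h0))\<^sup>2" by (auto simp: V_def)
    have "(norm (z h0))\<^sup>2 \<le> 2 * (norm (y h0))\<^sup>2" if z: "z \<in> Adm" "ort f n z" for z
    proof -
      have "(norm (z h0))\<^sup>2 \<in> V" using z by (auto simp: V_def)
      from up[OF this] show ?thesis using y(3) by simp
    qed
    then show ?thesis using y(1,2) by (auto simp: P_def)
  qed
  note Pex = this
  have Peq: "P f n y = P g n y" if "\<And>m. m < n \<Longrightarrow> f m = g m" for f g n y
  proof -
    have "ort f n = ort g n" by (rule ext) (simp add: ort_def that)
    then show ?thesis by (simp add: P_def)
  qed
  \<comment> \<open>The choice of \<open>x n\<close> depends on all earlier terms, through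
    \<open>ort\<close>.\<close>
  have "\<exists>x. \<forall>n. P x n (x n)"
    by (rule dependent_wellorder_choice[where P = P, OF Peq Pex])
  then obtain x where x: "\<And>n. P x n (x n)" by blast
  have xAdm: "x n \<in> Adm" for n using x[of n] by (simp add: P_def)
  have xA: "x n \<in> A" and px: "pisom (x n)" and pxn: "p (x n v) = x n v" and xq: "x n (q0 v) = x n v"
    and xK: "K * (norm (adj (x n) h0))\<^sup>2 \<le> (norm (x n h0))\<^sup>2" for n v
    using xAdm[of n] by (auto simp: Adm_def)
  have bx: "x n \<in> bounded_ops" for n using Abo[OF xA] .
  have lt: "adj (x i) (x j v) = 0" "x i (adj (x j) v) = 0" if "i < j" for i j v
    using x[of j] that by (auto simp: P_def ort_def)
  have ip1: "cinner (x i a) (x j b) = 0" if "i < j" for i j a b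
    using cinner_adj_right[OF bx[of i], of a "x j b"] lt(1)[OF that, of b] by (simp add: cinner.zero_right)
  have ip2: "cinner (adj (x i) a) (adj (x j) b) = 0" if "i < j" for i j a b
    using cinner_adj_left[OF bx[of i], of a "adj (x j) b"] lt(2)[OF that, of b] by (simp add: cinner.zero_right)
  have orth1: "adj (x i) (x j v) = 0" if ij: "i \<noteq> j" for i j v
  proof (cases "i < j")
    case False
    then have ji: "j < i" using ij by simp
    show ?thesis
    proof (rule cinner_eqI)
      fix w
      show "cinner w (adj (x i) (x j v)) = cinner w 0"
        using ip1[OF ji, of v w] cinner_commute[of "x i w" "x j v"]
        by (simp add: cinner_adj_right[OF bx] cinner.zero_right)
    qed
  qed (rule lt(1))
  have orth2: "x i (adj (x j) v) = 0" if ij: "i \<noteq> j" for i j v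
  proof (cases "i < j")
    case False
    then have ji: "j < i" using ij by simp
    show ?thesis
    proof (rule cinner_eqI)
      fix w
      have "cinner w (x i (adj (x j) v)) = cinner (adj (x i) w) (adj (x j) v)" by (simp only: cinner_adj_left[OF bx])
      then show "cinner w (x i (adj (x j) v)) = cinner w 0"
        using ip2[OF ji, of v w] cinner_commute[of "adj (x i) w" "adj (x j) v"] by (simp add: cinner.zero_right)
    qed
  qed (rule lt(2))
  obtain L where L: "pisom L" "\<And>v. (\<lambda>n. \<Sum>i<n. x i v) \<longlonglongrightarrow> blinfun_apply L v"
      "\<And>v. (\<lambda>n. \<Sum>i<n. adj (x i) v) \<longlonglongrightarrow> adj L v"
      "\<And>i v. L (adj L (x i v)) = x i v" "\<And>i v. adj L (L (adj (x i) v)) = adj (x i) v"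
      "\<And>v. (norm (L v))\<^sup>2 = (\<Sum>i. (norm (x i v))\<^sup>2)" "\<And>v. (norm (adj L v))\<^sup>2 = (\<Sum>i. (norm (adj (x i) v))\<^sup>2)"
    using orth_series_pisom[where x = x, OF px orth1 orth2] by blast
  have bL: "L \<in> bounded_ops" using pisomD(1)[OF L(1)] .
  have LA: "L \<in> A"
    by (rule vna_limit[OF A, of "\<lambda>n. \<Sum>i<n. x i"]) (simp_all add: vna_sum[OF A] xA blinfun.sum_left L(2) bL)
  have pL: "p (L v) = L v" for v
  proof -
    have "(\<lambda>n. p (\<Sum>i<n. x i v)) \<longlonglongrightarrow> p (L v)"
      by (intro bounded_linear.tendsto[OF blinfun.bounded_linear_right] L(2))
    then have "(\<lambda>n. \<Sum>i<n. x i v) \<longlonglongrightarrow> p (L v)" by (simp only: blinfun.sum_right pxn)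
    from LIMSEQ_unique[OF this L(2)] show ?thesis .
  qed
  have Lq: "L (q0 v) = L v" for v
  proof -
    have "(\<lambda>n. \<Sum>i<n. x i v) \<longlonglongrightarrow> L (q0 v)" using L(2)[of "q0 v"] by (simp only: xq)
    from LIMSEQ_unique[OF this L(2)] show ?thesis .
  qed
  have sm: "summable (\<lambda>i. (norm (x i h0))\<^sup>2)" by (rule orth_series(3)[where x = x, OF px orth1 orth2])
  have sm': "summable (\<lambda>i. (norm (adj (x i) h0))\<^sup>2)"
    by (rule orth_series(3)[where x = "\<lambda>i. adj (x i)", OF pisom_adj[OF px]]) (simp_all add: bx orth1 orth2)
  have LK: "K * (norm (adj L h0))\<^sup>2 \<le> (norm (L h0))\<^sup>2"
    unfolding L(6,7) suminf_mult[OF sm', symmetric] by (rule suminf_le[OF xK summable_mult[OF sm'] sm])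
  define r where "r = p - (L o\<^sub>L adj L)"
  define s where "s = q0 - (adj L o\<^sub>L L)"
  have r: "r v = p v - L (adj L v)" and s: "s v = q0 v - adj L (L v)" for v
    by (simp_all add: r_def s_def blinfun.diff_left)
  have LL: "proj (L o\<^sub>L adj L)" "proj (adj L o\<^sub>L L)" using pisomD[OF L(1)] by auto
  have Lp: "adj L (p v) = adj L v" for v
    by (rule cinner_eqI) (simp add: cinner_adj_right bL pL flip: saD[OF proj_sa[OF p(2)]])
  have qL: "q0 (adj L v) = adj L v" for v
    by (rule cinner_eqI) (simp add: cinner_adj_right bL Lq flip: saD[OF proj_sa[OF pq0]])
  have aLA: "adj L \<in> A" by (rule vna_adj[OF A LA])
  have rA: "r \<in> A" "s \<in> A" unfolding r_def s_def by (intro vna_diff[OF A] vna_comp[OF A] LA aLA p q0A)+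
  have pr: "proj r"
    unfolding proj_def
    using sa_diff[OF proj_sa[OF p(2)] proj_sa[OF LL(1)]]
    by (simp add: r_def[symmetric]) (simp add: r blinfun.diff_right projD[OF p(2)] Lp pL pisomD(4)[OF L(1)])
  have ps: "proj s"
    unfolding proj_def
    using sa_diff[OF proj_sa[OF pq0] proj_sa[OF LL(2)]]
    by (simp add: s_def[symmetric]) (simp add: s blinfun.diff_right projD[OF pq0] Lq qL pisomD(3)[OF L(1)])
  have q0L: "q0 (L v) = L v" for v using p(3)[of "L v"] by (simp add: pL)
  have q0r: "q0 (r v) = r v" for v by (simp add: r blinfun.diff_right p(3) q0L)
  have q0s: "q0 (s v) = s v" for v by (simp add: s blinfun.diff_right qL projD[OF pq0])
  have "s (a (r v)) = 0" if a: "a \<in> A" for a v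
  proof (rule ccontr)
    assume ne: "s (a (r v)) \<noteq> 0"
    obtain y where y: "y \<in> A" "pisom y" "\<And>v. r (y v) = y v" "\<And>v. y (s v) = y v" "blinfun_apply y h0 \<noteq> 0"
        "K * (norm (adj y h0))\<^sup>2 \<le> (norm (y h0))\<^sup>2"
      using pisom_extension[OF s0 PI rA(1) pr q0r rA(2) ps q0s a ne K] by blast
    have by_: "y \<in> bounded_ops" using Abo[OF y(1)] .
    have sy: "adj y v = s (adj y v)" for v
      by (rule cinner_eqI) (simp add: cinner_adj_right by_ y(4) flip: saD[OF proj_sa[OF ps]])
    have "p (r v) = r v" for v by (simp add: r blinfun.diff_right projD[OF p(2)] pL)
    then have py: "p (y v) = y v" for v by (metis y(3))
    have "s (q0 v) = s v" for v by (simp add: s Lq projD[OF pq0])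
    then have yq: "y (q0 v) = y v" for v by (metis y(4))
    have "y \<in> Adm" unfolding Adm_def using y py yq by blast
    moreover have "ort x n y" for n
      unfolding ort_def
    proof (intro allI impI conjI)
      fix i v
      have 1: "adj (x i) (r w) = 0" for w
      proof (rule cinner_eqI)
        fix z
        have "cinner z (adj (x i) (r w)) = cinner (r (x i z)) w"
          by (simp add: cinner_adj_right bx saD[OF proj_sa[OF pr]])
        also have "r (x i z) = 0" by (simp add: r pxn L(4))
        finally show "cinner z (adj (x i) (r w)) = cinner z 0" by (simp add: cinner.zero_left cinner.zero_right)
      qed
      show "adj (x i) (y v) = 0" using 1[of "y v"] by (simp add: y(3))
      have 2: "x i (s w) = 0" for w
      proof (rule cinner_eqI)
        fix z
        have "q0 (adj (x i) z) = adj (x i) z"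
          by (rule cinner_eqI) (simp add: cinner_adj_right bx xq flip: saD[OF proj_sa[OF pq0]])
        then have "s (adj (x i) z) = 0" by (simp add: s L(5))
        then have "cinner (s (adj (x i) z)) w = 0" by (simp add: cinner.zero_left)
        then show "cinner z (x i (s w)) = cinner z 0"
          by (simp add: saD[OF proj_sa[OF ps]] cinner_adj_left bx cinner.zero_right)
      qed
      show "x i (adj y v) = 0" by (subst sy) (rule 2)
    qed
    ultimately have le: "(norm (y h0))\<^sup>2 \<le> 2 * (norm (x n h0))\<^sup>2" for n using x[of n] by (auto simp: P_def)
    have "(\<lambda>n. 2 * (norm (x n h0))\<^sup>2) \<longlonglongrightarrow> 2 * 0" by (intro tendsto_mult tendsto_const summable_LIMSEQ_zero sm)
    then have "(norm (y h0))\<^sup>2 \<le> 2 * 0" by (rule LIMSEQ_le_const) (use le in blast)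
    then show False using y(5) by simp
  qed
  then show ?thesis
    using LA L(1) pL Lq LK unfolding r_def s_def by (intro bexI[of _ L]) auto
qed

text \<open>\<open>z\<close> is the projection onto the closed span of the vectors
  \<open>a (r v)\<close>. This set is invariant under both \<open>A\<close> and its commutant, so
  \<open>z\<close> is central.\<close>

lemma central_cover:
  assumes r: "r \<in> A" and s: "s \<in> bounded_ops"
    and sar: "\<And>a v. a \<in> A \<Longrightarrow> blinfun_apply s (blinfun_apply a (blinfun_apply r v)) = 0"
  shows "\<exists>z\<in>A. proj z \<and> (\<forall>a\<in>A. \<forall>v. blinfun_apply a (blinfun_apply z v) = z (blinfun_apply a v)) \<and>
    (\<forall>v. z (blinfun_apply r v) = r v) \<and> (\<forall>v. blinfun_apply s (z v) = 0)"
proof -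
  define S where "S = {blinfun_apply a (r v) |a v. a \<in> A}"
  have CA: "von_neumann_algebra (commutant A)" by (rule vna_commutant[OF A])
  define N where "N = A \<union> commutant A"
  have N: "N \<subseteq> bounded_ops" "\<And>c. c \<in> N \<Longrightarrow> adj c \<in> N"
    using Abo commutant_bo vna_adj[OF A] vna_adj[OF CA] by (auto simp: N_def)
  have invS: "c x \<in> S" if c: "c \<in> N" and x: "x \<in> S" for c x
  proof -
    obtain a v where a: "a \<in> A" "x = a (r v)" using x by (auto simp: S_def)
    show ?thesis
    proof (cases "c \<in> A")
      case True
      then have "c o\<^sub>L a \<in> A" by (intro vna_comp[OF A] a)
      then show ?thesis unfolding S_def a(2) by (intro CollectI exI[of _ "c o\<^sub>L a"] exI[of _ v]) simp
    next
      case False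
      then have "c \<in> commutant A" using c by (simp add: N_def)
      then have "c x = a (r (c v))" using commutantD[of c A] a(1) r by (simp add: a(2))
      then show ?thesis using a(1) by (auto simp: S_def)
    qed
  qed
  obtain z where z: "proj z" "\<And>c v. c \<in> N \<Longrightarrow> c (z v) = z (c v)" "\<And>v. v \<in> S \<Longrightarrow> z v = v"
    "\<And>y v. y \<in> bounded_ops \<Longrightarrow> (\<And>v. v \<in> S \<Longrightarrow> y v = 0) \<Longrightarrow> blinfun_apply y (z v) = 0"
    using generated_proj[OF N invS] by metis
  have "z \<in> A" by (rule vna_memI[OF A proj_bounded_ops[OF z(1)]]) (use z(2) in \<open>auto simp: N_def\<close>)
  moreover have "a (z v) = z (a v)" if "a \<in> A" for a v using z(2)[of a v] that by (simp add: N_def)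
  moreover have "z (r v) = r v" for v
    using z(3)[of "r v"] vna_id[OF A] by (force simp: S_def)
  moreover have "s (z v) = 0" for v by (rule z(4)[OF s]) (auto simp: S_def sar)
  ultimately show ?thesis using z(1) by blast
qed

text \<open>For a maximal partial isometry \<open>x\<close> from below \<open>q0\<close> to below \<open>p\<close>, the remainders of \<open>q0\<close> and \<open>p\<close> are
  separated by a central \<open>z\<close>. Swapping a subprojection of \<open>x\<^sup>*x\<close> into \<open>p\<close> gives an average of \<open>p\<close> above
  \<open>z q0 / 2\<close>, while \<open>(1 - z) p\<close> is small at \<open>h0\<close> by the choice of \<open>x\<close>.\<close>

lemma good_if_not_dominated:
  assumes s0: "is_supp A q0 h0"
    and PI: "\<And>q h k. is_supp A q h \<Longrightarrow> (\<forall>v. q0 (blinfun_apply q v) = q v) \<Longrightarrow> q \<noteq> 0 \<Longrightarrow>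
      \<exists>p u. p \<in> A \<and> proj p \<and> (\<forall>v. q (blinfun_apply p v) = p v) \<and> u \<in> Uq q \<and>
        norm (blinfun_apply p k) < norm (p (blinfun_apply u h))"
  shows "good q0 h0"
proof (rule good_by_proj)
  show q0A: "q0 \<in> A" and pq0: "proj q0" using is_suppD[OF s0] by auto
  have q0h: "q0 h0 = h0" using is_suppD[OF s0] by auto
  fix \<epsilon> :: real assume eps: "\<epsilon> > 0"
  \<comment> \<open>Large enough that |h0|^2 / K, the bound for |adj x h0|^2 below, is at most
    \<open>\<epsilon> / 2\<close>.\<close>
  define K where "K = 2 * (norm h0)\<^sup>2 / \<epsilon> + 1"
  have K: "K > 0" "(norm h0)\<^sup>2 / K \<le> \<epsilon> / 2"
    using eps by (simp_all add: K_def add_nonneg_pos divide_simps)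
  show "\<exists>\<delta>>0. \<forall>p\<in>A. proj p \<longrightarrow> (\<forall>v. q0 (p v) = p v) \<longrightarrow>
      (\<forall>\<Phi>\<in>avg q0. \<exists>u\<in>Uq q0. Re (cinner (u h0) (\<Phi> p (u h0))) < \<delta>) \<longrightarrow> (norm (p h0))\<^sup>2 \<le> \<epsilon>"
  proof (intro exI[of _ "\<epsilon> / 4"] conjI ballI impI)
    \<comment> \<open>The average constructed below dominates half of \<open>z\<close> at the
      conjugates of \<open>h0\<close>, so the threshold \<open>\<epsilon> / 4\<close> gives
      \<open>\<epsilon> / 2\<close> for \<open>z\<close>.\<close>
    show "\<epsilon> / 4 > 0" using eps by simp
    fix p assume p: "p \<in> A" "proj p" and q0p': "\<forall>v. q0 (p v) = p v"
      and small: "\<forall>\<Phi>\<in>avg q0. \<exists>u\<in>Uq q0. Re (cinner (u h0) (\<Phi> p (u h0))) < \<epsilon> / 4"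
    have q0p: "q0 (p v) = p v" for v using q0p' by blast
    have pq: "p (q0 v) = p v" for v by (rule proj_le_commute[OF p(2) pq0 q0p])
    obtain x where x: "x \<in> A" "pisom x" "\<And>v. p (x v) = x v" "\<And>v. x (q0 v) = x v"
        "K * (norm (adj x h0))\<^sup>2 \<le> (norm (x h0))\<^sup>2"
        "\<And>a v. a \<in> A \<Longrightarrow> (q0 - (adj x o\<^sub>L x)) (blinfun_apply a ((p - (x o\<^sub>L adj x)) v)) = 0"
      using maximal_pisom[OF s0 PI p q0p, of K] K(1) by force
    have bx: "x \<in> bounded_ops" using Abo[OF x(1)] .
    have axA: "adj x \<in> A" by (rule vna_adj[OF A x(1)])
    define r where "r = p - (x o\<^sub>L adj x)"
    define s where "s = q0 - (adj x o\<^sub>L x)"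
    have rA: "r \<in> A" and sA: "s \<in> A"
      unfolding r_def s_def by (intro vna_diff[OF A] vna_comp[OF A] x axA p q0A)+
    obtain z where z: "z \<in> A" "proj z" and zc: "\<And>a v. a \<in> A \<Longrightarrow> blinfun_apply a (blinfun_apply z v) = z (blinfun_apply a v)"
        and zr: "\<And>v. z (r v) = r v" and sz: "\<And>v. s (z v) = 0"
      using central_cover[OF rA Abo[OF sA]] x(6) unfolding r_def s_def by metis
    have q0z: "q0 (z v) = adj x (x (z v))" for v using sz[of v] by (simp add: s_def blinfun.diff_left)
    have pz: "p v - z (p v) = x (adj x v) - z (x (adj x v))" for v
      using zr[of v] by (simp add: r_def blinfun.diff_left blinfun.diff_right algebra_simps)
    \<comment> \<open>\<open>q0 - p\<close> cut down by \<open>z\<close>. Under \<open>z\<close>,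
      \<open>q0\<close> is exhausted by the initial projection of \<open>x\<close>, so
      \<open>x\<close> is isometric on the range of \<open>f\<close>.\<close>
    define f where "f = z o\<^sub>L (q0 - p)"
    have fA: "f \<in> A" unfolding f_def by (intro vna_comp[OF A] vna_diff[OF A] z q0A p)
    have f: "f v = z (q0 v) - z (p v)" for v by (simp add: f_def blinfun.diff_left blinfun.diff_right)
    have f': "f v = q0 (z v) - p (z v)" for v by (simp add: f zc q0A p(1))
    have xxf: "adj x (x (f v)) = f v" for v
    proof -
      have "adj x (x (f v)) = q0 (z (q0 v - p v))" unfolding q0z by (simp add: f_def blinfun.diff_left)
      also have "\<dots> = f v" by (simp add: f blinfun.diff_right zc[OF q0A, symmetric] projD[OF pq0] q0p)
        (simp add: zc[OF q0A] zc[OF p(1)] projD[OF pq0] q0p)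
      finally show ?thesis .
    qed
    have pf: "proj f"
      unfolding proj_def
    proof (intro conjI allI)
      have "cinner (f v) w = cinner v (f w)" for v w
        by (subst f, subst f') (simp add: cinner.diff_left cinner.diff_right saD[OF proj_sa[OF z(2)]]
            saD[OF proj_sa[OF pq0]] saD[OF proj_sa[OF p(2)]])
      then show "sa f" by (rule saI[OF Abo[OF fA]])
      show "f (f v) = f v" for v
        by (subst f', subst (1 2) f) (simp add: blinfun.diff_right projD[OF z(2)] zc[OF q0A] zc[OF p(1)] projD[OF pq0]
            projD[OF p(2)] q0p pq)
    qed
    have fp: "f (p v) = 0" for v by (simp add: f q0p projD[OF p(2)])
    have q0f: "q0 (f v) = f v" "f (q0 v) = f v" for v
    proof -
      show 1: "f (q0 v) = f v" for v by (simp add: f projD[OF pq0] pq)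
      show "q0 (f v) = f v" by (rule proj_le_commute'[OF pf pq0 1])
    qed
    \<comment> \<open>Its initial projection is \<open>f\<close>, orthogonal to \<open>p\<close>,
      and its range lies under \<open>p\<close>: the situation of \<open>swap_unitary\<close>, whose
      conjugate of \<open>p\<close> contains \<open>f\<close>.\<close>
    define c where "c = x o\<^sub>L f"
    have cA: "c \<in> A" unfolding c_def by (intro vna_comp[OF A] x fA)
    have bc: "c \<in> bounded_ops" using Abo[OF cA] .
    have ac: "adj c v = f (adj x v)" for v
      by (simp add: c_def adj_comp bx Abo fA sa_adj[OF proj_sa[OF pf]])
    have cv: "c v = x (f v)" for v by (simp add: c_def)
    have acc: "adj c (c v) = f v" for v by (simp add: ac cv xxf projD[OF pf])
    have "adj c o\<^sub>L c = f" by (rule blinfun_eqI) (simp add: acc)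
    then have pc: "pisom c" using bc pf by (simp add: pisom_def)
    obtain w where w: "w \<in> Uq q0" "\<And>v. w (p (adj w v)) = p v - c (adj c v) + adj c (c v)"
    proof -
      have "\<exists>w\<in>Uq q0. \<forall>v. w (p (adj w v)) = p v - c (adj c v) + adj c (c v)"
      proof (rule swap_unitary[OF cA pc pq0 _ _ p(2)])
        show pc': "p (c v) = c v" for v by (simp add: cv x(3))
        show "q0 (c v) = c v" for v using q0p[of "c v"] by (simp add: pc')
        show "c (q0 v) = c v" for v by (simp add: cv q0f)
        show "c (p v) = 0" for v by (simp add: cv fp blinfun.zero_right)
      qed
      then show ?thesis using that by blast
    qed
    have bw: "w \<in> bounded_ops" using unitaryD(5)[OF UqD(1)[OF w(1)]] .
    \<comment> \<open>The average of \<open>p\<close> with its swapped conjugate is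
      \<open>p - (c adj c) / 2 + f / 2\<close>. This is at least \<open>(p + f) / 2\<close>, and
      \<open>p + f\<close> dominates \<open>z q0\<close>.\<close>
    define \<Phi> where "\<Phi> y = (1/2) *\<^sub>R y + (1 - 1/2) *\<^sub>R (w o\<^sub>L y o\<^sub>L adj w)" for y
    have "\<Phi> \<in> avg q0" unfolding \<Phi>_def[abs_def] by (intro avg_mix avg_id avg_Ad w) auto
    then obtain u where u: "u \<in> Uq q0" "Re (cinner (u h0) (\<Phi> p (u h0))) < \<epsilon> / 4" using small by blast
    note uu = UqD(1)[OF u(1)]
    define g where "g = u h0"
    have q0g: "q0 g = g" using Uq_commutes[OF u(1) pq0, of h0] by (simp add: g_def q0h)
    have "Re (cinner g (\<Phi> p g)) = (norm (p g))\<^sup>2 - (1/2) * (norm (adj c g))\<^sup>2 + (1/2) * (norm (f g))\<^sup>2"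
    proof -
      have "\<Phi> p g = p g - (1/2) *\<^sub>R c (adj c g) + (1/2) *\<^sub>R f g"
        by (simp add: \<Phi>_def blinfun.add_left blinfun.scaleR_left w(2) acc scaleR_add_right scaleR_diff_right
            algebra_simps flip: scaleR_add_left)
      moreover have "cinner g (c (adj c g)) = of_real ((norm (adj c g))\<^sup>2)"
        by (simp add: cinner_self bc flip: cinner_adj_left)
      ultimately show ?thesis
        by (simp add: cinner.add_right cinner.diff_right cinner_scaleR_right proj_form[OF p(2)] proj_form[OF pf])
    qed
    moreover have "norm (adj c g) \<le> norm (p g)"
    proof -
      have "adj c (p g) = adj c g"
        by (rule cinner_eqI) (simp add: cinner_adj_right bc cv x(3) flip: saD[OF proj_sa[OF p(2)]])
      then have "norm (adj c g) = norm (c (adj c (p g)))" using pisom_norm[OF pisom_adj[OF pc], of g] by (simp add: bc)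
      also have "\<dots> \<le> norm (p g)" using proj_norm_le[OF pisomD(5)[OF pc], of "p g"] by simp
      finally show ?thesis .
    qed
    then have "(norm (adj c g))\<^sup>2 \<le> (norm (p g))\<^sup>2" by (intro power_mono) auto
    moreover have "(norm (z g))\<^sup>2 \<le> (norm (p g))\<^sup>2 + (norm (f g))\<^sup>2"
    proof -
      have "z g = z (p g) + f g" by (simp add: f q0g)
      moreover have "cinner (z (p g)) (f g) = 0"
        using fp[of "z g"] by (simp add: cinner.zero_left zc[OF p(1)] flip: saD[OF proj_sa[OF pf]])
      ultimately have "(norm (z g))\<^sup>2 = (norm (z (p g)))\<^sup>2 + (norm (f g))\<^sup>2" by (simp add: norm_add_sq)
      then show ?thesis using proj_norm_le[OF z(2), of "p g"] by (simp add: power_mono)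
    qed
    ultimately have zg: "(norm (z g))\<^sup>2 < \<epsilon> / 2" using u(2) unfolding g_def[symmetric] by linarith
    have "z g = u (z h0)" by (simp add: g_def zc[OF Uq_A[OF u(1)]])
    then have zh: "(norm (z h0))\<^sup>2 < \<epsilon> / 2" using zg by (simp add: unitaryD(4)[OF uu])
    \<comment> \<open>Under \<open>z\<close>, the projection \<open>p\<close> is small at
      \<open>h0\<close> because \<open>z\<close> is; off \<open>z\<close>, it coincides with
      \<open>x adj x\<close> and is small by the choice of \<open>K\<close>.\<close>
    have "(norm (p h0))\<^sup>2 = (norm (z (p h0)))\<^sup>2 + (norm (p h0 - z (p h0)))\<^sup>2" by (rule proj_pythagoras[OF z(2)])
    moreover have "(norm (z (p h0)))\<^sup>2 \<le> (norm (z h0))\<^sup>2"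
      unfolding zc[OF p(1), symmetric] by (intro power_mono proj_norm_le[OF p(2)]) auto
    moreover have "(norm (p h0 - z (p h0)))\<^sup>2 \<le> (norm h0)\<^sup>2 / K"
    proof -
      have "norm (p h0 - z (p h0)) \<le> norm (x (adj x h0))"
        unfolding pz using proj_norm_le[OF proj_complement[OF z(2)], of "x (adj x h0)"] by (simp add: blinfun.diff_left)
      also have "\<dots> = norm (adj x h0)" using pisom_norm[OF pisom_adj[OF x(2)], of h0] by (simp add: bx)
      finally have "(norm (p h0 - z (p h0)))\<^sup>2 \<le> (norm (adj x h0))\<^sup>2" by (intro power_mono) auto
      moreover have "norm (x h0) \<le> norm h0"
        using pisom_norm[OF x(2), of h0] proj_norm_le[OF pisomD(2)[OF x(2)], of h0] by simp
      then have "(norm (x h0))\<^sup>2 \<le> (norm h0)\<^sup>2" by (intro power_mono) auto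
      then have "K * (norm (adj x h0))\<^sup>2 \<le> (norm h0)\<^sup>2" using x(5) by linarith
      then have "(norm (adj x h0))\<^sup>2 \<le> (norm h0)\<^sup>2 / K" using K(1) by (simp only: pos_le_divide_eq mult.commute)
      ultimately show ?thesis by linarith
    qed
    ultimately show "(norm (p h0))\<^sup>2 \<le> \<epsilon>" using zh K(2) by linarith
  qed
qed

text \<open>A vector in the range of \<open>p\<close> has its support \<open>q0\<close> below
  \<open>p\<close>. The case distinction ranges over all subcorners of \<open>q0\<close>, so that
  its negative branch is the hypothesis of \<open>good_if_not_dominated\<close>.\<close>

lemma good_corner_exists:
  assumes p: "p \<in> A" "proj p" "p \<noteq> 0"
  shows "\<exists>q h. is_supp A q h \<and> q \<noteq> 0 \<and> (\<forall>v. p (q v) = q v) \<and> good q h"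
proof -
  obtain v where v: "p v \<noteq> 0" using p(3) by (metis blinfun_eqI zero_blinfun.rep_eq)
  define h0 where "h0 = p v"
  obtain q0 where s0: "is_supp A q0 h0" using is_supp_exists[OF A] by blast
  have le: "p (q0 v) = q0 v" for v
    by (rule is_supp_le[OF s0 A p(1)]) (simp add: h0_def projD[OF p(2)])
  have q0: "q0 \<noteq> 0" using is_suppD(3)[OF s0] v by (auto simp: h0_def)
  show ?thesis
  proof (cases "\<exists>q h k. is_supp A q h \<and> (\<forall>v. q0 (q v) = q v) \<and> q \<noteq> 0 \<and>
      (\<forall>p u. p \<in> A \<longrightarrow> proj p \<longrightarrow> (\<forall>v. q (p v) = p v) \<longrightarrow> u \<in> Uq q \<longrightarrow>
        norm (blinfun_apply p (blinfun_apply u h)) \<le> norm (p k))")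
    case True
    then obtain q h k where q: "is_supp A q h" "\<And>v. q0 (q v) = q v" "q \<noteq> 0"
      and T: "\<And>p u. p \<in> A \<Longrightarrow> proj p \<Longrightarrow> (\<forall>v. q (p v) = p v) \<Longrightarrow> u \<in> Uq q \<Longrightarrow>
        norm (blinfun_apply p (blinfun_apply u h)) \<le> norm (p k)" by blast
    have "p (q v) = q v" for v using le[of "q v"] by (simp add: q(2))
    then show ?thesis using q good_if_dominated[OF q(1) T] by blast
  next
    case False
    have "good q0 h0"
    proof (rule good_if_not_dominated[OF s0])
      fix q h k assume q: "is_supp A q h" "\<forall>v. q0 (blinfun_apply q v) = q v" "q \<noteq> 0"
      have "\<not> (\<forall>p u. p \<in> A \<longrightarrow> proj p \<longrightarrow> (\<forall>v. q (p v) = p v) \<longrightarrow> u \<in> Uq q \<longrightarrow>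
          norm (blinfun_apply p (blinfun_apply u h)) \<le> norm (p k))" using False q by blast
      then show "\<exists>p u. p \<in> A \<and> proj p \<and> (\<forall>v. q (blinfun_apply p v) = p v) \<and> u \<in> Uq q \<and>
        norm (blinfun_apply p k) < norm (p (blinfun_apply u h))" by (auto simp: not_le)
    qed
    then show ?thesis using s0 q0 le by blast
  qed
qed

end

section \<open>Gluing the corners\<close>

text \<open>On a norm ball, a \<sigma>-weakly continuous functional is controlled by the values at
  finitely many vectors: the bound \<open>R\<close> takes care of the tail of the series.\<close>

lemma vector_functional_small:
  assumes "square_summable \<xi>" "square_summable \<eta>" "\<delta> > 0" "0 \<le> R"
  shows "\<exists>G \<epsilon>. finite G \<and> \<epsilon> > 0 \<and> (\<forall>w :: 'h \<Rightarrow>\<^sub>L 'h. norm w \<le> R \<longrightarrow> (\<forall>g\<in>G. norm (blinfun_apply w g) < \<epsilon>) \<longrightarrow>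
    cmod (vector_functional (\<xi> :: nat \<Rightarrow> 'h::chilbert_space) \<eta> w) < \<delta>)"
proof -
  have sm: "summable (\<lambda>n. norm (\<xi> n) * norm (\<eta> n))" by (rule square_summable_bound(3)[OF assms(1,2)])
  have R1: "R + 1 > 0" using assms(4) by simp
  have "(\<lambda>N. \<Sum>n. norm (\<xi> (n + N)) * norm (\<eta> (n + N))) \<longlonglongrightarrow> 0" by (rule suminf_exist_split2[OF sm])
  then have "\<forall>\<^sub>F N in sequentially. (\<Sum>n. norm (\<xi> (n + N)) * norm (\<eta> (n + N))) < \<delta> / (2 * (R + 1))"
    by (rule order_tendstoD(2)) (use assms(3) R1 in simp)
  then obtain N where N: "(\<Sum>n. norm (\<xi> (n + N)) * norm (\<eta> (n + N))) < \<delta> / (2 * (R + 1))"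
    by (auto simp: eventually_sequentially)
  define S where "S = (\<Sum>n<N. norm (\<xi> n)) + 1"
  have S: "S > 0" by (simp add: S_def add_nonneg_pos sum_nonneg)
  define \<epsilon> where "\<epsilon> = \<delta> / (2 * S)"
  have eps: "\<epsilon> > 0" using assms(3) S by (simp add: \<epsilon>_def)
  have "cmod (vector_functional \<xi> \<eta> w) < \<delta>" if w: "norm w \<le> R" "\<forall>g\<in>\<eta> ` {..<N}. norm (blinfun_apply w g) < \<epsilon>" for w
  proof -
    define f where "f n = cinner (\<xi> n) (w (\<eta> n))" for n
    have sf: "summable f" unfolding f_def by (rule square_summable_bound(1)[OF assms(1,2)])
    have "vector_functional \<xi> \<eta> w = (\<Sum>n. f (n + N)) + (\<Sum>n<N. f n)"
      unfolding vector_functional_def f_def[symmetric] by (rule suminf_split_initial_segment[OF sf])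
    then have "cmod (vector_functional \<xi> \<eta> w) \<le> cmod (\<Sum>n. f (n + N)) + cmod (\<Sum>n<N. f n)"
      by (simp only: norm_triangle_ineq)
    also have "cmod (\<Sum>n. f (n + N)) \<le> R * (\<Sum>n. norm (\<xi> (n + N)) * norm (\<eta> (n + N)))"
    proof -
      have sm': "summable (\<lambda>n. norm (\<xi> (n + N)) * norm (\<eta> (n + N)))" using summable_ignore_initial_segment[OF sm] .
      have "cmod (f n) \<le> R * (norm (\<xi> n) * norm (\<eta> n))" for n
      proof -
        have "cmod (f n) \<le> norm (\<xi> n) * norm (w (\<eta> n))" unfolding f_def by (rule cinner_CS)
        also have "\<dots> \<le> norm (\<xi> n) * (norm w * norm (\<eta> n))" by (intro mult_left_mono norm_blinfun) simp
        also have "\<dots> \<le> norm (\<xi> n) * (R * norm (\<eta> n))" by (intro mult_left_mono mult_right_mono w) auto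
        finally show ?thesis by (simp add: mult_ac)
      qed
      then have "norm (\<Sum>n. f (n + N)) \<le> (\<Sum>n. R * (norm (\<xi> (n + N)) * norm (\<eta> (n + N))))"
        by (intro norm_suminf_le summable_mult sm')
      then show ?thesis by (simp add: suminf_mult[OF sm'])
    qed
    also have "\<dots> \<le> (R + 1) * (\<delta> / (2 * (R + 1)))"
    proof (rule mult_mono)
      show "0 \<le> (\<Sum>n. norm (\<xi> (n + N)) * norm (\<eta> (n + N)))"
        by (intro suminf_nonneg summable_ignore_initial_segment[OF sm]) simp
    qed (use N R1 in auto)
    also have "cmod (\<Sum>n<N. f n) \<le> (\<Sum>n<N. norm (\<xi> n) * \<epsilon>)"
    proof (rule sum_norm_le)
      fix n assume n: "n \<in> {..<N}"
      have "cmod (f n) \<le> norm (\<xi> n) * norm (w (\<eta> n))" unfolding f_def by (rule cinner_CS)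
      also have "\<dots> \<le> norm (\<xi> n) * \<epsilon>"
      proof (rule mult_left_mono)
        have "norm (w (\<eta> n)) < \<epsilon>" using w(2) n by blast
        then show "norm (w (\<eta> n)) \<le> \<epsilon>" by simp
      qed simp
      finally show "cmod (f n) \<le> norm (\<xi> n) * \<epsilon>" .
    qed
    also have "(\<Sum>n<N. norm (\<xi> n) * \<epsilon>) = (S - 1) * \<epsilon>" by (simp add: S_def sum_distrib_right)
    also have "(R + 1) * (\<delta> / (2 * (R + 1))) + (S - 1) * \<epsilon> < \<delta>"
    proof -
      have "r * (\<delta> / (2 * r)) = \<delta> / 2" if "r > 0" for r using that by simp
      from this[OF R1] have "(R + 1) * (\<delta> / (2 * (R + 1))) = \<delta> / 2" .
      moreover have "S * \<epsilon> = \<delta> / 2" using S by (simp add: \<epsilon>_def)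
      moreover have "(S - 1) * \<epsilon> < S * \<epsilon>" using eps by (intro mult_strict_right_mono) auto
      ultimately show ?thesis by linarith
    qed
    finally show ?thesis by simp
  qed
  then show ?thesis using eps by (intro exI[of _ "\<eta> ` {..<N}"] exI[of _ \<epsilon>]) auto
qed

context weight
begin

lemma Uq_subset: "Uq q \<subseteq> Uq id_blinfun"
  by (auto simp: Uq_def blinfun.zero_right)

lemma Uq_id_eq: "Uq id_blinfun = unitary_group A"
  by (auto simp: Uq_def blinfun.zero_right)

lemma avg_subset: "\<Phi> \<in> avg q \<Longrightarrow> \<Phi> \<in> avg id_blinfun"
proof (induction rule: avg.induct)
  case (avg_Ad u)
  then show ?case using Uq_subset by (intro avg.avg_Ad) blast
next
  case (avg_mix \<Phi> \<Psi> t)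
  then show ?case by (intro avg.avg_mix)
qed

lemma avg_fix:
  assumes "\<Phi> \<in> avg q" and q: "proj q" and x: "\<And>v. blinfun_apply x (q v) = 0" "\<And>v. blinfun_apply q (x v) = 0"
  shows "\<Phi> x = x"
  using assms(1)
proof (induction rule: avg.induct)
  case (avg_Ad u)
  show ?case
  proof (rule blinfun_eqI)
    fix v
    have x': "x (v - q v) = x v" for v by (simp add: blinfun.diff_right x)
    have "x (adj u v) = x (adj u v - q (adj u v))" by (rule x'[symmetric])
    also have "\<dots> = x (adj u (v - q v))"
      by (simp only: Uq_commutes[OF Uq_adj[OF avg_Ad] q, symmetric] blinfun.diff_right)
    also have "\<dots> = x v" unfolding UqD(2)[OF Uq_adj[OF avg_Ad]] by (rule x')
    finally have "x (adj u v) = x v" .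
    moreover have "u (x v) = x v" using UqD(2)[OF avg_Ad, of "x v"] by (simp add: x)
    ultimately show "(u o\<^sub>L x o\<^sub>L adj u) v = x v" by simp
  qed
next
  case (avg_mix \<Phi> \<Psi> t)
  then show ?case by (simp flip: scaleR_add_left)
qed

text \<open>Averaging over the identity and the symmetry \<open>2 f - 1\<close> removes the
  off-diagonal blocks.\<close>

lemma pinching_avg:
  assumes f: "f \<in> A" "proj f"
  shows "(\<lambda>x. (f o\<^sub>L x o\<^sub>L f) + ((id_blinfun - f) o\<^sub>L x o\<^sub>L (id_blinfun - f))) \<in> avg id_blinfun"
proof -
  define s where "s = 2 *\<^sub>R f - id_blinfun"
  have s: "s v = 2 *\<^sub>R f v - v" for v by (simp add: s_def blinfun.diff_left blinfun.scaleR_left)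
  have sA: "s \<in> A" unfolding s_def by (intro vna_diff[OF A] vna_scaleR[OF A] vna_id[OF A] f)
  have sas: "adj s = s" unfolding s_def by (intro sa_adj sa_diff sa_scaleR sa_id proj_sa f)
  have ss: "s (s v) = v" for v by (simp add: s blinfun.diff_right blinfun.scaleR_right blinfun.add_right projD[OF f(2)] scaleR_2)
  have "s \<in> Uq id_blinfun"
    unfolding Uq_id_eq unitary_group_def using sA ss by (simp add: sas blinfun_eq_iff)
  then have "(\<lambda>x. (1/2) *\<^sub>R x + (1 - 1/2) *\<^sub>R (s o\<^sub>L x o\<^sub>L adj s)) \<in> avg id_blinfun"
    by (intro avg_mix avg_id avg_Ad) auto
  also have "(\<lambda>x. (1/2) *\<^sub>R x + (1 - 1/2) *\<^sub>R (s o\<^sub>L x o\<^sub>L adj s))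
      = (\<lambda>x. (f o\<^sub>L x o\<^sub>L f) + ((id_blinfun - f) o\<^sub>L x o\<^sub>L (id_blinfun - f)))"
  proof (rule ext, rule blinfun_eqI)
    fix x v
    have "((1/2) *\<^sub>R x + (1 - 1/2) *\<^sub>R (s o\<^sub>L x o\<^sub>L adj s)) v
      = (1/2) *\<^sub>R (2 *\<^sub>R (f (x (f v)) + f (x (f v)) - f (x v) - x (f v) + x v))"
      unfolding sas by (simp add: blinfun.bilinear_simps s scaleR_2 algebra_simps)
    also have "\<dots> = ((f o\<^sub>L x o\<^sub>L f) + ((id_blinfun - f) o\<^sub>L x o\<^sub>L (id_blinfun - f))) v"
      by (simp add: blinfun.bilinear_simps algebra_simps)
    finally show "((1/2) *\<^sub>R x + (1 - 1/2) *\<^sub>R (s o\<^sub>L x o\<^sub>L adj s)) v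
      = ((f o\<^sub>L x o\<^sub>L f) + ((id_blinfun - f) o\<^sub>L x o\<^sub>L (id_blinfun - f))) v" .
  qed
  finally show ?thesis .
qed

text \<open>Pinching by \<open>f\<close> and then averaging in the corner \<open>f\<close> leaves the orthogonal corners alone,
  so that the corners can be treated one after the other.\<close>

lemma glue_corners:
  assumes "finite F" and F: "\<And>f. f \<in> F \<Longrightarrow> f \<in> A \<and> proj f"
    and orth: "\<And>f g v. f \<in> F \<Longrightarrow> g \<in> F \<Longrightarrow> f \<noteq> g \<Longrightarrow> blinfun_apply f (blinfun_apply g v) = 0"
    and G: "finite G" and eps: "\<epsilon> > 0"
    and small: "\<And>f. f \<in> F \<Longrightarrow> \<exists>\<Phi>\<in>avg f. \<forall>g\<in>G. norm (\<Phi> (f o\<^sub>L x o\<^sub>L f) g) < \<epsilon>"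
  shows "\<exists>\<Psi>\<in>avg id_blinfun. (\<forall>f\<in>F. (\<forall>v. blinfun_apply f (blinfun_apply (\<Psi> x) v) = \<Psi> x (blinfun_apply f v)) \<and>
      (\<forall>g\<in>G. norm (blinfun_apply f (blinfun_apply (\<Psi> x) g)) < \<epsilon>)) \<and>
    (\<forall>v. (id_blinfun - \<Sum>F) (\<Psi> x ((id_blinfun - \<Sum>F) v)) = (id_blinfun - \<Sum>F) (blinfun_apply x ((id_blinfun - \<Sum>F) v)))"
  using assms(1) F orth small
proof (induction F)
  case empty
  then show ?case by (intro bexI[OF _ avg_id]) simp
next
  case (insert f F)
  have f: "f \<in> A" "proj f" using insert.prems(1) by auto
  have Fo: "f (k v) = 0" "k (f v) = 0" if "k \<in> F" for k v
    using insert.prems(2)[of f k v] insert.prems(2)[of k f v] insert.hyps(2) that by auto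
  obtain \<Psi> where \<Psi>: "\<Psi> \<in> avg id_blinfun"
      and \<Psi>F: "\<And>k v. k \<in> F \<Longrightarrow> blinfun_apply k (blinfun_apply (\<Psi> x) v) = \<Psi> x (blinfun_apply k v)"
      "\<And>k g. k \<in> F \<Longrightarrow> g \<in> G \<Longrightarrow> norm (blinfun_apply k (blinfun_apply (\<Psi> x) g)) < \<epsilon>"
      and \<Psi>0: "\<And>v. (id_blinfun - \<Sum>F) (\<Psi> x ((id_blinfun - \<Sum>F) v)) = (id_blinfun - \<Sum>F) (x ((id_blinfun - \<Sum>F) v))"
    using insert.IH[OF insert.prems(1)[OF insertI2] insert.prems(2)[OF insertI2 insertI2] insert.prems(3)[OF insertI2]]
    by blast
  obtain \<Phi> where \<Phi>: "\<Phi> \<in> avg f" "\<And>g. g \<in> G \<Longrightarrow> norm (\<Phi> (f o\<^sub>L x o\<^sub>L f) g) < \<epsilon>"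
    using insert.prems(3) by blast
  define y where "y = \<Psi> x"
  define p where "p = id_blinfun - \<Sum>F"
  have p: "p v = v - (\<Sum>k\<in>F. blinfun_apply k v)" for v by (simp add: p_def blinfun.diff_left blinfun.sum_left)
  have fp: "f (p v) = f v" "p (f v) = f v" for v
    using Fo by (simp_all add: p blinfun.diff_right blinfun.sum_right)
  \<comment> \<open>\<open>\<Psi>\<close> has not changed the compression of \<open>x\<close> to the
    complement of \<open>F\<close>, so the corner at \<open>f\<close> is still that of
    \<open>x\<close>.\<close>
  have fyf: "f (y (f v)) = f (x (f v))" for v
  proof -
    have "f (y (f v)) = f (p (y (p (f v))))" by (simp add: fp)
    also have "\<dots> = f (p (x (p (f v))))" using \<Psi>0[of "f v"] by (simp only: p_def y_def)
    finally show ?thesis by (simp add: fp)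
  qed
  define a where "a = f o\<^sub>L y o\<^sub>L f"
  define b where "b = (id_blinfun - f) o\<^sub>L y o\<^sub>L (id_blinfun - f)"
  have ax: "a = f o\<^sub>L x o\<^sub>L f" by (rule blinfun_eqI) (simp add: a_def fyf)
  \<comment> \<open>After pinching, the average in the corner \<open>f\<close> acts on the block
    \<open>a\<close> and fixes the other block \<open>b\<close> by \<open>avg_fix\<close>.\<close>
  define \<Psi>' where "\<Psi>' z = \<Phi> ((f o\<^sub>L \<Psi> z o\<^sub>L f) + ((id_blinfun - f) o\<^sub>L \<Psi> z o\<^sub>L (id_blinfun - f)))" for z
  have \<Psi>'a: "\<Psi>' \<in> avg id_blinfun"
    unfolding \<Psi>'_def[abs_def]
    by (rule avg_comp[OF avg_subset[OF \<Phi>(1)] avg_comp[OF pinching_avg[OF f] \<Psi>]])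
  have b: "b (f v) = 0" "f (b v) = 0" for v
    by (simp_all add: b_def blinfun.diff_left blinfun.diff_right projD[OF f(2)] blinfun.zero_right)
  have "\<Psi>' x = \<Phi> a + b"
    by (simp add: \<Psi>'_def avg_add[OF \<Phi>(1)] avg_fix[OF \<Phi>(1) f(2) b] flip: y_def a_def b_def)
  then have \<Psi>'x: "\<Psi>' x v = \<Phi> a v + b v" for v by (simp add: blinfun.add_left)
  have \<Phi>a: "\<Phi> a (f v) = \<Phi> a v" "f (\<Phi> a v) = \<Phi> a v" for v
    using avg_corner[OF \<Phi>(1) f(2), of a v] by (simp_all add: a_def projD[OF f(2)])
  have kb: "k (b v) = k (y v)" "b (k v) = k (y v)" if k: "k \<in> F" for k v
  proof -
    have "k (y (f v)) = 0" for v unfolding y_def \<Psi>F(1)[OF k] by (simp add: Fo[OF k] blinfun.zero_right)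
    then show "k (b v) = k (y v)" by (simp add: b_def blinfun.diff_left blinfun.diff_right Fo[OF k])
    have "f (k (y v)) = 0" by (rule Fo(1)[OF k])
    then show "b (k v) = k (y v)"
      using \<Psi>F(1)[OF k, of v] by (simp add: b_def y_def blinfun.diff_left blinfun.diff_right Fo[OF k] blinfun.zero_right)
  qed
  have k\<Phi>: "k (\<Phi> a v) = 0" "\<Phi> a (k v) = 0" if k: "k \<in> F" for k v
  proof -
    show "k (\<Phi> a v) = 0" using Fo(2)[OF k, of "\<Phi> a v"] by (simp only: \<Phi>a)
    show "\<Phi> a (k v) = 0" using \<Phi>a(1)[of "k v"] by (simp add: Fo(1)[OF k] blinfun.zero_right)
  qed
  have 1: "k (\<Psi>' x v) = \<Psi>' x (k v)" if "k \<in> insert f F" for k v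
  proof (cases "k = f")
    case True
    then show ?thesis by (simp add: \<Psi>'x blinfun.add_right \<Phi>a b)
  next
    case False
    then have "k \<in> F" using that by simp
    then show ?thesis by (simp add: \<Psi>'x blinfun.add_right kb k\<Phi>)
  qed
  have 2: "norm (k (\<Psi>' x g)) < \<epsilon>" if "k \<in> insert f F" "g \<in> G" for k g
  proof (cases "k = f")
    case True
    have "f (\<Psi>' x g) = \<Phi> a g" by (simp add: \<Psi>'x blinfun.add_right \<Phi>a b)
    then show ?thesis using \<Phi>(2)[OF that(2)] by (simp only: True ax)
  next
    case False
    then have "k \<in> F" using that by simp
    then show ?thesis using \<Psi>F(2)[OF _ that(2)] by (simp add: \<Psi>'x blinfun.add_right kb k\<Phi> y_def)
  qed
  define p' where "p' = id_blinfun - \<Sum>(insert f F)"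
  have p': "p' v = p v - f v" for v
    using insert.hyps by (simp add: p'_def p_def blinfun.diff_left blinfun.add_left)
  have 3: "p' (\<Psi>' x (p' v)) = p' (x (p' v))" for v
  proof -
    have fp': "f (p' v) = 0" for v by (simp add: p' blinfun.diff_right fp projD[OF f(2)])
    have pp: "p (p v) = p v" for v
    proof -
      have "(\<Sum>k\<in>F. blinfun_apply k (p v)) = 0"
      proof (rule sum.neutral, rule ballI)
        fix k assume k: "k \<in> F"
        have "k ((\<Sum>F) v) = k v" using orth_sum_proj(3)[OF insert.hyps(1) _ _ k, of v] insert.prems by auto
        then show "k (p v) = 0" by (simp add: p_def blinfun.diff_left blinfun.diff_right)
      qed
      then show ?thesis by (subst p) simp
    qed
    have p'p: "p (p' v) = p' v" for v by (simp add: p' blinfun.diff_right fp pp)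
    have p'p2: "p' (p w) = p' w" for w by (simp add: p' fp pp)
    have "\<Psi>' x (p' v) = y (p' v) - f (y (p' v))"
    proof -
      have "\<Phi> a (p' v) = 0" using \<Phi>a(1)[of "p' v"] by (simp add: fp' blinfun.zero_right)
      then show ?thesis by (simp add: \<Psi>'x b_def blinfun.diff_left fp')
    qed
    then have "p' (\<Psi>' x (p' v)) = p' (y (p' v))"
      by (simp add: blinfun.diff_right) (simp add: p' fp projD[OF f(2)])
    also have "\<dots> = p' (p (y (p (p' v))))" by (simp only: p'p p'p2)
    also have "\<dots> = p' (p (x (p (p' v))))" using \<Psi>0[of "p' v"] by (simp only: p_def y_def)
    also have "\<dots> = p' (x (p' v))" by (simp only: p'p p'p2)
    finally show ?thesis .
  qed
  show ?case
    using \<Psi>'a 1 2 3 unfolding p'_def by (intro bexI[of _ \<Psi>']) auto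
qed

text \<open>A nonzero limit from \<open>near_min\<close> would be turned by
  \<open>central_extension\<close> into a nonzero element of the relative commutant with finite
  weight.\<close>

lemma corner_zero:
  assumes inf: "\<And>T. T \<in> M \<Longrightarrow> T \<in> commutant A \<Longrightarrow> pos T \<Longrightarrow> T \<noteq> 0 \<Longrightarrow> \<not> weight_finite_at A E T"
    and s: "is_supp A q h" and good: "good q h" and x: "x \<in> M" "pos x"
    and bd: "\<And>g. e x g \<le> ennreal (C * (norm g)\<^sup>2)" and C: "0 \<le> C"
  shows "\<exists>\<Phi>. (\<forall>n. \<Phi> n \<in> avg q) \<and> (\<forall>v. (\<lambda>n. \<Phi> n (q o\<^sub>L x o\<^sub>L q) v) \<longlonglongrightarrow> 0)"
proof -
  have qA: "q \<in> A" and pq: "proj q" using is_suppD[OF s] by auto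
  have aq: "adj q = q" by (rule sa_adj[OF proj_sa[OF pq]])
  define x' where "x' = q o\<^sub>L x o\<^sub>L q"
  have x': "x' \<in> M" "pos x'"
    using vna_comp[OF M vna_comp[OF M AMD[OF qA] x(1)] AMD[OF qA]] pos_conj[OF x(2) Abo[OF qA]]
    by (simp_all add: x'_def aq)
  have bd': "e x' g \<le> ennreal (C * (norm g)\<^sup>2)" for g
  proof -
    have "e x' g = e x (q g)" using e_conj[OF x qA, of g] by (simp add: x'_def aq)
    also have "\<dots> \<le> ennreal (C * (norm (q g))\<^sup>2)" by (rule bd)
    also have "\<dots> \<le> ennreal (C * (norm g)\<^sup>2)"
      using C by (intro ennreal_leI mult_left_mono power_mono proj_norm_le[OF pq]) auto
    finally show ?thesis .
  qed
  have "x' (q v) = x' v" "q (x' v) = x' v" for v by (simp_all add: x'_def projD[OF pq])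
  from near_min[OF s good x' this bd' C] obtain y \<Phi> where y: "y \<in> M" "pos y" "\<And>v. y (q v) = y v" "\<And>v. q (y v) = y v"
      "\<And>u v. u \<in> Uq q \<Longrightarrow> blinfun_apply u (y v) = y (u v)"
    and \<Phi>: "\<And>n. \<Phi> n \<in> avg q" "\<And>v. (\<lambda>n. \<Phi> n x' v) \<longlonglongrightarrow> blinfun_apply y v"
    and ye: "\<And>g. e2 y g \<le> ennreal (2 * (norm x' * C * (norm g)\<^sup>2))" by blast
  have "y = 0"
  proof (rule ccontr)
    assume "y \<noteq> 0"
    have "e2 y g \<le> ennreal (2 * (norm x' * C) * (norm g)\<^sup>2)" for g using ye[of g] by (simp add: mult_ac)
    from central_extension[OF qA pq y(1,2) \<open>y \<noteq> 0\<close> y(5)[symmetric] y(3,4) this]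
    show False using inf C by (metis mult_nonneg_nonneg norm_ge_zero zero_le_numeral)
  qed
  then have "(\<lambda>n. \<Phi> n x' v) \<longlonglongrightarrow> 0" for v using \<Phi>(2)[of v] by simp
  then show ?thesis using \<Phi>(1) unfolding x'_def by blast
qed

text \<open>Finitely many orthogonal corners carry almost all of the vectors in \<open>G\<close>.
  \<open>\<Psi> x\<close> commutes with these projections and is small in each corner; on the
  remainder its norm, at most that of \<open>x\<close>, suffices.\<close>

lemma avg_small:
  assumes inf: "\<And>T. T \<in> M \<Longrightarrow> T \<in> commutant A \<Longrightarrow> pos T \<Longrightarrow> T \<noteq> 0 \<Longrightarrow> \<not> weight_finite_at A E T"
    and x: "x \<in> M" "pos x" and bd: "\<And>g. e x g \<le> ennreal (C * (norm g)\<^sup>2)" and C: "0 \<le> C"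
    and G: "finite G" and eps: "\<epsilon> > 0"
  shows "\<exists>\<Psi>\<in>avg id_blinfun. \<forall>g\<in>G. norm (\<Psi> x g) < \<epsilon>"
proof -
  define Q where "Q = {q \<in> A. proj q \<and> (\<exists>\<Phi>. (\<forall>n::nat. \<Phi> n \<in> avg q) \<and> (\<forall>v. (\<lambda>n. \<Phi> n (q o\<^sub>L x o\<^sub>L q) v) \<longlonglongrightarrow> 0))}"
  have "\<exists>S\<subseteq>Q. (\<forall>f\<in>S. \<forall>g\<in>S. f \<noteq> g \<longrightarrow> (\<forall>v. f (blinfun_apply g v) = 0)) \<and>
    (\<forall>G \<epsilon>. finite G \<and> \<epsilon> > 0 \<longrightarrow> (\<exists>F\<subseteq>S. finite F \<and> (\<forall>g\<in>G. norm (g - (\<Sum>F) g) < \<epsilon>)))"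
  proof (rule exhaustion[OF A])
    show "f \<in> A \<and> proj f" if "f \<in> Q" for f using that by (simp add: Q_def)
    fix p assume "p \<in> A" "proj p" "p \<noteq> 0"
    from good_corner_exists[OF this] obtain q h where q: "is_supp A q h" "q \<noteq> 0" "\<forall>v. p (q v) = q v" "good q h" by blast
    have "q \<in> Q" using is_suppD(1,2)[OF q(1)] corner_zero[OF inf q(1,4) x bd C] by (simp add: Q_def)
    then show "\<exists>f\<in>Q. f \<noteq> 0 \<and> (\<forall>v. p (blinfun_apply f v) = f v)" using q by blast
  qed
  then obtain S where S: "S \<subseteq> Q" "\<And>f g v. f \<in> S \<Longrightarrow> g \<in> S \<Longrightarrow> f \<noteq> g \<Longrightarrow> blinfun_apply f (blinfun_apply g v) = 0"
    "\<And>G \<epsilon>. finite G \<Longrightarrow> \<epsilon> > 0 \<Longrightarrow> \<exists>F\<subseteq>S. finite F \<and> (\<forall>g\<in>G. norm (g - (\<Sum>F) g) < \<epsilon>)" by metis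
  have nx: "norm x + 1 > 0" by (simp add: add_nonneg_pos)
  obtain F where F: "F \<subseteq> S" "finite F" "\<And>g. g \<in> G \<Longrightarrow> norm (g - (\<Sum>F) g) < \<epsilon> / (2 * (norm x + 1))"
    using S(3)[OF G, of "\<epsilon> / (2 * (norm x + 1))"] eps nx by auto
  \<comment> \<open>Shares \<open>\<epsilon> / 2\<close> among the corners in \<open>F\<close>; the
    summand 1 covers an empty \<open>F\<close>.\<close>
  define c where "c = real (card F) + 1"
  have c: "c > 0" by (simp add: c_def add_nonneg_pos)
  have SA: "f \<in> A \<and> proj f" if "f \<in> F" for f using that F(1) S(1) by (auto simp: Q_def)
  have so: "blinfun_apply f (blinfun_apply g v) = 0" if "f \<in> F" "g \<in> F" "f \<noteq> g" for f g v using S(2) that F(1) by blast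
  have small: "\<exists>\<Phi>\<in>avg f. \<forall>g\<in>G. norm (\<Phi> (f o\<^sub>L x o\<^sub>L f) g) < \<epsilon> / (2 * c)" if f: "f \<in> F" for f
  proof -
    obtain \<Phi> where \<Phi>: "\<And>n::nat. \<Phi> n \<in> avg f" "\<And>v. (\<lambda>n. \<Phi> n (f o\<^sub>L x o\<^sub>L f) v) \<longlonglongrightarrow> 0"
      using f F(1) S(1) unfolding Q_def by blast
    have "\<forall>\<^sub>F n in sequentially. \<forall>g\<in>G. norm (\<Phi> n (f o\<^sub>L x o\<^sub>L f) g) < \<epsilon> / (2 * c)"
    proof (intro eventually_ball_finite G ballI)
      fix g
      show "\<forall>\<^sub>F n in sequentially. norm (\<Phi> n (f o\<^sub>L x o\<^sub>L f) g) < \<epsilon> / (2 * c)"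
        by (rule order_tendstoD(2)[OF tendsto_norm_zero[OF \<Phi>(2)]]) (use eps c in simp)
    qed
    then obtain n where "\<forall>g\<in>G. norm (\<Phi> n (f o\<^sub>L x o\<^sub>L f) g) < \<epsilon> / (2 * c)"
      by (auto simp: eventually_sequentially)
    then show ?thesis using \<Phi>(1) by blast
  qed
  have ec: "\<epsilon> / (2 * c) > 0" using eps c by simp
  obtain \<Psi> where \<Psi>: "\<Psi> \<in> avg id_blinfun"
    "\<And>f v. f \<in> F \<Longrightarrow> blinfun_apply f (blinfun_apply (\<Psi> x) v) = \<Psi> x (blinfun_apply f v)"
    "\<And>f g. f \<in> F \<Longrightarrow> g \<in> G \<Longrightarrow> norm (blinfun_apply f (blinfun_apply (\<Psi> x) g)) < \<epsilon> / (2 * c)"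
    using glue_corners[OF F(2) SA so G ec small] by blast
  have "norm (\<Psi> x g) < \<epsilon>" if g: "g \<in> G" for g
  proof -
    have "(\<Sum>F) (\<Psi> x g) = \<Psi> x ((\<Sum>F) g)" by (simp add: blinfun.sum_left blinfun.sum_right \<Psi>(2))
    then have eq: "\<Psi> x g = (\<Sum>f\<in>F. blinfun_apply f (\<Psi> x g)) + \<Psi> x (g - (\<Sum>F) g)"
      by (simp add: blinfun.diff_right flip: blinfun.sum_left)
    have "norm (\<Psi> x g) \<le> norm (\<Sum>f\<in>F. blinfun_apply f (\<Psi> x g)) + norm (\<Psi> x (g - (\<Sum>F) g))"
      by (subst eq) (rule norm_triangle_ineq)
    also have "norm (\<Sum>f\<in>F. blinfun_apply f (\<Psi> x g)) \<le> (\<Sum>f\<in>F. \<epsilon> / (2 * c))"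
      by (intro sum_norm_le less_imp_le \<Psi>(3) g)
    also have "\<dots> \<le> \<epsilon> / 2"
    proof -
      have "real (card F) * \<epsilon> \<le> c * \<epsilon>" using eps by (intro mult_right_mono) (auto simp: c_def)
      then show ?thesis using c by (simp add: field_simps)
    qed
    also have "norm (\<Psi> x (g - (\<Sum>F) g)) \<le> norm (\<Psi> x) * norm (g - (\<Sum>F) g)" by (rule norm_blinfun)
    also have "\<dots> \<le> (norm x + 1) * norm (g - (\<Sum>F) g)"
      using avg_norm[OF \<Psi>(1), of x] by (intro mult_right_mono) auto
    also have "\<dots> < \<epsilon> / 2" using F(3)[OF g] nx by (simp add: field_simps)
    finally show ?thesis by simp
  qed
  then show ?thesis using \<Psi>(1) by blast
qed

section \<open>From averages to the closed convex hull\<close>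

lemma conj_orbit: "{u o\<^sub>L x o\<^sub>L adj u |u. u \<in> unitary_group A} = {u o\<^sub>L x o\<^sub>L adj u |u. u \<in> Uq id_blinfun}"
  by (simp add: Uq_id_eq)

lemma hull_avg: "convex hull {u o\<^sub>L x o\<^sub>L adj u |u. u \<in> unitary_group A} = {\<Phi> x |\<Phi>. \<Phi> \<in> avg id_blinfun}"
proof
  show "convex hull {u o\<^sub>L x o\<^sub>L adj u |u. u \<in> unitary_group A} \<subseteq> {\<Phi> x |\<Phi>. \<Phi> \<in> avg id_blinfun}"
  proof (rule hull_minimal)
    show "{u o\<^sub>L x o\<^sub>L adj u |u. u \<in> unitary_group A} \<subseteq> {\<Phi> x |\<Phi>. \<Phi> \<in> avg id_blinfun}"
    proof
      fix w assume "w \<in> {u o\<^sub>L x o\<^sub>L adj u |u. u \<in> unitary_group A}"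
      then obtain u where u: "u \<in> Uq id_blinfun" "w = u o\<^sub>L x o\<^sub>L adj u" by (auto simp: Uq_id_eq)
      show "w \<in> {\<Phi> x |\<Phi>. \<Phi> \<in> avg id_blinfun}"
        using avg_Ad[OF u(1)] unfolding u(2) by (intro CollectI exI[of _ "\<lambda>x. u o\<^sub>L x o\<^sub>L adj u"]) simp
    qed
  qed (rule avg_convex)
  show "{\<Phi> x |\<Phi>. \<Phi> \<in> avg id_blinfun} \<subseteq> convex hull {u o\<^sub>L x o\<^sub>L adj u |u. u \<in> unitary_group A}"
    unfolding conj_orbit using avg_hull by blast
qed

lemma zero_in_conj_hull:
  assumes inf: "\<And>T. T \<in> M \<Longrightarrow> T \<in> commutant A \<Longrightarrow> pos T \<Longrightarrow> T \<noteq> 0 \<Longrightarrow> \<not> weight_finite_at A E T"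
    and x: "x \<in> M" "pos x" "weight_finite_at A E x"
  shows "0 \<in> conj_hull M A x"
proof -
  have Mb: "M \<subseteq> bounded_ops" using Mbo by blast
  obtain C where C: "0 \<le> C" "\<And>g. e x g \<le> ennreal (C * (norm g)\<^sup>2)" using bounded_if_finite[OF x(3)] by blast
  have "\<exists>w\<in>convex hull {u o\<^sub>L x o\<^sub>L adj u |u. u \<in> unitary_group A}. w \<in> W"
    if W: "0 \<in> W" "openin (sigma_weak M) W" for W
  proof -
    obtain P \<delta> where P12: "finite P" "\<delta> > 0"
      and P': "\<forall>(\<xi>, \<eta>)\<in>P. square_summable \<xi> \<and> square_summable \<eta>"
      "\<forall>w\<in>M. (\<forall>(\<xi>, \<eta>)\<in>P. cmod (vector_functional \<xi> \<eta> w - vector_functional \<xi> \<eta> 0) < \<delta>) \<longrightarrow> w \<in> W"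
      using sigma_weak_nbhd[OF W(2,1) Mb] by blast
    have P34: "square_summable \<xi> \<and> square_summable \<eta>" if "(\<xi>, \<eta>) \<in> P" for \<xi> \<eta> using bspec[OF P'(1) that] by simp
    have P4: "w \<in> W" if "w \<in> M" "\<And>\<xi> \<eta>. (\<xi>, \<eta>) \<in> P \<Longrightarrow> cmod (vector_functional \<xi> \<eta> w - vector_functional \<xi> \<eta> 0) < \<delta>" for w
      using bspec[OF P'(2) that(1)] that(2) by auto
    note P = P12 P34 P4
    have "\<forall>i\<in>P. \<exists>G \<epsilon>. finite G \<and> \<epsilon> > 0 \<and> (\<forall>w :: 'h \<Rightarrow>\<^sub>L 'h. norm w \<le> norm x \<longrightarrow> (\<forall>g\<in>G. norm (blinfun_apply w g) < \<epsilon>) \<longrightarrow>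
        cmod (vector_functional (fst i) (snd i) w) < \<delta>)"
    proof
      fix i assume "i \<in> P"
      then have "square_summable (fst i)" "square_summable (snd i)" using P(3)[of "fst i" "snd i"] by auto
      from vector_functional_small[OF this P(2), of "norm x"]
      show "\<exists>G \<epsilon>. finite G \<and> \<epsilon> > 0 \<and> (\<forall>w :: 'h \<Rightarrow>\<^sub>L 'h. norm w \<le> norm x \<longrightarrow> (\<forall>g\<in>G. norm (blinfun_apply w g) < \<epsilon>) \<longrightarrow>
        cmod (vector_functional (fst i) (snd i) w) < \<delta>)" by simp
    qed
    then obtain G \<epsilon> where G: "\<And>i. i \<in> P \<Longrightarrow> finite (G i)" "\<And>i. i \<in> P \<Longrightarrow> \<epsilon> i > (0::real)"
      "\<And>i w. i \<in> P \<Longrightarrow> norm (w :: 'h \<Rightarrow>\<^sub>L 'h) \<le> norm x \<Longrightarrow> (\<forall>g\<in>G i. norm (blinfun_apply w g) < \<epsilon> i) \<Longrightarrow>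
        cmod (vector_functional (fst i) (snd i) w) < \<delta>" by metis
    \<comment> \<open>The 1 covers an empty \<open>P\<close>.\<close>
    define \<epsilon>0 where "\<epsilon>0 = Min (insert 1 (\<epsilon> ` P))"
    have eps0: "\<epsilon>0 > 0" "\<And>i. i \<in> P \<Longrightarrow> \<epsilon>0 \<le> \<epsilon> i" using P(1) G(2) by (auto simp: \<epsilon>0_def)
    have "finite (\<Union>i\<in>P. G i)" using P(1) G(1) by blast
    from avg_small[OF inf x(1,2) C(2,1) this eps0(1)]
    obtain \<Psi> where \<Psi>: "\<Psi> \<in> avg id_blinfun" "\<forall>g\<in>(\<Union>i\<in>P. G i). norm (\<Psi> x g) < \<epsilon>0" by blast
    have "\<Psi> x \<in> W"
    proof (rule P(4)[OF avg_M[OF \<Psi>(1) x(1)]])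
      fix \<xi> \<eta> assume i: "(\<xi>, \<eta>) \<in> P"
      have "\<forall>g\<in>G (\<xi>, \<eta>). norm (\<Psi> x g) < \<epsilon> (\<xi>, \<eta>)"
      proof
        fix g assume "g \<in> G (\<xi>, \<eta>)"
        then have "norm (\<Psi> x g) < \<epsilon>0" using \<Psi>(2) i by blast
        then show "norm (\<Psi> x g) < \<epsilon> (\<xi>, \<eta>)" using eps0(2)[OF i] by simp
      qed
      from G(3)[OF i avg_norm[OF \<Psi>(1)] this]
      show "cmod (vector_functional \<xi> \<eta> (\<Psi> x) - vector_functional \<xi> \<eta> 0) < \<delta>"
        by (simp add: vector_functional_def cinner.zero_right)
    qed
    then show ?thesis unfolding hull_avg using \<Psi>(1) by blast
  qed
  then show ?thesis
    unfolding conj_hull_def in_closure_of topspace_sigma_weak[OF Mb] using vna_zero[OF M] by blast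
qed

lemma conj_hull_commutant_zero:
  assumes inf: "\<And>T. T \<in> M \<Longrightarrow> T \<in> commutant A \<Longrightarrow> pos T \<Longrightarrow> T \<noteq> 0 \<Longrightarrow> \<not> weight_finite_at A E T"
    and x: "x \<in> M" "pos x" "weight_finite_at A E x"
    and y: "y \<in> commutant A" "y \<in> conj_hull M A x"
  shows "y = 0"
proof -
  have Mb: "M \<subseteq> bounded_ops" using Mbo by blast
  obtain C where C: "0 \<le> C" "\<And>g. e x g \<le> ennreal (C * (norm g)\<^sup>2)" using bounded_if_finite[OF x(3)] by blast
  define H where "H = {\<Phi> x |\<Phi>. \<Phi> \<in> avg id_blinfun}"
  have yM: "y \<in> M" and ycl: "\<And>W. y \<in> W \<Longrightarrow> openin (sigma_weak M) W \<Longrightarrow> \<exists>w\<in>H. w \<in> W"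
    using y(2) unfolding conj_hull_def in_closure_of topspace_sigma_weak[OF Mb] hull_avg H_def by blast+
  have HM: "w \<in> M" "pos w" "norm w \<le> norm x" "e2 w g \<le> ennreal (norm x * C * (norm g)\<^sup>2)" if wH: "w \<in> H" for w g
  proof -
    obtain \<Phi> where \<Phi>: "\<Phi> \<in> avg id_blinfun" "w = \<Phi> x" using wH by (auto simp: H_def)
    show w: "w \<in> M" "pos w" "norm w \<le> norm x" unfolding \<Phi>(2) by (auto intro: avg_M avg_pos avg_norm \<Phi>(1) x)
    have "e w g \<le> ennreal (C * (norm g)\<^sup>2)"
      unfolding \<Phi>(2)
    proof (rule avg_e_le[OF \<Phi>(1) x(1,2)])
      fix u assume "u \<in> Uq id_blinfun"
      then show "e x (u g) \<le> ennreal (C * (norm g)\<^sup>2)" using C(2)[of "u g"] by (simp add: unitaryD(4)[OF UqD(1)])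
    qed
    then have "ennreal (norm w) * e w g \<le> ennreal (norm x) * ennreal (C * (norm g)\<^sup>2)"
      by (intro mult_mono ennreal_leI w) auto
    also have "\<dots> = ennreal (norm x * C * (norm g)\<^sup>2)" using C(1) by (simp add: mult.assoc flip: ennreal_mult)
    finally show "e2 w g \<le> ennreal (norm x * C * (norm g)\<^sup>2)" using e2_le_e[OF w(1,2), of g] by simp
  qed
  have "e2 y g \<le> ennreal (2 * (norm x * C * (norm g)\<^sup>2))" for g
  proof (rule e2_lsc[where C = H and R = "norm x"])
    show "convex H" unfolding H_def by (rule avg_convex)
    show "H \<subseteq> M" using HM(1) by blast
    show "0 \<le> norm x * C * (norm g)\<^sup>2" using C(1) by simp
    \<comment> \<open>Membership of \<open>y\<close> in the \<sigma>-weak closure is used through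
      matrix coefficients at finitely many vectors only.\<close>
    fix G :: "'h set" and \<epsilon> :: real assume G: "finite G" "\<epsilon> > 0"
    define V where "V i = {z \<in> M. vector_functional (unit_seq (fst i)) (unit_seq (snd i)) z \<in>
        ball (cinner (fst i) (y (snd i))) \<epsilon>}" for i
    have "openin (sigma_weak M) (V i)" for i
      unfolding V_def by (intro sigma_weak_open square_summable_unit_seq open_ball Mb)
    then have "openin (sigma_weak M) (M \<inter> (\<Inter>i\<in>G \<times> G. V i))"
      using G(1) openin_topspace[of "sigma_weak M"] unfolding topspace_sigma_weak[OF Mb]
      by (cases "G \<times> G = {}") (auto intro!: openin_Int openin_INT2 simp del: Int_iff)
    moreover have "y \<in> M \<inter> (\<Inter>i\<in>G \<times> G. V i)"
      using yM G(2) by (auto simp: V_def vector_functional_unit_seq)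
    ultimately obtain w where w: "w \<in> H" "w \<in> M \<inter> (\<Inter>i\<in>G \<times> G. V i)" using ycl by blast
    have "cmod (cinner g ((w - y) g')) < \<epsilon>" if "g \<in> G" "g' \<in> G" for g g'
    proof -
      have "w \<in> V (g, g')" using w(2) that by blast
      then show ?thesis
        by (simp add: V_def vector_functional_unit_seq dist_norm norm_minus_commute blinfun.diff_left cinner.diff_right)
    qed
    then show "\<exists>w\<in>H. \<forall>g\<in>G. \<forall>g'\<in>G. cmod (cinner g ((w - y) g')) < \<epsilon>" using w(1) by blast
  qed (use HM yM in auto)
  then have bd: "e (adj y o\<^sub>L y) g \<le> ennreal (2 * (norm x * C) * (norm g)\<^sup>2)" for g
    by (simp add: e2_def mult_ac)
  have CA: "von_neumann_algebra (commutant A)" by (rule vna_commutant[OF A])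
  have "weight_finite_at A E (adj y o\<^sub>L y)"
    using C(1) by (intro finite_if_bounded(1)[OF sq_M[OF yM] bd]) simp
  moreover have "adj y o\<^sub>L y \<in> commutant A" by (intro vna_comp[OF CA] vna_adj[OF CA] y(1))
  ultimately have "adj y o\<^sub>L y = 0" using inf[OF sq_M(1)[OF yM] _ sq_M(2)[OF yM]] by blast
  then have "(norm (y v))\<^sup>2 = 0" for v using sq_form[OF Mbo[OF yM], of v] by (simp add: cinner.zero_right)
  then show "y = 0" by (simp add: blinfun_eq_iff)
qed

text \<open>Conjugation fixes \<open>x\<close>, so the orbit is a single point; matrix coefficients
  separate points, so the closure contains nothing else.\<close>

lemma conj_hull_commuting:
  assumes x: "x \<in> M" "x \<in> commutant A" and z: "0 \<in> conj_hull M A x"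
  shows "x = 0"
proof -
  have Mb: "M \<subseteq> bounded_ops" using Mbo by blast
  have "{u o\<^sub>L x o\<^sub>L adj u |u. u \<in> unitary_group A} \<subseteq> {x}"
  proof
    fix w assume "w \<in> {u o\<^sub>L x o\<^sub>L adj u |u. u \<in> unitary_group A}"
    then obtain u where u: "u \<in> unitary_group A" "w = u o\<^sub>L x o\<^sub>L adj u" by blast
    have "w v = x v" for v
      using commutantD[OF x(2) unitaryD(1)[OF u(1)], of "adj u v"] by (simp add: u(2) unitaryD(3)[OF u(1)])
    then show "w \<in> {x}" by (simp add: blinfun_eq_iff)
  qed
  then have sub: "convex hull {u o\<^sub>L x o\<^sub>L adj u |u. u \<in> unitary_group A} \<subseteq> {x}"
    by (rule hull_minimal) simp
  have "cinner g (x h) = cinner g 0" for g h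
  proof (rule ccontr)
    assume ne: "cinner g (x h) \<noteq> cinner g 0"
    define W where "W = {w \<in> M. vector_functional (unit_seq g) (unit_seq h) w \<in> ball 0 (cmod (cinner g (x h)))}"
    have "openin (sigma_weak M) W"
      unfolding W_def by (intro sigma_weak_open square_summable_unit_seq open_ball Mb)
    moreover have "0 \<in> W" using vna_zero[OF M] ne by (simp add: W_def vector_functional_unit_seq cinner.zero_right)
    ultimately have "x \<in> W" using z sub unfolding conj_hull_def in_closure_of by blast
    then show False by (simp add: W_def vector_functional_unit_seq)
  qed
  then have "x h = 0" for h by (rule cinner_eqI)
  then show ?thesis by (simp add: blinfun_eq_iff)
qed

end

theorem corollaryB:
  fixes M A :: "('h::chilbert_space \<Rightarrow>\<^sub>L 'h) set"
    and E :: "('h \<Rightarrow>\<^sub>L 'h) \<Rightarrow> 'h ext_pos"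
  assumes "von_neumann_algebra M" and "von_neumann_algebra A" and "A \<subseteq> M"
    and "operator_valued_weight M A E" and "weight_faithful M E"
    and "weight_normal M A E" and "weight_semifinite M A E"
  shows
    "((\<forall>x \<in> positive_cone (commutant A \<inter> M). x \<noteq> 0 \<longrightarrow> \<not> weight_finite_at A E x) \<longleftrightarrow>
      (\<forall>x \<in> positive_cone M. weight_finite_at A E x \<longrightarrow> 0 \<in> conj_hull M A x)) \<and>
     ((\<forall>x \<in> positive_cone M. weight_finite_at A E x \<longrightarrow> 0 \<in> conj_hull M A x) \<longleftrightarrow>
      (\<forall>x \<in> positive_cone M. weight_finite_at A E x \<longrightarrow>
        commutant A \<inter> conj_hull M A x = {0}))"
    (is "(?one \<longleftrightarrow> ?two) \<and> (?two \<longleftrightarrow> ?three)")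
proof -
  interpret weight M A E using assms(1-6) by unfold_locales
  have cone: "x \<in> positive_cone (commutant A \<inter> M) \<longleftrightarrow> x \<in> commutant A \<and> x \<in> M \<and> pos x" for x
    using cone_iff[of x] by (auto simp: positive_cone_def)
  have h12: ?two and h13: ?three if one: ?one
  proof -
    have inf: "\<not> weight_finite_at A E T" if "T \<in> M" "T \<in> commutant A" "pos T" "T \<noteq> 0" for T
      using one that by (simp add: cone)
    show two: ?two using zero_in_conj_hull[OF inf] by (auto simp: cone_iff)
    show ?three
    proof (intro ballI impI)
      fix x assume x: "x \<in> positive_cone M" "weight_finite_at A E x"
      have "0 \<in> commutant A" by (rule vna_zero[OF vna_commutant[OF A]])
      moreover have "y = 0" if "y \<in> commutant A" "y \<in> conj_hull M A x" for y
        using conj_hull_commutant_zero[OF inf _ _ x(2) that] x(1) by (simp add: cone_iff)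
      ultimately show "commutant A \<inter> conj_hull M A x = {0}" using two x by blast
    qed
  qed
  have h32: ?two if ?three using that by blast
  have h21: ?one if two: ?two
  proof (intro ballI impI notI)
    fix x assume x: "x \<in> positive_cone (commutant A \<inter> M)" "x \<noteq> 0" "weight_finite_at A E x"
    then have "0 \<in> conj_hull M A x" using two by (simp add: cone cone_iff)
    then show False using conj_hull_commuting[of x] x by (simp add: cone)
  qed
  show ?thesis
    by (intro conjI iffI) (erule h12, erule h21, erule h13[OF h21], erule h32)
qed

end
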